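(* Let $k\ge2$. Let $U_{\tau,h}$ be the fully discrete solution with initial value $U_{0,h}:=\{R_hu_0,R_hu_1\}$, let $L_\tau U_{\tau,h}=\{L_\tau u^0_{\tau,h},L_\tau u^1_{\tau,h}\}$ be its lifting, and assume that the exact solution $U=\{u^0,u^1\}:=\{u,\partial_tu\}$ is sufficiently smooth. Then, for all $t\in\bar I$, $$\|\partial_tU(t)-\partial_tL_\tau U_{\tau,h}(t)\|\lesssim\tau^{k+1}C_t(\partial_tu)+h^{r+1}C_x(\partial_tu)\lesssim\tau^{k+1}+h^{r+1},$$ $$\|\nabla(\partial_tu^0(t)-\partial_tL_\tau u^0_{\tau,h}(t))\|\lesssim\tau^{k+1}C_t(\partial_tu)+h^{r}C_x(\partial_tu)\lesssim\tau^{k+1}+h^{r},$$ where $C_t(\partial_tu)$ and $C_x(\partial_tu)$ are quantities depending on various temporal and spatial derivatives of $\partial_tu$.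
   Context: Setting. $\Omega\subset\mathbb R^d$, $d\in\{2,3\}$, is a bounded polygonal or polyhedral domain, $T>0$, $I=(0,T]$, $\bar I=[0,T]$, $H=L^2(\Omega)$, $V=H^1_0(\Omega)$. $\langle\cdot,\cdot\rangle$ and $\|\cdot\|$ are the inner product and norm of $L^2(\Omega)$ (the norm symbol is also used for pairs), and $\langle\!\langle\cdot,\cdot\rangle\!\rangle$ is the inner product of $(L^2(\Omega))^2$. The wave problem is $\partial_t^2u-\Delta u=f$ in $\Omega\times(0,T]$, $u=0$ on $\partial\Omega\times(0,T]$, $u(\cdot,0)=u_0$, $\partial_tu(\cdot,0)=u_1$ in $\Omega$, with $f\in C^1([0,T];H)$. Put $F=\{0,f\}$. Regularity convention. The solution $u$ is assumed to satisfy all regularity conditions required by the analysis (smooth enough in time and space, depending on $k$ and $r$); this includes the corresponding implied assumptions on $f,u_0,u_1$ and $\partial\Omega$, so that in particular the standard approximation property $\|w-R_hw\|_{H^m(\Omega)}\le C h^{r+1-m}\|w\|_{H^{r+1}(\Omega)}$, $m\in\{0,1\}$ ($H^0=L^2$), of the elliptic projection $R_h$ defined below is available. The notation $a\lesssim b$ means $a\le Cb$ with a constant $C$ independent of the sizes of the space and time meshes; $C$ may depend on the shape regularity of the space mesh, the polynomial degrees $k,r$, and the data (including $\Omega,T$, and hence the exact solution). Time discretization. $0=t_0<t_1<\dots<t_N=T$, $I_n=(t_{n-1},t_n]$, $\tau_n=t_n-t_{n-1}$, $\tau=\max_n\tau_n$. $\mathbb P_k(I_n;B)$ is the space of polynomials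 in $t$ of degree at most $k$ with coefficients in $B$; $X_\tau^k(B)=\{w\in C(\bar I;B): w|_{I_n}\in\mathbb P_k(I_n;B)\ \forall n\}$. Values (also of derivatives) of $w|_{I_n}$ at the endpoints of $I_n$ are one-sided limits from the interior of $I_n$. $t_{n-1}=t_{n,0}<\dots<t_{n,k}=t_n$ are the $(k+1)$ Gauss–Lobatto points on $\bar I_n$ and $Q_n(g)=\frac{\tau_n}{2}\sum_{\mu=0}^k\hat\omega_\mu\, g|_{I_n}(t_{n,\mu})$ is the Gauss–Lobatto quadrature formula ($\hat\omega_\mu$: weights on $[-1,1]$). Space discretization. $\mathcal T_h$ is a shape-regular mesh of $\Omega$ of quadrilateral or hexahedral elements with mesh size $h$, and $V_h=\{v_h\in C(\bar\Omega): v_h|_K\in\mathbb Q_r(K)\ \forall K\in\mathcal T_h\}\cap H^1_0(\Omega)$, where $\mathbb Q_r(K)$ consists of the functions obtained via the reference mapping from polynomials of degree at most $r$ in each variable. $P_h:H\to V_h$ is the $L^2$-projection, $\mathcal P_h$ is its componentwise version; $R_h:V\to V_h$ is the elliptic projection, $\langle\nabla R_hw,\nabla v_h\rangle=\langle\nabla w,\nabla v_h\rangle$ for all $v_h\in V_h$. $A_h:V\to V_h$ is given by $\langle A_hw,v_h\rangle=\langle\nabla w,\nabla v_h\rangle$ for all $v_h\in V_h$, and $\mathcal A_h\{w^0,w^1\}:=\{-w^1,A_hw^0\}$. Fully discrete solution. Given $U_{0,h}\in V_h^2$, $U_{\tau,h}=\{u^0_{\tau,h},u^1_{\tau,h}\}\in(X^k_\tau(V_h))^2$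 satisfies $U_{\tau,h}(0)=U_{0,h}$ and, for $n=1,\dots,N$, $$\int_{I_n}\big(\langle\!\langle\partial_tU_{\tau,h},V_{\tau,h}\rangle\!\rangle+\langle\!\langle\mathcal A_hU_{\tau,h},V_{\tau,h}\rangle\!\rangle\big)\,dt=Q_n(\langle\!\langle F,V_{\tau,h}\rangle\!\rangle)\quad\forall V_{\tau,h}\in(\mathbb P_{k-1}(I_n;V_h))^2.$$ Lifting. Let $\vartheta_n\in\mathbb P_{k+1}(\bar I_n;\mathbb R)$ with $\vartheta_n(t_{n,\mu})=0$ for $\mu=0,\dots,k$ and $\vartheta_n'(t_{n-1})=1$. Acting componentwise, $L_\tau U_{\tau,h}(0)=U_{\tau,h}(0)$ and $L_\tau U_{\tau,h}(t)=U_{\tau,h}(t)-c_{n-1}\vartheta_n(t)$ for $t\in I_n$, where $\partial_tL_\tau U_{\tau,h}(0):=\mathcal P_hF(0)-\mathcal A_hU_{0,h}$, $c_0=\partial_tU_{\tau,h}|_{I_1}(0)-\partial_tL_\tau U_{\tau,h}(0)$ and $c_{n-1}=\partial_tU_{\tau,h}|_{I_n}(t_{n-1})-\partial_tL_\tau U_{\tau,h}|_{I_{n-1}}(t_{n-1})$ for $n>1$. Then $L_\tau U_{\tau,h}\in C^1(\bar I;V_h)^2$. *)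

theory Defs
  imports
    "HOL-Analysis.Analysis"
    "HOL-Library.Multiset"
    "HOL-Computational_Algebra.Polynomial"
begin

text \<open>Elements of \<open>L\<^sup>2(\<Omega>)\<close> and \<open>H\<^sup>m(\<Omega>)\<close> are represented by functions on the whole of \<open>\<real>\<^sup>d\<close>;
  values outside \<open>\<Omega>\<close> and on null sets do not influence any of the norms and inner products below.\<close>

type_synonym 'd field = "real^'d \<Rightarrow> real"


section \<open>Domain and function spaces\<close>

definition polyhedral_domain :: "(real^'d::finite) set \<Rightarrow> bool" where
  "polyhedral_domain \<Omega> \<longleftrightarrow> open \<Omega> \<and> connected \<Omega> \<and> bounded \<Omega> \<and> \<Omega> \<noteq> {} \<and>
     (\<exists>\<P>. finite \<P> \<and> (\<forall>P\<in>\<P>. polytope P \<and> aff_dim P = int CARD('d) - 1) \<and> frontier \<Omega> = \<Union>\<P>)"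

definition L2_space :: "(real^'d::finite) set \<Rightarrow> 'd field set" where
  "L2_space \<Omega> = {v. v \<in> borel_measurable (lebesgue_on \<Omega>) \<and> integrable (lebesgue_on \<Omega>) (\<lambda>x. (v x)\<^sup>2)}"

definition L2_inner :: "(real^'d::finite) set \<Rightarrow> 'd field \<Rightarrow> 'd field \<Rightarrow> real" where
  "L2_inner \<Omega> v w = (\<integral>x. v x * w x \<partial>lebesgue_on \<Omega>)"

definition L2_norm :: "(real^'d::finite) set \<Rightarrow> 'd field \<Rightarrow> real" where
  "L2_norm \<Omega> v = sqrt (L2_inner \<Omega> v v)"

definition L2_inner_pair :: "(real^'d::finite) set \<Rightarrow> 'd field \<times> 'd field \<Rightarrow> 'd field \<times> 'd field \<Rightarrow> real" where
  "L2_inner_pair \<Omega> V W = L2_inner \<Omega> (fst V) (fst W) + L2_inner \<Omega> (snd V) (snd W)"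

definition L2_norm_pair :: "(real^'d::finite) set \<Rightarrow> 'd field \<times> 'd field \<Rightarrow> real" where
  "L2_norm_pair \<Omega> V = sqrt (L2_inner_pair \<Omega> V V)"

definition partial :: "'d::finite \<Rightarrow> 'd field \<Rightarrow> 'd field" where
  "partial i \<phi> x = frechet_derivative \<phi> (at x) (axis i 1)"

primrec C_class :: "nat \<Rightarrow> 'd::finite field \<Rightarrow> bool" where
  "C_class 0 \<phi> \<longleftrightarrow> continuous_on UNIV \<phi>"
| "C_class (Suc n) \<phi> \<longleftrightarrow> (\<forall>x. \<phi> differentiable (at x)) \<and> (\<forall>i. C_class n (partial i \<phi>))"

definition test_functions :: "(real^'d::finite) set \<Rightarrow> 'd field set" where
  "test_functions \<Omega> = {\<phi>. (\<forall>n. C_class n \<phi>) \<and>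
     compact (closure {x. \<phi> x \<noteq> 0}) \<and> closure {x. \<phi> x \<noteq> 0} \<subseteq> \<Omega>}"

text \<open>Multi-indices are multisets of coordinate directions.  The order of differentiation, left open
  here, is immaterial for the smooth functions to which this is applied.\<close>

definition multi_partial :: "'d::finite multiset \<Rightarrow> 'd field \<Rightarrow> 'd field" where
  "multi_partial \<alpha> \<phi> = foldr partial (SOME js. mset js = \<alpha>) \<phi>"

definition has_weak_deriv :: "(real^'d::finite) set \<Rightarrow> 'd multiset \<Rightarrow> 'd field \<Rightarrow> 'd field \<Rightarrow> bool" where
  "has_weak_deriv \<Omega> \<alpha> v g \<longleftrightarrow> v \<in> L2_space \<Omega> \<and> g \<in> L2_space \<Omega> \<and>
     (\<forall>\<phi>\<in>test_functions \<Omega>. L2_inner \<Omega> v (multi_partial \<alpha> \<phi>) = (-1) ^ size \<alpha> * L2_inner \<Omega> g \<phi>)"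

definition weak_deriv :: "(real^'d::finite) set \<Rightarrow> 'd multiset \<Rightarrow> 'd field \<Rightarrow> 'd field" where
  "weak_deriv \<Omega> \<alpha> v = (SOME g. has_weak_deriv \<Omega> \<alpha> v g)"

definition H_space :: "(real^'d::finite) set \<Rightarrow> nat \<Rightarrow> 'd field set" where
  "H_space \<Omega> m = {v \<in> L2_space \<Omega>. \<forall>\<alpha>. size \<alpha> \<le> m \<longrightarrow> (\<exists>g. has_weak_deriv \<Omega> \<alpha> v g)}"

definition H_norm :: "(real^'d::finite) set \<Rightarrow> nat \<Rightarrow> 'd field \<Rightarrow> real" where
  "H_norm \<Omega> m v = sqrt (\<Sum>\<alpha> | size \<alpha> \<le> m. (L2_norm \<Omega> (weak_deriv \<Omega> \<alpha> v))\<^sup>2)"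

definition H10_space :: "(real^'d::finite) set \<Rightarrow> 'd field set" where
  "H10_space \<Omega> = {v \<in> H_space \<Omega> 1.
     \<forall>\<epsilon>>0. \<exists>\<phi>\<in>test_functions \<Omega>. H_norm \<Omega> 1 (\<lambda>x. v x - \<phi> x) < \<epsilon>}"

definition weak_grad :: "(real^'d::finite) set \<Rightarrow> 'd field \<Rightarrow> real^'d \<Rightarrow> real^'d" where
  "weak_grad \<Omega> v x = (\<chi> i. weak_deriv \<Omega> {#i#} v x)"

definition grad_inner :: "(real^'d::finite) set \<Rightarrow> 'd field \<Rightarrow> 'd field \<Rightarrow> real" where
  "grad_inner \<Omega> v w = (\<integral>x. weak_grad \<Omega> v x \<bullet> weak_grad \<Omega> w x \<partial>lebesgue_on \<Omega>)"

definition grad_norm :: "(real^'d::finite) set \<Rightarrow> 'd field \<Rightarrow> real" where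
  "grad_norm \<Omega> v = sqrt (grad_inner \<Omega> v v)"

definition weak_laplace :: "(real^'d::finite) set \<Rightarrow> 'd field \<Rightarrow> 'd field" where
  "weak_laplace \<Omega> v x = (\<Sum>i\<in>UNIV. weak_deriv \<Omega> {#i, i#} v x)"


section \<open>Functions of time with values in a function space\<close>

text \<open>Limits of functions of time are taken in the norm of \<open>H\<^sup>l(\<Omega>)\<close>, with \<open>l = 0\<close> for \<open>L\<^sup>2(\<Omega>)\<close>, along
  times in \<open>S\<close>; at an end point of an interval \<open>S\<close> they are one-sided.\<close>

definition has_time_deriv ::
  "(real^'d::finite) set \<Rightarrow> nat \<Rightarrow> real set \<Rightarrow> (real \<Rightarrow> 'd field) \<Rightarrow> real \<Rightarrow> 'd field \<Rightarrow> bool" where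
  "has_time_deriv \<Omega> l S g s g' \<longleftrightarrow>
     ((\<lambda>s'. H_norm \<Omega> l (\<lambda>x. (g s' x - g s x) / (s' - s) - g' x)) \<longlongrightarrow> 0) (at s within S)"

definition time_deriv ::
  "(real^'d::finite) set \<Rightarrow> real set \<Rightarrow> (real \<Rightarrow> 'd field) \<Rightarrow> real \<Rightarrow> 'd field" where
  "time_deriv \<Omega> S g s = (SOME g'. g' \<in> L2_space \<Omega> \<and> has_time_deriv \<Omega> 0 S g s g')"

definition time_continuous ::
  "(real^'d::finite) set \<Rightarrow> nat \<Rightarrow> real set \<Rightarrow> (real \<Rightarrow> 'd field) \<Rightarrow> bool" where
  "time_continuous \<Omega> l S g \<longleftrightarrow>
     (\<forall>s\<in>S. ((\<lambda>s'. H_norm \<Omega> l (\<lambda>x. g s' x - g s x)) \<longlongrightarrow> 0) (at s within S))"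

text \<open>The space \<open>C\<^sup>m(S; H\<^sup>l(\<Omega>))\<close>.\<close>

definition C_H_space :: "(real^'d::finite) set \<Rightarrow> real set \<Rightarrow> nat \<Rightarrow> nat \<Rightarrow> (real \<Rightarrow> 'd field) set" where
  "C_H_space \<Omega> S m l = {g.
     (\<forall>j\<le>m. (\<forall>s\<in>S. (time_deriv \<Omega> S ^^ j) g s \<in> H_space \<Omega> l) \<and>
            time_continuous \<Omega> l S ((time_deriv \<Omega> S ^^ j) g)) \<and>
     (\<forall>j<m. \<forall>s\<in>S. has_time_deriv \<Omega> l S ((time_deriv \<Omega> S ^^ j) g) s ((time_deriv \<Omega> S ^^ Suc j) g s))}"

text \<open>A quantity depending on derivatives: the pair \<open>(j, m)\<close> contributes the norm of
  \<open>\<partial>\<^sub>t\<^sup>j v\<close> in \<open>L\<^sup>\<infinity>(0, T; H\<^sup>m(\<Omega>))\<close>.\<close>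

definition deriv_quantity ::
  "(real^'d::finite) set \<Rightarrow> real \<Rightarrow> (nat \<times> nat) set \<Rightarrow> (real \<Rightarrow> 'd field) \<Rightarrow> real" where
  "deriv_quantity \<Omega> T J v =
     (\<Sum>(j, m)\<in>J. SUP s\<in>{0..T}. H_norm \<Omega> m ((time_deriv \<Omega> {0..T} ^^ j) v s))"

definition wave_solution ::
  "(real^'d::finite) set \<Rightarrow> real \<Rightarrow> (real \<Rightarrow> 'd field) \<Rightarrow> 'd field \<Rightarrow> 'd field \<Rightarrow> (real \<Rightarrow> 'd field) \<Rightarrow> bool" where
  "wave_solution \<Omega> T f u\<^sub>0 u\<^sub>1 u \<longleftrightarrow>
     (\<forall>s\<in>{0<..T}. AE x in lebesgue_on \<Omega>.
        (time_deriv \<Omega> {0..T} ^^ 2) u s x - weak_laplace \<Omega> (u s) x = f s x) \<and>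
     (\<forall>s\<in>{0<..T}. u s \<in> H10_space \<Omega>) \<and>
     (AE x in lebesgue_on \<Omega>. u 0 x = u\<^sub>0 x) \<and>
     (AE x in lebesgue_on \<Omega>. time_deriv \<Omega> {0..T} u 0 x = u\<^sub>1 x)"


section \<open>Space discretization\<close>

definition Q_poly :: "nat \<Rightarrow> 'd::finite field \<Rightarrow> bool" where
  "Q_poly r p \<longleftrightarrow>
     (\<exists>c. \<forall>x. p x = (\<Sum>\<alpha> | \<forall>i. \<alpha> i \<le> r. c \<alpha> * (\<Prod>i\<in>UNIV. (x $ i) ^ \<alpha> i)))"

text \<open>A mesh is given by the set of its reference mappings \<open>F\<close>, which are multilinear; the elements
  are the images of the unit cube.  The last condition is shape regularity:
  \<open>\<parallel>DF\<inverse>\<parallel> \<le> \<sigma> / h\<^sub>K\<close> on the reference cube, with \<open>h\<^sub>K\<close> the diameter of \<open>K\<close>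
  (the matching bound of \<open>DF\<close> by a multiple of \<open>h\<^sub>K\<close> holds for every multilinear map).\<close>

type_synonym 'd mesh = "(real^'d \<Rightarrow> real^'d) set"

definition shape_regular_mesh :: "(real^'d::finite) set \<Rightarrow> real \<Rightarrow> 'd mesh \<Rightarrow> bool" where
  "shape_regular_mesh \<Omega> \<sigma> \<T> \<longleftrightarrow> finite \<T> \<and> \<T> \<noteq> {} \<and>
     (\<forall>F\<in>\<T>. (\<forall>i. Q_poly 1 (\<lambda>x. F x $ i)) \<and> inj_on F (cbox 0 1)) \<and>
     (\<Union>F\<in>\<T>. F ` cbox 0 1) = closure \<Omega> \<and>
     (\<forall>F\<in>\<T>. \<forall>G\<in>\<T>. F \<noteq> G \<longrightarrow> interior (F ` cbox 0 1) \<inter> interior (G ` cbox 0 1) = {}) \<and>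
     (\<forall>F\<in>\<T>. \<forall>x\<in>cbox 0 1. \<forall>v.
        diameter (F ` cbox 0 1) * norm v \<le> \<sigma> * norm (frechet_derivative F (at x) v))"

definition mesh_size :: "'d::finite mesh \<Rightarrow> real" where
  "mesh_size \<T> = Max ((\<lambda>F. diameter (F ` cbox 0 1)) ` \<T>)"

text \<open>Finite element functions are extended by zero outside the closure of the domain, so that
  each of them is a unique function on \<open>\<real>\<^sup>d\<close>.\<close>

definition FE_space :: "(real^'d::finite) set \<Rightarrow> nat \<Rightarrow> 'd mesh \<Rightarrow> 'd field set" where
  "FE_space \<Omega> r \<T> = {v \<in> H10_space \<Omega>.
     continuous_on (closure \<Omega>) v \<and> (\<forall>x. x \<notin> closure \<Omega> \<longrightarrow> v x = 0) \<and>
     (\<forall>F\<in>\<T>. \<exists>p. Q_poly r p \<and> (\<forall>x\<in>cbox 0 1. v (F x) = p x))}"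

definition L2_proj :: "(real^'d::finite) set \<Rightarrow> 'd field set \<Rightarrow> 'd field \<Rightarrow> 'd field" where
  "L2_proj \<Omega> V\<^sub>h w = (THE v. v \<in> V\<^sub>h \<and> (\<forall>v\<^sub>h\<in>V\<^sub>h. L2_inner \<Omega> v v\<^sub>h = L2_inner \<Omega> w v\<^sub>h))"

definition elliptic_proj :: "(real^'d::finite) set \<Rightarrow> 'd field set \<Rightarrow> 'd field \<Rightarrow> 'd field" where
  "elliptic_proj \<Omega> V\<^sub>h w = (THE v. v \<in> V\<^sub>h \<and> (\<forall>v\<^sub>h\<in>V\<^sub>h. grad_inner \<Omega> v v\<^sub>h = grad_inner \<Omega> w v\<^sub>h))"

definition discrete_laplace :: "(real^'d::finite) set \<Rightarrow> 'd field set \<Rightarrow> 'd field \<Rightarrow> 'd field" where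
  "discrete_laplace \<Omega> V\<^sub>h w = (THE v. v \<in> V\<^sub>h \<and> (\<forall>v\<^sub>h\<in>V\<^sub>h. L2_inner \<Omega> v v\<^sub>h = grad_inner \<Omega> w v\<^sub>h))"

definition discrete_wave_op ::
  "(real^'d::finite) set \<Rightarrow> 'd field set \<Rightarrow> 'd field \<times> 'd field \<Rightarrow> 'd field \<times> 'd field" where
  "discrete_wave_op \<Omega> V\<^sub>h W = ((\<lambda>x. - snd W x), discrete_laplace \<Omega> V\<^sub>h (fst W))"

definition elliptic_approx :: "(real^'d::finite) set \<Rightarrow> nat \<Rightarrow> real \<Rightarrow> 'd mesh \<Rightarrow> bool" where
  "elliptic_approx \<Omega> r C\<^sub>R \<T> \<longleftrightarrow>
     (\<forall>w\<in>H10_space \<Omega> \<inter> H_space \<Omega> (r + 1). \<forall>m\<in>{0, 1}.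
        H_norm \<Omega> m (\<lambda>x. w x - elliptic_proj \<Omega> (FE_space \<Omega> r \<T>) w x)
          \<le> C\<^sub>R * mesh_size \<T> ^ (r + 1 - m) * H_norm \<Omega> (r + 1) w)"


section \<open>Time discretization\<close>

definition time_mesh :: "real \<Rightarrow> nat \<Rightarrow> (nat \<Rightarrow> real) \<Rightarrow> bool" where
  "time_mesh T N t \<longleftrightarrow> N \<ge> 1 \<and> t 0 = 0 \<and> t N = T \<and> (\<forall>n<N. t n < t (Suc n))"

definition time_mesh_size :: "nat \<Rightarrow> (nat \<Rightarrow> real) \<Rightarrow> real" where
  "time_mesh_size N t = Max ((\<lambda>n. t n - t (n - 1)) ` {1..N})"

definition legendre :: "nat \<Rightarrow> real poly" where
  "legendre k = smult (1 / (2 ^ k * fact k)) ((pderiv ^^ k) ([:-1, 0, 1:] ^ k))"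

text \<open>On \<open>[-1, 1]\<close> the \<open>k + 1\<close> Gauss-Lobatto points are the zeros of \<open>(x\<^sup>2 - 1) P\<^sub>k'(x)\<close>, with \<open>P\<^sub>k\<close>
  the Legendre polynomial; the quadrature weights are the integrals of the Lagrange basis.\<close>

definition lobatto_node :: "nat \<Rightarrow> nat \<Rightarrow> real" where
  "lobatto_node k \<mu> = sorted_list_of_set {x. poly ([:-1, 0, 1:] * pderiv (legendre k)) x = 0} ! \<mu>"

definition lobatto_weight :: "nat \<Rightarrow> nat \<Rightarrow> real" where
  "lobatto_weight k \<mu> = integral {-1..1}
     (\<lambda>x. \<Prod>\<nu>\<in>{..k} - {\<mu>}. (x - lobatto_node k \<nu>) / (lobatto_node k \<mu> - lobatto_node k \<nu>))"

definition lobatto_point :: "nat \<Rightarrow> (nat \<Rightarrow> real) \<Rightarrow> nat \<Rightarrow> nat \<Rightarrow> real" where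
  "lobatto_point k t n \<mu> = (t (n - 1) + t n) / 2 + (t n - t (n - 1)) / 2 * lobatto_node k \<mu>"

definition lobatto_quad :: "nat \<Rightarrow> (nat \<Rightarrow> real) \<Rightarrow> nat \<Rightarrow> (real \<Rightarrow> real) \<Rightarrow> real" where
  "lobatto_quad k t n g =
     (t n - t (n - 1)) / 2 * (\<Sum>\<mu>\<le>k. lobatto_weight k \<mu> * g (lobatto_point k t n \<mu>))"

text \<open>A polynomial in time is taken as a function of all times; an element of
  \<open>\<P>\<^sub>k(I\<^sub>n; B)\<close> is the restriction of one of these to \<open>I\<^sub>n\<close>.\<close>

definition time_poly :: "nat \<Rightarrow> 'd::finite field set \<Rightarrow> (real \<Rightarrow> 'd field) set" where
  "time_poly k B = {w. \<exists>a. (\<forall>j\<le>k. a j \<in> B) \<and> (\<forall>s x. w s x = (\<Sum>j\<le>k. s ^ j * a j x))}"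

text \<open>The space \<open>X\<^sub>\<tau>\<^sup>k(B)\<close> for a finite-dimensional \<open>B\<close>, on which continuity may be
  measured in the \<open>L\<^sup>2\<close> norm.\<close>

definition cont_time_poly ::
  "(real^'d::finite) set \<Rightarrow> nat \<Rightarrow> nat \<Rightarrow> (nat \<Rightarrow> real) \<Rightarrow> 'd field set \<Rightarrow> (real \<Rightarrow> 'd field) set" where
  "cont_time_poly \<Omega> k N t B = {w.
     (\<forall>s\<in>{t 0..t N}. w s \<in> B) \<and> time_continuous \<Omega> 0 {t 0..t N} w \<and>
     (\<forall>n\<in>{1..N}. \<exists>p\<in>time_poly k B. \<forall>s\<in>{t (n - 1)<..t n}. w s = p s)}"

definition fully_discrete_solution ::
  "(real^'d::finite) set \<Rightarrow> 'd field set \<Rightarrow> nat \<Rightarrow> nat \<Rightarrow> (nat \<Rightarrow> real) \<Rightarrow> (real \<Rightarrow> 'd field) \<Rightarrow>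
   'd field \<times> 'd field \<Rightarrow> (real \<Rightarrow> 'd field) \<Rightarrow> (real \<Rightarrow> 'd field) \<Rightarrow> bool" where
  "fully_discrete_solution \<Omega> V\<^sub>h k N t f U\<^sub>0 w\<^sub>0 w\<^sub>1 \<longleftrightarrow>
     w\<^sub>0 \<in> cont_time_poly \<Omega> k N t V\<^sub>h \<and> w\<^sub>1 \<in> cont_time_poly \<Omega> k N t V\<^sub>h \<and> (w\<^sub>0 0, w\<^sub>1 0) = U\<^sub>0 \<and>
     (\<forall>n\<in>{1..N}. \<forall>v\<^sub>0\<in>time_poly (k - 1) V\<^sub>h. \<forall>v\<^sub>1\<in>time_poly (k - 1) V\<^sub>h.
        integral {t (n - 1)..t n} (\<lambda>s.
          L2_inner_pair \<Omega> (time_deriv \<Omega> {t (n - 1)..t n} w\<^sub>0 s, time_deriv \<Omega> {t (n - 1)..t n} w\<^sub>1 s)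
                          (v\<^sub>0 s, v\<^sub>1 s) +
          L2_inner_pair \<Omega> (discrete_wave_op \<Omega> V\<^sub>h (w\<^sub>0 s, w\<^sub>1 s)) (v\<^sub>0 s, v\<^sub>1 s))
        = lobatto_quad k t n (\<lambda>s. L2_inner_pair \<Omega> (\<lambda>x. 0, f s) (v\<^sub>0 s, v\<^sub>1 s)))"


section \<open>Lifting\<close>

definition lift_poly :: "nat \<Rightarrow> (nat \<Rightarrow> real) \<Rightarrow> nat \<Rightarrow> real poly" where
  "lift_poly k t n = (THE p. degree p \<le> k + 1 \<and>
     (\<forall>\<mu>\<le>k. poly p (lobatto_point k t n \<mu>) = 0) \<and> poly (pderiv p) (t (n - 1)) = 1)"

text \<open>The argument \<open>d\<^sub>0\<close> is the prescribed value of \<open>\<partial>\<^sub>t L\<^sub>\<tau> w(0)\<close>.  The coefficient with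
  index \<open>n - 1\<close> belongs to the interval \<open>I\<^sub>n\<close>.\<close>

primrec lift_coeff ::
  "(real^'d::finite) set \<Rightarrow> nat \<Rightarrow> (nat \<Rightarrow> real) \<Rightarrow> 'd field \<Rightarrow> (real \<Rightarrow> 'd field) \<Rightarrow> nat \<Rightarrow> 'd field" where
  "lift_coeff \<Omega> k t d\<^sub>0 w 0 = (\<lambda>x. time_deriv \<Omega> {t 0..t 1} w (t 0) x - d\<^sub>0 x)"
| "lift_coeff \<Omega> k t d\<^sub>0 w (Suc m) = (\<lambda>x.
     time_deriv \<Omega> {t (Suc m)..t (Suc (Suc m))} w (t (Suc m)) x
     - time_deriv \<Omega> {t m..t (Suc m)}
         (\<lambda>s y. w s y - lift_coeff \<Omega> k t d\<^sub>0 w m y * poly (lift_poly k t (Suc m)) s) (t (Suc m)) x)"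

definition lifting ::
  "(real^'d::finite) set \<Rightarrow> nat \<Rightarrow> (nat \<Rightarrow> real) \<Rightarrow> 'd field \<Rightarrow> (real \<Rightarrow> 'd field) \<Rightarrow> real \<Rightarrow> 'd field" where
  "lifting \<Omega> k t d\<^sub>0 w s =
     (if s \<le> t 0 then w s
      else let n = (LEAST n. s \<le> t n)
           in (\<lambda>x. w s x - lift_coeff \<Omega> k t d\<^sub>0 w (n - 1) x * poly (lift_poly k t n) s))"

text \<open>\<open>\<P>\<^sub>h F(0) - \<A>\<^sub>h U\<^sub>0\<close> with \<open>F = {0, f}\<close>.\<close>

definition lift_init ::
  "(real^'d::finite) set \<Rightarrow> 'd field set \<Rightarrow> (real \<Rightarrow> 'd field) \<Rightarrow> 'd field \<times> 'd field \<Rightarrow> 'd field \<times> 'd field" where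
  "lift_init \<Omega> V\<^sub>h f U\<^sub>0 =
     ((\<lambda>x. L2_proj \<Omega> V\<^sub>h (\<lambda>_. 0) x - fst (discrete_wave_op \<Omega> V\<^sub>h U\<^sub>0) x),
      (\<lambda>x. L2_proj \<Omega> V\<^sub>h (f 0) x - snd (discrete_wave_op \<Omega> V\<^sub>h U\<^sub>0) x))"

end

theory Submission
  imports Defs
begin

text \<open>
Write \<open>W\<close> for \<open>\<partial>\<^sub>tL\<^sub>\<tau>U\<^sub>\<tau>\<^sub>,\<^sub>h\<close>. The theorem is a stability and consistency argument for \<open>W\<close>, not for
\<open>U\<^sub>\<tau>\<^sub>,\<^sub>h\<close> itself, and it rests on the fact that lifting turns the Galerkin scheme into a collocation
scheme at the Gauss-Lobatto points. On one time interval the residual of the scheme has degree at most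
\<open>k\<close> and is orthogonal, in the sense of the quadrature formula, to all polynomials of degree below
\<open>k\<close>; hence it is a multiple of \<open>\<theta>\<^sub>n'\<close> (\<open>galerkin_residual\<close>), and this multiple is exactly what the lifting
removes. So on each interval \<open>W\<close> is the interpolant of degree \<open>k\<close> of the nodal values
\<open>W\<^sup>0 = u\<^sup>1\<^sub>\<tau>\<^sub>,\<^sub>h\<close> and \<open>W\<^sup>1 = P\<^sub>hf - A\<^sub>hu\<^sup>0\<^sub>\<tau>\<^sub>,\<^sub>h\<close>. The lifting does not change \<open>U\<^sub>\<tau>\<^sub>,\<^sub>h\<close> at the nodes, and
integrating \<open>W\<close> gives \<open>U\<^sub>\<tau>\<^sub>,\<^sub>h(t\<^sub>n\<^sub>,\<^sub>\<mu>) - U\<^sub>\<tau>\<^sub>,\<^sub>h(t\<^sub>n\<^sub>-\<^sub>1)\<close> (\<open>lifted_collocation\<close>): the nodal values of \<open>W\<close> solve the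
Lobatto collocation equations for the wave equation differentiated in time.

The nodal errors \<open>E = (R\<^sub>h\<partial>\<^sub>tu - W\<^sup>0, R\<^sub>h\<partial>\<^sub>t\<^sup>2u - W\<^sup>1)\<close> solve the same equations with a defect. The defect consists
of quadrature errors of the exact solution, of size \<open>\<tau>\<^sub>n \<tau>\<^sup>k\<^sup>+\<^sup>1\<close>, and of the increment of the elliptic
projection error of \<open>\<partial>\<^sub>t\<^sup>2u\<close>, of size \<open>\<tau>\<^sub>n h\<^sup>r\<^sup>+\<^sup>1\<close>. In the energy norm \<open>(\<parallel>\<nabla>E\<^sup>0\<parallel>\<^sup>2 + \<parallel>E\<^sup>1\<parallel>\<^sup>2)\<^sup>1\<^sup>/\<^sup>2\<close> the wave operator is skew. Testing the
equations with the projection in time of \<open>E\<close> onto degree \<open>k - 1\<close> therefore cancels the operator and leaves the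
energy increment, so that one step increases the energy norm by at most a constant times the defect
(\<open>lobatto_step_stability\<close>), and the factors \<open>\<tau>\<^sub>n\<close> add up to \<open>T\<close>.

At an arbitrary time, \<open>\<partial>\<^sub>tU - W\<close> is the error of interpolating \<open>\<partial>\<^sub>tU\<close> in time, plus the interpolant of
the elliptic projection error of \<open>\<partial>\<^sub>tU\<close>, plus the interpolant of \<open>E\<close> (\<open>error_estimate\<close>). The elliptic projection error is
of order \<open>h\<^sup>r\<^sup>+\<^sup>1\<close> in \<open>L\<^sup>2\<close> and of order \<open>h\<^sup>r\<close> in the gradient, which is the only source of the loss in the second estimate. The
\<open>L\<^sup>2\<close> norm of the first component of \<open>E\<close> follows from its gradient by the Poincare inequality.

The analysis in space is entirely variational. It uses that weak derivatives are unique
(\<open>fundamental_lemma\<close>), Green's formula for a function in \<open>H\<^sup>2\<close> and one in \<open>H\<^sub>0\<^sup>1\<close>, obtained by density,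
and Riesz representation on the finite element space.
\<close>

section \<open>Legendre polynomials and Gauss-Lobatto nodes\<close>

definition pint :: "real poly \<Rightarrow> real" where
  "pint p = integral {-1..1} (poly p)"

lemma poly_integrable_on [simp]: "poly (p :: real poly) integrable_on {a..b}"
  by (rule integrable_continuous_real) (intro continuous_intros)

lemma pint_add: "pint (p + q) = pint p + pint q"
  unfolding pint_def poly_add by (subst integral_add) auto

lemma pint_smult: "pint (smult c p) = c * pint p"
  unfolding pint_def poly_smult by simp

lemma pint_0 [simp]: "pint 0 = 0"
  using pint_smult[of 0 0] by simp

lemma pint_minus: "pint (- p) = - pint p"
  using pint_smult[of "-1" p] by simp

lemma pint_diff: "pint (p - q) = pint p - pint q"
  using pint_add[of p "- q"] by (simp add: pint_minus)

lemma pint_sum: "pint (\<Sum>i\<in>I. p i) = (\<Sum>i\<in>I. pint (p i))"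
  by (induction I rule: infinite_finite_induct) (auto simp: pint_add)

lemma integral_pderiv:
  assumes "a \<le> b" shows "integral {a..b} (poly (pderiv p)) = poly p b - poly (p :: real poly) a"
  by (rule integral_unique, rule fundamental_theorem_of_calculus[OF assms])
    (auto simp flip: has_real_derivative_iff_has_vector_derivative intro: DERIV_subset[OF poly_DERIV])

lemma pint_pderiv: "pint (pderiv p) = poly p 1 - poly p (-1)"
  unfolding pint_def by (rule integral_pderiv) simp

lemma pint_by_parts:
  "pint (pderiv p * q) = poly p 1 * poly q 1 - poly p (-1) * poly q (-1) - pint (p * pderiv q)"
  using pint_pderiv[of "p * q"] by (simp add: pderiv_mult pint_add mult.commute)

lemma pint_mono:
  assumes "\<And>x. x \<in> {-1..1} \<Longrightarrow> poly p x \<le> poly q x"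
  shows "pint p \<le> pint q"
  unfolding pint_def by (rule integral_le) (use assms in auto)

lemma pint_const: "pint [:c:] = 2 * c"
  using pint_pderiv[of "[:0, c:]"] by (simp add: pderiv_pCons)

lemma pint_square_nonneg: "0 \<le> pint (p * p)"
  using pint_mono[of 0 "p * p"] by simp

lemma pint_square_eq_0D:
  assumes "pint (p * p) = 0" shows "p = 0"
proof (rule ccontr)
  assume "p \<noteq> 0"
  have "((\<lambda>x. poly (p * p) x) has_integral 0) (cbox (-1) 1)"
    using assms unfolding pint_def cbox_interval by (metis integrable_integral poly_integrable_on)
  then have "poly (p * p) x = 0" if "x \<in> {-1..1}" for x
    by (rule has_integral_0_cbox_imp_0[rotated 2]) (use that in \<open>auto intro!: continuous_intros\<close>)
  then have "{-1..1} \<subseteq> {x. poly p x = 0}" by auto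
  moreover have "infinite {-1..(1::real)}" by (simp add: infinite_Icc)
  ultimately show False using poly_roots_finite[OF \<open>p \<noteq> 0\<close>] finite_subset by blast
qed

text \<open>Integration from the left end point raises the degree by one.\<close>
lemma has_pderiv_antiderivative: "\<exists>q. pderiv q = (p :: real poly) \<and> poly q (-1) = 0 \<and> degree q \<le> Suc (degree p)"
proof -
  define q0 where "q0 = (\<Sum>i\<le>degree p. monom (coeff p i / real (Suc i)) (Suc i))"
  have "pderiv q0 = (\<Sum>i\<le>degree p. monom (coeff p i) i)"
    unfolding q0_def by (simp add: higher_pderiv_sum[of 1, simplified] pderiv_monom del: of_nat_Suc)
  then have q0: "pderiv q0 = p" by (simp add: poly_as_sum_of_monoms)
  have "degree q0 \<le> Suc (degree p)"
    unfolding q0_def by (intro degree_sum_le) (auto intro: order.trans[OF degree_monom_le])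
  then show ?thesis
    by (intro exI[of _ "q0 - [:poly q0 (-1):]"]) (auto simp: pderiv_diff q0 pderiv_pCons intro!: degree_diff_le)
qed

lemma degree_pderiv_power_iter: "degree ((pderiv ^^ i) (p :: real poly)) = degree p - i"
  by (induction i) (auto simp: degree_pderiv)

text \<open>Each differentiation of a power lowers the multiplicity of the base by at most one; for the Rodrigues formula this
  gives zero boundary values.\<close>
lemma pderiv_iter_power_dvd:
  fixes q :: "real poly"
  shows "i \<le> n \<Longrightarrow> q ^ (n - i) dvd (pderiv ^^ i) (q ^ n)"
proof (induction i)
  case (Suc i)
  then obtain s where s: "(pderiv ^^ i) (q ^ n) = q ^ (n - i) * s" by (auto elim: dvdE)
  define m where "m = n - Suc i"
  have m: "n - i = Suc m" using Suc.prems by (simp add: m_def)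
  have "(pderiv ^^ Suc i) (q ^ n) = q ^ m * (pderiv s * q + s * smult (of_nat (Suc m)) (pderiv q))"
    unfolding funpow.simps comp_apply s m pderiv_mult pderiv_power_Suc
    by (simp add: distrib_left mult_ac del: of_nat_Suc)
  then show ?case unfolding m_def by simp
qed simp

lemma pderiv_iter_power_ends:
  assumes "i < k"
  shows "poly ((pderiv ^^ i) ([:-1, 0, 1::real:] ^ k)) 1 = 0"
    "poly ((pderiv ^^ i) ([:-1, 0, 1::real:] ^ k)) (-1) = 0"
proof -
  have "[:-1, 0, 1:] ^ (k - i) dvd (pderiv ^^ i) ([:-1, 0, 1::real:] ^ k)"
    using assms by (intro pderiv_iter_power_dvd) simp
  then obtain s where s: "(pderiv ^^ i) ([:-1, 0, 1::real:] ^ k) = [:-1, 0, 1:] ^ (k - i) * s"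
    by (rule dvdE)
  show "poly ((pderiv ^^ i) ([:-1, 0, 1::real:] ^ k)) 1 = 0"
    "poly ((pderiv ^^ i) ([:-1, 0, 1::real:] ^ k)) (-1) = 0"
    unfolding s using assms by (simp_all add: poly_power zero_power)
qed

lemma degree_legendre: "degree (legendre k) = k"
proof -
  have "degree ([:-1, 0, 1::real:] ^ k) = 2 * k" by (simp add: degree_power_eq)
  then show ?thesis unfolding legendre_def by (simp add: degree_pderiv_power_iter)
qed

text \<open>Rodrigues' formula and \<open>k\<close> integrations by parts.\<close>

lemma legendre_orthogonal:
  assumes "degree v < k" shows "pint (legendre k * v) = 0"
proof -
  define b where "b = [:-1, 0, 1::real:] ^ k"
  note b0 = pderiv_iter_power_ends[of _ k, folded b_def]
  have "pint ((pderiv ^^ k) b * v) = (-1) ^ i * pint ((pderiv ^^ (k - i)) b * (pderiv ^^ i) v)" if "i \<le> k" for i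
    using that
  proof (induction i)
    case (Suc i)
    define j where "j = k - Suc i"
    have j: "k - i = Suc j" "j < k" using Suc.prems by (auto simp: j_def)
    have "pint ((pderiv ^^ (k - i)) b * (pderiv ^^ i) v) = - pint ((pderiv ^^ j) b * (pderiv ^^ Suc i) v)"
      using pint_by_parts[of "(pderiv ^^ j) b" "(pderiv ^^ i) v"] b0[OF j(2)] by (simp add: j)
    then show ?case using Suc by (simp add: j_def)
  qed simp
  from this[of k] have "pint ((pderiv ^^ k) b * v) = (-1) ^ k * pint (b * (pderiv ^^ k) v)" by simp
  moreover have "(pderiv ^^ k) v = 0"
  proof -
    obtain c where c: "(pderiv ^^ (degree v)) v = [:c:]"
      using degree_pderiv_power_iter[of "degree v" v] by (auto elim: degree_eq_zeroE)
    have "k = (k - Suc (degree v)) + Suc (degree v)" using assms by simp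
    moreover have "(pderiv ^^ (m + Suc (degree v))) v = 0" for m
      by (induction m) (simp_all add: c pderiv_pCons)
    ultimately show ?thesis by metis
  qed
  ultimately show ?thesis unfolding legendre_def b_def[symmetric] by (simp add: pint_smult)
qed

lemma legendre_nonzero: "legendre k \<noteq> 0"
proof
  assume *: "legendre k = 0"
  then have "k = 0" using degree_legendre[of k] by simp
  with * show False by (simp add: legendre_def)
qed

text \<open>Rolle's theorem between neighbouring roots.\<close>
lemma pderiv_many_roots:
  fixes p :: "real poly"
  assumes "finite A" "card A = Suc n" "\<And>x. x \<in> A \<Longrightarrow> poly p x = 0"
  shows "\<exists>B. finite B \<and> card B = n \<and> (\<forall>x\<in>B. poly (pderiv p) x = 0 \<and> Min A < x \<and> x < Max A)"
  using assms
proof (induction n arbitrary: A)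
  case 0
  then show ?case by (intro exI[of _ "{}"]) auto
next
  case (Suc n)
  define M where "M = Max A"
  define A' where "A' = A - {M}"
  have ne: "A \<noteq> {}" using Suc.prems by auto
  have MA: "M \<in> A" using Suc.prems ne by (simp add: M_def)
  have cA': "card A' = Suc n" "finite A'" using Suc.prems MA by (auto simp: A'_def)
  then have neA': "A' \<noteq> {}" by auto
  obtain B where B: "finite B" "card B = n" "\<And>x. x \<in> B \<Longrightarrow> poly (pderiv p) x = 0 \<and> Min A' < x \<and> x < Max A'"
    using Suc.IH[OF cA'(2,1)] Suc.prems by (auto simp: A'_def)
  have m': "Max A' \<in> A'" "Min A' \<in> A'" using cA' neA' by auto
  have "Max A' < M" using m'(1) Suc.prems(1) unfolding A'_def M_def
    by (metis Diff_iff Max_ge insertI1 order_less_le)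
  moreover have "poly p (Max A') = poly p M" using m' MA Suc.prems(3) by (auto simp: A'_def)
  ultimately obtain z where z: "Max A' < z" "z < M" "poly (pderiv p) z = 0"
    using poly_MVT[of "Max A'" M p] by (auto)
  have "Min A \<le> Min A'" by (rule Min_antimono) (use Suc.prems neA' in \<open>auto simp: A'_def\<close>)
  moreover have "Min A' \<le> Max A'" using m' cA' by simp
  moreover have "z \<notin> B" using B(3) z by fastforce
  ultimately show ?case
    using B z \<open>Max A' < M\<close> unfolding M_def[symmetric] by (intro exI[of _ "insert z B"]) force
qed

text \<open>Up to a factor, the nodal polynomial of the Gauss-Lobatto points. Its derivative is, up to a factor, the Legendre
  polynomial of degree \<open>k\<close>; the proofs below use its orthogonality only.\<close>
definition lob_nodal :: "nat \<Rightarrow> real poly" where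
  "lob_nodal k = [:-1, 0, 1:] * pderiv (legendre k)"

lemma degree_lob_nodal: "k \<ge> 1 \<Longrightarrow> degree (lob_nodal k) = Suc k"
proof -
  assume k: "k \<ge> 1"
  have "pderiv (legendre k) \<noteq> 0" using degree_legendre[of k] k by (auto simp: pderiv_eq_0_iff)
  then show ?thesis unfolding lob_nodal_def using k
    by (subst degree_mult_eq) (auto simp: degree_pderiv degree_legendre)
qed

lemma lob_nodal_ends: "poly (lob_nodal k) 1 = 0" "poly (lob_nodal k) (-1) = 0"
  by (auto simp: lob_nodal_def)

text \<open>Integration by parts moves the derivative from the Legendre polynomial to \<open>(x\<^sup>2 - 1) w\<close>, whose
  degree is below \<open>k\<close>.\<close>
lemma lob_nodal_orthogonal:
  assumes "k \<ge> 1" "degree w + 2 \<le> k"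
  shows "pint (lob_nodal k * w) = 0"
proof -
  let ?q = "[:-1, 0, 1:] * w"
  have "degree (pderiv ?q) \<le> degree w + 1" unfolding degree_pderiv
    using degree_mult_le[of "[:-1, 0, 1::real:]" w] by simp
  then have "pint (legendre k * pderiv ?q) = 0" using assms by (intro legendre_orthogonal) simp
  then have "pint (pderiv (legendre k) * ?q) = 0"
    by (subst pint_by_parts) simp
  moreover have "lob_nodal k * w = pderiv (legendre k) * ?q"
    unfolding lob_nodal_def by (simp only: mult_ac)
  ultimately show ?thesis by simp
qed

lemma pderiv_lob_nodal_orthogonal:
  assumes "k \<ge> 1" "degree v < k"
  shows "pint (pderiv (lob_nodal k) * v) = 0"
proof -
  have "pint (lob_nodal k * pderiv v) = 0"
  proof (cases "degree v = 0")
    case True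
    then show ?thesis by (auto elim!: degree_eq_zeroE simp: pderiv_pCons)
  next
    case False
    then show ?thesis using assms by (intro lob_nodal_orthogonal) (auto simp: degree_pderiv)
  qed
  then show ?thesis by (simp add: pint_by_parts lob_nodal_ends)
qed

text \<open>Induction on the number of derivatives of \<open>(x\<^sup>2 - 1)\<^sup>k\<close>: Rolle's theorem produces one more
  interior root each time, because the two end points remain roots.\<close>
lemma legendre_roots:
  "\<exists>B. finite B \<and> card B = k \<and> (\<forall>x\<in>B. poly (legendre k) x = 0 \<and> -1 < x \<and> x < 1)"
proof -
  define b where "b = [:-1, 0, 1::real:] ^ k"
  note b0 = pderiv_iter_power_ends[of _ k, folded b_def]
  have "\<exists>B. finite B \<and> card B = i \<and> (\<forall>x\<in>B. poly ((pderiv ^^ i) b) x = 0 \<and> -1 < x \<and> x < 1)" if "i \<le> k" for i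
    using that
  proof (induction i)
    case (Suc i)
    then obtain B where B: "finite B" "card B = i" "\<And>x. x \<in> B \<Longrightarrow> poly ((pderiv ^^ i) b) x = 0 \<and> -1 < x \<and> x < 1"
      by auto
    define A where "A = insert (-1) (insert 1 B)"
    have "-1 \<notin> B" "1 \<notin> B" using B(3) by fastforce+
    then have cA: "card A = Suc (Suc i)" using B(1,2) by (simp add: A_def)
    have "finite A" using B by (simp add: A_def)
    moreover have "poly ((pderiv ^^ i) b) x = 0" if "x \<in> A" for x
      using that B(3) b0[of i] Suc.prems by (auto simp: A_def)
    ultimately obtain B' where B': "finite B'" "card B' = Suc i"
      "\<And>x. x \<in> B' \<Longrightarrow> poly (pderiv ((pderiv ^^ i) b)) x = 0 \<and> Min A < x \<and> x < Max A"
      using pderiv_many_roots[OF _ cA] by metis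
    have "Min A = -1" unfolding A_def using B by (intro Min_eqI) (auto intro: less_imp_le)
    moreover have "Max A = 1" unfolding A_def using B by (intro Max_eqI) (auto intro: less_imp_le)
    ultimately show ?case using B' by (intro exI[of _ B']) auto
  qed (intro exI[of _ "{}"], simp)
  from this[of k] show ?thesis unfolding legendre_def b_def[symmetric] by simp
qed

definition lob_nodes :: "nat \<Rightarrow> real set" where
  "lob_nodes k = {x. poly (lob_nodal k) x = 0}"

lemma lob_nodes:
  assumes "k \<ge> 1"
  shows "finite (lob_nodes k)" "card (lob_nodes k) = Suc k" "lob_nodes k \<subseteq> {-1..1}"
    "-1 \<in> lob_nodes k" "1 \<in> lob_nodes k"
proof -
  have nz: "lob_nodal k \<noteq> 0" using degree_lob_nodal[OF assms] by auto
  obtain B where B: "finite B" "card B = k" "\<And>x. x \<in> B \<Longrightarrow> poly (legendre k) x = 0 \<and> -1 < x \<and> x < 1"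
    using legendre_roots[of k] by auto
  have ck: "card B = Suc (k - 1)" using B assms by simp
  have neB: "B \<noteq> {}" using ck by auto
  obtain D where D: "finite D" "card D = k - 1" "\<And>x. x \<in> D \<Longrightarrow> poly (pderiv (legendre k)) x = 0 \<and> Min B < x \<and> x < Max B"
    using pderiv_many_roots[OF B(1) ck, of "legendre k"] B(3) by metis
  have D1: "-1 < x \<and> x < 1" if "x \<in> D" for x
  proof -
    have "Min B \<in> B" "Max B \<in> B" using B(1) neB by auto
    then have "-1 < Min B" "Max B < 1" using B(3) by auto
    then show ?thesis using D(3)[OF that] by linarith
  qed
  define A where "A = insert (-1) (insert 1 D)"
  have "-1 \<notin> D" "1 \<notin> D" using D1 by fastforce+
  then have cA: "card A = Suc k" using D(1,2) assms by (simp add: A_def)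
  have sub: "A \<subseteq> lob_nodes k" using D(3) by (auto simp: A_def lob_nodes_def lob_nodal_def)
  show fin: "finite (lob_nodes k)" unfolding lob_nodes_def by (rule poly_roots_finite[OF nz])
  have "card (lob_nodes k) \<le> Suc k"
    using card_poly_roots_bound[OF nz] degree_lob_nodal[OF assms] by (simp add: lob_nodes_def)
  then have eq: "A = lob_nodes k" using sub fin cA by (metis card_seteq)
  then show "card (lob_nodes k) = Suc k" using cA by simp
  show "lob_nodes k \<subseteq> {-1..1}" unfolding eq[symmetric] A_def using D1 by force
  show "-1 \<in> lob_nodes k" "1 \<in> lob_nodes k" unfolding eq[symmetric] by (auto simp: A_def)
qed

lemma lobatto_node_eq: "lobatto_node k \<mu> = sorted_list_of_set (lob_nodes k) ! \<mu>"
  by (simp add: lobatto_node_def lob_nodes_def lob_nodal_def)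

lemma lobatto_node_bij:
  assumes "k \<ge> 1" shows "bij_betw (lobatto_node k) {..k} (lob_nodes k)"
proof -
  let ?l = "sorted_list_of_set (lob_nodes k)"
  have "length ?l = Suc k" "distinct ?l" "set ?l = lob_nodes k"
    using lob_nodes[OF assms] by (auto simp: sorted_list_of_set.distinct_sorted_key_list_of_set)
  then have "bij_betw ((!) ?l) {..<Suc k} (lob_nodes k)"
    by (intro bij_betw_nth) auto
  then show ?thesis unfolding lobatto_node_eq[abs_def] by (simp add: lessThan_Suc_atMost)
qed

lemma lobatto_node_root:
  assumes "k \<ge> 1" "\<mu> \<le> k"
  shows "poly (lob_nodal k) (lobatto_node k \<mu>) = 0" "lobatto_node k \<mu> \<in> {-1..1}"
proof -
  have "lobatto_node k \<mu> \<in> lob_nodes k" using lobatto_node_bij[OF assms(1)] assms(2) by (auto simp: bij_betw_def)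
  then show "poly (lob_nodal k) (lobatto_node k \<mu>) = 0" "lobatto_node k \<mu> \<in> {-1..1}"
    using lob_nodes(3)[OF assms(1)] by (auto simp: lob_nodes_def)
qed

lemma lobatto_node_inj:
  assumes "k \<ge> 1" shows "inj_on (lobatto_node k) {..k}"
  using lobatto_node_bij[OF assms] by (auto simp: bij_betw_def)

lemma lobatto_node_mono:
  assumes "k \<ge> 1" "\<mu> \<le> \<nu>" "\<nu> \<le> k" shows "lobatto_node k \<mu> \<le> lobatto_node k \<nu>"
  unfolding lobatto_node_eq
  by (rule sorted_nth_mono) (use assms lob_nodes[OF assms(1)] in auto)

lemma lobatto_node_ends:
  assumes "k \<ge> 1" shows "lobatto_node k 0 = -1" "lobatto_node k k = 1"
proof -
  have im: "lobatto_node k ` {..k} = lob_nodes k" using lobatto_node_bij[OF assms] by (auto simp: bij_betw_def)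
  then obtain \<mu> \<nu> where "\<mu> \<le> k" "\<nu> \<le> k" "lobatto_node k \<mu> = -1" "lobatto_node k \<nu> = 1"
    using lob_nodes(4,5)[OF assms] by (smt (verit) atMost_iff imageE)
  then show "lobatto_node k 0 = -1" "lobatto_node k k = 1"
    using lobatto_node_mono[OF assms, of 0 \<mu>] lobatto_node_mono[OF assms, of \<nu> k]
      lobatto_node_root(2)[OF assms, of 0] lobatto_node_root(2)[OF assms, of k] by auto
qed

text \<open>Two polynomials of degree \<open>k + 1\<close> with the same \<open>k + 1\<close> roots are proportional. This
  identifies the lifting polynomial and, after differentiation, every residual of the scheme.\<close>
lemma poly_eq_multiple_nodal:
  assumes k: "k \<ge> 1" and "degree p \<le> Suc k" "\<And>\<mu>. \<mu> \<le> k \<Longrightarrow> poly p (lobatto_node k \<mu>) = 0"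
  shows "\<exists>c. p = smult c (lob_nodal k)"
proof -
  let ?w = "lob_nodal k"
  define c where "c = coeff p (Suc k) / coeff ?w (Suc k)"
  have lc: "coeff ?w (Suc k) \<noteq> 0" using degree_lob_nodal[OF k] by (metis degree_0 leading_coeff_0_iff nat.distinct(1))
  define d where "d = p - smult c ?w"
  have "degree d \<le> k"
  proof (rule degree_le, intro allI impI)
    fix i assume "k < i"
    show "coeff d i = 0"
    proof (cases "i = Suc k")
      case False
      then show ?thesis using \<open>k < i\<close> assms(2) degree_lob_nodal[OF k] by (auto simp: d_def coeff_eq_0)
    qed (use lc in \<open>simp add: d_def c_def\<close>)
  qed
  have "d = 0"
  proof (rule ccontr)
    assume "d \<noteq> 0"
    then have "card {x. poly d x = 0} \<le> k" using card_poly_roots_bound \<open>degree d \<le> k\<close> order.trans by blast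
    moreover have "lobatto_node k ` {..k} \<subseteq> {x. poly d x = 0}"
      using assms(3) lobatto_node_root(1)[OF k] by (auto simp: d_def)
    then have "card (lobatto_node k ` {..k}) \<le> card {x. poly d x = 0}"
      using poly_roots_finite[OF \<open>d \<noteq> 0\<close>] by (intro card_mono)
    moreover have "card (lobatto_node k ` {..k}) = Suc k" using lobatto_node_inj[OF k] by (simp add: card_image)
    ultimately show False by simp
  qed
  then show ?thesis by (auto simp: d_def)
qed

lemma poly_eq_0_nodal:
  assumes k: "k \<ge> 1" and "degree p \<le> k" "\<And>\<mu>. \<mu> \<le> k \<Longrightarrow> poly p (lobatto_node k \<mu>) = 0"
  shows "p = 0"
proof -
  obtain c where c: "p = smult c (lob_nodal k)" using poly_eq_multiple_nodal[OF k _ assms(3)] assms(2) by auto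
  then have "c = 0" using assms(2) degree_lob_nodal[OF k] by (auto split: if_splits)
  then show ?thesis by (simp add: c)
qed

lemma pderiv_lob_nodal_at_left:
  assumes k: "k \<ge> 1" shows "poly (pderiv (lob_nodal k)) (-1) \<noteq> 0"
proof
  assume *: "poly (pderiv (lob_nodal k)) (-1) = 0"
  obtain q where q: "lob_nodal k = [:1, 1:] * q"
    using lob_nodal_ends(2)[of k] unfolding poly_eq_0_iff_dvd by (auto elim: dvdE)
  have "poly q (-1) = 0" using * unfolding q pderiv_mult by (simp add: pderiv_pCons)
  moreover have "poly q (lobatto_node k \<mu>) = 0" if "\<mu> \<le> k" "lobatto_node k \<mu> \<noteq> -1" for \<mu>
    using lobatto_node_root(1)[OF k that(1)] that(2) unfolding q poly_mult by simp
  moreover have "degree q \<le> k"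
  proof -
    have "q \<noteq> 0" using q degree_lob_nodal[OF k] by auto
    then have "degree (lob_nodal k) = Suc (degree q)" unfolding q by (subst degree_mult_eq) auto
    then show ?thesis using degree_lob_nodal[OF k] by simp
  qed
  ultimately have "q = 0" by (intro poly_eq_0_nodal[OF k]) metis+
  then show False using q degree_lob_nodal[OF k] by auto
qed

text \<open>The orthogonal complement of the polynomials of degree below \<open>k\<close> within degree \<open>k\<close> is
  one-dimensional, and \<open>pderiv_lob_nodal_orthogonal\<close> exhibits an element of it.\<close>
lemma orthogonal_multiple:
  assumes k: "k \<ge> 1" and "degree p \<le> k" and orth: "\<And>v. degree v < k \<Longrightarrow> pint (p * v) = 0"
  shows "\<exists>c. p = smult c (pderiv (lob_nodal k))"
proof -
  let ?w = "pderiv (lob_nodal k)"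
  have dw: "degree ?w = k" by (simp add: degree_pderiv degree_lob_nodal[OF k])
  have lc: "coeff ?w k \<noteq> 0" using dw k by (metis degree_0 leading_coeff_0_iff not_one_le_zero)
  define c where "c = coeff p k / coeff ?w k"
  define d where "d = p - smult c ?w"
  have "degree d < k"
  proof (rule degree_lessI)
    show "\<forall>i\<ge>k. coeff d i = 0"
    proof (intro allI impI)
      fix i assume "k \<le> i"
      then show "coeff d i = 0" 
        using assms(2) dw lc by (cases "i = k") (auto simp: d_def c_def coeff_eq_0)
    qed
  qed (use k in simp)
  then have "pint (p * d) = 0" "pint (?w * d) = 0"
    using orth pderiv_lob_nodal_orthogonal[OF k] by auto
  moreover have "d * d = p * d - smult c (?w * d)"
    by (simp add: d_def left_diff_distrib[of _ _ "p - smult c ?w"])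
  ultimately have "pint (d * d) = 0" by (simp add: pint_diff pint_smult)
  then have "d = 0" by (rule pint_square_eq_0D)
  then show ?thesis by (auto simp: d_def)
qed

section \<open>Lobatto collocation on the reference interval\<close>

lemma poly_bounded_on_ref: "\<exists>K\<ge>0. \<forall>x\<in>{-1..1}. \<bar>poly (p :: real poly) x\<bar> \<le> K"
proof -
  have "compact (poly p ` {-1..1})" by (intro compact_continuous_image continuous_intros) auto
  then obtain K where "\<And>y. y \<in> poly p ` {-1..1} \<Longrightarrow> norm y \<le> K"
    using compact_imp_bounded bounded_iff by metis
  then show ?thesis by (intro exI[of _ "\<bar>K\<bar>"]) force
qed

lemma poly_bounds:
  obtains K :: "real poly \<Rightarrow> real" where "\<And>p. 0 \<le> K p" "\<And>p x. x \<in> {-1..1} \<Longrightarrow> \<bar>poly p x\<bar> \<le> K p"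
proof -
  define K where "K p = (SOME K. 0 \<le> K \<and> (\<forall>x\<in>{-1..1}. \<bar>poly p x\<bar> \<le> K))" for p :: "real poly"
  have "0 \<le> K p \<and> (\<forall>x\<in>{-1..1}. \<bar>poly p x\<bar> \<le> K p)" for p
    unfolding K_def by (rule someI_ex) (use poly_bounded_on_ref in blast)
  then show thesis using that by blast
qed

lemma legendre_expansion:
  "degree p \<le> n \<Longrightarrow> \<exists>c. p = (\<Sum>j\<le>n. smult (c j) (legendre j))"
proof (induction n arbitrary: p)
  case 0
  have "degree (legendre 0) = 0" "legendre 0 \<noteq> 0" using degree_legendre legendre_nonzero by auto
  then obtain b where b: "legendre 0 = [:b:]" "b \<noteq> 0" by (auto elim: degree_eq_zeroE)
  obtain a where "p = [:a:]" using 0 by (auto elim: degree_eq_zeroE)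
  then show ?case using b by (intro exI[of _ "\<lambda>_. a / b"]) simp
next
  case (Suc n)
  let ?P = "legendre (Suc n)"
  have lc: "coeff ?P (Suc n) \<noteq> 0" using degree_legendre[of "Suc n"] legendre_nonzero[of "Suc n"]
    by (metis leading_coeff_0_iff)
  define a where "a = coeff p (Suc n) / coeff ?P (Suc n)"
  have "degree (p - smult a ?P) \<le> n"
  proof (rule degree_le, intro allI impI)
    fix i assume "n < i"
    then show "coeff (p - smult a ?P) i = 0"
      using lc Suc.prems degree_legendre[of "Suc n"] by (cases "i = Suc n") (auto simp: a_def coeff_eq_0)
  qed
  then obtain c where c: "p - smult a ?P = (\<Sum>j\<le>n. smult (c j) (legendre j))" using Suc.IH by blast
  have "(\<Sum>j\<le>Suc n. smult ((c(Suc n := a)) j) (legendre j)) = (\<Sum>j\<le>n. smult (c j) (legendre j)) + smult a ?P"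
    by simp
  also have "\<dots> = p" using c by (simp add: algebra_simps)
  finally show ?case by metis
qed

text \<open>On nonnegative polynomials the integral controls the Legendre coefficients, because
  \<open>\<bar>\<integral>pP\<^sub>j\<bar> \<le> max \<bar>P\<^sub>j\<bar> \<integral>p\<close>. For the squared norm of
  a polynomial in time this turns control of the mean into control at every time.\<close>
lemma poly_inverse_inequality:
  "\<exists>C>0. \<forall>p. degree p \<le> n \<longrightarrow> (\<forall>x\<in>{-1..1}. 0 \<le> poly p x) \<longrightarrow> (\<forall>x\<in>{-1..1}. poly p x \<le> C * pint p)"
proof -
  obtain K' :: "real poly \<Rightarrow> real" where K': "\<And>p. 0 \<le> K' p" "\<And>p x. x \<in> {-1..1} \<Longrightarrow> \<bar>poly p x\<bar> \<le> K' p"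
    using poly_bounds by blast
  define K where "K j = K' (legendre j)" for j
  have K: "\<And>j. 0 \<le> K j" "\<And>j x. x \<in> {-1..1} \<Longrightarrow> \<bar>poly (legendre j) x\<bar> \<le> K j"
    using K' by (auto simp: K_def)
  define S where "S j = pint (legendre j * legendre j)" for j
  have S: "S j > 0" for j
    using pint_square_nonneg[of "legendre j"] pint_square_eq_0D[of "legendre j"] legendre_nonzero[of j]
    unfolding S_def by linarith
  have orth: "pint (legendre i * legendre j) = 0" if "i \<noteq> j" for i j
    using legendre_orthogonal[of "legendre i" j] legendre_orthogonal[of "legendre j" i] that
    by (cases "i < j") (auto simp: degree_legendre mult.commute)
  define C where "C = 1 + (\<Sum>j\<le>n. K j * K j / S j)"
  have C0: "C > 0" unfolding C_def using K(1) S by (smt (verit) divide_nonneg_pos mult_nonneg_nonneg sum_nonneg)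
  have "poly p x \<le> C * pint p"
    if p: "degree p \<le> n" "\<forall>x\<in>{-1..1}. 0 \<le> poly p x" and x: "x \<in> {-1..1}" for p x
  proof -
    obtain c where c: "p = (\<Sum>j\<le>n. smult (c j) (legendre j))" using legendre_expansion[OF p(1)] by blast
    have p0: "0 \<le> pint p" using pint_mono[of 0 p] p(2) by simp
    have cj: "\<bar>c j\<bar> \<le> K j / S j * pint p" if j: "j \<le> n" for j
    proof -
      have "pint (p * legendre j) = (\<Sum>i\<le>n. c i * pint (legendre i * legendre j))"
        unfolding c by (simp add: sum_distrib_right pint_sum pint_smult)
      also have "\<dots> = (\<Sum>i\<le>n. if i = j then c j * S j else 0)"
        by (rule sum.cong) (auto simp: orth S_def)
      also have "\<dots> = c j * S j" using j by simp
      finally have e: "c j * S j = pint (p * legendre j)" by simp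
      have "pint (p * legendre j) \<le> pint (smult (K j) p)" "pint (smult (- K j) p) \<le> pint (p * legendre j)"
      proof -
        have "poly (p * legendre j) y \<le> poly (smult (K j) p) y \<and> poly (smult (- K j) p) y \<le> poly (p * legendre j) y"
          if y: "y \<in> {-1..1}" for y
        proof -
          have "\<bar>poly p y * poly (legendre j) y\<bar> \<le> poly p y * K j"
            using p(2) K(2)[OF y, of j] y by (simp add: abs_mult mult_left_mono)
          then show ?thesis by (auto simp: algebra_simps abs_le_iff)
        qed
        then show "pint (p * legendre j) \<le> pint (smult (K j) p)" "pint (smult (- K j) p) \<le> pint (p * legendre j)"
          by (auto intro!: pint_mono)
      qed
      then have "\<bar>c j * S j\<bar> \<le> K j * pint p" unfolding e by (simp add: pint_smult pint_minus)
      then show ?thesis using S[of j] by (simp add: abs_mult field_simps)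
    qed
    have "poly p x = (\<Sum>j\<le>n. c j * poly (legendre j) x)" by (subst c) (simp add: poly_sum)
    also have "\<dots> \<le> (\<Sum>j\<le>n. (K j / S j * pint p) * K j)"
    proof (rule sum_mono)
      fix j assume "j \<in> {..n}"
      then have "\<bar>c j\<bar> * \<bar>poly (legendre j) x\<bar> \<le> (K j / S j * pint p) * K j"
        using cj K x S[of j] p0 by (intro mult_mono) (auto intro!: mult_nonneg_nonneg divide_nonneg_pos)
      then show "c j * poly (legendre j) x \<le> (K j / S j * pint p) * K j"
        by (metis abs_ge_self abs_mult order_trans)
    qed
    also have "\<dots> = (\<Sum>j\<le>n. K j * K j / S j) * pint p"
      unfolding sum_distrib_right by (rule sum.cong) auto
    also have "\<dots> = (C - 1) * pint p" unfolding C_def by simp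
    also have "\<dots> \<le> C * pint p" using p0 by (simp add: algebra_simps)
    finally show ?thesis .
  qed
  then show ?thesis using C0 by blast
qed

definition lagr :: "nat \<Rightarrow> nat \<Rightarrow> real poly" where
  "lagr k \<mu> = (\<Prod>\<nu>\<in>{..k} - {\<mu>}. smult (1 / (lobatto_node k \<mu> - lobatto_node k \<nu>)) [:- lobatto_node k \<nu>, 1:])"

lemma lobatto_weight_pint: "lobatto_weight k \<mu> = pint (lagr k \<mu>)"
  unfolding lobatto_weight_def pint_def lagr_def
  by (rule arg_cong[where f = "integral _"]) (auto simp: poly_prod diff_divide_distrib intro!: prod.cong)

lemma degree_lagr: "\<mu> \<le> k \<Longrightarrow> degree (lagr k \<mu>) \<le> k"
proof -
  assume "\<mu> \<le> k"
  have "degree (lagr k \<mu>) \<le> (\<Sum>\<nu>\<in>{..k} - {\<mu>}. 1)"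
    unfolding lagr_def
  proof (rule order.trans[OF degree_prod_sum_le])
    show "sum (degree \<circ> (\<lambda>\<nu>. smult (1 / (lobatto_node k \<mu> - lobatto_node k \<nu>)) [:- lobatto_node k \<nu>, 1:])) ({..k} - {\<mu>})
        \<le> (\<Sum>\<nu>\<in>{..k} - {\<mu>}. 1)"
      unfolding comp_def by (intro sum_mono order.trans[OF degree_smult_le]) simp
  qed simp
  then show ?thesis using \<open>\<mu> \<le> k\<close> by simp
qed

lemma lagr_node:
  assumes "k \<ge> 1" "\<mu> \<le> k" "\<nu> \<le> k"
  shows "poly (lagr k \<mu>) (lobatto_node k \<nu>) = (if \<mu> = \<nu> then 1 else 0)"
proof (cases "\<mu> = \<nu>")
  case True
  have "lobatto_node k \<mu> - lobatto_node k i \<noteq> 0" if "i \<in> {..k} - {\<mu>}" for i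
    using lobatto_node_inj[OF assms(1)] assms that by (auto simp: inj_on_def)
  then show ?thesis using True unfolding lagr_def poly_prod
    by (auto intro!: prod.neutral simp: diff_divide_distrib[symmetric])
next
  case False
  then show ?thesis unfolding lagr_def poly_prod using assms by (auto intro!: prod_zero bexI[of _ \<nu>])
qed

lemma lagr_interp:
  assumes "k \<ge> 1" "degree p \<le> k"
  shows "p = (\<Sum>\<mu>\<le>k. smult (poly p (lobatto_node k \<mu>)) (lagr k \<mu>))"
proof -
  have "p - (\<Sum>\<mu>\<le>k. smult (poly p (lobatto_node k \<mu>)) (lagr k \<mu>)) = 0"
  proof (rule poly_eq_0_nodal[OF assms(1)])
    show "degree (p - (\<Sum>\<mu>\<le>k. smult (poly p (lobatto_node k \<mu>)) (lagr k \<mu>))) \<le> k"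
      using assms by (intro degree_diff_le degree_sum_le order.trans[OF degree_smult_le] degree_lagr) auto
    fix \<nu> assume "\<nu> \<le> k"
    then show "poly (p - (\<Sum>\<mu>\<le>k. smult (poly p (lobatto_node k \<mu>)) (lagr k \<mu>))) (lobatto_node k \<nu>) = 0"
      by (simp add: poly_sum lagr_node[OF assms(1)] if_distrib[of "(*) _"] cong: if_cong)
  qed
  then show ?thesis by simp
qed

lemma sum_lagr: "k \<ge> 1 \<Longrightarrow> (\<Sum>\<mu>\<le>k. lagr k \<mu>) = 1"
  using lagr_interp[of k 1] by simp

lemma sum_pderiv: "pderiv (\<Sum>i\<in>I. p i) = (\<Sum>i\<in>I. pderiv (p i))"
  by (induction I rule: infinite_finite_induct) (auto simp: pderiv_add)

text \<open>Division by the nodal polynomial leaves a remainder that interpolates \<open>g\<close>, and the quotient has degree at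
  most \<open>k - 2\<close>.\<close>
lemma quad_exact:
  assumes k: "k \<ge> 1" and "degree g \<le> 2 * k - 1"
  shows "pint g = (\<Sum>\<mu>\<le>k. lobatto_weight k \<mu> * poly g (lobatto_node k \<mu>))"
proof -
  let ?w = "lob_nodal k"
  define q where "q = g div ?w"
  define r where "r = g mod ?w"
  have g: "g = ?w * q + r" by (simp add: q_def r_def)
  have w0: "?w \<noteq> 0" using degree_lob_nodal[OF k] by auto
  have dr: "degree r \<le> k" unfolding r_def using degree_mod_less[OF w0, of g] degree_lob_nodal[OF k] by auto
  have "pint (?w * q) = 0"
  proof (cases "q = 0")
    case False
    have "degree (?w * q) \<le> 2 * k - 1"
    proof -
      have "?w * q = g - r" using g by simp
      then show ?thesis using assms(2) dr k by (simp add: degree_diff_le)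
    qed
    then have "Suc k + degree q \<le> 2 * k - 1" using False w0 degree_lob_nodal[OF k] by (simp add: degree_mult_eq)
    then show ?thesis by (intro lob_nodal_orthogonal[OF k]) simp
  qed simp
  then have "pint g = pint r" by (subst g) (simp add: pint_add)
  also have "\<dots> = pint (\<Sum>\<mu>\<le>k. smult (poly r (lobatto_node k \<mu>)) (lagr k \<mu>))"
    using lagr_interp[OF k dr] by simp
  also have "\<dots> = (\<Sum>\<mu>\<le>k. lobatto_weight k \<mu> * poly r (lobatto_node k \<mu>))"
    by (simp add: pint_sum pint_smult lobatto_weight_pint mult.commute)
  also have "\<dots> = (\<Sum>\<mu>\<le>k. lobatto_weight k \<mu> * poly g (lobatto_node k \<mu>))"
    by (rule sum.cong) (use lobatto_node_root(1)[OF k] in \<open>auto simp: g\<close>)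
  finally show ?thesis .
qed

definition lagr_int :: "nat \<Rightarrow> nat \<Rightarrow> real poly" where
  "lagr_int k \<nu> = (SOME q. pderiv q = lagr k \<nu> \<and> poly q (-1) = 0 \<and> degree q \<le> Suc (degree (lagr k \<nu>)))"

lemma lagr_int: "pderiv (lagr_int k \<nu>) = lagr k \<nu>" "poly (lagr_int k \<nu>) (-1) = 0"
  "degree (lagr_int k \<nu>) \<le> Suc (degree (lagr k \<nu>))"
  unfolding lagr_int_def using someI_ex[OF has_pderiv_antiderivative[of "lagr k \<nu>"]] by auto

text \<open>The Butcher matrix of the Lobatto IIIA method on \<open>[-1, 1]\<close>: the integrals of the Lagrange basis from
  \<open>-1\<close> to the nodes.\<close>
definition rk :: "nat \<Rightarrow> nat \<Rightarrow> nat \<Rightarrow> real" where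
  "rk k \<mu> \<nu> = poly (lagr_int k \<nu>) (lobatto_node k \<mu>)"

text \<open>The derivative of \<open>Y\<close> has degree at most \<open>k\<close>, so it equals its interpolant, and integrating
  the interpolant gives the increments.\<close>
lemma nodal_increment:
  assumes k: "k \<ge> 1" and "degree Y \<le> Suc k"
  shows "poly Y (lobatto_node k \<mu>) - poly Y (-1) = (\<Sum>\<nu>\<le>k. rk k \<mu> \<nu> * poly (pderiv Y) (lobatto_node k \<nu>))"
proof -
  define D where "D = Y - (\<Sum>\<nu>\<le>k. smult (poly (pderiv Y) (lobatto_node k \<nu>)) (lagr_int k \<nu>))"
  have "degree (pderiv Y) \<le> k" using assms(2) by (simp add: degree_pderiv)
  then have "pderiv D = 0" unfolding D_def
    using lagr_interp[OF k, of "pderiv Y"] by (simp add: pderiv_diff sum_pderiv pderiv_smult lagr_int)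
  then obtain c where "D = [:c:]" by (auto simp: pderiv_eq_0_iff elim: degree_eq_zeroE)
  then have "poly D (lobatto_node k \<mu>) = poly D (-1)" by simp
  then show ?thesis by (simp add: D_def poly_sum lagr_int rk_def mult.commute)
qed

text \<open>The projection in time of the Lagrange basis function onto degree \<open>k - 1\<close>, see \<open>lagr_lproj\<close>.
  It is written as the derivative of the interpolant of the integral because the collocation equations, combined with
  the weights \<open>pderiv (lagr k \<mu>)\<close>, then produce this function directly.\<close>
definition lproj :: "nat \<Rightarrow> nat \<Rightarrow> real poly" where
  "lproj k \<nu> = (\<Sum>\<mu>\<le>k. smult (rk k \<mu> \<nu>) (pderiv (lagr k \<mu>)))"

lemma degree_pderiv_lagr: "k \<ge> 1 \<Longrightarrow> \<mu> \<le> k \<Longrightarrow> degree (pderiv (lagr k \<mu>)) < k"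
  using degree_lagr[of \<mu> k] by (simp add: degree_pderiv)

lemma degree_lproj: assumes "k \<ge> 1" shows "degree (lproj k \<nu>) < k"
proof -
  have "degree (smult (rk k \<mu> \<nu>) (pderiv (lagr k \<mu>))) \<le> k - 1" if "\<mu> \<le> k" for \<mu>
    using degree_pderiv_lagr[OF assms that] by (intro order.trans[OF degree_smult_le]) simp
  then have "degree (lproj k \<nu>) \<le> k - 1" unfolding lproj_def by (intro degree_sum_le) auto
  then show ?thesis using assms by simp
qed

text \<open>The difference of the integral of a basis function and its interpolant vanishes at all nodes, so it is a multiple of
  the nodal polynomial.\<close>
lemma lagr_lproj:
  assumes k: "k \<ge> 1" and "\<nu> \<le> k"
  shows "\<exists>c. lagr k \<nu> = lproj k \<nu> + smult c (pderiv (lob_nodal k))"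
proof -
  define D where "D = lagr_int k \<nu> - (\<Sum>\<mu>\<le>k. smult (rk k \<mu> \<nu>) (lagr k \<mu>))"
  have "\<exists>c. D = smult c (lob_nodal k)"
  proof (rule poly_eq_multiple_nodal[OF k])
    show "degree D \<le> Suc k" unfolding D_def
      using assms by (intro degree_diff_le degree_sum_le order.trans[OF degree_smult_le] le_SucI[OF degree_lagr] order.trans[OF lagr_int(3)])
        (auto intro: degree_lagr)
    fix i assume "i \<le> k"
    then show "poly D (lobatto_node k i) = 0"
      by (simp add: D_def poly_sum lagr_node[OF k] rk_def if_distrib[of "(*) _"] cong: if_cong)
  qed
  then obtain c where c: "D = smult c (lob_nodal k)" by blast
  have "pderiv D = lagr k \<nu> - lproj k \<nu>"
    by (simp add: D_def pderiv_diff sum_pderiv pderiv_smult lagr_int lproj_def)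
  then show ?thesis using c by (intro exI[of _ c]) (simp add: pderiv_smult algebra_simps)
qed

text \<open>For nodal values \<open>e \<mu>\<close> and \<open>b \<mu> \<nu> = B (e \<mu>) (e \<nu>)\<close> this is the
  polynomial in time \<open>B (\<Sum> p \<mu> e \<mu>) (\<Sum> q \<nu> e \<nu>)\<close>. Through it the energy argument
  becomes one about real polynomials.\<close>
definition qform :: "nat \<Rightarrow> (nat \<Rightarrow> nat \<Rightarrow> real) \<Rightarrow> (nat \<Rightarrow> real poly) \<Rightarrow> (nat \<Rightarrow> real poly) \<Rightarrow> real poly" where
  "qform k b p q = (\<Sum>\<mu>\<le>k. \<Sum>\<nu>\<le>k. smult (b \<mu> \<nu>) (p \<mu> * q \<nu>))"

lemma poly_qform: "poly (qform k b p q) x = (\<Sum>\<mu>\<le>k. \<Sum>\<nu>\<le>k. b \<mu> \<nu> * (poly (p \<mu>) x * poly (q \<nu>) x))"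
  by (simp add: qform_def poly_sum)

lemma degree_qform:
  assumes "\<And>\<mu>. \<mu> \<le> k \<Longrightarrow> degree (p \<mu>) \<le> m" "\<And>\<mu>. \<mu> \<le> k \<Longrightarrow> degree (q \<mu>) \<le> n"
  shows "degree (qform k b p q) \<le> m + n"
  unfolding qform_def
  using assms by (intro degree_sum_le order.trans[OF degree_smult_le] order.trans[OF degree_mult_le] add_mono) auto

text \<open>Let \<open>E\<close> be the interpolant of the nodal values behind \<open>b\<close>, and \<open>G\<close> its
  projection onto degree \<open>k - 1\<close>. Then \<open>H = B(E', G)\<close>, and the omitted part of
  \<open>E\<close> is a multiple of \<open>w = pderiv (lob_nodal k)\<close>, which is orthogonal to \<open>E'\<close>.
  So the integral of \<open>H\<close> is that of \<open>B(E', E)\<close>, the energy increment. With the weight \<open>1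
  - x\<close> the omitted part survives, but its contribution is a negative multiple of
  \<open>\<integral>w\<^sup>2\<close> and hence has a good sign; integration by parts then bounds the mean of the energy
  \<open>N\<close> by its initial value. The last inequality is that \<open>G\<close> is an orthogonal projection.\<close>
lemma energy_identities:
  fixes b :: "nat \<Rightarrow> nat \<Rightarrow> real"
  assumes k: "k \<ge> 1" and sym: "\<And>\<mu> \<nu>. \<mu> \<le> k \<Longrightarrow> \<nu> \<le> k \<Longrightarrow> b \<mu> \<nu> = b \<nu> \<mu>"
    and psd: "\<And>c. 0 \<le> (\<Sum>\<mu>\<le>k. \<Sum>\<nu>\<le>k. b \<mu> \<nu> * (c \<mu> * c \<nu>))"
  defines "N \<equiv> qform k b (lagr k) (lagr k)" and "NG \<equiv> qform k b (lproj k) (lproj k)"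
    and "H \<equiv> qform k b (\<lambda>\<mu>. pderiv (lagr k \<mu>)) (lproj k)"
  shows "pint H = (b k k - b 0 0) / 2" "pint ([:1, -1:] * H) \<ge> - b 0 0 + pint N / 2" "pint NG \<le> pint N"
proof -
  define w where "w = pderiv (lob_nodal k)"
  have worth: "pint (w * v) = 0" "pint (v * w) = 0" if "degree v < k" for v
    using pderiv_lob_nodal_orthogonal[OF k that] by (auto simp: w_def mult.commute)
  obtain c where c: "\<And>\<nu>. \<nu> \<le> k \<Longrightarrow> lagr k \<nu> = lproj k \<nu> + smult (c \<nu>) w"
    using lagr_lproj[OF k] unfolding w_def by metis
  have dl: "degree (pderiv (lagr k \<mu>)) < k" if "\<mu> \<le> k" for \<mu> using degree_pderiv_lagr[OF k that] .
  let ?l' = "\<lambda>\<mu>. pderiv (lagr k \<mu>)"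
  define R where "R = qform k b ?l' (\<lambda>\<nu>. smult (c \<nu>) w)"
  define cc where "cc = (\<Sum>\<mu>\<le>k. \<Sum>\<nu>\<le>k. b \<mu> \<nu> * (c \<mu> * c \<nu>))"
  have cc0: "0 \<le> cc" unfolding cc_def by (rule psd)
  have "qform k b ?l' (lagr k) = H + R"
    unfolding H_def R_def qform_def sum.distrib[symmetric]
    by (intro sum.cong refl) (simp add: c distrib_left smult_add_right)
  moreover have dN: "pderiv N = smult 2 (qform k b ?l' (lagr k))"
  proof -
    have "qform k b (lagr k) ?l' = qform k b ?l' (lagr k)"
      unfolding qform_def by (subst sum.swap) (auto intro!: sum.cong simp: sym mult.commute)
    moreover have "pderiv N = qform k b ?l' (lagr k) + qform k b (lagr k) ?l'"
      unfolding N_def qform_def sum_pderiv sum.distrib[symmetric]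
      by (intro sum.cong refl) (simp add: pderiv_smult pderiv_mult smult_add_right mult.commute)
    ultimately show ?thesis by (metis one_add_one smult_1_left smult_add_left)
  qed
  ultimately have H: "H = smult (1/2) (pderiv N) - R" by simp
  have Nends: "poly N 1 = b k k" "poly N (-1) = b 0 0"
  proof -
    have "poly N (lobatto_node k i) = b i i" if "i \<le> k" for i
    proof -
      have "poly N (lobatto_node k i) = (\<Sum>\<mu>\<le>k. if \<mu> = i then b i i else 0)"
        unfolding N_def poly_qform using that
        by (intro sum.cong refl) (auto simp: lagr_node[OF k] if_distrib[of "(*) _"] cong: if_cong)
      then show ?thesis using that by simp
    qed
    from this[of k] this[of 0] show "poly N 1 = b k k" "poly N (-1) = b 0 0" using lobatto_node_ends[OF k] by auto
  qed
  have "pint R = (\<Sum>\<mu>\<le>k. \<Sum>\<nu>\<le>k. b \<mu> \<nu> * (c \<nu> * pint (?l' \<mu> * w)))"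
    unfolding R_def qform_def pint_sum pint_smult by (simp add: pint_smult)
  then have "pint R = 0" using worth dl by simp
  then show "pint H = (b k k - b 0 0) / 2"
    by (simp add: H pint_diff pint_smult pint_pderiv Nends)
  have wl: "pint ([:1, -1:] * ?l' \<mu> * w) = - (c \<mu> * k * pint (w * w))" if \<mu>: "\<mu> \<le> k" for \<mu>
  proof -
    have deg_w: "degree w = k" unfolding w_def by (simp add: degree_pderiv degree_lob_nodal[OF k])
    have a: "degree ([:1, -1:] * pderiv (lproj k \<mu>)) < k"
    proof (cases "degree (lproj k \<mu>) = 0")
      case True
      then show ?thesis using k by (auto elim!: degree_eq_zeroE simp: pderiv_pCons)
    next
      case False
      have "degree ([:1, -1:] * pderiv (lproj k \<mu>)) \<le> 1 + (degree (lproj k \<mu>) - 1)"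
        using degree_mult_le[of "[:1, -1::real:]" "pderiv (lproj k \<mu>)"] by (simp add: degree_pderiv)
      then show ?thesis using False degree_lproj[OF k, of \<mu>] by simp
    qed
    have b: "degree ([:1, -1:] * pderiv w + smult (real k) w) < k"
    proof (rule degree_lessI)
      show "\<forall>i\<ge>k. coeff ([:1, -1:] * pderiv w + smult (real k) w) i = 0"
      proof (intro allI impI)
        fix i assume i: "k \<le> i"
        then obtain j where j: "i = Suc j" using k by (cases i) auto
        have "coeff w (Suc i) = 0" using i deg_w by (simp add: coeff_eq_0)
        moreover have "i > k \<Longrightarrow> coeff w i = 0" using deg_w by (simp add: coeff_eq_0)
        ultimately show "coeff ([:1, -1:] * pderiv w + smult (real k) w) i = 0"
          using i by (cases "i = k") (auto simp: j coeff_pderiv)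
      qed
    qed (use k in simp)
    have "[:1, -1:] * ?l' \<mu> * w
        = [:1, -1:] * pderiv (lproj k \<mu>) * w + smult (c \<mu>) (([:1, -1:] * pderiv w + smult (real k) w) * w)
          - smult (c \<mu> * k) (w * w)"
      unfolding c[OF \<mu>] pderiv_add pderiv_smult by (simp add: algebra_simps smult_add_right smult_diff_right)
    then have "pint ([:1, -1:] * ?l' \<mu> * w) = - (c \<mu> * k * pint (w * w))"
      using worth(2)[OF a] worth(2)[OF b] by (simp only: pint_add pint_diff pint_smult)
    then show ?thesis .
  qed
  have "pint ([:1, -1:] * R) = (\<Sum>\<mu>\<le>k. \<Sum>\<nu>\<le>k. b \<mu> \<nu> * (c \<nu> * pint ([:1, -1:] * ?l' \<mu> * w)))"
    unfolding R_def qform_def sum_distrib_left pint_sum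
    by (intro sum.cong refl) (simp only: mult_smult_right pint_smult mult.assoc)
  also have "\<dots> = (\<Sum>\<mu>\<le>k. \<Sum>\<nu>\<le>k. (- (k * pint (w * w))) * (b \<mu> \<nu> * (c \<mu> * c \<nu>)))"
  proof (intro sum.cong refl)
    fix \<mu> \<nu> assume "\<mu> \<in> {..k}"
    then show "b \<mu> \<nu> * (c \<nu> * pint ([:1, -1:] * ?l' \<mu> * w)) = - (k * pint (w * w)) * (b \<mu> \<nu> * (c \<mu> * c \<nu>))"
      by (subst wl) auto
  qed
  also have "\<dots> = - (k * pint (w * w)) * cc" unfolding cc_def by (simp only: sum_distrib_left)
  also have "\<dots> \<le> 0" using cc0 pint_square_nonneg[of w] by (simp add: mult_nonneg_nonneg)
  finally have R0: "pint ([:1, -1:] * R) \<le> 0" .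
  have "pint (pderiv N * [:1, -1:]) = - 2 * b 0 0 + pint N"
    unfolding pint_by_parts by (simp add: Nends pderiv_pCons pint_minus)
  then have "pint ([:1, -1:] * H) = - b 0 0 + pint N / 2 - pint ([:1, -1:] * R)"
    unfolding H right_diff_distrib mult_smult_right pint_diff pint_smult by (simp add: mult.commute)
  then show "pint ([:1, -1:] * H) \<ge> - b 0 0 + pint N / 2" using R0 by simp
  have "pint N = (\<Sum>\<mu>\<le>k. \<Sum>\<nu>\<le>k. b \<mu> \<nu> * pint (lproj k \<mu> * lproj k \<nu>) + b \<mu> \<nu> * (c \<mu> * c \<nu>) * pint (w * w))"
    unfolding N_def qform_def pint_sum pint_smult
  proof (intro sum.cong refl)
    fix \<mu> \<nu> assume "\<mu> \<in> {..k}" "\<nu> \<in> {..k}"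
    then have e: "lagr k \<mu> * lagr k \<nu> = lproj k \<mu> * lproj k \<nu> + smult (c \<nu>) (lproj k \<mu> * w)
        + smult (c \<mu>) (w * lproj k \<nu>) + smult (c \<mu> * c \<nu>) (w * w)"
      by (simp add: c algebra_simps smult_add_right)
    show "b \<mu> \<nu> * pint (lagr k \<mu> * lagr k \<nu>) = b \<mu> \<nu> * pint (lproj k \<mu> * lproj k \<nu>) + b \<mu> \<nu> * (c \<mu> * c \<nu>) * pint (w * w)"
      unfolding e pint_add pint_smult using worth[OF degree_lproj[OF k, of \<mu>]] worth[OF degree_lproj[OF k, of \<nu>]]
      by (simp add: algebra_simps)
  qed
  also have "\<dots> = pint NG + cc * pint (w * w)"
    unfolding NG_def qform_def pint_sum pint_smult sum.distrib cc_def sum_distrib_right ..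
  finally show "pint NG \<le> pint N" using cc0 pint_square_nonneg[of w] by simp
qed

text \<open>Taylor's theorem for derivatives that are one-sided at the end points.\<close>

lemma taylor_poly_bound:
  fixes g :: "nat \<Rightarrow> real \<Rightarrow> real"
  assumes "a \<le> b"
    and "\<And>j s. j \<le> n \<Longrightarrow> s \<in> {a..b} \<Longrightarrow> (g j has_real_derivative g (Suc j) s) (at s within {a..b})"
    and "\<And>s. s \<in> {a..b} \<Longrightarrow> \<bar>g (Suc n) s\<bar> \<le> M"
  shows "\<exists>T. degree T \<le> n \<and> (\<forall>j\<le>n. \<forall>s\<in>{a..b}. \<bar>g j s - poly ((pderiv ^^ j) T) s\<bar> \<le> M * (s - a) ^ (Suc n - j))"
  using assms(2,3)
proof (induction n arbitrary: g)
  case 0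
  have "\<bar>g 0 s - g 0 a\<bar> \<le> M * (s - a)" if "s \<in> {a..b}" for s
    using field_differentiable_bound[of "{a..b}" "g 0" "g (Suc 0)" M s a] 0 that assms(1) by auto
  then show ?case by (intro exI[of _ "[:g 0 a:]"]) simp
next
  case (Suc n)
  obtain T1 where T1: "degree T1 \<le> n"
    "\<And>j s. j \<le> n \<Longrightarrow> s \<in> {a..b} \<Longrightarrow> \<bar>g (Suc j) s - poly ((pderiv ^^ j) T1) s\<bar> \<le> M * (s - a) ^ (Suc n - j)"
    using Suc.IH[of "\<lambda>j. g (Suc j)"] Suc.prems by auto
  obtain q where q: "pderiv q = T1" "degree q \<le> Suc (degree T1)" using has_pderiv_antiderivative by blast
  define T where "T = q + [:g 0 a - poly q a:]"
  have T: "pderiv T = T1" "poly T a = g 0 a" "degree T \<le> Suc n"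
    using q T1(1) by (auto simp: T_def pderiv_add pderiv_pCons intro!: degree_add_le)
  have M0: "0 \<le> M" using Suc.prems(2)[of a] assms(1) by (smt (verit) atLeastAtMost_iff)
  have "\<bar>g 0 s - poly T s\<bar> \<le> M * (s - a) ^ (Suc (Suc n))" if s: "s \<in> {a..b}" for s
  proof -
    have "norm ((g 0 s - poly T s) - (g 0 a - poly T a)) \<le> (M * (s - a) ^ Suc n) * norm (s - a)"
    proof (rule field_differentiable_bound[of "{a..s}" _ "\<lambda>r. g (Suc 0) r - poly T1 r"])
      fix r assume r: "r \<in> {a..s}"
      then have r': "r \<in> {a..b}" using s by auto
      show "((\<lambda>s. g 0 s - poly T s) has_real_derivative g (Suc 0) r - poly T1 r) (at r within {a..s})"
        using DERIV_subset[OF Suc.prems(1)[OF _ r', of 0], of "{a..s}"] s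
        unfolding T(1)[symmetric] by (intro DERIV_diff DERIV_subset[OF poly_DERIV]) auto
      have "\<bar>g (Suc 0) r - poly T1 r\<bar> \<le> M * (r - a) ^ Suc n" using T1(2)[of 0 r] r' by simp
      also have "\<dots> \<le> M * (s - a) ^ Suc n" using r M0 by (intro mult_left_mono power_mono) auto
      finally show "norm (g (Suc 0) r - poly T1 r) \<le> M * (s - a) ^ Suc n" by simp
    qed (use s in auto)
    then show ?thesis using s by (simp add: T(2) mult_ac)
  qed
  moreover have "\<bar>g j s - poly ((pderiv ^^ j) T) s\<bar> \<le> M * (s - a) ^ (Suc (Suc n) - j)"
    if "j = Suc i" "i \<le> n" "s \<in> {a..b}" for i j s
    using T1(2)[OF that(2,3)] by (simp add: that(1) funpow_swap1 T(1) del: funpow.simps(2)) (simp add: funpow_swap1 T(1))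
  ultimately have "\<forall>j\<le>Suc n. \<forall>s\<in>{a..b}. \<bar>g j s - poly ((pderiv ^^ j) T) s\<bar> \<le> M * (s - a) ^ (Suc (Suc n) - j)"
    by (metis Suc_le_mono diff_zero funpow_0 not0_implies_Suc)
  then show ?case using T(3) by blast
qed

lemma affine_ref_in:
  fixes a b y :: real
  assumes "a < b" "y \<in> {-1..1}" shows "(a + b) / 2 + (b - a) / 2 * y \<in> {a..b}"
proof -
  have "(b - a) * y \<le> (b - a) * 1" using assms by (intro mult_left_mono) auto
  moreover have "(b - a) * (-1) \<le> (b - a) * y" using assms by (intro mult_left_mono) auto
  ultimately show ?thesis by (simp add: field_simps)
qed

text \<open>Twice the Taylor remainder for the increment, plus the row sums of the Butcher matrix.\<close>
definition quad_err_const :: "nat \<Rightarrow> real" where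
  "quad_err_const k = 2 + (\<Sum>\<mu>\<le>k. \<Sum>\<nu>\<le>k. \<bar>rk k \<mu> \<nu>\<bar>)"

text \<open>The collocation rule is exact for the Taylor polynomial of degree \<open>k + 1\<close>, so only the Taylor remainders
  enter.\<close>
lemma quad_error:
  fixes g :: "nat \<Rightarrow> real \<Rightarrow> real"
  assumes k: "k \<ge> 1" and ab: "a < b"
    and der: "\<And>j s. j \<le> Suc k \<Longrightarrow> s \<in> {a..b} \<Longrightarrow> (g j has_real_derivative g (Suc j) s) (at s within {a..b})"
    and M: "\<And>s. s \<in> {a..b} \<Longrightarrow> \<bar>g (Suc (Suc k)) s\<bar> \<le> M"
    and \<mu>: "\<mu> \<le> k"
  defines "\<sigma> \<equiv> \<lambda>x. (a + b) / 2 + (b - a) / 2 * x"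
  shows "\<bar>g 0 (\<sigma> (lobatto_node k \<mu>)) - g 0 a - (b - a) / 2 * (\<Sum>\<nu>\<le>k. rk k \<mu> \<nu> * g 1 (\<sigma> (lobatto_node k \<nu>)))\<bar>
    \<le> quad_err_const k * (M * (b - a) ^ (k + 2))"
proof -
  define \<tau> where "\<tau> = b - a"
  have \<tau>: "\<tau> > 0" using ab by (simp add: \<tau>_def)
  obtain T where T: "degree T \<le> Suc k"
    "\<And>j s. j \<le> Suc k \<Longrightarrow> s \<in> {a..b} \<Longrightarrow> \<bar>g j s - poly ((pderiv ^^ j) T) s\<bar> \<le> M * (s - a) ^ (Suc (Suc k) - j)"
    using taylor_poly_bound[of a b "Suc k" g M] der M ab by auto
  have M0: "0 \<le> M" using M[of a] ab by (smt (verit) atLeastAtMost_iff)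
  have pts: "\<sigma> (lobatto_node k i) \<in> {a..b}" if "i \<le> k" for i
    unfolding \<sigma>_def using lobatto_node_root(2)[OF k that] by (rule affine_ref_in[OF ab])
  define T' where "T' = pcompose T [:(a + b) / 2, (b - a) / 2:]"
  have T': "poly T' x = poly T (\<sigma> x)" for x by (simp add: T'_def \<sigma>_def poly_pcompose mult.commute)
  have dT': "poly (pderiv T') x = \<tau> / 2 * poly (pderiv T) (\<sigma> x)" for x
    by (simp add: T'_def \<sigma>_def \<tau>_def pderiv_pcompose poly_pcompose pderiv_pCons mult.commute)
  have "degree T' \<le> Suc k" using T(1) ab by (simp add: T'_def degree_pcompose)
  from nodal_increment[OF k this, of \<mu>]
  have exact: "poly T (\<sigma> (lobatto_node k \<mu>)) - poly T a = \<tau> / 2 * (\<Sum>\<nu>\<le>k. rk k \<mu> \<nu> * poly (pderiv T) (\<sigma> (lobatto_node k \<nu>)))"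
    by (simp add: T' dT' sum_distrib_left mult_ac) (simp add: \<sigma>_def field_simps)
  define e0 where "e0 s = g 0 s - poly T s" for s
  define e1 where "e1 s = g 1 s - poly (pderiv T) s" for s
  have e0: "\<bar>e0 s\<bar> \<le> M * \<tau> ^ (k + 2)" and e1: "\<bar>e1 s\<bar> \<le> M * \<tau> ^ (k + 1)" if s: "s \<in> {a..b}" for s
  proof -
    have "\<bar>e0 s\<bar> \<le> M * (s - a) ^ (k + 2)" "\<bar>e1 s\<bar> \<le> M * (s - a) ^ (k + 1)"
      using T(2)[of 0 s] T(2)[of 1 s] s by (simp_all add: e0_def e1_def)
    moreover have "(s - a) ^ m \<le> \<tau> ^ m" for m using s by (intro power_mono) (auto simp: \<tau>_def)
    ultimately show "\<bar>e0 s\<bar> \<le> M * \<tau> ^ (k + 2)" "\<bar>e1 s\<bar> \<le> M * \<tau> ^ (k + 1)"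
      using M0 by (meson mult_left_mono order_trans)+
  qed
  have "g 0 (\<sigma> (lobatto_node k \<mu>)) - g 0 a - \<tau> / 2 * (\<Sum>\<nu>\<le>k. rk k \<mu> \<nu> * g 1 (\<sigma> (lobatto_node k \<nu>)))
      = e0 (\<sigma> (lobatto_node k \<mu>)) - e0 a - \<tau> / 2 * (\<Sum>\<nu>\<le>k. rk k \<mu> \<nu> * e1 (\<sigma> (lobatto_node k \<nu>)))"
    using exact by (simp add: e0_def e1_def right_diff_distrib sum_subtractf)
  also have "\<bar>\<dots>\<bar> \<le> M * \<tau> ^ (k + 2) + M * \<tau> ^ (k + 2) + \<tau> / 2 * (\<Sum>\<nu>\<le>k. \<bar>rk k \<mu> \<nu>\<bar> * (M * \<tau> ^ (k + 1)))"
  proof -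
    have "\<bar>\<Sum>\<nu>\<le>k. rk k \<mu> \<nu> * e1 (\<sigma> (lobatto_node k \<nu>))\<bar> \<le> (\<Sum>\<nu>\<le>k. \<bar>rk k \<mu> \<nu>\<bar> * (M * \<tau> ^ (k + 1)))"
      by (rule order.trans[OF sum_abs]) (unfold abs_mult, intro sum_mono mult_left_mono e1 pts, auto)
    then have "\<bar>\<tau> / 2 * (\<Sum>\<nu>\<le>k. rk k \<mu> \<nu> * e1 (\<sigma> (lobatto_node k \<nu>)))\<bar> \<le> \<tau> / 2 * (\<Sum>\<nu>\<le>k. \<bar>rk k \<mu> \<nu>\<bar> * (M * \<tau> ^ (k + 1)))"
      unfolding abs_mult using \<tau> by (intro mult_mono) auto
    moreover have "\<bar>e0 (\<sigma> (lobatto_node k \<mu>))\<bar> \<le> M * \<tau> ^ (k + 2)" "\<bar>e0 a\<bar> \<le> M * \<tau> ^ (k + 2)"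
      using e0 pts[OF \<mu>] ab by auto
    ultimately show ?thesis by linarith
  qed
  also have "\<dots> = (2 + (\<Sum>\<nu>\<le>k. \<bar>rk k \<mu> \<nu>\<bar>) / 2) * (M * \<tau> ^ (k + 2))"
    unfolding sum_distrib_right[symmetric] by (simp add: field_simps)
  also have "\<dots> \<le> quad_err_const k * (M * \<tau> ^ (k + 2))"
  proof (rule mult_right_mono)
    have "(\<Sum>\<nu>\<le>k. \<bar>rk k \<mu> \<nu>\<bar>) \<le> (\<Sum>\<mu>\<le>k. \<Sum>\<nu>\<le>k. \<bar>rk k \<mu> \<nu>\<bar>)"
      using member_le_sum[of \<mu> "{..k}" "\<lambda>\<mu>. \<Sum>\<nu>\<le>k. \<bar>rk k \<mu> \<nu>\<bar>"] \<mu> by (simp add: sum_nonneg)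
    moreover have "0 \<le> (\<Sum>\<nu>\<le>k. \<bar>rk k \<mu> \<nu>\<bar>)" by (simp add: sum_nonneg)
    ultimately show "2 + (\<Sum>\<nu>\<le>k. \<bar>rk k \<mu> \<nu>\<bar>) / 2 \<le> quad_err_const k" unfolding quad_err_const_def by linarith
  qed (use M0 \<tau> in simp)
  finally show ?thesis by (simp add: \<tau>_def)
qed

lemma lagr_bound_ex: "\<exists>K\<ge>0. \<forall>\<mu>\<le>k. \<forall>x\<in>{-1..1}. \<bar>poly (lagr k \<mu>) x\<bar> \<le> K \<and> \<bar>poly (pderiv (lagr k \<mu>)) x\<bar> \<le> K"
proof -
  obtain K :: "real poly \<Rightarrow> real" where K: "\<And>p. 0 \<le> K p" "\<And>p x. x \<in> {-1..1} \<Longrightarrow> \<bar>poly p x\<bar> \<le> K p"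
    using poly_bounds by blast
  let ?S = "\<Sum>\<mu>\<le>k. K (lagr k \<mu>) + K (pderiv (lagr k \<mu>))"
  have "\<bar>poly (lagr k \<mu>) x\<bar> \<le> ?S \<and> \<bar>poly (pderiv (lagr k \<mu>)) x\<bar> \<le> ?S" if "\<mu> \<le> k" "x \<in> {-1..1}" for \<mu> x
    using member_le_sum[of \<mu> "{..k}" "\<lambda>\<mu>. K (lagr k \<mu>) + K (pderiv (lagr k \<mu>))"] K(2)[OF that(2)] K(1) that(1)
    by (smt (verit) add_nonneg_nonneg atMost_iff finite_atMost)
  moreover have "0 \<le> ?S" using K(1) by (simp add: sum_nonneg)
  ultimately show ?thesis by blast
qed

definition lagr_bound :: "nat \<Rightarrow> real" where
  "lagr_bound k = (SOME K. K \<ge> 0 \<and> (\<forall>\<mu>\<le>k. \<forall>x\<in>{-1..1}. \<bar>poly (lagr k \<mu>) x\<bar> \<le> K \<and> \<bar>poly (pderiv (lagr k \<mu>)) x\<bar> \<le> K))"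

lemma lagr_bound: "0 \<le> lagr_bound k"
  "\<mu> \<le> k \<Longrightarrow> x \<in> {-1..1} \<Longrightarrow> \<bar>poly (lagr k \<mu>) x\<bar> \<le> lagr_bound k"
  "\<mu> \<le> k \<Longrightarrow> x \<in> {-1..1} \<Longrightarrow> \<bar>poly (pderiv (lagr k \<mu>)) x\<bar> \<le> lagr_bound k"
  using someI_ex[OF lagr_bound_ex[of k]] unfolding lagr_bound_def[symmetric] by auto

text \<open>Interpolation reproduces the Taylor polynomial of degree \<open>k\<close>, so only the Taylor remainders enter.\<close>
lemma interp_error:
  fixes g :: "nat \<Rightarrow> real \<Rightarrow> real"
  assumes k: "k \<ge> 1" and ab: "a < b"
    and der: "\<And>j s. j \<le> k \<Longrightarrow> s \<in> {a..b} \<Longrightarrow> (g j has_real_derivative g (Suc j) s) (at s within {a..b})"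
    and M: "\<And>s. s \<in> {a..b} \<Longrightarrow> \<bar>g (Suc k) s\<bar> \<le> M"
    and x: "x \<in> {-1..1}"
  defines "\<sigma> \<equiv> \<lambda>x. (a + b) / 2 + (b - a) / 2 * x"
  shows "\<bar>g 0 (\<sigma> x) - (\<Sum>\<mu>\<le>k. poly (lagr k \<mu>) x * g 0 (\<sigma> (lobatto_node k \<mu>)))\<bar>
    \<le> (1 + (real k + 1) * lagr_bound k) * (M * (b - a) ^ (k + 1))"
proof -
  define \<tau> where "\<tau> = b - a"
  have \<tau>: "\<tau> > 0" using ab by (simp add: \<tau>_def)
  obtain T where T: "degree T \<le> k"
    "\<And>j s. j \<le> k \<Longrightarrow> s \<in> {a..b} \<Longrightarrow> \<bar>g j s - poly ((pderiv ^^ j) T) s\<bar> \<le> M * (s - a) ^ (Suc k - j)"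
    using taylor_poly_bound[of a b k g M] der M ab by auto
  have M0: "0 \<le> M" using M[of a] ab by (smt (verit) atLeastAtMost_iff)
  have pts: "\<sigma> y \<in> {a..b}" if y: "y \<in> {-1..1}" for y
    unfolding \<sigma>_def using y by (rule affine_ref_in[OF ab])
  define T' where "T' = pcompose T [:(a + b) / 2, (b - a) / 2:]"
  have T': "poly T' x = poly T (\<sigma> x)" for x by (simp add: T'_def \<sigma>_def poly_pcompose mult.commute)
  have "degree T' \<le> k" using T(1) ab by (simp add: T'_def degree_pcompose)
  from arg_cong[OF lagr_interp[OF k this], of "\<lambda>p. poly p x"]
  have exact: "poly T (\<sigma> x) = (\<Sum>\<mu>\<le>k. poly (lagr k \<mu>) x * poly T (\<sigma> (lobatto_node k \<mu>)))"
    by (simp add: T' poly_sum mult.commute)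
  define e0 where "e0 s = g 0 s - poly T s" for s
  have e0: "\<bar>e0 s\<bar> \<le> M * \<tau> ^ (k + 1)" if s: "s \<in> {a..b}" for s
  proof -
    have "\<bar>e0 s\<bar> \<le> M * (s - a) ^ (k + 1)" using T(2)[of 0 s] s by (simp_all add: e0_def)
    moreover have "(s - a) ^ m \<le> \<tau> ^ m" for m using s by (intro power_mono) (auto simp: \<tau>_def)
    ultimately show ?thesis using M0 by (meson mult_left_mono order_trans)
  qed
  have "g 0 (\<sigma> x) - (\<Sum>\<mu>\<le>k. poly (lagr k \<mu>) x * g 0 (\<sigma> (lobatto_node k \<mu>)))
     = e0 (\<sigma> x) - (\<Sum>\<mu>\<le>k. poly (lagr k \<mu>) x * e0 (\<sigma> (lobatto_node k \<mu>)))"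
    using exact by (simp add: e0_def right_diff_distrib sum_subtractf)
  also have "\<bar>\<dots>\<bar> \<le> M * \<tau> ^ (k + 1) + (\<Sum>\<mu>\<le>k. lagr_bound k * (M * \<tau> ^ (k + 1)))"
  proof -
    have "\<bar>\<Sum>\<mu>\<le>k. poly (lagr k \<mu>) x * e0 (\<sigma> (lobatto_node k \<mu>))\<bar> \<le> (\<Sum>\<mu>\<le>k. lagr_bound k * (M * \<tau> ^ (k + 1)))"
      using lagr_bound x lobatto_node_root(2)[OF k]
      by (intro order.trans[OF sum_abs] sum_mono) (auto simp only: abs_mult atMost_iff intro!: mult_mono e0 pts)
    then show ?thesis using e0[OF pts[OF x]] by linarith
  qed
  also have "\<dots> = (1 + (real k + 1) * lagr_bound k) * (M * \<tau> ^ (k + 1))" by (simp add: algebra_simps)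
  finally show ?thesis by (simp add: \<tau>_def)
qed

lemma integral_affine_ref:
  fixes h :: "real poly"
  assumes "a \<le> b"
  shows "integral {a..b} (poly h) = (b - a) / 2 * pint (pcompose h [:(a + b) / 2, (b - a) / 2:])"
proof -
  let ?l = "[:(a + b) / 2, (b - a) / 2:]"
  obtain H where H: "pderiv H = h" using has_pderiv_antiderivative by blast
  have l: "poly ?l 1 = b" "poly ?l (-1) = a" by (simp_all add: field_simps)
  have "pderiv (pcompose H ?l) = smult ((b - a) / 2) (pcompose h ?l)"
    by (simp add: pderiv_pcompose H pderiv_pCons mult.commute)
  then have "(b - a) / 2 * pint (pcompose h ?l) = poly H b - poly H a"
    using pint_pderiv[of "pcompose H ?l"] by (simp add: pint_smult poly_pcompose l del: poly_pCons)
  then show ?thesis using integral_pderiv[OF assms, of H] H by simp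
qed

definition ref_map :: "(nat \<Rightarrow> real) \<Rightarrow> nat \<Rightarrow> real poly" where
  "ref_map t n = [:(t (n - 1) + t n) / 2, (t n - t (n - 1)) / 2:]"

lemma ref_map:
  assumes "t (n - 1) < t n"
  shows "poly (ref_map t n) (-1) = t (n - 1)" "poly (ref_map t n) 1 = t n"
    "lobatto_point k t n \<mu> = poly (ref_map t n) (lobatto_node k \<mu>)"
    "x \<in> {-1..1} \<Longrightarrow> poly (ref_map t n) x \<in> {t (n - 1)..t n}"
  using affine_ref_in[OF assms, of x] by (auto simp: ref_map_def lobatto_point_def field_simps)

lemma ref_map_surj:
  assumes "t (n - 1) < t n" "s \<in> {t (n - 1)..t n}"
  obtains x where "x \<in> {-1..1}" "poly (ref_map t n) x = s"
proof -
  let ?x = "(2 * s - (t (n - 1) + t n)) / (t n - t (n - 1))"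
  have "?x \<in> {-1..1}" using assms by (auto simp: field_simps)
  moreover have "poly (ref_map t n) ?x = s" using assms by (simp add: ref_map_def field_simps)
  ultimately show thesis using that by blast
qed

lemma degree_ref_map: "t (n - 1) < t n \<Longrightarrow> degree (ref_map t n) = 1"
  by (simp add: ref_map_def)

lemma poly_pderiv_ref_map:
  "poly (pderiv (pcompose p (ref_map t n))) x = (t n - t (n - 1)) / 2 * poly (pderiv p) (poly (ref_map t n) x)"
  by (simp add: pderiv_pcompose poly_pcompose ref_map_def pderiv_pCons mult.commute)

text \<open>The lifting polynomial is a multiple of the transformed nodal polynomial, by \<open>poly_eq_multiple_nodal\<close>;
  the last equation records the multiple.\<close>
lemma lift_poly_props:
  assumes k: "k \<ge> 1" and t: "t (n - 1) < t n"
  shows "degree (lift_poly k t n) \<le> k + 1"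
    "\<And>\<mu>. \<mu> \<le> k \<Longrightarrow> poly (lift_poly k t n) (lobatto_point k t n \<mu>) = 0"
    "poly (pderiv (lift_poly k t n)) (t (n - 1)) = 1"
    "poly (pderiv (lift_poly k t n)) (poly (ref_map t n) x)
      = poly (pderiv (lob_nodal k)) x / poly (pderiv (lob_nodal k)) (-1)"
proof -
  let ?P = "\<lambda>p. degree p \<le> k + 1 \<and> (\<forall>\<mu>\<le>k. poly p (lobatto_point k t n \<mu>) = 0) \<and> poly (pderiv p) (t (n - 1)) = 1"
  let ?l = "ref_map t n"
  define \<tau> where "\<tau> = t n - t (n - 1)"
  have \<tau>: "\<tau> > 0" using t by (simp add: \<tau>_def)
  define w1 where "w1 = poly (pderiv (lob_nodal k)) (-1)"
  have w1: "w1 \<noteq> 0" unfolding w1_def by (rule pderiv_lob_nodal_at_left[OF k])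
  define q where "q = smult (\<tau> / 2 / w1) (lob_nodal k)"
  let ?inv = "[:- (t (n - 1) + t n) / \<tau>, 2 / \<tau>:]"
  have inv: "pcompose ?l ?inv = [:0, 1:]" "pcompose ?inv ?l = [:0, 1:]"
    using \<tau> unfolding \<tau>_def by (auto simp: ref_map_def pcompose_pCons field_simps)
  have shape: "pcompose p ?l = q" if p: "?P p" for p
  proof -
    have "\<exists>c. pcompose p ?l = smult c (lob_nodal k)"
    proof (rule poly_eq_multiple_nodal[OF k])
      show "degree (pcompose p ?l) \<le> Suc k" using p degree_ref_map[of t n] t by (simp add: degree_pcompose)
    next
      fix \<mu> assume "\<mu> \<le> k"
      then show "poly (pcompose p ?l) (lobatto_node k \<mu>) = 0"
        using p by (simp add: poly_pcompose ref_map(3)[of t n, OF t, symmetric])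
    qed
    then obtain c where c: "pcompose p ?l = smult c (lob_nodal k)" by blast
    have "c * w1 = poly (pderiv (pcompose p ?l)) (-1)" by (simp add: c pderiv_smult w1_def)
    also have "\<dots> = \<tau> / 2" unfolding poly_pderiv_ref_map ref_map(1)[OF t] using p by (simp add: \<tau>_def)
    finally have "c = \<tau> / 2 / w1" using w1 by (simp add: field_simps)
    then show ?thesis by (simp add: c q_def)
  qed
  define p0 where "p0 = pcompose q ?inv"
  have p0l: "pcompose p0 ?l = q"
    unfolding p0_def pcompose_assoc[symmetric] inv by (simp add: pcompose_idR)
  have P0: "?P p0"
  proof (intro conjI allI impI)
    show "degree p0 \<le> k + 1" using \<tau> w1 degree_lob_nodal[OF k] by (simp add: p0_def q_def degree_pcompose)
    show "poly p0 (lobatto_point k t n \<mu>) = 0" if "\<mu> \<le> k" for \<mu>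
    proof -
      have "poly p0 (lobatto_point k t n \<mu>) = poly (pcompose p0 ?l) (lobatto_node k \<mu>)"
        by (simp add: poly_pcompose ref_map(3)[of t n, OF t])
      then show ?thesis unfolding p0l using lobatto_node_root(1)[OF k that] by (simp add: q_def)
    qed
    have "\<tau> / 2 * poly (pderiv p0) (t (n - 1)) = poly (pderiv q) (-1)"
      using poly_pderiv_ref_map[of p0 t n "-1"] ref_map(1)[of t n, OF t] by (simp add: p0l \<tau>_def)
    also have "\<dots> = \<tau> / 2" using w1 by (simp add: q_def pderiv_smult w1_def[symmetric])
    finally show "poly (pderiv p0) (t (n - 1)) = 1" using \<tau> by simp
  qed
  have uniq: "p = p0" if "?P p" for p
  proof -
    have "pcompose (pcompose p ?l) ?inv = pcompose (pcompose p0 ?l) ?inv" using shape[OF that] p0l by simp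
    then show ?thesis unfolding pcompose_assoc[symmetric] inv by (simp add: pcompose_idR)
  qed
  have lp: "lift_poly k t n = p0" unfolding lift_poly_def by (rule the_equality[of ?P, OF P0 uniq])
  show "degree (lift_poly k t n) \<le> k + 1"
    "\<And>\<mu>. \<mu> \<le> k \<Longrightarrow> poly (lift_poly k t n) (lobatto_point k t n \<mu>) = 0"
    "poly (pderiv (lift_poly k t n)) (t (n - 1)) = 1"
    unfolding lp using P0 by auto
  have "\<tau> / 2 * poly (pderiv p0) (poly ?l x) = poly (pderiv q) x"
    using poly_pderiv_ref_map[of p0 t n x] by (simp add: p0l \<tau>_def)
  also have "\<dots> = \<tau> / 2 * (poly (pderiv (lob_nodal k)) x / w1)" by (simp add: q_def pderiv_smult)
  finally show "poly (pderiv (lift_poly k t n)) (poly (ref_map t n) x)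
      = poly (pderiv (lob_nodal k)) x / poly (pderiv (lob_nodal k)) (-1)"
    unfolding lp w1_def[symmetric] by (rule mult_left_cancel[THEN iffD1, rotated]) (use \<tau> in simp)
qed

lemma lobatto_point_ends:
  assumes "k \<ge> 1" "t (n - 1) < t n"
  shows "lobatto_point k t n 0 = t (n - 1)" "lobatto_point k t n k = t n"
  using ref_map[of t n, OF assms(2)] lobatto_node_ends[OF assms(1)] by simp_all

text \<open>Quadrature replaces \<open>F\<close> by its interpolant, since the products have degree at most \<open>2 k -
  1\<close>. So \<open>g\<close> minus the interpolant is orthogonal to degree below \<open>k\<close> and a multiple of
  the derivative of the nodal polynomial. The factor is read off at the left end point, where the derivative of the
  lifting polynomial is one.\<close>
lemma galerkin_residual:
  assumes k: "k \<ge> 1" and t: "t (n - 1) < t n" and dg: "degree g \<le> k"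
    and gal: "\<And>\<psi>. degree \<psi> < k \<Longrightarrow>
      integral {t (n - 1)..t n} (\<lambda>s. poly g s * poly \<psi> s) = lobatto_quad k t n (\<lambda>s. F s * poly \<psi> s)"
    and \<mu>: "\<mu> \<le> k"
  shows "poly g (lobatto_point k t n \<mu>) - F (lobatto_point k t n \<mu>)
    = (poly g (t (n - 1)) - F (t (n - 1))) * poly (pderiv (lift_poly k t n)) (lobatto_point k t n \<mu>)"
proof -
  let ?l = "ref_map t n" and ?w = "pderiv (lob_nodal k)"
  define \<tau> where "\<tau> = t n - t (n - 1)"
  have \<tau>: "\<tau> > 0" using t by (simp add: \<tau>_def)
  let ?inv = "[:- (t (n - 1) + t n) / \<tau>, 2 / \<tau>:]"
  have inv: "pcompose ?inv ?l = [:0, 1:]"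
    using \<tau> unfolding \<tau>_def by (auto simp: ref_map_def pcompose_pCons field_simps)
  define I where "I = (\<Sum>\<nu>\<le>k. smult (F (lobatto_point k t n \<nu>)) (lagr k \<nu>))"
  have dI: "degree I \<le> k" unfolding I_def
    by (intro degree_sum_le order.trans[OF degree_smult_le] degree_lagr) auto
  have I: "poly I (lobatto_node k \<nu>) = F (lobatto_point k t n \<nu>)" if "\<nu> \<le> k" for \<nu>
    using that by (simp add: I_def poly_sum lagr_node[OF k] if_distrib[of "(*) _"] cong: if_cong)
  define e where "e = pcompose g ?l - I"
  have de: "degree e \<le> k" unfolding e_def
    using dg dI degree_ref_map[of t n] t by (intro degree_diff_le) (auto simp: degree_pcompose)
  have "\<exists>c. e = smult c ?w"
  proof (rule orthogonal_multiple[OF k de])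
    fix v :: "real poly" assume v: "degree v < k"
    define \<psi> where "\<psi> = pcompose v ?inv"
    have \<psi>: "pcompose \<psi> ?l = v" unfolding \<psi>_def pcompose_assoc[symmetric] inv by (simp add: pcompose_idR)
    have "degree \<psi> < k" using v \<tau> by (simp add: \<psi>_def degree_pcompose)
    from gal[OF this] have "integral {t (n - 1)..t n} (poly (g * \<psi>)) = lobatto_quad k t n (\<lambda>s. F s * poly \<psi> s)"
      by (simp add: poly_mult[abs_def])
    also have "integral {t (n - 1)..t n} (poly (g * \<psi>)) = \<tau> / 2 * pint (pcompose g ?l * v)"
      using integral_affine_ref[of "t (n - 1)" "t n" "g * \<psi>"] t
      unfolding \<tau>_def ref_map_def[symmetric] pcompose_mult \<psi> by simp
    also have "lobatto_quad k t n (\<lambda>s. F s * poly \<psi> s)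
        = \<tau> / 2 * (\<Sum>\<nu>\<le>k. lobatto_weight k \<nu> * poly (I * v) (lobatto_node k \<nu>))"
      unfolding lobatto_quad_def \<tau>_def
    proof (intro arg_cong2[where f="(*)"] sum.cong refl)
      fix \<nu> assume \<nu>: "\<nu> \<in> {..k}"
      have "poly \<psi> (lobatto_point k t n \<nu>) = poly v (lobatto_node k \<nu>)"
        unfolding ref_map(3)[of t n, OF t] \<psi>[symmetric] poly_pcompose ..
      then show "F (lobatto_point k t n \<nu>) * poly \<psi> (lobatto_point k t n \<nu>) = poly (I * v) (lobatto_node k \<nu>)"
        using \<nu> by (simp add: I)
    qed
    also have "(\<Sum>\<nu>\<le>k. lobatto_weight k \<nu> * poly (I * v) (lobatto_node k \<nu>)) = pint (I * v)"
    proof (rule quad_exact[OF k, symmetric])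
      show "degree (I * v) \<le> 2 * k - 1" using degree_mult_le[of I v] dI v by simp
    qed
    finally have "pint (pcompose g ?l * v) = pint (I * v)" using \<tau> by simp
    then show "pint (e * v) = 0" by (simp add: e_def left_diff_distrib pint_diff)
  qed
  then obtain c where c: "e = smult c ?w" by blast
  have e: "poly e (lobatto_node k \<nu>) = poly g (lobatto_point k t n \<nu>) - F (lobatto_point k t n \<nu>)" if "\<nu> \<le> k" for \<nu>
    using I[OF that] by (simp add: e_def poly_pcompose ref_map(3)[of t n, OF t])
  have e0: "poly g (t (n - 1)) - F (t (n - 1)) = c * poly ?w (-1)"
    using e[of 0] by (simp add: c lobatto_node_ends[OF k] lobatto_point_ends[of k t n, OF k t])
  have lift: "poly (pderiv (lift_poly k t n)) (lobatto_point k t n \<mu>) = poly ?w (lobatto_node k \<mu>) / poly ?w (-1)"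
    using lift_poly_props(4)[of k t n "lobatto_node k \<mu>", OF k t] ref_map(3)[of t n k \<mu>, OF t] by simp
  have "poly g (lobatto_point k t n \<mu>) - F (lobatto_point k t n \<mu>) = c * poly ?w (lobatto_node k \<mu>)"
    using e[OF \<mu>] by (simp add: c)
  then show ?thesis unfolding e0 lift using pderiv_lob_nodal_at_left[OF k] by simp
qed

section \<open>Stability of one collocation step\<close>

text \<open>Functions that agree almost everywhere are not identified in the spaces below, so their inner products are only
  positive semidefinite. Energy estimates, Cauchy-Schwarz and Riesz representation need no more, except that the last
  one asks for definiteness on the subspace.\<close>
locale semi_inner =
  fixes V :: "('a \<Rightarrow> real) set" and B :: "('a \<Rightarrow> real) \<Rightarrow> ('a \<Rightarrow> real) \<Rightarrow> real"
  assumes zero: "(\<lambda>_. 0) \<in> V"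
    and lin: "v \<in> V \<Longrightarrow> w \<in> V \<Longrightarrow> (\<lambda>x. c * v x + d * w x) \<in> V"
    and sym: "v \<in> V \<Longrightarrow> w \<in> V \<Longrightarrow> B v w = B w v"
    and bil: "v \<in> V \<Longrightarrow> w \<in> V \<Longrightarrow> u \<in> V \<Longrightarrow> B (\<lambda>x. c * v x + d * w x) u = c * B v u + d * B w u"
    and nonneg: "v \<in> V \<Longrightarrow> 0 \<le> B v v"
begin

lemma scale: "v \<in> V \<Longrightarrow> (\<lambda>x. c * v x) \<in> V" using lin[of v v c 0] by simp
lemma add: "v \<in> V \<Longrightarrow> w \<in> V \<Longrightarrow> (\<lambda>x. v x + w x) \<in> V" using lin[of v w 1 1] by simp
lemma diff: "v \<in> V \<Longrightarrow> w \<in> V \<Longrightarrow> (\<lambda>x. v x - w x) \<in> V" using lin[of v w 1 "-1"] by simp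
lemma B_zero: "u \<in> V \<Longrightarrow> B (\<lambda>_. 0) u = 0" using bil[of u u u 0 0] by simp
lemma B_scale: "v \<in> V \<Longrightarrow> u \<in> V \<Longrightarrow> B (\<lambda>x. c * v x) u = c * B v u" using bil[of v v u c 0] by simp
lemma B_diff: "v \<in> V \<Longrightarrow> w \<in> V \<Longrightarrow> u \<in> V \<Longrightarrow> B (\<lambda>x. v x - w x) u = B v u - B w u" using bil[of v w u 1 "-1"] by simp
lemma B_minus: "v \<in> V \<Longrightarrow> u \<in> V \<Longrightarrow> B (\<lambda>x. - v x) u = - B v u" using bil[of v v u "-1" 0] by simp

lemma sum_closed: "finite I \<Longrightarrow> (\<And>i. i \<in> I \<Longrightarrow> v i \<in> V) \<Longrightarrow> (\<lambda>x. \<Sum>i\<in>I. c i * v i x) \<in> V"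
proof (induction I rule: finite_induct)
  case (insert i I)
  then show ?case using lin[of "v i" "\<lambda>x. \<Sum>i\<in>I. c i * v i x" "c i" 1] by simp
qed (simp add: zero)

lemma B_sum: "finite I \<Longrightarrow> (\<And>i. i \<in> I \<Longrightarrow> v i \<in> V) \<Longrightarrow> u \<in> V \<Longrightarrow>
  B (\<lambda>x. \<Sum>i\<in>I. c i * v i x) u = (\<Sum>i\<in>I. c i * B (v i) u)"
proof (induction I rule: finite_induct)
  case (insert i I)
  then show ?case using bil[of "v i" "\<lambda>x. \<Sum>i\<in>I. c i * v i x" u "c i" 1] sum_closed[of I v c] by simp
qed (simp add: B_zero)

lemma B_sum_right: "finite I \<Longrightarrow> (\<And>i. i \<in> I \<Longrightarrow> v i \<in> V) \<Longrightarrow> u \<in> V \<Longrightarrow>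
  B u (\<lambda>x. \<Sum>i\<in>I. c i * v i x) = (\<Sum>i\<in>I. c i * B u (v i))"
  using B_sum[of I v u c] sym[of u] sum_closed[of I v c] by (auto intro!: sum.cong)

definition nrm :: "('a \<Rightarrow> real) \<Rightarrow> real" where "nrm v = sqrt (B v v)"

lemma nrm_nonneg: "v \<in> V \<Longrightarrow> 0 \<le> nrm v" by (simp add: nrm_def nonneg)
lemma nrm_sq: "v \<in> V \<Longrightarrow> (nrm v)\<^sup>2 = B v v" by (simp add: nrm_def nonneg)
lemma nrm_zero: "nrm (\<lambda>_. 0) = 0" by (simp add: nrm_def B_zero zero)

text \<open>If \<open>w\<close> has norm zero, the discriminant argument degenerates, and linearity of \<open>B (v + s w) (v + s
  w)\<close> in \<open>s\<close> is used instead.\<close>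
lemma cauchy_schwarz:
  assumes v: "v \<in> V" and w: "w \<in> V" shows "\<bar>B v w\<bar> \<le> nrm v * nrm w"
proof -
  have q: "0 \<le> B v v + 2 * c * B v w + c\<^sup>2 * B w w" for c
  proof -
    define z where "z = (\<lambda>x. 1 * v x + c * w x)"
    have z: "z \<in> V" unfolding z_def by (rule lin[OF v w])
    have zu: "B z u = B v u + c * B w u" if "u \<in> V" for u
      unfolding z_def using bil[OF v w that, of 1 c] by simp
    have "B z z = B z v + c * B z w" using zu[OF z] sym[OF v z] sym[OF w z] by simp
    also have "\<dots> = B v v + 2 * c * B v w + c\<^sup>2 * B w w"
      unfolding zu[OF v] zu[OF w] sym[OF w v] by (simp add: power2_eq_square algebra_simps)
    finally show ?thesis using nonneg[OF z] by simp
  qed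
  have "(B v w)\<^sup>2 \<le> B v v * B w w"
  proof (cases "B w w = 0")
    case True
    have "B v w = 0"
    proof (rule ccontr)
      assume n: "B v w \<noteq> 0"
      have "0 \<le> B v v + 2 * (- (B v v + 1) / (2 * B v w)) * B v w"
        using q[of "- (B v v + 1) / (2 * B v w)"] True by simp
      then show False using n by (simp add: field_simps)
    qed
    then show ?thesis using True by simp
  next
    case False
    then have p: "B w w > 0" using nonneg[OF w] by simp
    have "0 \<le> B v v + 2 * (- B v w / B w w) * B v w + (- B v w / B w w)\<^sup>2 * B w w" by (rule q)
    also have "\<dots> = B v v - (B v w)\<^sup>2 / B w w" using p by (simp add: field_simps power2_eq_square)
    finally show ?thesis using p by (simp add: field_simps)
  qed
  then have "sqrt ((B v w)\<^sup>2) \<le> sqrt (B v v * B w w)" by (rule real_sqrt_le_mono)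
  then show ?thesis by (simp add: nrm_def real_sqrt_mult)
qed

lemma nrm_lin:
  assumes v: "v \<in> V" and w: "w \<in> V"
  shows "nrm (\<lambda>x. c * v x + d * w x) \<le> \<bar>c\<bar> * nrm v + \<bar>d\<bar> * nrm w"
proof -
  let ?z = "\<lambda>x. c * v x + d * w x"
  have z: "?z \<in> V" by (rule lin[OF v w])
  have "(nrm ?z)\<^sup>2 = c * B v ?z + d * B w ?z" using v w z by (simp add: nrm_sq bil)
  also have "\<dots> \<le> \<bar>c\<bar> * \<bar>B v ?z\<bar> + \<bar>d\<bar> * \<bar>B w ?z\<bar>"
    unfolding abs_mult[symmetric] by (intro add_mono abs_ge_self)
  also have "\<dots> \<le> \<bar>c\<bar> * (nrm v * nrm ?z) + \<bar>d\<bar> * (nrm w * nrm ?z)"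
    using cauchy_schwarz v w z by (intro add_mono mult_left_mono) auto
  also have "\<dots> = (\<bar>c\<bar> * nrm v + \<bar>d\<bar> * nrm w) * nrm ?z" by (simp add: algebra_simps)
  finally have *: "nrm ?z * nrm ?z \<le> (\<bar>c\<bar> * nrm v + \<bar>d\<bar> * nrm w) * nrm ?z" by (simp add: power2_eq_square)
  show ?thesis
  proof (cases "nrm ?z = 0")
    case True
    then show ?thesis using nrm_nonneg v w by simp
  next
    case False
    then have "0 < nrm ?z" using nrm_nonneg[OF z] by linarith
    with * show ?thesis by (rule mult_right_le_imp_le)
  qed
qed

lemma nrm_add: "v \<in> V \<Longrightarrow> w \<in> V \<Longrightarrow> nrm (\<lambda>x. v x + w x) \<le> nrm v + nrm w" using nrm_lin[of v w 1 1] by simp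
lemma nrm_diff: "v \<in> V \<Longrightarrow> w \<in> V \<Longrightarrow> nrm (\<lambda>x. v x - w x) \<le> nrm v + nrm w" using nrm_lin[of v w 1 "-1"] by simp

lemma nrm_scale: assumes "v \<in> V" shows "nrm (\<lambda>x. c * v x) = \<bar>c\<bar> * nrm v"
proof -
  have "B (\<lambda>x. c * v x) (\<lambda>x. c * v x) = c\<^sup>2 * B v v"
    using assms scale[OF assms, of c] by (simp add: B_scale sym[of v "\<lambda>x. c * v x"] power2_eq_square)
  then show ?thesis by (simp add: nrm_def real_sqrt_mult)
qed

lemma nrm_sum: "finite I \<Longrightarrow> (\<And>i. i \<in> I \<Longrightarrow> v i \<in> V) \<Longrightarrow>
  nrm (\<lambda>x. \<Sum>i\<in>I. c i * v i x) \<le> (\<Sum>i\<in>I. \<bar>c i\<bar> * nrm (v i))"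
proof (induction I rule: finite_induct)
  case (insert i I)
  then show ?case using nrm_lin[of "v i" "\<lambda>x. \<Sum>i\<in>I. c i * v i x" "c i" 1] sum_closed[of I v c] by fastforce
qed (simp add: nrm_zero)

text \<open>Riesz representation on a finite-dimensional space, by induction on a spanning set.\<close>

lemma riesz_exists:
  assumes fin: "finite S" and "W \<subseteq> V" and W0: "(\<lambda>_. 0) \<in> W"
    and Wlin: "\<And>v w c d. v \<in> W \<Longrightarrow> w \<in> W \<Longrightarrow> (\<lambda>x. c * v x + d * w x) \<in> W"
    and span: "\<And>v. v \<in> W \<Longrightarrow> \<exists>c. v = (\<lambda>x. \<Sum>b\<in>S. c b * b x)"
    and def: "\<And>v. v \<in> W \<Longrightarrow> B v v = 0 \<Longrightarrow> v = (\<lambda>_. 0)"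
    and ell: "\<And>v w c d. v \<in> W \<Longrightarrow> w \<in> W \<Longrightarrow> \<l> (\<lambda>x. c * v x + d * w x) = c * \<l> v + d * \<l> w"
  shows "\<exists>v\<in>W. \<forall>w\<in>W. B v w = \<l> w"
  using assms
proof (induction S arbitrary: W \<l> rule: finite_induct)
  case empty
  have W: "W = {\<lambda>_. 0}" using empty.prems(2,4) by fastforce
  have "\<l> (\<lambda>_. 0) = 0" using empty.prems(6)[OF empty.prems(2) empty.prems(2), of 0 0] by simp
  then show ?case using B_zero[OF zero] by (simp add: W)
next
  case (insert b S)
  define W' where "W' = {v \<in> W. \<exists>c. v = (\<lambda>x. \<Sum>b\<in>S. c b * b x)}"
  have W'W: "W' \<subseteq> W" by (auto simp: W'_def)
  have W'0: "(\<lambda>_. 0) \<in> W'" unfolding W'_def using insert.prems(2) by (auto intro!: exI[of _ "\<lambda>_. 0"])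
  have W'lin: "(\<lambda>x. c * v x + d * w x) \<in> W'" if v: "v \<in> W'" and w: "w \<in> W'" for v w c d
  proof -
    obtain e f where "v = (\<lambda>x. \<Sum>b\<in>S. e b * b x)" "w = (\<lambda>x. \<Sum>b\<in>S. f b * b x)" using v w by (auto simp: W'_def)
    then have "(\<lambda>x. c * v x + d * w x) = (\<lambda>x. \<Sum>b\<in>S. (c * e b + d * f b) * b x)"
      by (auto simp: sum_distrib_left sum.distrib[symmetric] algebra_simps)
    moreover have "(\<lambda>x. c * v x + d * w x) \<in> W" using insert.prems(3) v w by (simp add: W'_def)
    ultimately show ?thesis unfolding W'_def by (intro CollectI conjI exI[of _ "\<lambda>b. c * e b + d * f b"])
  qed
  have IH: "\<exists>v\<in>W'. \<forall>w\<in>W'. B v w = m w"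
    if "\<And>v w c d. v \<in> W' \<Longrightarrow> w \<in> W' \<Longrightarrow> m (\<lambda>x. c * v x + d * w x) = c * m v + d * m w" for m
  proof (rule insert.IH)
    show "W' \<subseteq> V" using W'W insert.prems(1) by (rule order_trans)
    show "\<exists>c. v = (\<lambda>x. \<Sum>b\<in>S. c b * b x)" if "v \<in> W'" for v using that unfolding W'_def by blast
    show "v = (\<lambda>_. 0)" if "v \<in> W'" "B v v = 0" for v by (rule insert.prems(5)) (use that W'W in blast)+
  qed (fact W'0 W'lin that)+
  obtain r where r: "r \<in> W'" "\<And>w. w \<in> W' \<Longrightarrow> B r w = \<l> w"
    using IH[of \<l>] insert.prems(6) W'W by blast
  show ?case
  proof (cases "W' = W")
    case True then show ?thesis using r by blast
  next
    case False
    then obtain v0 where v0: "v0 \<in> W" "v0 \<notin> W'" using W'W by auto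
    obtain c0 where "v0 = (\<lambda>x. \<Sum>b\<in>insert b S. c0 b * b x)" using insert.prems(4)[OF v0(1)] by blast
    then have c0: "v0 = (\<lambda>x. c0 b * b x + (\<Sum>b\<in>S. c0 b * b x))" using insert.hyps by simp
    have c0b: "c0 b \<noteq> 0" using v0 c0 by (auto simp: W'_def)
    have V: "W \<subseteq> V" "W' \<subseteq> V" using insert.prems(1) W'W by auto
    obtain p where p: "p \<in> W'" "\<And>u. u \<in> W' \<Longrightarrow> B p u = B v0 u"
    proof -
      have "\<exists>v\<in>W'. \<forall>w\<in>W'. B v w = B v0 w"
      proof (rule IH)
        fix v w c d assume vw: "v \<in> W'" "w \<in> W'"
        then show "B v0 (\<lambda>x. c * v x + d * w x) = c * B v0 v + d * B v0 w"
          using V v0(1) by (simp add: bil sym[of v0] lin subset_iff)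
      qed
      then show ?thesis using that by blast
    qed
    define v1 where "v1 = (\<lambda>x. 1 * v0 x + (-1) * p x)"
    have v1W: "v1 \<in> W" unfolding v1_def using insert.prems(3) v0(1) p(1) W'W by blast
    have v1o: "B v1 u = 0" if "u \<in> W'" for u
      unfolding v1_def using bil[of v0 p u 1 "-1"] v0(1) p that V by auto
    have "v1 \<noteq> (\<lambda>_. 0)"
    proof
      assume "v1 = (\<lambda>_. 0)"
      then have "v0 = p" by (auto simp: v1_def fun_eq_iff)
      then show False using p(1) v0(2) by simp
    qed
    then have v11: "B v1 v1 \<noteq> 0" using insert.prems(5)[OF v1W] by blast
    define a where "a = \<l> v1 / B v1 v1"
    define v where "v = (\<lambda>x. 1 * r x + a * v1 x)"
    have vW: "v \<in> W" unfolding v_def using insert.prems(3) r(1) v1W W'W by blast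
    have "B v w = \<l> w" if w: "w \<in> W" for w
    proof -
      obtain c where "w = (\<lambda>x. \<Sum>b\<in>insert b S. c b * b x)" using insert.prems(4)[OF w] by blast
      then have c: "w = (\<lambda>x. c b * b x + (\<Sum>b\<in>S. c b * b x))" using insert.hyps by simp
      define \<alpha> where "\<alpha> = c b / c0 b"
      define w' where "w' = (\<lambda>x. 1 * w x + (- \<alpha>) * v0 x)"
      have w'W: "w' \<in> W" unfolding w'_def using insert.prems(3) w v0(1) by blast
      have "w' = (\<lambda>x. \<Sum>b\<in>S. (c b - \<alpha> * c0 b) * b x)"
      proof
        fix x show "w' x = (\<Sum>b\<in>S. (c b - \<alpha> * c0 b) * b x)"
          unfolding w'_def c c0 using c0b
          by (simp add: \<alpha>_def sum_distrib_left sum_subtractf left_diff_distrib distrib_left mult.assoc sum_negf)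
      qed
      then have w'W': "w' \<in> W'" using w'W by (auto simp: W'_def)
      define w2 where "w2 = (\<lambda>x. 1 * w' x + \<alpha> * p x)"
      have w2: "w2 \<in> W'" unfolding w2_def using W'lin w'W' p(1) by blast
      have we: "w = (\<lambda>x. 1 * w2 x + \<alpha> * v1 x)"
        by (auto simp: w2_def w'_def v1_def algebra_simps)
      have *: "B u w = B u w2 + \<alpha> * B u v1" if "u \<in> W" for u
      proof -
        have "B w u = 1 * B w2 u + \<alpha> * B v1 u"
          by (subst we, rule bil) (use that w2 v1W V in auto)
        then show ?thesis using that w w2 v1W V by (simp add: sym[of _ u] subset_iff)
      qed
      have "B v w = B r w + a * B v1 w"
        unfolding v_def using bil[of r v1 w 1 a] r(1) v1W w V by auto
      also have "\<dots> = \<l> w2 + \<alpha> * B r v1 + a * (0 + \<alpha> * B v1 v1)"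
        using * r v1W W'W w2 v1o by (simp add: subset_iff)
      also have "B r v1 = 0" using v1o[OF r(1)] sym[of r v1] r(1) v1W V by auto
      also have "\<l> w2 + \<alpha> * 0 + a * (0 + \<alpha> * B v1 v1) = 1 * \<l> w2 + \<alpha> * \<l> v1"
        using v11 by (simp add: a_def)
      also have "\<dots> = \<l> (\<lambda>x. 1 * w2 x + \<alpha> * v1 x)" using insert.prems(6)[of w2 v1 1 \<alpha>] w2 v1W W'W by auto
      also have "\<dots> = \<l> w" unfolding we[symmetric] ..
      finally show ?thesis .
    qed
    then show ?thesis using vW by blast
  qed
qed

end

lemma semi_inner_subset:
  assumes "semi_inner V B" "W \<subseteq> V" "(\<lambda>_. 0) \<in> W"
    "\<And>v w c d. v \<in> W \<Longrightarrow> w \<in> W \<Longrightarrow> (\<lambda>x. c * v x + d * w x) \<in> W"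
  shows "semi_inner W B"
  using assms by (auto simp: semi_inner_def subset_iff)

text \<open>The best choice of \<open>\<rho>\<close> is of the order \<open>\<eta> / (b + \<eta>)\<close>. It makes the growth of
  the norm, not of its square, linear in the defect \<open>\<eta>\<close>; the factor in front of \<open>b\<close> stays
  one, so iteration over arbitrarily many steps is harmless.\<close>
lemma growth_bound:
  fixes b H G N1 \<eta> :: real
  assumes b: "0 \<le> b" and \<eta>: "0 \<le> \<eta>" and G0: "0 \<le> G"
    and H: "\<And>\<rho>. \<rho> > 0 \<Longrightarrow> N1 \<le> b\<^sup>2 + 2 * \<eta>\<^sup>2 / \<rho> + \<rho> * G" and G: "G \<le> 4 * b\<^sup>2 + 32 * \<eta>\<^sup>2"
  shows "N1 \<le> (b + 6 * \<eta>)\<^sup>2"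
proof (cases "\<eta> = 0")
  case True
  have "N1 \<le> b\<^sup>2 + e" if "e > 0" for e
  proof -
    have "N1 \<le> b\<^sup>2 + e / (G + 1) * G" using H[of "e / (G + 1)"] G0 that True by simp
    also have "e / (G + 1) * G \<le> e" using G0 that by (simp add: field_simps)
    finally show ?thesis by simp
  qed
  then have "N1 \<le> b\<^sup>2" by (rule field_le_epsilon)
  then show ?thesis using True by simp
next
  case False
  then have \<eta>: "\<eta> > 0" using \<eta> by simp
  define \<rho> where "\<rho> = \<eta> / (b + \<eta>)"
  have l: "\<rho> > 0" "\<rho> \<le> 1" using \<eta> b by (auto simp: \<rho>_def field_simps)
  have 1: "2 * \<eta>\<^sup>2 / \<rho> = 2 * \<eta> * b + 2 * \<eta>\<^sup>2" 
  proof -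
    have "2 * \<eta>\<^sup>2 / \<rho> = 2 * \<eta>\<^sup>2 * (b + \<eta>) / \<eta>" by (simp add: \<rho>_def)
    also have "\<dots> = 2 * \<eta> * (b + \<eta>)" using False by (simp add: power2_eq_square)
    finally show ?thesis by (simp add: power2_eq_square algebra_simps)
  qed
  have lb: "\<rho> * b \<le> \<eta>" using \<eta> b by (simp add: \<rho>_def field_simps)
  have "\<rho> * (4 * b\<^sup>2) = 4 * b * (\<rho> * b)" by (simp add: power2_eq_square)
  also have "\<dots> \<le> 4 * b * \<eta>" using lb b by (intro mult_left_mono) auto
  finally have 2: "\<rho> * (4 * b\<^sup>2) \<le> 4 * b * \<eta>" .
  have 3: "\<rho> * (32 * \<eta>\<^sup>2) \<le> 32 * \<eta>\<^sup>2" using l by (simp add: mult_left_le_one_le)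
  have "\<rho> * G \<le> \<rho> * (4 * b\<^sup>2 + 32 * \<eta>\<^sup>2)" using l G by (intro mult_left_mono) auto
  then have "\<rho> * G \<le> 4 * b * \<eta> + 32 * \<eta>\<^sup>2" using 2 3 by (simp add: distrib_left)
  then have "N1 \<le> b\<^sup>2 + 6 * \<eta> * b + 34 * \<eta>\<^sup>2" using H[OF l(1)] unfolding 1 by (simp add: algebra_simps)
  also have "\<dots> \<le> (b + 6 * \<eta>)\<^sup>2"
  proof -
    have "(b + 6 * \<eta>)\<^sup>2 = b\<^sup>2 + 12 * (\<eta> * b) + 36 * \<eta>\<^sup>2" by (simp add: power2_eq_square algebra_simps)
    moreover have "0 \<le> \<eta> * b" "0 \<le> \<eta>\<^sup>2" using b \<eta> by auto
    ultimately show ?thesis by simp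
  qed
  finally show ?thesis .
qed

definition inv_const :: "nat \<Rightarrow> real" where
  "inv_const n = (SOME C. C > 0 \<and> (\<forall>p. degree p \<le> n \<longrightarrow> (\<forall>x\<in>{-1..1}. 0 \<le> poly p x) \<longrightarrow> (\<forall>x\<in>{-1..1}. poly p x \<le> C * pint p)))"

lemma inv_const: "inv_const n > 0"
  "degree p \<le> n \<Longrightarrow> (\<And>x. x \<in> {-1..1} \<Longrightarrow> 0 \<le> poly p x) \<Longrightarrow> x \<in> {-1..1} \<Longrightarrow> poly p x \<le> inv_const n * pint p"
  using someI_ex[OF poly_inverse_inequality[of n]] unfolding inv_const_def[symmetric] by blast+

definition stab_const :: "nat \<Rightarrow> real" where
  "stab_const k = (let \<kappa> = 2 * (real k + 1) * lagr_bound k in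
     6 * \<kappa> + sqrt (32 * inv_const (2 * k)) * (1 + \<kappa>))"

lemma stab_const_nonneg: "0 \<le> stab_const k"
  using lagr_bound(1)[of k] inv_const(1)[of "2 * k"] by (simp add: stab_const_def Let_def)

text \<open>Let \<open>E\<close> be the interpolant of \<open>(e0, e1)\<close> and \<open>G\<close> its projection onto degree
  \<open>k - 1\<close>. At a fixed point \<open>x\<close> both equations are tested with the components of
  \<open>G(x)\<close> and combined with the weights \<open>pderiv (lagr k \<mu>)\<close>. The left-hand sides become
  \<open>B(E'(x), G(x))\<close>, and the coupling terms become \<open>h a(G\<^sub>1, G\<^sub>0) - h a(G\<^sub>0,
  G\<^sub>1) = 0\<close>. What remains of \<open>B(E', G)\<close> is bounded by the defect times the norm of
  \<open>G\<close>, and \<open>energy_identities\<close> and \<open>growth_bound\<close> turn this into a bound for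
  \<open>E\<close>. The constant depends on \<open>k\<close> only, so the method is unconditionally stable.\<close>
lemma lobatto_step_stability:
  fixes V :: "('a \<Rightarrow> real) set"
  assumes k: "k \<ge> 1" and "semi_inner V a" "semi_inner V m"
    and e: "\<And>\<mu>. \<mu> \<le> k \<Longrightarrow> e0 \<mu> \<in> V" "\<And>\<mu>. \<mu> \<le> k \<Longrightarrow> e1 \<mu> \<in> V"
    and \<delta>: "0 \<le> \<delta>"
    and eq0: "\<And>\<mu> \<phi>. \<mu> \<le> k \<Longrightarrow> \<phi> \<in> V \<Longrightarrow>
      \<bar>a (\<lambda>x. e0 \<mu> x - e0 0 x) \<phi> - h * (\<Sum>\<nu>\<le>k. rk k \<mu> \<nu> * a (e1 \<nu>) \<phi>)\<bar> \<le> \<delta> * sqrt (a \<phi> \<phi>)"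
    and eq1: "\<And>\<mu> \<phi>. \<mu> \<le> k \<Longrightarrow> \<phi> \<in> V \<Longrightarrow>
      \<bar>m (\<lambda>x. e1 \<mu> x - e1 0 x) \<phi> + h * (\<Sum>\<nu>\<le>k. rk k \<mu> \<nu> * a (e0 \<nu>) \<phi>)\<bar> \<le> \<delta> * sqrt (m \<phi> \<phi>)"
  defines "E \<equiv> \<lambda>v w. sqrt (a v v + m w w)"
  shows "E (e0 k) (e1 k) \<le> E (e0 0) (e1 0) + stab_const k * \<delta>"
    and "\<And>x. x \<in> {-1..1} \<Longrightarrow>
      E (\<lambda>y. \<Sum>\<mu>\<le>k. poly (lagr k \<mu>) x * e0 \<mu> y) (\<lambda>y. \<Sum>\<mu>\<le>k. poly (lagr k \<mu>) x * e1 \<mu> y)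
        \<le> stab_const k * (E (e0 0) (e1 0) + \<delta>)"
proof -
  interpret a: semi_inner V a by fact
  interpret m: semi_inner V m by fact
  define b where "b \<mu> \<nu> = a (e0 \<mu>) (e0 \<nu>) + m (e1 \<mu>) (e1 \<nu>)" for \<mu> \<nu>
  define C0 where "C0 c = (\<lambda>y. \<Sum>\<mu>\<le>k. c \<mu> * e0 \<mu> y)" for c
  define C1 where "C1 c = (\<lambda>y. \<Sum>\<mu>\<le>k. c \<mu> * e1 \<mu> y)" for c
  have CV: "C0 c \<in> V" "C1 c \<in> V" for c using a.sum_closed[of "{..k}"] e by (auto simp: C0_def C1_def)
  have aC: "a (C0 c) \<phi> = (\<Sum>\<mu>\<le>k. c \<mu> * a (e0 \<mu>) \<phi>)" "a (C1 c) \<phi> = (\<Sum>\<mu>\<le>k. c \<mu> * a (e1 \<mu>) \<phi>)"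
    "m (C1 c) \<phi> = (\<Sum>\<mu>\<le>k. c \<mu> * m (e1 \<mu>) \<phi>)" if "\<phi> \<in> V" for \<phi> c
    unfolding C0_def C1_def using that e by (auto intro!: a.B_sum m.B_sum)
  have bsum: "(\<Sum>\<mu>\<le>k. \<Sum>\<nu>\<le>k. b \<mu> \<nu> * (c \<mu> * d \<nu>)) = a (C0 c) (C0 d) + m (C1 c) (C1 d)" for c d
  proof -
    have "a (e0 \<mu>) (C0 d) = (\<Sum>\<nu>\<le>k. d \<nu> * a (e0 \<mu>) (e0 \<nu>))" "m (e1 \<mu>) (C1 d) = (\<Sum>\<nu>\<le>k. d \<nu> * m (e1 \<mu>) (e1 \<nu>))"
      if "\<mu> \<le> k" for \<mu> unfolding C0_def C1_def using e that by (auto intro!: a.B_sum_right m.B_sum_right)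
    then show ?thesis unfolding aC[OF CV(1)] aC[OF CV(2)]
      by (simp add: sum.distrib[symmetric] sum_distrib_left b_def algebra_simps)
  qed
  have bsym: "b \<mu> \<nu> = b \<nu> \<mu>" if "\<mu> \<le> k" "\<nu> \<le> k" for \<mu> \<nu> using a.sym m.sym e that by (simp add: b_def)
  have psd: "0 \<le> (\<Sum>\<mu>\<le>k. \<Sum>\<nu>\<le>k. b \<mu> \<nu> * (c \<mu> * c \<nu>))" for c
    unfolding bsum using a.nonneg m.nonneg CV by (simp add: add_nonneg_nonneg)
  define N where "N = qform k b (lagr k) (lagr k)"
  define NG where "NG = qform k b (lproj k) (lproj k)"
  define H where "H = qform k b (\<lambda>\<mu>. pderiv (lagr k \<mu>)) (lproj k)"
  have en: "pint H = (b k k - b 0 0) / 2" "pint ([:1, -1:] * H) \<ge> - b 0 0 + pint N / 2" "pint NG \<le> pint N"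
    unfolding N_def NG_def H_def by (intro energy_identities k bsym psd; assumption)+
  define \<kappa> where "\<kappa> = 2 * (real k + 1) * lagr_bound k"
  define \<eta> where "\<eta> = \<kappa> * \<delta>"
  have \<kappa>0: "0 \<le> \<kappa>" using lagr_bound(1)[of k] by (simp add: \<kappa>_def)
  have \<eta>0: "0 \<le> \<eta>" using \<delta> \<kappa>0 by (simp add: \<eta>_def)
  have NG0: "0 \<le> poly NG x" for x unfolding NG_def poly_qform by (rule psd)
  have Hx: "\<bar>poly H x\<bar> \<le> \<eta> * sqrt (poly NG x)" if x: "x \<in> {-1..1}" for x
  proof -
    define l' where "l' \<mu> = poly (pderiv (lagr k \<mu>)) x" for \<mu>
    define G where "G \<nu> = poly (lproj k \<nu>) x" for \<nu>
    have l'0: "(\<Sum>\<mu>\<le>k. l' \<mu>) = 0"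
      using arg_cong[OF arg_cong[OF sum_lagr[OF k], of pderiv], of "\<lambda>p. poly p x"]
      by (simp add: sum_pderiv poly_sum l'_def)
    have G: "G \<nu> = (\<Sum>\<mu>\<le>k. l' \<mu> * rk k \<mu> \<nu>)" for \<nu>
      by (simp add: G_def lproj_def poly_sum l'_def mult.commute)
    define A where "A \<mu> = a (\<lambda>y. e0 \<mu> y - e0 0 y) (C0 G) - h * (\<Sum>\<nu>\<le>k. rk k \<mu> \<nu> * a (e1 \<nu>) (C0 G))" for \<mu>
    define M where "M \<mu> = m (\<lambda>y. e1 \<mu> y - e1 0 y) (C1 G) + h * (\<Sum>\<nu>\<le>k. rk k \<mu> \<nu> * a (e0 \<nu>) (C1 G))" for \<mu>
    have HH: "poly H x = a (C0 l') (C0 G) + m (C1 l') (C1 G)"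
      unfolding H_def poly_qform l'_def[symmetric] G_def[symmetric] by (rule bsum)
    have s1: "(\<Sum>\<mu>\<le>k. l' \<mu> * a (\<lambda>y. e0 \<mu> y - e0 0 y) (C0 G)) = a (C0 l') (C0 G)"
    proof -
      have "(\<Sum>\<mu>\<le>k. l' \<mu> * a (\<lambda>y. e0 \<mu> y - e0 0 y) (C0 G)) = (\<Sum>\<mu>\<le>k. l' \<mu> * a (e0 \<mu>) (C0 G)) - (\<Sum>\<mu>\<le>k. l' \<mu>) * a (e0 0) (C0 G)"
        using e CV by (simp add: a.B_diff sum_subtractf right_diff_distrib sum_distrib_right)
      then show ?thesis using l'0 CV by (simp add: aC)
    qed
    have s2: "(\<Sum>\<mu>\<le>k. l' \<mu> * m (\<lambda>y. e1 \<mu> y - e1 0 y) (C1 G)) = m (C1 l') (C1 G)"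
    proof -
      have "(\<Sum>\<mu>\<le>k. l' \<mu> * m (\<lambda>y. e1 \<mu> y - e1 0 y) (C1 G)) = (\<Sum>\<mu>\<le>k. l' \<mu> * m (e1 \<mu>) (C1 G)) - (\<Sum>\<mu>\<le>k. l' \<mu>) * m (e1 0) (C1 G)"
        using e CV by (simp add: m.B_diff sum_subtractf right_diff_distrib sum_distrib_right)
      then show ?thesis using l'0 CV by (simp add: aC)
    qed
    have s3: "(\<Sum>\<mu>\<le>k. l' \<mu> * (\<Sum>\<nu>\<le>k. rk k \<mu> \<nu> * z \<nu>)) = (\<Sum>\<nu>\<le>k. G \<nu> * z \<nu>)" for z
      unfolding G sum_distrib_left sum_distrib_right by (subst sum.swap) (simp add: mult.assoc)
    have sA: "(\<Sum>\<mu>\<le>k. l' \<mu> * A \<mu>) = a (C0 l') (C0 G) - h * a (C1 G) (C0 G)"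
    proof -
      have "(\<Sum>\<mu>\<le>k. l' \<mu> * A \<mu>) = (\<Sum>\<mu>\<le>k. l' \<mu> * a (\<lambda>y. e0 \<mu> y - e0 0 y) (C0 G)) - h * (\<Sum>\<mu>\<le>k. l' \<mu> * (\<Sum>\<nu>\<le>k. rk k \<mu> \<nu> * a (e1 \<nu>) (C0 G)))"
        unfolding A_def right_diff_distrib sum_subtractf by (simp add: sum_distrib_left mult.left_commute)
      then show ?thesis unfolding s1 s3 using aC(2)[OF CV(1)] by simp
    qed
    have sM: "(\<Sum>\<mu>\<le>k. l' \<mu> * M \<mu>) = m (C1 l') (C1 G) + h * a (C0 G) (C1 G)"
    proof -
      have "(\<Sum>\<mu>\<le>k. l' \<mu> * M \<mu>) = (\<Sum>\<mu>\<le>k. l' \<mu> * m (\<lambda>y. e1 \<mu> y - e1 0 y) (C1 G)) + h * (\<Sum>\<mu>\<le>k. l' \<mu> * (\<Sum>\<nu>\<le>k. rk k \<mu> \<nu> * a (e0 \<nu>) (C1 G)))"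
        unfolding M_def distrib_left sum.distrib by (simp add: sum_distrib_left mult.left_commute)
      then show ?thesis unfolding s2 s3 using aC(1)[OF CV(2)] by simp
    qed
    have "poly H x = (\<Sum>\<mu>\<le>k. l' \<mu> * A \<mu>) + (\<Sum>\<mu>\<le>k. l' \<mu> * M \<mu>)"
      unfolding HH sA sM using a.sym[OF CV(1) CV(2)] by simp
    also have "\<dots> = (\<Sum>\<mu>\<le>k. l' \<mu> * (A \<mu> + M \<mu>))" by (simp add: sum.distrib distrib_left)
    also have "\<bar>\<dots>\<bar> \<le> (\<Sum>\<mu>\<le>k. lagr_bound k * (2 * \<delta> * sqrt (poly NG x)))"
    proof (rule order.trans[OF sum_abs], rule sum_mono)
      fix \<mu> assume \<mu>: "\<mu> \<in> {..k}"
      have ng: "poly NG x = a (C0 G) (C0 G) + m (C1 G) (C1 G)"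
        unfolding NG_def poly_qform G_def[symmetric] by (rule bsum)
      have "sqrt (a (C0 G) (C0 G)) \<le> sqrt (poly NG x)" "sqrt (m (C1 G) (C1 G)) \<le> sqrt (poly NG x)"
        unfolding ng using a.nonneg m.nonneg CV by simp_all
      then have "\<delta> * sqrt (a (C0 G) (C0 G)) \<le> \<delta> * sqrt (poly NG x)" "\<delta> * sqrt (m (C1 G) (C1 G)) \<le> \<delta> * sqrt (poly NG x)"
        using \<delta> by (auto intro: mult_left_mono)
      moreover have "\<bar>A \<mu>\<bar> \<le> \<delta> * sqrt (a (C0 G) (C0 G))" "\<bar>M \<mu>\<bar> \<le> \<delta> * sqrt (m (C1 G) (C1 G))"
        unfolding A_def M_def using eq0 eq1 CV \<mu> by auto
      ultimately have "\<bar>A \<mu> + M \<mu>\<bar> \<le> 2 * \<delta> * sqrt (poly NG x)" by linarith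
      then show "\<bar>l' \<mu> * (A \<mu> + M \<mu>)\<bar> \<le> lagr_bound k * (2 * \<delta> * sqrt (poly NG x))"
        unfolding abs_mult using lagr_bound(1,3) x \<mu> by (intro mult_mono) (auto simp: l'_def)
    qed
    also have "\<dots> = \<eta> * sqrt (poly NG x)" by (simp add: \<eta>_def \<kappa>_def algebra_simps)
    finally show ?thesis .
  qed
  have young: "\<bar>poly H x\<bar> \<le> \<eta>\<^sup>2 / (2 * \<rho>) + \<rho> / 2 * poly NG x" if x: "x \<in> {-1..1}" and l: "\<rho> > 0" for x \<rho>
  proof -
    define z where "z = sqrt (poly NG x)"
    have z: "z\<^sup>2 = poly NG x" using NG0 by (simp add: z_def)
    have "0 \<le> (\<eta> - \<rho> * z)\<^sup>2 / (2 * \<rho>)" using l by simp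
    also have "(\<eta> - \<rho> * z)\<^sup>2 / (2 * \<rho>) = \<eta>\<^sup>2 / (2 * \<rho>) + \<rho> / 2 * z\<^sup>2 - \<eta> * z"
      using l by (simp add: power2_eq_square field_simps)
    finally have "\<eta> * z \<le> \<eta>\<^sup>2 / (2 * \<rho>) + \<rho> / 2 * z\<^sup>2" by simp
    moreover have "\<bar>poly H x\<bar> \<le> \<eta> * z" unfolding z_def by (rule Hx[OF x])
    ultimately show ?thesis unfolding z[symmetric] by linarith
  qed
  have NGN: "0 \<le> pint NG" using pint_mono[of 0 NG] NG0 by simp
  have I1: "2 * pint H \<le> 2 * \<eta>\<^sup>2 / \<rho> + \<rho> * pint NG" if l: "\<rho> > 0" for \<rho>
  proof -
    have "pint H \<le> pint ([:\<eta>\<^sup>2 / (2 * \<rho>):] + smult (\<rho> / 2) NG)"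
      by (rule pint_mono) (use young[OF _ l] in \<open>force simp: abs_le_iff\<close>)
    also have "\<dots> = 2 * (\<eta>\<^sup>2 / (2 * \<rho>)) + \<rho> / 2 * pint NG" by (simp only: pint_add pint_smult pint_const)
    finally have "2 * pint H \<le> 2 * (2 * (\<eta>\<^sup>2 / (2 * \<rho>)) + \<rho> / 2 * pint NG)" by simp
    also have "\<dots> = 2 * \<eta>\<^sup>2 / \<rho> + \<rho> * pint NG" using l by (simp add: field_simps)
    finally show ?thesis .
  qed
  have I2: "pint ([:1, -1:] * H) \<le> 8 * \<eta>\<^sup>2 + pint NG / 4"
  proof -
    have "pint ([:1, -1:] * H) \<le> pint ([:4 * \<eta>\<^sup>2:] + smult (1 / 4) NG)"
    proof (rule pint_mono)
      fix x :: real assume x: "x \<in> {-1..1}"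
      have "poly ([:1, -1:] * H) x = (1 - x) * poly H x" by (simp add: algebra_simps)
      also have "\<dots> \<le> 2 * \<bar>poly H x\<bar>"
        using x abs_ge_self[of "(1 - x) * poly H x"] mult_right_mono[of "\<bar>1 - x\<bar>" 2 "\<bar>poly H x\<bar>"] by (auto simp: abs_mult)
      also have "\<dots> \<le> 2 * (\<eta>\<^sup>2 / (2 * (1/4)) + (1/4) / 2 * poly NG x)" using young[OF x, of "1/4"] by simp
      finally show "poly ([:1, -1:] * H) x \<le> poly ([:4 * \<eta>\<^sup>2:] + smult (1 / 4) NG) x" by simp
    qed
    then show ?thesis by (simp add: pint_add pint_smult pint_const)
  qed
  have b0: "0 \<le> b 0 0" "0 \<le> b k k" using a.nonneg m.nonneg e k by (auto simp: b_def)
  define \<beta> where "\<beta> = sqrt (b 0 0)"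
  have \<beta>: "0 \<le> \<beta>" "\<beta>\<^sup>2 = b 0 0" using b0 by (auto simp: \<beta>_def)
  have NB: "pint N \<le> 4 * \<beta>\<^sup>2 + 32 * \<eta>\<^sup>2" using I2 en(2,3) NGN \<beta> by simp
  have E0: "E (e0 0) (e1 0) = \<beta>" "E (e0 k) (e1 k) = sqrt (b k k)" by (simp_all add: E_def \<beta>_def b_def)
  have "b k k \<le> (\<beta> + 6 * \<eta>)\<^sup>2"
  proof (rule growth_bound[OF \<beta>(1) \<eta>0 NGN])
    fix \<rho> :: real assume "\<rho> > 0"
    have "b k k = \<beta>\<^sup>2 + 2 * pint H" using en(1) \<beta>(2) by simp
    also have "\<dots> \<le> \<beta>\<^sup>2 + (2 * \<eta>\<^sup>2 / \<rho> + \<rho> * pint NG)" by (intro add_left_mono I1) fact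
    finally show "b k k \<le> \<beta>\<^sup>2 + 2 * \<eta>\<^sup>2 / \<rho> + \<rho> * pint NG" by (simp only: add.assoc)
  qed (use NB en(3) in linarith)
  then have "sqrt (b k k) \<le> \<beta> + 6 * \<eta>" using real_sqrt_le_mono[of "b k k" "(\<beta> + 6 * \<eta>)\<^sup>2"] \<beta>(1) \<eta>0 by simp
  moreover have "6 * \<eta> \<le> stab_const k * \<delta>"
    unfolding stab_const_def Let_def \<kappa>_def[symmetric] \<eta>_def using \<delta> \<kappa>0 inv_const(1)[of "2 * k"] by (simp add: distrib_right)
  ultimately show "E (e0 k) (e1 k) \<le> E (e0 0) (e1 0) + stab_const k * \<delta>" unfolding E0 by simp
  fix x :: real assume x: "x \<in> {-1..1}"
  let ?c = "\<lambda>\<mu>. poly (lagr k \<mu>) x"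
  have "E (C0 ?c) (C1 ?c) = sqrt (poly N x)"
    unfolding E_def N_def poly_qform bsum ..
  also have "poly N x \<le> inv_const (2 * k) * pint N"
  proof (rule inv_const(2)[OF _ _ x])
    show "degree N \<le> 2 * k" unfolding N_def mult_2 by (intro degree_qform degree_lagr)
    show "0 \<le> poly N y" for y unfolding N_def poly_qform by (rule psd)
  qed
  also have "\<dots> \<le> inv_const (2 * k) * (32 * (\<beta> + \<eta>)\<^sup>2)"
  proof (rule mult_left_mono)
    have "(\<beta> + \<eta>)\<^sup>2 = \<beta>\<^sup>2 + 2 * (\<beta> * \<eta>) + \<eta>\<^sup>2" by (simp add: power2_eq_square algebra_simps)
    moreover have "0 \<le> \<beta> * \<eta>" "0 \<le> \<beta>\<^sup>2" using \<beta>(1) \<eta>0 by simp_all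
    ultimately show "pint N \<le> 32 * (\<beta> + \<eta>)\<^sup>2" using NB by linarith
  qed (use inv_const(1)[of "2 * k"] in simp)
  also have "sqrt (inv_const (2 * k) * (32 * (\<beta> + \<eta>)\<^sup>2)) = sqrt (32 * inv_const (2 * k)) * (\<beta> + \<eta>)"
    using \<beta> \<eta>0 by (simp add: real_sqrt_mult mult_ac)
  also have "\<dots> \<le> sqrt (32 * inv_const (2 * k)) * ((1 + \<kappa>) * (\<beta> + \<delta>))"
  proof (rule mult_left_mono)
    have "0 \<le> \<kappa> * \<beta>" using \<kappa>0 \<beta> by simp
    then show "\<beta> + \<eta> \<le> (1 + \<kappa>) * (\<beta> + \<delta>)" using \<delta> by (simp add: \<eta>_def algebra_simps)
  qed (use inv_const(1)[of "2 * k"] in simp)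
  also have "\<dots> \<le> stab_const k * (\<beta> + \<delta>)"
    unfolding stab_const_def Let_def \<kappa>_def[symmetric] using \<delta> \<kappa>0 \<beta>
    by (simp add: distrib_right mult.assoc)
  finally show "E (\<lambda>y. \<Sum>\<mu>\<le>k. poly (lagr k \<mu>) x * e0 \<mu> y) (\<lambda>y. \<Sum>\<mu>\<le>k. poly (lagr k \<mu>) x * e1 \<mu> y)
        \<le> stab_const k * (E (e0 0) (e1 0) + \<delta>)"
    unfolding E0 C0_def C1_def by simp
qed

section \<open>Smooth functions with compact support\<close>

lemma partial_eq: "(\<phi> has_derivative D) (at x) \<Longrightarrow> partial i \<phi> x = D (axis i 1)"
  by (simp add: partial_def frechet_derivative_at[symmetric])

lemma partial_const: "partial i (\<lambda>_. c) = (\<lambda>_. 0)"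
  by (rule ext, rule partial_eq[where D = "\<lambda>_. 0"]) auto

lemma partial_lin:
  assumes "\<phi> differentiable (at x)" "\<psi> differentiable (at x)"
  shows "partial i (\<lambda>y. c * \<phi> y + d * \<psi> y) x = c * partial i \<phi> x + d * partial i \<psi> x"
proof -
  obtain P Q where "(\<phi> has_derivative P) (at x)" "(\<psi> has_derivative Q) (at x)"
    using assms by (auto simp: differentiable_def)
  moreover from this have "((\<lambda>y. c * \<phi> y + d * \<psi> y) has_derivative (\<lambda>h. c * P h + d * Q h)) (at x)"
    by (auto intro!: derivative_eq_intros)
  ultimately show ?thesis by (simp add: partial_eq)
qed

lemma partial_mult:
  assumes "\<phi> differentiable (at x)" "\<psi> differentiable (at x)"
  shows "partial i (\<lambda>y. \<phi> y * \<psi> y) x = \<phi> x * partial i \<psi> x + partial i \<phi> x * \<psi> x"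
proof -
  obtain P Q where PQ: "(\<phi> has_derivative P) (at x)" "(\<psi> has_derivative Q) (at x)"
    using assms by (auto simp: differentiable_def)
  then have "((\<lambda>y. \<phi> y * \<psi> y) has_derivative (\<lambda>h. \<phi> x * Q h + P h * \<psi> x)) (at x)"
    by (rule has_derivative_mult)
  from partial_eq[OF this] partial_eq[OF PQ(1)] partial_eq[OF PQ(2)] show ?thesis by simp
qed

lemma has_derivative_coord: "((\<lambda>x :: real^'d::finite. x $ j) has_derivative (\<lambda>h. h $ j)) (at x)"
  by (rule bounded_linear.has_derivative[OF bounded_linear_vec_nth]) (rule has_derivative_ident)

lemma partial_coord: "partial i (\<lambda>x :: real^'d::finite. x $ j) x = (if i = j then 1 else 0)"
  by (subst partial_eq[OF has_derivative_coord]) (simp add: axis_def)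

text \<open>The functions \<open>p(1/s) exp(-1/s)\<close>, extended by zero to \<open>s \<le> 0\<close>, are closed under differentiation.\<close>

definition flat :: "real poly \<Rightarrow> real \<Rightarrow> real" where
  "flat p s = (if s > 0 then poly p (1 / s) * exp (- (1 / s)) else 0)"

definition flat_deriv :: "real poly \<Rightarrow> real poly" where
  "flat_deriv p = [:0, 0, 1:] * (p - pderiv p)"

lemma poly_div_exp_tendsto_0: "((\<lambda>x. poly p x / exp x) \<longlongrightarrow> 0) (at_top :: real filter)"
proof -
  have "((\<lambda>x. \<Sum>i\<le>degree p. coeff p i * (x ^ i / exp x)) \<longlongrightarrow> (\<Sum>i\<le>degree p. coeff p i * 0)) at_top"
    by (intro tendsto_intros tendsto_power_div_exp_0)
  then show ?thesis by (simp add: poly_altdef sum_divide_distrib)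
qed

text \<open>With \<open>y = 1/s\<close> this is the decay of a polynomial in \<open>y\<close> against \<open>exp y\<close>.\<close>
lemma flat_tendsto_0: "((\<lambda>s. flat p s / s) \<longlongrightarrow> 0) (at 0)"
proof -
  have "((\<lambda>s. poly ([:0, 1:] * p) (inverse s) / exp (inverse s)) \<longlongrightarrow> 0) (at_right 0)"
    by (rule filterlim_compose[OF poly_div_exp_tendsto_0 filterlim_inverse_at_top_right])
  then have r: "((\<lambda>s. flat p s / s) \<longlongrightarrow> 0) (at_right 0)"
    by (rule Lim_transform_eventually)
      (auto simp: eventually_at_right_field flat_def exp_minus field_simps intro!: exI[of _ 1])
  have l: "((\<lambda>s. flat p s / s) \<longlongrightarrow> 0) (at_left 0)"
    by (rule Lim_transform_eventually[OF tendsto_const])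
      (auto simp: eventually_at_left_field flat_def intro!: exI[of _ "-1"])
  show ?thesis using l r by (simp add: filterlim_split_at)
qed

lemma flat_has_derivative: "(flat p has_real_derivative flat (flat_deriv p) s) (at s)"
proof -
  consider "s > 0" | "s < 0" | "s = 0" by linarith
  then show ?thesis
  proof cases
    case 1
    have "((\<lambda>s. poly p (1 / s) * exp (- (1 / s))) has_real_derivative flat (flat_deriv p) s) (at s)"
      using 1 by (auto intro!: derivative_eq_intros simp: flat_def flat_deriv_def field_simps power2_eq_square)
    then show ?thesis
      by (rule DERIV_cong_ev[THEN iffD1, rotated 3])
        (use 1 in \<open>auto simp: flat_def intro!: eventually_mono[OF eventually_nhds_in_open[of "{0<..}"]]\<close>)
  next
    case 2
    have "((\<lambda>s. 0) has_real_derivative flat (flat_deriv p) s) (at s)" using 2 by (simp add: flat_def)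
    then show ?thesis
      by (rule DERIV_cong_ev[THEN iffD1, rotated 3])
        (use 2 in \<open>auto simp: flat_def intro!: eventually_mono[OF eventually_nhds_in_open[of "{..<0}"]]\<close>)
  next
    case 3
    then show ?thesis using flat_tendsto_0[of p] by (simp add: DERIV_def flat_def)
  qed
qed

text \<open>A family closed under partial derivatives, so that membership alone gives infinite differentiability. Products of
  ridge functions of \<open>flat\<close> are the bump functions of a box.\<close>
inductive smooth_gen :: "'d::finite field \<Rightarrow> bool" where
  smooth_const: "smooth_gen (\<lambda>_. c)"
| smooth_ridge: "smooth_gen (\<lambda>x. flat p (c * x $ i + e))"
| smooth_add: "smooth_gen \<phi> \<Longrightarrow> smooth_gen \<psi> \<Longrightarrow> smooth_gen (\<lambda>x. \<phi> x + \<psi> x)"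
| smooth_mult: "smooth_gen \<phi> \<Longrightarrow> smooth_gen \<psi> \<Longrightarrow> smooth_gen (\<lambda>x. \<phi> x * \<psi> x)"

lemma smooth_gen_partial:
  "smooth_gen \<phi> \<Longrightarrow> (\<forall>x. \<phi> differentiable (at x)) \<and> (\<forall>i. smooth_gen (partial i \<phi>))"
proof (induction rule: smooth_gen.induct)
  case (smooth_const c)
  then show ?case by (auto simp: partial_const intro: smooth_gen.smooth_const)
next
  case (smooth_ridge p c i e)
  have *: "((\<lambda>x. flat p (c * x $ i + e)) has_derivative (\<lambda>h. flat (flat_deriv p) (c * x $ i + e) * (c * h $ i))) (at x)" for x :: "real^'a"
  proof -
    have "((\<lambda>x :: real^'a. c * x $ i + e) has_derivative (\<lambda>h. c * h $ i)) (at x)"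
      using has_derivative_coord by (auto intro!: derivative_eq_intros)
    then show ?thesis
      by (rule has_derivative_compose[OF _ flat_has_derivative[unfolded has_field_derivative_def]])
  qed
  have "partial j (\<lambda>x. flat p (c * x $ i + e)) = (\<lambda>x. (if i = j then c else 0) * flat (flat_deriv p) (c * x $ i + e))" for j
    by (rule ext) (auto simp: partial_eq[OF *] axis_def)
  moreover have "smooth_gen (\<lambda>x. b * flat (flat_deriv p) (c * x $ i + e))" for b
    by (intro smooth_gen.intros)
  ultimately show ?case using * by (auto simp: differentiable_def)
next
  case (smooth_add \<phi> \<psi>)
  have "partial i (\<lambda>x. \<phi> x + \<psi> x) = (\<lambda>x. partial i \<phi> x + partial i \<psi> x)" for i
    using smooth_add.IH partial_lin[of \<phi> _ \<psi> i 1 1] by auto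
  then show ?case using smooth_add by (auto intro: smooth_gen.intros)
next
  case (smooth_mult \<phi> \<psi>)
  have "partial i (\<lambda>x. \<phi> x * \<psi> x) = (\<lambda>x. \<phi> x * partial i \<psi> x + partial i \<phi> x * \<psi> x)" for i
    using smooth_mult.IH partial_mult[of \<phi> _ \<psi> i] by auto
  then show ?case using smooth_mult by (auto intro!: smooth_gen.intros)
qed

lemma smooth_gen_C_class: "smooth_gen \<phi> \<Longrightarrow> C_class n \<phi>"
proof (induction n arbitrary: \<phi>)
  case 0
  then show ?case using smooth_gen_partial by (auto intro: differentiable_imp_continuous_within continuous_at_imp_continuous_on)
next
  case (Suc n)
  then show ?case using smooth_gen_partial by auto
qed

lemma smooth_gen_prod: "finite I \<Longrightarrow> (\<And>i. i \<in> I \<Longrightarrow> smooth_gen (\<phi> i)) \<Longrightarrow> smooth_gen (\<lambda>x. \<Prod>i\<in>I. \<phi> i x)"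
  by (induction I rule: finite_induct) (auto intro: smooth_gen.intros)

lemma C_class_lin: "C_class n \<phi> \<Longrightarrow> C_class n \<psi> \<Longrightarrow> C_class n (\<lambda>x. c * \<phi> x + d * \<psi> x)"
proof (induction n arbitrary: \<phi> \<psi>)
  case 0
  then show ?case by (auto intro!: continuous_intros)
next
  case (Suc n)
  have diff: "\<phi> differentiable (at x)" "\<psi> differentiable (at x)" for x using Suc.prems by simp_all
  have eq: "partial i (\<lambda>x. c * \<phi> x + d * \<psi> x) = (\<lambda>x. c * partial i \<phi> x + d * partial i \<psi> x)" for i
    by (rule ext, rule partial_lin) (rule diff)+
  show ?case unfolding C_class.simps eq
  proof (intro conjI allI)
    show "(\<lambda>x. c * \<phi> x + d * \<psi> x) differentiable (at x)" for x
      by (intro differentiable_add differentiable_mult differentiable_const diff)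
    show "C_class n (\<lambda>x. c * partial i \<phi> x + d * partial i \<psi> x)" for i
      by (rule Suc.IH) (use Suc.prems in simp_all)
  qed
qed

lemma test_outside:
  assumes "\<phi> \<in> test_functions \<Omega>" "x \<notin> \<Omega>" shows "\<phi> x = 0"
proof (rule ccontr)
  assume "\<phi> x \<noteq> 0"
  then have "x \<in> closure {x. \<phi> x \<noteq> 0}" using closure_subset[of "{x. \<phi> x \<noteq> 0}"] by auto
  moreover have "closure {x. \<phi> x \<noteq> 0} \<subseteq> \<Omega>" using assms(1) by (simp add: test_functions_def)
  ultimately show False using assms(2) by auto
qed

lemma test_C_class: "\<phi> \<in> test_functions \<Omega> \<Longrightarrow> C_class n \<phi>"
  by (simp add: test_functions_def)

lemma test_differentiable: "\<phi> \<in> test_functions \<Omega> \<Longrightarrow> \<phi> differentiable (at x)"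
  using test_C_class[of \<phi> \<Omega> "Suc 0"] by simp

lemma test_continuous: "\<phi> \<in> test_functions \<Omega> \<Longrightarrow> continuous_on UNIV \<phi>"
  using test_C_class[of \<phi> \<Omega> 0] by simp

lemma test_I:
  assumes "\<And>n. C_class n \<phi>" "compact K" "K \<subseteq> \<Omega>" "\<And>x. x \<notin> K \<Longrightarrow> \<phi> x = 0"
  shows "\<phi> \<in> test_functions \<Omega>"
proof -
  have "{x. \<phi> x \<noteq> 0} \<subseteq> K" using assms(4) by auto
  then have "closure {x. \<phi> x \<noteq> 0} \<subseteq> K"
    using closure_minimal compact_imp_closed[OF assms(2)] by blast
  moreover from this have "compact (closure {x. \<phi> x \<noteq> 0})"
    using assms(2) by (meson bounded_subset closed_closure compact_eq_bounded_closed)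
  ultimately show ?thesis using assms(1,3) unfolding test_functions_def by auto
qed

lemma test_support:
  assumes "\<phi> \<in> test_functions \<Omega>"
  obtains K where "compact K" "K \<subseteq> \<Omega>" "\<And>x. x \<notin> K \<Longrightarrow> \<phi> x = 0"
proof -
  let ?K = "closure {x. \<phi> x \<noteq> 0}"
  have "compact ?K" "?K \<subseteq> \<Omega>" using assms by (simp_all add: test_functions_def)
  moreover have "\<phi> x = 0" if "x \<notin> ?K" for x using that closure_subset[of "{x. \<phi> x \<noteq> 0}"] by auto
  ultimately show thesis using that by blast
qed

text \<open>Outside the closed set the function vanishes in a whole neighbourhood.\<close>
lemma partial_zero_outside:
  assumes "closed K" "\<And>x. x \<notin> K \<Longrightarrow> \<phi> x = 0" "x \<notin> K"
  shows "partial i \<phi> x = (0 :: real)"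
proof -
  have "(\<phi> has_derivative (\<lambda>_. 0)) (at x)"
  proof (rule has_derivative_transform_within_open[of "\<lambda>_. 0"])
    show "open (- K)" "x \<in> - K" using assms by auto
    show "\<And>y. y \<in> - K \<Longrightarrow> 0 = \<phi> y" using assms(2) by simp
  qed simp
  then show ?thesis by (simp add: partial_eq)
qed

lemma test_partial: "\<phi> \<in> test_functions \<Omega> \<Longrightarrow> partial i \<phi> \<in> test_functions \<Omega>"
proof -
  assume \<phi>: "\<phi> \<in> test_functions \<Omega>"
  obtain K where K: "compact K" "K \<subseteq> \<Omega>" "\<And>x. x \<notin> K \<Longrightarrow> \<phi> x = 0" using test_support[OF \<phi>] by blast
  show ?thesis
  proof (rule test_I[OF _ K(1,2)])
    show "C_class n (partial i \<phi>)" for n using test_C_class[OF \<phi>, of "Suc n"] by simp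
    show "partial i \<phi> x = 0" if "x \<notin> K" for x
      by (rule partial_zero_outside[OF compact_imp_closed[OF K(1)] _ that]) (rule K(3))
  qed
qed

lemma test_lin:
  assumes "\<phi> \<in> test_functions \<Omega>" "\<psi> \<in> test_functions \<Omega>"
  shows "(\<lambda>x. c * \<phi> x + d * \<psi> x) \<in> test_functions \<Omega>"
proof -
  obtain K where K: "compact K" "K \<subseteq> \<Omega>" "\<And>x. x \<notin> K \<Longrightarrow> \<phi> x = 0" using test_support[OF assms(1)] by blast
  obtain L where L: "compact L" "L \<subseteq> \<Omega>" "\<And>x. x \<notin> L \<Longrightarrow> \<psi> x = 0" using test_support[OF assms(2)] by blast
  show ?thesis
    by (rule test_I[of _ "K \<union> L"]) (use K L assms in \<open>auto intro!: C_class_lin intro: test_C_class compact_Un\<close>)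
qed

lemma test_zero: "(\<lambda>_. 0) \<in> test_functions \<Omega>"
  by (rule test_I[of _ "{}"]) (auto intro: smooth_gen_C_class smooth_gen.intros)


lemma integrable_compact_support:
  fixes F :: "real^'d::finite \<Rightarrow> real"
  assumes "continuous_on UNIV F" "compact K" "\<And>x. x \<notin> K \<Longrightarrow> F x = 0"
  shows "integrable lborel F"
proof -
  have "integrable lborel (\<lambda>x. indicator K x *\<^sub>R F x)"
    using borel_integrable_compact[OF assms(2) continuous_on_subset[OF assms(1)]] by simp
  moreover have "(\<lambda>x. indicator K x *\<^sub>R F x) = F"
  proof
    show "indicator K x *\<^sub>R F x = F x" for x using assms(3)[of x] by (cases "x \<in> K") auto
  qed
  ultimately show ?thesis by simp
qed

text \<open>By translation invariance the difference quotients in direction \<open>i\<close> have integral zero. They converge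
  boundedly and have their supports in one compact set, so dominated convergence applies.\<close>
lemma integral_partial_zero:
  fixes F :: "real^'d::finite \<Rightarrow> real"
  assumes diff: "\<And>x. F differentiable (at x)" and cont: "continuous_on UNIV (partial i F)"
    and K: "compact K" "\<And>x. x \<notin> K \<Longrightarrow> F x = 0"
  shows "(\<integral>x. partial i F x \<partial>lborel) = 0"
proof -
  let ?e = "axis i 1 :: real^'d"
  have contF: "continuous_on UNIV F"
    using diff by (auto intro: differentiable_imp_continuous_within continuous_at_imp_continuous_on)
  have pK: "partial i F x = 0" if "x \<notin> K" for x
    by (rule partial_zero_outside[OF compact_imp_closed[OF K(1)] _ that]) (rule K(2))
  obtain C where C: "\<And>x. \<bar>partial i F x\<bar> \<le> C" "0 \<le> C"
  proof -
    have "compact (partial i F ` K)" using K(1) cont by (intro compact_continuous_image continuous_on_subset[OF cont]) auto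
    then obtain C where "\<And>y. y \<in> partial i F ` K \<Longrightarrow> norm y \<le> C" using compact_imp_bounded bounded_iff by metis
    then have "\<bar>partial i F x\<bar> \<le> \<bar>C\<bar>" for x by (cases "x \<in> K") (force simp: pK)+
    then show ?thesis using that[of "\<bar>C\<bar>"] by simp
  qed
  obtain R where "\<And>x. x \<in> K \<Longrightarrow> norm x \<le> R" using compact_imp_bounded[OF K(1)] unfolding bounded_iff by blast
  then have R: "K \<subseteq> cball 0 R" by auto
  define h where "h n = inverse (real (Suc n))" for n
  have h: "h n > 0" "h n \<le> 1" for n by (auto simp: h_def field_simps)
  define D where "D n x = (F (x + h n *\<^sub>R ?e) - F x) / h n" for n x
  have der: "((\<lambda>s. F (x + s *\<^sub>R ?e)) has_real_derivative partial i F (x + s *\<^sub>R ?e)) (at s within S)" for x s S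
  proof -
    obtain P where P: "(F has_derivative P) (at (x + s *\<^sub>R ?e))" using diff by (auto simp: differentiable_def)
    have "((\<lambda>s. x + s *\<^sub>R ?e) has_derivative (\<lambda>r. r *\<^sub>R ?e)) (at s within S)"
      by (auto intro!: derivative_eq_intros)
    from has_derivative_compose[OF this P] have "((\<lambda>s. F (x + s *\<^sub>R ?e)) has_derivative (\<lambda>r. P (r *\<^sub>R ?e))) (at s within S)" .
    moreover have "P (r *\<^sub>R ?e) = partial i F (x + s *\<^sub>R ?e) * r" for r
      using partial_eq[OF P] linear_scale[OF has_derivative_linear[OF P], of r ?e] by (simp add: mult.commute)
    ultimately show ?thesis by (simp add: has_field_derivative_def)
  qed
  have Dlim: "(\<lambda>n. D n x) \<longlonglongrightarrow> partial i F x" for x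
  proof -
    have "((\<lambda>r. (F (x + r *\<^sub>R ?e) - F x) / r) \<longlongrightarrow> partial i F x) (at 0)"
      using der[of x 0 UNIV] by (simp add: DERIV_def)
    moreover have "filterlim h (at 0) sequentially"
      unfolding filterlim_at h_def using LIMSEQ_inverse_real_of_nat by (simp add: del: of_nat_Suc) 
    ultimately show ?thesis unfolding D_def by (rule filterlim_compose)
  qed
  have Dbound: "\<bar>D n x\<bar> \<le> C * indicator (cball 0 (R + 1)) x" for n x
  proof (cases "x \<in> cball 0 (R + 1)")
    case True
    have "norm (F (x + h n *\<^sub>R ?e) - F (x + 0 *\<^sub>R ?e)) \<le> C * norm (h n - 0)"
      by (rule field_differentiable_bound[of "{0..h n}" _ "\<lambda>s. partial i F (x + s *\<^sub>R ?e)"])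
        (use der C h[of n] in \<open>auto intro: less_imp_le\<close>)
    then show ?thesis using h[of n] True by (simp add: D_def field_simps)
  next
    case False
    then have "x \<notin> K" using R by auto
    moreover have "x + h n *\<^sub>R ?e \<notin> K"
    proof
      assume "x + h n *\<^sub>R ?e \<in> K"
      then have "norm (x + h n *\<^sub>R ?e) \<le> R" using R by auto
      moreover have "norm x \<le> norm (x + h n *\<^sub>R ?e) + norm (h n *\<^sub>R ?e)" by (metis add_diff_cancel_right' norm_triangle_ineq4)
      moreover have "norm (h n *\<^sub>R ?e) \<le> 1" using h[of n] by (simp add: norm_axis_1)
      ultimately show False using False by auto
    qed
    ultimately show ?thesis using K(2) False by (simp add: D_def)
  qed
  have intF: "integrable lborel F" by (rule integrable_compact_support[OF contF K])
  have Dm: "D n \<in> borel_measurable lborel" for n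
    unfolding D_def by (simp, intro borel_measurable_continuous_onI continuous_intros continuous_on_compose2[OF contF]) (use h[of n] in auto)
  have D0: "(\<integral>x. D n x \<partial>lborel) = 0" for n
  proof -
    have "integrable lborel (\<lambda>x. F (x + h n *\<^sub>R ?e))" "(\<integral>x. F (x + h n *\<^sub>R ?e) \<partial>lborel) = (\<integral>x. F x \<partial>lborel)"
    proof -
      have m: "F \<in> borel_measurable borel" by (rule borel_measurable_continuous_onI[OF contF])
      have d: "distr lborel borel (\<lambda>x. h n *\<^sub>R ?e + x) = lborel" by (rule lborel_distr_plus)
      have "integrable (distr lborel borel (\<lambda>x. h n *\<^sub>R ?e + x)) F" using intF d by simp
      then show "integrable lborel (\<lambda>x. F (x + h n *\<^sub>R ?e))"
        by (subst (asm) integrable_distr_eq) (use m in \<open>auto simp: add.commute\<close>)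
      have "(\<integral>x. F x \<partial>distr lborel borel (\<lambda>x. h n *\<^sub>R ?e + x)) = (\<integral>x. F (h n *\<^sub>R ?e + x) \<partial>lborel)"
        by (rule integral_distr) (use m in auto)
      then show "(\<integral>x. F (x + h n *\<^sub>R ?e) \<partial>lborel) = (\<integral>x. F x \<partial>lborel)"
        using d by (simp add: add.commute)
    qed
    then show ?thesis unfolding D_def using intF by simp
  qed
  have "(\<lambda>n. \<integral>x. D n x \<partial>lborel) \<longlonglongrightarrow> (\<integral>x. partial i F x \<partial>lborel)"
  proof (rule integral_dominated_convergence[where w = "\<lambda>x. C * indicator (cball 0 (R + 1)) x"])
    show "partial i F \<in> borel_measurable lborel" using borel_measurable_continuous_onI[OF cont] by simp
    show "integrable lborel (\<lambda>x :: real^'d. C * indicator (cball 0 (R + 1)) x)"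
      by (intro integrable_mult_right integrable_real_indicator) (use emeasure_bounded_finite[of "cball 0 (R + 1) :: (real^'d) set"] in auto)
  qed (use Dlim Dbound Dm in auto)
  then show ?thesis using D0 LIMSEQ_unique by (simp add: LIMSEQ_const_iff)
qed

section \<open>The space \<open>L\<^sup>2\<close> and the fundamental lemma\<close>

context
  fixes \<Omega> :: "(real^'d::finite) set"
  assumes open\<Omega>: "open \<Omega>" and bdd: "bounded \<Omega>"
begin

lemma om_sets: "\<Omega> \<in> sets lebesgue" using open\<Omega> by auto
lemma om_sets' [simp]: "\<Omega> \<inter> space lebesgue \<in> sets lebesgue" using open\<Omega> by auto

lemma om_lmeasurable: "\<Omega> \<in> lmeasurable" using bdd open\<Omega> by (simp add: bounded_set_imp_lmeasurable)

lemma L2_prod_integrable: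
  assumes "v \<in> L2_space \<Omega>" "w \<in> L2_space \<Omega>"
  shows "integrable (lebesgue_on \<Omega>) (\<lambda>x. v x * w x)"
proof (rule Bochner_Integration.integrable_bound)
  show "integrable (lebesgue_on \<Omega>) (\<lambda>x. (v x)\<^sup>2 + (w x)\<^sup>2)"
    using assms by (auto simp: L2_space_def)
  show "(\<lambda>x. v x * w x) \<in> borel_measurable (lebesgue_on \<Omega>)" using assms by (auto simp: L2_space_def)
  have "\<bar>a * b\<bar> \<le> a\<^sup>2 + b\<^sup>2" for a b :: real
  proof -
    have "0 \<le> (\<bar>a\<bar> - \<bar>b\<bar>)\<^sup>2" by simp
    also have "\<dots> = a\<^sup>2 + b\<^sup>2 - 2 * \<bar>a * b\<bar>" by (simp add: power2_diff abs_mult)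
    finally show ?thesis by (smt (verit) zero_le_power2)
  qed
  then show "AE x in lebesgue_on \<Omega>. norm (v x * w x) \<le> norm ((v x)\<^sup>2 + (w x)\<^sup>2)" by simp
qed

lemma L2_semi_inner: "semi_inner (L2_space \<Omega>) (L2_inner \<Omega>)"
proof
  show "(\<lambda>_. 0) \<in> L2_space \<Omega>" by (simp add: L2_space_def)
  fix v w u :: "'d field" and c d :: real
  assume v: "v \<in> L2_space \<Omega>" and w: "w \<in> L2_space \<Omega>"
  have e: "(\<lambda>x. (c * v x + d * w x)\<^sup>2) = (\<lambda>x. c\<^sup>2 * (v x)\<^sup>2 + d\<^sup>2 * (w x)\<^sup>2 + 2 * c * d * (v x * w x))"
    by (auto simp: power2_eq_square algebra_simps)
  show "(\<lambda>x. c * v x + d * w x) \<in> L2_space \<Omega>"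
    unfolding L2_space_def mem_Collect_eq e
    using v w L2_prod_integrable[OF v w] by (auto simp: L2_space_def intro!: Bochner_Integration.integrable_add integrable_mult_right)
  show "L2_inner \<Omega> v w = L2_inner \<Omega> w v" by (simp add: L2_inner_def mult.commute)
  assume u: "u \<in> L2_space \<Omega>"
  have "(\<lambda>x. (c * v x + d * w x) * u x) = (\<lambda>x. c * (v x * u x) + d * (w x * u x))" by (auto simp: algebra_simps)
  then show "L2_inner \<Omega> (\<lambda>x. c * v x + d * w x) u = c * L2_inner \<Omega> v u + d * L2_inner \<Omega> w u"
    unfolding L2_inner_def using L2_prod_integrable[OF v u] L2_prod_integrable[OF w u] by simp
qed (simp add: L2_inner_def)

lemma nrm_L2: "semi_inner.nrm (L2_inner \<Omega>) v = L2_norm \<Omega> v"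
  by (simp add: semi_inner.nrm_def[OF L2_semi_inner] L2_norm_def)

lemma L2_AE:
  assumes "v \<in> L2_space \<Omega>" and ae: "AE x in lebesgue_on \<Omega>. v x = w x"
  shows "w \<in> L2_space \<Omega>"
proof -
  have m: "v \<in> borel_measurable (lebesgue_on \<Omega>)" using assms by (simp add: L2_space_def)
  have "(\<lambda>x. if x \<in> \<Omega> then v x else 0) \<in> borel_measurable lebesgue"
    using m borel_measurable_if_I[OF _ om_sets] by blast
  moreover have "AE x in lebesgue. (if x \<in> \<Omega> then v x else 0) = (if x \<in> \<Omega> then w x else 0)"
    using ae unfolding AE_restrict_space_iff[OF om_sets'] by (rule AE_mp) (rule AE_I2, auto)
  ultimately have "(\<lambda>x. if x \<in> \<Omega> then w x else 0) \<in> borel_measurable lebesgue"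
    by (rule borel_measurable_AE)
  then have m': "w \<in> borel_measurable (lebesgue_on \<Omega>)" by (rule borel_measurable_if_D)
  have "integrable (lebesgue_on \<Omega>) (\<lambda>x. (w x)\<^sup>2) = integrable (lebesgue_on \<Omega>) (\<lambda>x. (v x)\<^sup>2)"
    by (rule integrable_cong_AE) (use m m' ae in auto)
  then show ?thesis using assms m' by (simp add: L2_space_def)
qed

lemma L2_inner_cong:
  assumes v: "v \<in> L2_space \<Omega>" and w: "w \<in> L2_space \<Omega>"
    and "AE x in lebesgue_on \<Omega>. v x = v' x" "AE x in lebesgue_on \<Omega>. w x = w' x"
  shows "L2_inner \<Omega> v w = L2_inner \<Omega> v' w'"
  unfolding L2_inner_def
proof (rule integral_cong_AE)
  have "v' \<in> L2_space \<Omega>" "w' \<in> L2_space \<Omega>" using L2_AE assms by blast+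
  then show "(\<lambda>x. v x * w x) \<in> borel_measurable (lebesgue_on \<Omega>)" "(\<lambda>x. v' x * w' x) \<in> borel_measurable (lebesgue_on \<Omega>)"
    using v w by (auto simp: L2_space_def)
  show "AE x in lebesgue_on \<Omega>. v x * w x = v' x * w' x" using assms(3,4) by auto
qed

lemma L2_norm_cong:
  assumes "v \<in> L2_space \<Omega>" "AE x in lebesgue_on \<Omega>. v x = w x"
  shows "L2_norm \<Omega> v = L2_norm \<Omega> w"
  using L2_inner_cong[OF assms(1) assms(1) assms(2) assms(2)] by (simp add: L2_norm_def)

lemma L2_norm_zero_AE:
  assumes "v \<in> L2_space \<Omega>" "L2_inner \<Omega> v v = 0"
  shows "AE x in lebesgue_on \<Omega>. v x = 0"
proof -
  have "AE x in lebesgue_on \<Omega>. v x * v x = 0"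
    using integral_nonneg_eq_0_iff_AE[OF L2_prod_integrable[OF assms(1) assms(1)]] assms(2)
    by (simp add: L2_inner_def)
  then show ?thesis by simp
qed

lemma test_L2:
  assumes "\<phi> \<in> test_functions \<Omega>" shows "\<phi> \<in> L2_space \<Omega>"
proof -
  obtain K where K: "compact K" "K \<subseteq> \<Omega>" "\<And>x. x \<notin> K \<Longrightarrow> \<phi> x = 0" using test_support[OF assms] by blast
  have c: "continuous_on UNIV \<phi>" using test_continuous[OF assms] .
  have "integrable lborel (\<lambda>x. (\<phi> x)\<^sup>2)"
    by (rule integrable_compact_support[OF _ K(1)]) (use c K(3) in \<open>auto intro!: continuous_intros\<close>)
  then have "integrable lebesgue (\<lambda>x. (\<phi> x)\<^sup>2)"
    by (subst integrable_completion) auto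
  then have "integrable (lebesgue_on \<Omega>) (\<lambda>x. (\<phi> x)\<^sup>2)"
    unfolding integrable_restrict_space[OF om_sets']
  proof (rule Bochner_Integration.integrable_cong[THEN iffD1, rotated 2])
    show "(\<phi> x)\<^sup>2 = indicator \<Omega> x *\<^sub>R (\<phi> x)\<^sup>2" for x
      using test_outside[OF assms, of x] by (cases "x \<in> \<Omega>") auto
  qed simp
  moreover have "\<phi> \<in> borel_measurable (lebesgue_on \<Omega>)"
    by (rule continuous_imp_measurable_on_sets_lebesgue[OF continuous_on_subset[OF c] om_sets]) auto
  ultimately show ?thesis by (simp add: L2_space_def)
qed

lemma bounded_L2:
  assumes "v \<in> borel_measurable (lebesgue_on \<Omega>)" "\<And>x. x \<in> \<Omega> \<Longrightarrow> \<bar>v x\<bar> \<le> C"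
  shows "v \<in> L2_space \<Omega>"
proof -
  interpret finite_measure "lebesgue_on \<Omega>"
    using om_lmeasurable by (simp add: finite_measure_lebesgue_on)
  have "integrable (lebesgue_on \<Omega>) (\<lambda>x. (v x)\<^sup>2)"
  proof (rule integrable_const_bound)
    show "AE x in lebesgue_on \<Omega>. norm ((v x)\<^sup>2) \<le> C\<^sup>2"
      using assms(2) by (intro AE_I2) (auto simp: space_restrict_space intro!: power2_le_iff_abs_le[THEN iffD2] abs_le_square_iff[THEN iffD1] order_trans[OF _ abs_ge_self])
  qed (use assms(1) in simp)
  then show ?thesis using assms(1) by (simp add: L2_space_def)
qed

lemma L2_inner_lborel:
  assumes m: "(\<lambda>x. v x * w x) \<in> borel_measurable borel" and z: "\<And>x. x \<notin> \<Omega> \<Longrightarrow> v x * w x = 0"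
  shows "L2_inner \<Omega> v w = (\<integral>x. v x * w x \<partial>lborel)"
proof -
  have "L2_inner \<Omega> v w = (\<integral>x. indicator \<Omega> x *\<^sub>R (v x * w x) \<partial>lebesgue)"
    unfolding L2_inner_def using om_sets' by (rule integral_restrict_space)
  also have "(\<lambda>x. indicator \<Omega> x *\<^sub>R (v x * w x)) = (\<lambda>x. v x * w x)"
  proof
    show "indicator \<Omega> x *\<^sub>R (v x * w x) = v x * w x" for x using z[of x] by (cases "x \<in> \<Omega>") auto
  qed
  also have "(\<integral>x. v x * w x \<partial>lebesgue) = (\<integral>x. v x * w x \<partial>lborel)"
    by (rule integral_completion) (use m in simp)
  finally show ?thesis .
qed

text \<open>Bumps that increase to the indicator of an open box.\<close>

definition bump :: "(real^'d) \<times> (real^'d) \<Rightarrow> nat \<Rightarrow> 'd field" where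
  "bump p n x = (\<Prod>i\<in>UNIV. flat 1 (real n * x $ i + - (real n * fst p $ i)) * flat 1 ((- real n) * x $ i + real n * snd p $ i))"

lemma flat1_range: "0 \<le> flat 1 s" "flat 1 s \<le> 1" "s \<le> 0 \<Longrightarrow> flat 1 s = 0"
  by (auto simp: flat_def)

lemma flat1_tendsto:
  assumes "c > 0" shows "(\<lambda>n. flat 1 (real n * c)) \<longlonglongrightarrow> 1"
proof -
  have "(\<lambda>n. exp (- (inverse (real n) * (1 / c)))) \<longlonglongrightarrow> exp (- (0 * (1 / c)))"
    by (intro tendsto_intros lim_inverse_n)
  then have "(\<lambda>n. exp (- (inverse (real n) * (1 / c)))) \<longlonglongrightarrow> 1" by simp
  then show ?thesis
    by (rule Lim_transform_eventually)
      (use assms in \<open>auto simp: flat_def field_simps intro!: eventually_mono[OF eventually_gt_at_top[of 0]]\<close>)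
qed

text \<open>Each factor is zero outside a half-space and increases to one inside it.\<close>
lemma bump_props:
  shows "smooth_gen (bump p n)" "0 \<le> bump p n x" "bump p n x \<le> 1"
    "x \<notin> box (fst p) (snd p) \<Longrightarrow> bump p n x = 0"
    "x \<in> box (fst p) (snd p) \<Longrightarrow> (\<lambda>n. bump p n x) \<longlonglongrightarrow> 1"
proof -
  show "smooth_gen (bump p n)" unfolding bump_def[abs_def] by (intro smooth_gen_prod smooth_gen.intros) auto
  show "0 \<le> bump p n x" unfolding bump_def by (intro prod_nonneg ballI mult_nonneg_nonneg flat1_range)
  show "bump p n x \<le> 1" unfolding bump_def by (intro prod_le_1) (auto intro!: mult_nonneg_nonneg mult_le_one flat1_range)
  show "bump p n x = 0" if "x \<notin> box (fst p) (snd p)"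
  proof -
    obtain i where "x $ i \<le> fst p $ i \<or> snd p $ i \<le> x $ i" using \<open>x \<notin> _\<close> by (auto simp: mem_box_cart not_less)
    then have "real n * x $ i + - (real n * fst p $ i) \<le> 0 \<or> (- real n) * x $ i + real n * snd p $ i \<le> 0"
      by (auto intro: mult_left_mono)
    then have "flat 1 (real n * x $ i + - (real n * fst p $ i)) * flat 1 ((- real n) * x $ i + real n * snd p $ i) = 0"
      by (metis flat1_range(3) mult_eq_0_iff)
    then show ?thesis unfolding bump_def by (intro prod_zero bexI[of _ i]) auto
  qed
  show "(\<lambda>n. bump p n x) \<longlonglongrightarrow> 1" if "x \<in> box (fst p) (snd p)"
  proof -
    have "(\<lambda>n. flat 1 (real n * x $ i + - (real n * fst p $ i)) * flat 1 ((- real n) * x $ i + real n * snd p $ i)) \<longlonglongrightarrow> 1 * 1" for i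
    proof -
      have "x $ i - fst p $ i > 0" "snd p $ i - x $ i > 0" using that by (auto simp: mem_box_cart)
      from tendsto_mult[OF flat1_tendsto[OF this(1)] flat1_tendsto[OF this(2)]] show ?thesis by (simp add: algebra_simps)
    qed
    then have "(\<lambda>n. bump p n x) \<longlonglongrightarrow> (\<Prod>i\<in>(UNIV :: 'd set). 1 * 1)" unfolding bump_def by (intro tendsto_prod)
    then show ?thesis by simp
  qed
qed

text \<open>Dominated convergence with the dominating function \<open>\<bar>g\<bar>\<close>, which is integrable because the
  domain is bounded.\<close>
lemma indicator_inner_limit:
  assumes g: "g \<in> L2_space \<Omega>" and m: "\<And>n. F n \<in> borel_measurable (lebesgue_on \<Omega>)"
    and b: "\<And>n x. x \<in> \<Omega> \<Longrightarrow> \<bar>F n x\<bar> \<le> 1" and l: "\<And>x. x \<in> \<Omega> \<Longrightarrow> (\<lambda>n. F n x) \<longlonglongrightarrow> G x"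
    and z: "\<And>n. L2_inner \<Omega> g (F n) = 0"
  shows "L2_inner \<Omega> g G = 0"
proof -
  have one: "(\<lambda>_. 1) \<in> L2_space \<Omega>" by (rule bounded_L2[of _ 1]) auto
  have "(\<lambda>n. \<integral>x. g x * F n x \<partial>lebesgue_on \<Omega>) \<longlonglongrightarrow> (\<integral>x. g x * G x \<partial>lebesgue_on \<Omega>)"
  proof (rule integral_dominated_convergence[where w = "\<lambda>x. \<bar>g x\<bar>"])
    have gm: "g \<in> borel_measurable (lebesgue_on \<Omega>)" using g by (simp add: L2_space_def)
    have Gm: "G \<in> borel_measurable (lebesgue_on \<Omega>)"
      by (rule borel_measurable_LIMSEQ_real[OF _ m]) (use l in \<open>auto simp: space_restrict_space\<close>)
    show "(\<lambda>x. g x * G x) \<in> borel_measurable (lebesgue_on \<Omega>)" "(\<lambda>x. g x * F n x) \<in> borel_measurable (lebesgue_on \<Omega>)" for n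
      using gm Gm m by auto
    show "integrable (lebesgue_on \<Omega>) (\<lambda>x. \<bar>g x\<bar>)" using L2_prod_integrable[OF g one] by simp
    show "AE x in lebesgue_on \<Omega>. (\<lambda>n. g x * F n x) \<longlonglongrightarrow> g x * G x"
      using l by (intro AE_I2 tendsto_mult) (auto simp: space_restrict_space)
    show "AE x in lebesgue_on \<Omega>. norm (g x * F n x) \<le> \<bar>g x\<bar>" for n
      using b by (intro AE_I2) (auto simp: space_restrict_space abs_mult intro!: mult_left_le)
  qed
  then show ?thesis using z LIMSEQ_unique by (simp add: L2_inner_def LIMSEQ_const_iff)
qed

text \<open>Orthogonality passes from bump functions to indicators of boxes, then to finite unions by multiplying the
  complementary bumps, to open sets by a countable cover with boxes, and to measurable sets by outer regularity. The
  choice of the sets \<open>{g > 0}\<close> and \<open>{g < 0}\<close> finishes the proof.\<close>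
lemma fundamental_lemma:
  assumes g: "g \<in> L2_space \<Omega>" and z: "\<And>\<phi>. \<phi> \<in> test_functions \<Omega> \<Longrightarrow> L2_inner \<Omega> g \<phi> = 0"
  shows "AE x in lebesgue_on \<Omega>. g x = 0"
proof -
  interpret L: semi_inner "L2_space \<Omega>" "L2_inner \<Omega>" by (rule L2_semi_inner)
  have ind_m: "indicator S \<in> borel_measurable (lebesgue_on \<Omega>)" if "S \<in> sets lebesgue" for S :: "(real^'d) set"
    using that by (intro measurable_restrict_space1 borel_measurable_indicator)
  have ind_L2: "(indicator S :: 'd field) \<in> L2_space \<Omega>" if "S \<in> sets lebesgue" for S :: "(real^'d) set"
    by (rule bounded_L2[OF ind_m[OF that], of 1]) (auto simp: indicator_def)
  have s1: "L2_inner \<Omega> g (indicator (\<Union>p\<in>P. box (fst p) (snd p))) = 0"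
    if P: "finite P" "\<And>p. p \<in> P \<Longrightarrow> cbox (fst p) (snd p) \<subseteq> \<Omega>" for P :: "((real^'d) \<times> (real^'d)) set"
  proof (rule indicator_inner_limit[OF g])
    define \<Phi> where "\<Phi> n x = 1 + (-1) * (\<Prod>p\<in>P. 1 + (-1) * bump p n x)" for n :: nat and x
    have sm: "smooth_gen (\<Phi> n)" for n
      unfolding \<Phi>_def[abs_def] by (intro smooth_gen.intros smooth_gen_prod P(1) bump_props)
    have t: "\<Phi> n \<in> test_functions \<Omega>" for n
    proof (rule test_I[of _ "\<Union>p\<in>P. cbox (fst p) (snd p)"])
      show "C_class m (\<Phi> n)" for m by (rule smooth_gen_C_class[OF sm])
      show "compact (\<Union>p\<in>P. cbox (fst p) (snd p))" using P(1) by (intro compact_UN) auto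
      show "(\<Union>p\<in>P. cbox (fst p) (snd p)) \<subseteq> \<Omega>" using P(2) by blast
      show "\<Phi> n x = 0" if "x \<notin> (\<Union>p\<in>P. cbox (fst p) (snd p))" for x
      proof -
        have "bump p n x = 0" if "p \<in> P" for p
          using \<open>x \<notin> _\<close> that box_subset_cbox by (intro bump_props(4)) blast
        then show ?thesis by (simp add: \<Phi>_def)
      qed
    qed
    show "L2_inner \<Omega> g (\<Phi> n) = 0" for n by (rule z[OF t])
    show "\<Phi> n \<in> borel_measurable (lebesgue_on \<Omega>)" for n using test_L2[OF t] by (simp add: L2_space_def)
    show "\<bar>\<Phi> n x\<bar> \<le> 1" for n x
    proof -
      have "0 \<le> (\<Prod>p\<in>P. 1 + (-1) * bump p n x)" "(\<Prod>p\<in>P. 1 + (-1) * bump p n x) \<le> 1"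
        using bump_props(2,3)[of _ n x] by (auto intro!: prod_nonneg prod_le_1)
      then show ?thesis by (simp add: \<Phi>_def)
    qed
    show "(\<lambda>n. \<Phi> n x) \<longlonglongrightarrow> indicator (\<Union>p\<in>P. box (fst p) (snd p)) x" for x
    proof -
      have "(\<lambda>n. bump p n x) \<longlonglongrightarrow> indicator (box (fst p) (snd p)) x" for p
        using bump_props(4,5)[of x p] by (cases "x \<in> box (fst p) (snd p)") auto
      then have "(\<lambda>n. \<Phi> n x) \<longlonglongrightarrow> 1 + (-1) * (\<Prod>p\<in>P. 1 + (-1) * indicator (box (fst p) (snd p)) x)"
        unfolding \<Phi>_def by (intro tendsto_intros)
      moreover have "1 + (-1) * (\<Prod>p\<in>P. 1 + (-1) * indicator (box (fst p) (snd p)) x)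
          = (indicator (\<Union>p\<in>P. box (fst p) (snd p)) x :: real)"
      proof (cases "x \<in> (\<Union>p\<in>P. box (fst p) (snd p))")
        case True
        then obtain p where "p \<in> P" "x \<in> box (fst p) (snd p)" by blast
        then have "(\<Prod>p\<in>P. 1 + (-1) * indicator (box (fst p) (snd p)) x) = (0 :: real)"
          using P(1) by (intro prod_zero) (auto intro!: bexI[of _ p])
        then show ?thesis using True by simp
      next
        case False
        then have "(\<Prod>p\<in>P. 1 + (-1) * indicator (box (fst p) (snd p)) x) = (1 :: real)"
          by (intro prod.neutral) auto
        then show ?thesis using False by simp
      qed
      ultimately show ?thesis by simp
    qed
  qed
  have s2: "L2_inner \<Omega> g (indicator U) = 0" if U: "open U" "U \<subseteq> \<Omega>" for U
  proof -
    define \<F> where "\<F> = (\<lambda>p. box (fst p) (snd p)) ` {p :: (real^'d) \<times> (real^'d). cbox (fst p) (snd p) \<subseteq> U}"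
    obtain \<F>' where F': "\<F>' \<subseteq> \<F>" "countable \<F>'" "\<Union>\<F>' = \<Union>\<F>"
      using Lindelof[of \<F>] by (auto simp: \<F>_def open_box)
    have "\<Union>\<F> = U"
    proof
      show "\<Union>\<F> \<subseteq> U" using box_subset_cbox by (fastforce simp: \<F>_def)
      show "U \<subseteq> \<Union>\<F>"
      proof
        fix x assume "x \<in> U"
        then obtain a b where "cbox a b \<subseteq> U" "x \<in> box a b" using open_contains_cbox[OF U(1)] by metis
        then show "x \<in> \<Union>\<F>" unfolding \<F>_def by (intro UnionI[of "box a b"] image_eqI[of _ _ "(a, b)"]) auto
      qed
    qed
    then have U': "\<Union>\<F>' = U" using F' by simp
    obtain P where P: "P \<subseteq> {p :: (real^'d) \<times> (real^'d). cbox (fst p) (snd p) \<subseteq> U}" "\<F>' = (\<lambda>p. box (fst p) (snd p)) ` P" "countable P"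
      using F'(1,2) unfolding \<F>_def by (meson countable_subset_image)
    define Q where "Q n = {p \<in> P. to_nat_on P p < n}" for n
    have Qf: "finite (Q n)" for n
    proof -
      have "inj_on (to_nat_on P) (Q n)" using inj_on_to_nat_on[OF P(3)] by (rule inj_on_subset) (auto simp: Q_def)
      moreover have "to_nat_on P ` Q n \<subseteq> {..<n}" by (auto simp: Q_def)
      ultimately show ?thesis by (meson finite_lessThan inj_on_finite)
    qed
    show ?thesis
    proof (rule indicator_inner_limit[OF g])
      let ?F = "\<lambda>n. indicator (\<Union>p\<in>Q n. box (fst p) (snd p)) :: 'd field"
      show "L2_inner \<Omega> g (?F n) = 0" for n
        by (rule s1[OF Qf]) (use P(1) U(2) in \<open>auto simp: Q_def\<close>)
      show "?F n \<in> borel_measurable (lebesgue_on \<Omega>)" for n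
        by (rule ind_m) (auto intro!: open_UN open_box borel_open)
      show "\<bar>?F n x\<bar> \<le> 1" for n x by (auto simp: indicator_def)
      show "(\<lambda>n. ?F n x) \<longlonglongrightarrow> indicator U x" for x
      proof (cases "x \<in> U")
        case True
        then obtain p where p: "p \<in> P" "x \<in> box (fst p) (snd p)" using U' P(2) by auto
        have "?F n x = 1" if "n > to_nat_on P p" for n
        proof -
          have "p \<in> Q n" using p(1) that by (simp add: Q_def)
          then have "x \<in> (\<Union>p\<in>Q n. box (fst p) (snd p))" using p(2) by blast
          then show ?thesis by simp
        qed
        then have "eventually (\<lambda>n. 1 = ?F n x) sequentially"
          by (intro eventually_mono[OF eventually_gt_at_top[of "to_nat_on P p"]]) simp
        then show ?thesis using True by (auto intro: Lim_transform_eventually[OF tendsto_const])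
      next
        case False
        have "?F n x = 0" for n using False U' P(2) by (auto simp: Q_def indicator_def)
        then show ?thesis using False by simp
      qed
    qed
  qed
  have s3: "L2_inner \<Omega> g (indicator S) = 0" if S: "S \<in> sets lebesgue" "S \<subseteq> \<Omega>" for S
  proof -
    have "\<bar>L2_inner \<Omega> g (indicator S)\<bar> \<le> L2_norm \<Omega> g * sqrt e" if e: "e > 0" for e
    proof -
      obtain T where T: "open T" "S \<subseteq> T" "T - S \<in> lmeasurable" "emeasure lebesgue (T - S) < ennreal e"
        using sets_lebesgue_outer_open[OF S(1) e] by blast
      define U where "U = T \<inter> \<Omega>"
      have U: "open U" "U \<subseteq> \<Omega>" "S \<subseteq> U" using T S open\<Omega> by (auto simp: U_def)
      have Um: "U \<in> sets lebesgue" "U - S \<in> sets lebesgue" using U(1) S(1) by auto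
      have e1: "indicator S = (\<lambda>x. indicator U x - (indicator (U - S) x :: real))"
        using U(3) by (auto simp: indicator_def fun_eq_iff)
      have "L2_inner \<Omega> (indicator S) g = L2_inner \<Omega> (indicator U) g - L2_inner \<Omega> (indicator (U - S)) g"
        unfolding e1 by (rule L.B_diff) (auto intro: ind_L2 Um g)
      then have "L2_inner \<Omega> g (indicator S) = L2_inner \<Omega> g (indicator U) - L2_inner \<Omega> g (indicator (U - S))"
        using g S(1) Um by (simp add: L.sym[of g] ind_L2)
      also have "\<dots> = - L2_inner \<Omega> g (indicator (U - S))" using s2[OF U(1,2)] by simp
      finally have "\<bar>L2_inner \<Omega> g (indicator S)\<bar> = \<bar>L2_inner \<Omega> g (indicator (U - S))\<bar>" by simp
      also have "\<dots> \<le> L2_norm \<Omega> g * L2_norm \<Omega> (indicator (U - S))"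
        using L.cauchy_schwarz[OF g ind_L2[OF Um(2)]] by (simp add: nrm_L2)
      also have "L2_norm \<Omega> (indicator (U - S)) \<le> sqrt e"
        unfolding L2_norm_def
      proof (rule real_sqrt_le_mono)
        have "L2_inner \<Omega> (indicator (U - S)) (indicator (U - S)) = (\<integral>x. indicator (U - S) x \<partial>lebesgue_on \<Omega>)"
          unfolding L2_inner_def by (rule Bochner_Integration.integral_cong) (auto simp: indicator_def)
        also have "\<dots> = (\<integral>x. indicator \<Omega> x *\<^sub>R indicator (U - S) x \<partial>lebesgue)"
          by (rule integral_restrict_space) (rule om_sets')
        also have "\<dots> = (\<integral>x. indicator (U - S) x \<partial>lebesgue)"
          by (rule Bochner_Integration.integral_cong) (use U(2) in \<open>auto simp: indicator_def\<close>)
        also have "\<dots> = measure lebesgue (U - S)" by simp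
        also have "\<dots> \<le> measure lebesgue (T - S)"
          by (rule measure_mono_fmeasurable) (use T(3) Um in \<open>auto simp: U_def\<close>)
        also have "\<dots> \<le> e"
          using T(3,4) e by (metis emeasure_eq_measure2 ennreal_less_iff less_imp_le measure_nonneg)
        finally show "L2_inner \<Omega> (indicator (U - S)) (indicator (U - S)) \<le> e" .
      qed
      finally show ?thesis using L.nrm_nonneg[OF g] by (simp add: nrm_L2 mult_left_mono)
    qed
    note small = this
    have "L2_inner \<Omega> g (indicator S) = 0"
    proof (rule ccontr)
      assume n: "L2_inner \<Omega> g (indicator S) \<noteq> 0"
      define a where "a = \<bar>L2_inner \<Omega> g (indicator S)\<bar>"
      have a: "a > 0" using n by (simp add: a_def)
      define N where "N = L2_norm \<Omega> g"
      have N0: "N \<ge> 0" using L.nrm_nonneg[OF g] by (simp add: nrm_L2 N_def)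
      have "a \<le> N * sqrt ((a / (2 * (N + 1)))\<^sup>2)"
        using small[of "(a / (2 * (N + 1)))\<^sup>2"] a N0 by (simp add: a_def N_def)
      also have "\<dots> = N / (N + 1) * (a / 2)" using a N0 by simp
      also have "\<dots> \<le> 1 * (a / 2)" using N0 a by (intro mult_right_mono) auto
      finally show False using a by simp
    qed
    then show ?thesis .
  qed
  have gm: "g \<in> borel_measurable (lebesgue_on \<Omega>)" using g by (simp add: L2_space_def)
  define gp where "gp x = max (g x) 0" for x
  define gn where "gn x = max (- g x) 0" for x
  have nn: "0 \<le> gp x" "0 \<le> gn x" for x by (simp_all add: gp_def gn_def)
  have L2': "gp \<in> L2_space \<Omega>" "gn \<in> L2_space \<Omega>"
  proof -
    have i: "integrable (lebesgue_on \<Omega>) (\<lambda>x. (g x)\<^sup>2)" using g by (simp add: L2_space_def)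
    have "integrable (lebesgue_on \<Omega>) (\<lambda>x. (gp x)\<^sup>2)" "integrable (lebesgue_on \<Omega>) (\<lambda>x. (gn x)\<^sup>2)"
      by (rule Bochner_Integration.integrable_bound[OF i]; use gm in \<open>auto simp: gp_def gn_def max_def\<close>)+
    then show "gp \<in> L2_space \<Omega>" "gn \<in> L2_space \<Omega>" using gm by (auto simp: L2_space_def gp_def[abs_def] gn_def[abs_def])
  qed
  have setm: "{x \<in> \<Omega>. P (g x)} \<in> sets lebesgue" if "Measurable.pred borel P" for P
  proof -
    have "{x \<in> space (lebesgue_on \<Omega>). P (g x)} \<in> sets (lebesgue_on \<Omega>)" using gm that by measurable
    then show ?thesis using om_sets by (auto simp: sets_restrict_space_iff space_restrict_space)
  qed
  have one: "(\<lambda>_. 1) \<in> L2_space \<Omega>" by (rule bounded_L2[of _ 1]) auto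
  have "(\<integral>x. gp x \<partial>lebesgue_on \<Omega>) = L2_inner \<Omega> g (indicator {x \<in> \<Omega>. g x > 0})"
    unfolding L2_inner_def by (rule Bochner_Integration.integral_cong) (auto simp: gp_def indicator_def space_restrict_space)
  also have "\<dots> = 0" by (rule s3) (auto intro: setm)
  finally have "AE x in lebesgue_on \<Omega>. gp x = 0"
    using integral_nonneg_eq_0_iff_AE[of "lebesgue_on \<Omega>" gp] L2_prod_integrable[OF L2'(1) one] nn by simp
  moreover
  have "(\<integral>x. gn x \<partial>lebesgue_on \<Omega>) = - L2_inner \<Omega> g (indicator {x \<in> \<Omega>. g x < 0})"
    unfolding L2_inner_def integral_minus[symmetric]
    by (rule Bochner_Integration.integral_cong) (auto simp: gn_def indicator_def space_restrict_space)
  then have "(\<integral>x. gn x \<partial>lebesgue_on \<Omega>) = 0" using s3[of "{x \<in> \<Omega>. g x < 0}"] setm[of "\<lambda>y. y < 0"] by auto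
  then have "AE x in lebesgue_on \<Omega>. gn x = 0"
    using integral_nonneg_eq_0_iff_AE[of "lebesgue_on \<Omega>" gn] L2_prod_integrable[OF L2'(2) one] nn by simp
  ultimately show ?thesis by (auto simp: gp_def gn_def max_def split: if_splits)
qed

text \<open>The integral of \<open>partial i (\<phi> \<psi>)\<close> vanishes.\<close>
lemma partial_by_parts:
  assumes \<phi>: "\<phi> \<in> test_functions \<Omega>" and \<psi>: "\<psi> \<in> test_functions \<Omega>"
  shows "L2_inner \<Omega> \<phi> (partial i \<psi>) = - L2_inner \<Omega> (partial i \<phi>) \<psi>"
proof -
  note d = test_differentiable[OF \<phi>] test_differentiable[OF \<psi>]
  note c = test_continuous[OF \<phi>] test_continuous[OF \<psi>]
    test_continuous[OF test_partial[OF \<phi>]] test_continuous[OF test_partial[OF \<psi>]]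
  obtain K where K: "compact K" "K \<subseteq> \<Omega>" "\<And>x. x \<notin> K \<Longrightarrow> \<phi> x = 0" using test_support[OF \<phi>] by blast
  have p: "partial i (\<lambda>x. \<phi> x * \<psi> x) = (\<lambda>x. \<phi> x * partial i \<psi> x + partial i \<phi> x * \<psi> x)"
    by (rule ext, rule partial_mult) (rule d)+
  have "(\<integral>x. partial i (\<lambda>x. \<phi> x * \<psi> x) x \<partial>lborel) = 0"
  proof (rule integral_partial_zero[OF _ _ K(1)])
    show "(\<lambda>x. \<phi> x * \<psi> x) differentiable (at x)" for x by (intro differentiable_mult d)
    show "continuous_on UNIV (partial i (\<lambda>x. \<phi> x * \<psi> x))" unfolding p by (intro continuous_intros c)
  qed (simp add: K(3))
  moreover have "integrable lborel (\<lambda>x. \<phi> x * partial i \<psi> x)" "integrable lborel (\<lambda>x. partial i \<phi> x * \<psi> x)"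
    using partial_zero_outside[OF compact_imp_closed[OF K(1)], of \<phi> _ i] K(3)
    by (auto intro!: integrable_compact_support[OF _ K(1)] continuous_intros c simp: K(3))
  ultimately have "(\<integral>x. \<phi> x * partial i \<psi> x \<partial>lborel) = - (\<integral>x. partial i \<phi> x * \<psi> x \<partial>lborel)"
    unfolding p by (simp add: eq_neg_iff_add_eq_0)
  moreover have "L2_inner \<Omega> \<phi> (partial i \<psi>) = (\<integral>x. \<phi> x * partial i \<psi> x \<partial>lborel)"
    by (intro L2_inner_lborel borel_measurable_continuous_onI continuous_intros c) (simp add: test_outside[OF \<phi>])
  moreover have "L2_inner \<Omega> (partial i \<phi>) \<psi> = (\<integral>x. partial i \<phi> x * \<psi> x \<partial>lborel)"
    by (intro L2_inner_lborel borel_measurable_continuous_onI continuous_intros c) (simp add: test_outside[OF \<psi>])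
  ultimately show ?thesis by simp
qed

text \<open>Integrating \<open>partial i (x\<^sub>i \<phi>\<^sup>2)\<close> gives \<open>\<integral>\<phi>\<^sup>2 = - 2
  \<integral>x\<^sub>i \<phi> (partial i \<phi>)\<close>; Cauchy-Schwarz completes the proof.\<close>
lemma poincare_test:
  assumes \<phi>: "\<phi> \<in> test_functions \<Omega>" and R: "\<And>x. x \<in> \<Omega> \<Longrightarrow> norm x \<le> R" "0 \<le> R"
  shows "L2_norm \<Omega> \<phi> \<le> 2 * R * L2_norm \<Omega> (partial i \<phi>)"
proof -
  interpret L: semi_inner "L2_space \<Omega>" "L2_inner \<Omega>" by (rule L2_semi_inner)
  note p\<phi> = test_partial[OF \<phi>, of i]
  note d = test_differentiable[OF \<phi>]
  note c = test_continuous[OF \<phi>] test_continuous[OF p\<phi>]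
  obtain K where K: "compact K" "K \<subseteq> \<Omega>" "\<And>x. x \<notin> K \<Longrightarrow> \<phi> x = 0" using test_support[OF \<phi>] by blast
  have dx: "(\<lambda>x :: real^'d. x $ i) differentiable (at x)" for x
    using has_derivative_coord by (auto simp: differentiable_def)
  let ?F = "\<lambda>x. x $ i * (\<phi> x * \<phi> x)"
  have p: "partial i ?F = (\<lambda>x. x $ i * (2 * (\<phi> x * partial i \<phi> x)) + \<phi> x * \<phi> x)"
  proof
    fix x
    have "partial i ?F x = x $ i * partial i (\<lambda>x. \<phi> x * \<phi> x) x + partial i (\<lambda>x. x $ i) x * (\<phi> x * \<phi> x)"
      by (intro partial_mult dx differentiable_mult d)
    then show "partial i ?F x = x $ i * (2 * (\<phi> x * partial i \<phi> x)) + \<phi> x * \<phi> x"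
      by (simp add: partial_coord partial_mult[OF d d])
  qed
  have cx: "continuous_on UNIV (\<lambda>x :: real^'d. x $ i)" by (intro continuous_intros)
  have z: "(\<integral>x. partial i ?F x \<partial>lborel) = 0"
  proof (rule integral_partial_zero[OF _ _ K(1)])
    show "?F differentiable (at x)" for x by (intro differentiable_mult d dx)
    show "continuous_on UNIV (partial i ?F)" unfolding p by (intro continuous_intros c cx)
  qed (simp add: K(3))
  define G where "G x = x $ i * \<phi> x" for x
  have G: "G \<in> L2_space \<Omega>"
  proof (rule test_L2, rule test_I[OF _ K(1,2)])
    fix n
    have "C_class n (\<lambda>x. x $ i * \<phi> x)" if "\<phi> \<in> test_functions \<Omega>" for \<phi>
      using that
    proof (induction n arbitrary: \<phi>)
      case 0
      then show ?case using test_continuous by (auto intro!: continuous_intros cx)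
    next
      case (Suc n)
      have e: "partial j (\<lambda>x. x $ i * \<phi> x) = (\<lambda>x. 1 * (x $ i * partial j \<phi> x) + (if j = i then 1 else 0) * \<phi> x)" for j
        using partial_mult[OF dx test_differentiable[OF Suc.prems]] by (auto simp: partial_coord)
      show ?case unfolding C_class.simps e
      proof (intro conjI allI)
        show "(\<lambda>x. x $ i * \<phi> x) differentiable (at x)" for x
          by (intro differentiable_mult dx test_differentiable[OF Suc.prems])
        show "C_class n (\<lambda>x. 1 * (x $ i * partial j \<phi> x) + (if j = i then 1 else 0) * \<phi> x)" for j
          by (intro C_class_lin Suc.IH test_partial Suc.prems test_C_class[OF Suc.prems])
      qed
    qed
    from this[OF \<phi>] show "C_class n G" by (simp add: G_def[abs_def])
  qed (simp add: G_def K(3))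
  have "integrable lborel (\<lambda>x. x $ i * (2 * (\<phi> x * partial i \<phi> x)))" "integrable lborel (\<lambda>x. \<phi> x * \<phi> x)"
    by (auto intro!: integrable_compact_support[OF _ K(1)] continuous_intros c cx simp: K(3))
  then have "(\<integral>x. \<phi> x * \<phi> x \<partial>lborel) = - (\<integral>x. x $ i * (2 * (\<phi> x * partial i \<phi> x)) \<partial>lborel)"
    using z unfolding p by simp
  also have "(\<integral>x. x $ i * (2 * (\<phi> x * partial i \<phi> x)) \<partial>lborel) = (\<integral>x. 2 * (G x * partial i \<phi> x) \<partial>lborel)"
    by (simp add: G_def mult_ac)
  also have "\<dots> = 2 * (\<integral>x. G x * partial i \<phi> x \<partial>lborel)" by simp
  also have "(\<integral>x. G x * partial i \<phi> x \<partial>lborel) = L2_inner \<Omega> G (partial i \<phi>)"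
    unfolding G_def by (intro L2_inner_lborel[symmetric] borel_measurable_continuous_onI continuous_intros c cx)
      (simp add: test_outside[OF \<phi>])
  also have "(\<integral>x. \<phi> x * \<phi> x \<partial>lborel) = L2_inner \<Omega> \<phi> \<phi>"
    by (intro L2_inner_lborel[symmetric] borel_measurable_continuous_onI continuous_intros c) (simp add: test_outside[OF \<phi>])
  finally have "L2_inner \<Omega> \<phi> \<phi> \<le> 2 * \<bar>L2_inner \<Omega> G (partial i \<phi>)\<bar>" by simp
  also have "\<dots> \<le> 2 * (L2_norm \<Omega> G * L2_norm \<Omega> (partial i \<phi>))"
    using L.cauchy_schwarz[OF G test_L2[OF p\<phi>]] by (simp add: nrm_L2)
  also have "L2_norm \<Omega> G \<le> R * L2_norm \<Omega> \<phi>"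
  proof -
    have "L2_inner \<Omega> G G \<le> (\<integral>x. R\<^sup>2 * (\<phi> x * \<phi> x) \<partial>lebesgue_on \<Omega>)"
      unfolding L2_inner_def
    proof (rule integral_mono)
      show "integrable (lebesgue_on \<Omega>) (\<lambda>x. G x * G x)" by (rule L2_prod_integrable[OF G G])
      show "integrable (lebesgue_on \<Omega>) (\<lambda>x. R\<^sup>2 * (\<phi> x * \<phi> x))"
        by (intro integrable_mult_right L2_prod_integrable test_L2 \<phi>)
      fix x assume "x \<in> space (lebesgue_on \<Omega>)"
      then have "norm x \<le> R" using R by (simp add: space_restrict_space)
      then have "\<bar>x $ i\<bar> \<le> R" using component_le_norm_cart[of x i] by simp
      then have "(x $ i)\<^sup>2 \<le> R\<^sup>2" by (metis R(2) abs_le_square_iff abs_of_nonneg)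
      then have "(x $ i)\<^sup>2 * (\<phi> x * \<phi> x) \<le> R\<^sup>2 * (\<phi> x * \<phi> x)" by (intro mult_right_mono) auto
      then show "G x * G x \<le> R\<^sup>2 * (\<phi> x * \<phi> x)" by (simp add: G_def power2_eq_square mult_ac)
    qed
    also have "\<dots> = R\<^sup>2 * L2_inner \<Omega> \<phi> \<phi>" by (simp add: L2_inner_def)
    finally have "sqrt (L2_inner \<Omega> G G) \<le> sqrt (R\<^sup>2 * L2_inner \<Omega> \<phi> \<phi>)" by simp
    then show ?thesis using R(2) by (simp add: L2_norm_def real_sqrt_mult)
  qed
  finally have "L2_norm \<Omega> \<phi> * L2_norm \<Omega> \<phi> \<le> 2 * R * L2_norm \<Omega> (partial i \<phi>) * L2_norm \<Omega> \<phi>"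
    using L.nrm_nonneg[OF test_L2[OF p\<phi>]] L.nrm_sq[OF test_L2[OF \<phi>]] by (simp add: nrm_L2 mult_right_mono power2_eq_square mult_ac)
  then show ?thesis
    using L.nrm_nonneg[OF test_L2[OF \<phi>]] L.nrm_nonneg[OF test_L2[OF p\<phi>]] R(2)
    by (cases "L2_norm \<Omega> \<phi> = 0") (auto simp: nrm_L2 intro: mult_right_le_imp_le)
qed

end

section \<open>Weak derivatives and Sobolev spaces\<close>

lemma finite_multi_indices: "finite {\<alpha> :: 'd::finite multiset. size \<alpha> \<le> m}"
proof -
  have "{\<alpha> :: 'd multiset. size \<alpha> \<le> m} \<subseteq> mset ` {xs. set xs \<subseteq> UNIV \<and> length xs \<le> m}"
  proof
    fix \<alpha> :: "'d multiset" assume "\<alpha> \<in> {\<alpha>. size \<alpha> \<le> m}"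
    moreover obtain xs where "mset xs = \<alpha>" using ex_mset by blast
    ultimately show "\<alpha> \<in> mset ` {xs. set xs \<subseteq> UNIV \<and> length xs \<le> m}" by auto
  qed
  moreover have "finite {xs :: 'd list. set xs \<subseteq> UNIV \<and> length xs \<le> m}" by (rule finite_lists_length_le) simp
  ultimately show ?thesis by (meson finite_imageI finite_subset)
qed

lemma multi_partial_eqs:
  "multi_partial {#} \<phi> = \<phi>" "multi_partial {#i#} \<phi> = partial i \<phi>"
  "multi_partial {#i, i#} \<phi> = partial i (partial i \<phi>)"
proof -
  have "(SOME js. mset js = {#i, i#}) = [i, i]"
  proof (rule some_equality)
    fix js assume js: "mset js = {#i, i#}"
    then have "length js = 2" by (metis size_mset size_add_mset size_empty numeral_2_eq_2)
    then obtain a b where "js = [a, b]" by (auto simp: numeral_2_eq_2 length_Suc_conv)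
    moreover have "set js = {i}" using js by (metis set_mset_mset set_mset_add_mset_insert set_mset_empty insert_absorb2)
    ultimately show "js = [i, i]" by auto
  qed simp
  then show "multi_partial {#i, i#} \<phi> = partial i (partial i \<phi>)" by (simp add: multi_partial_def)
  have "(SOME js. mset js = {#i#}) = [i]" by (rule some_equality) auto
  then show "multi_partial {#i#} \<phi> = partial i \<phi>" by (simp add: multi_partial_def)
qed (simp add: multi_partial_def)

lemma test_multi_partial: "\<phi> \<in> test_functions \<Omega> \<Longrightarrow> multi_partial \<alpha> \<phi> \<in> test_functions \<Omega>"
proof -
  assume \<phi>: "\<phi> \<in> test_functions \<Omega>"
  have "foldr partial js \<phi> \<in> test_functions \<Omega>" for js by (induction js) (auto simp: \<phi> intro: test_partial)
  then show ?thesis by (simp add: multi_partial_def)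
qed

lemma H_space_mono: "m \<le> n \<Longrightarrow> H_space \<Omega> n \<subseteq> H_space \<Omega> m"
  by (auto simp: H_space_def)

lemma H_space_L2: "v \<in> H_space \<Omega> m \<Longrightarrow> v \<in> L2_space \<Omega>"
  by (simp add: H_space_def)

lemma has_weak_deriv_weak_deriv: "v \<in> H_space \<Omega> m \<Longrightarrow> size \<alpha> \<le> m \<Longrightarrow> has_weak_deriv \<Omega> \<alpha> v (weak_deriv \<Omega> \<alpha> v)"
  unfolding weak_deriv_def using someI_ex[of "has_weak_deriv \<Omega> \<alpha> v"] by (simp add: H_space_def)

lemma weak_deriv_L2: "v \<in> H_space \<Omega> m \<Longrightarrow> size \<alpha> \<le> m \<Longrightarrow> weak_deriv \<Omega> \<alpha> v \<in> L2_space \<Omega>"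
  using has_weak_deriv_weak_deriv[of v \<Omega> m \<alpha>] by (simp add: has_weak_deriv_def)

text \<open>The inner product that induces \<open>H_norm\<close>.\<close>
definition H_inner :: "(real^'d::finite) set \<Rightarrow> nat \<Rightarrow> 'd field \<Rightarrow> 'd field \<Rightarrow> real" where
  "H_inner \<Omega> m v w = (\<Sum>\<alpha> | size \<alpha> \<le> m. L2_inner \<Omega> (weak_deriv \<Omega> \<alpha> v) (weak_deriv \<Omega> \<alpha> w))"

context
  fixes \<Omega> :: "(real^'d::finite) set"
  assumes open\<Omega>: "open \<Omega>" and bdd: "bounded \<Omega>"
begin

interpretation L: semi_inner "L2_space \<Omega>" "L2_inner \<Omega>" by (rule L2_semi_inner[OF open\<Omega> bdd])

lemma L_nrm [simp]: "L.nrm = L2_norm \<Omega>" by (rule ext) (rule nrm_L2[OF open\<Omega> bdd])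

lemma has_weak_deriv_cong_imp:
  assumes "AE x in lebesgue_on \<Omega>. v x = v' x" "AE x in lebesgue_on \<Omega>. g x = g' x" "has_weak_deriv \<Omega> \<alpha> v g"
  shows "has_weak_deriv \<Omega> \<alpha> v' g'"
proof -
  have v: "v \<in> L2_space \<Omega>" and g: "g \<in> L2_space \<Omega>" using assms(3) by (auto simp: has_weak_deriv_def)
  have "v' \<in> L2_space \<Omega>" "g' \<in> L2_space \<Omega>" using L2_AE[OF open\<Omega>] bdd assms(1,2) v g by blast+
  moreover have "L2_inner \<Omega> v' (multi_partial \<alpha> \<phi>) = (-1) ^ size \<alpha> * L2_inner \<Omega> g' \<phi>" if \<phi>: "\<phi> \<in> test_functions \<Omega>" for \<phi>
  proof -
    have "L2_inner \<Omega> v (multi_partial \<alpha> \<phi>) = L2_inner \<Omega> v' (multi_partial \<alpha> \<phi>)"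
      by (rule L2_inner_cong[OF open\<Omega> bdd v test_L2[OF open\<Omega> bdd test_multi_partial[OF \<phi>]] assms(1)]) simp
    moreover have "L2_inner \<Omega> g \<phi> = L2_inner \<Omega> g' \<phi>"
      by (rule L2_inner_cong[OF open\<Omega> bdd g test_L2[OF open\<Omega> bdd \<phi>] assms(2)]) simp
    ultimately show ?thesis using assms(3) \<phi> by (simp add: has_weak_deriv_def)
  qed
  ultimately show ?thesis by (simp add: has_weak_deriv_def)
qed

lemma AE_sym: "(AE x in M. v x = w x) \<Longrightarrow> (AE x in M. w x = v x)" by (simp add: eq_commute)

lemma has_weak_deriv_cong:
  assumes "AE x in lebesgue_on \<Omega>. v x = v' x"
  shows "has_weak_deriv \<Omega> \<alpha> v g = has_weak_deriv \<Omega> \<alpha> v' g"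
  using has_weak_deriv_cong_imp[of v v' g g] has_weak_deriv_cong_imp[of v' v g g] assms AE_sym[OF assms] by auto

lemma weak_deriv_cong:
  assumes "AE x in lebesgue_on \<Omega>. v x = v' x"
  shows "weak_deriv \<Omega> \<alpha> v = weak_deriv \<Omega> \<alpha> v'"
  unfolding weak_deriv_def has_weak_deriv_cong[OF assms] ..

lemma H_space_cong:
  assumes "AE x in lebesgue_on \<Omega>. v x = v' x" "v \<in> H_space \<Omega> m" shows "v' \<in> H_space \<Omega> m"
proof -
  have "has_weak_deriv \<Omega> \<alpha> v = has_weak_deriv \<Omega> \<alpha> v'" for \<alpha> by (rule ext) (rule has_weak_deriv_cong[OF assms(1)])
  then show ?thesis using assms(2) L2_AE[OF open\<Omega> bdd _ assms(1)] by (simp add: H_space_def)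
qed

lemma H_norm_cong: "AE x in lebesgue_on \<Omega>. v x = v' x \<Longrightarrow> H_norm \<Omega> m v = H_norm \<Omega> m v'"
  unfolding H_norm_def using weak_deriv_cong by simp

lemma grad_cong: "AE x in lebesgue_on \<Omega>. v x = v' x \<Longrightarrow> AE x in lebesgue_on \<Omega>. w x = w' x \<Longrightarrow> grad_inner \<Omega> v w = grad_inner \<Omega> v' w'"
  unfolding grad_inner_def weak_grad_def using weak_deriv_cong by simp

lemma weak_deriv_unique:
  assumes "has_weak_deriv \<Omega> \<alpha> v g" "has_weak_deriv \<Omega> \<alpha> v g'"
  shows "AE x in lebesgue_on \<Omega>. g x = g' x"
proof -
  have g: "g \<in> L2_space \<Omega>" "g' \<in> L2_space \<Omega>" using assms by (auto simp: has_weak_deriv_def)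
  have "AE x in lebesgue_on \<Omega>. g x - g' x = 0"
  proof (rule fundamental_lemma[OF open\<Omega> bdd L.diff[OF g]])
    fix \<phi> assume \<phi>: "\<phi> \<in> test_functions \<Omega>"
    have "(-1) ^ size \<alpha> * L2_inner \<Omega> g \<phi> = (-1) ^ size \<alpha> * L2_inner \<Omega> g' \<phi>"
      using assms \<phi> unfolding has_weak_deriv_def by metis
    then have "L2_inner \<Omega> g \<phi> = L2_inner \<Omega> g' \<phi>" by simp
    then show "L2_inner \<Omega> (\<lambda>x. g x - g' x) \<phi> = 0" using g test_L2[OF open\<Omega> bdd \<phi>] by (simp add: L.B_diff)
  qed
  then show ?thesis by simp
qed

lemma weak_deriv_eqI: "has_weak_deriv \<Omega> \<alpha> v g \<Longrightarrow> AE x in lebesgue_on \<Omega>. weak_deriv \<Omega> \<alpha> v x = g x"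
  unfolding weak_deriv_def using someI[of "has_weak_deriv \<Omega> \<alpha> v" g] by (intro weak_deriv_unique) auto

lemma has_weak_deriv_lin:
  assumes "has_weak_deriv \<Omega> \<alpha> v g" "has_weak_deriv \<Omega> \<alpha> w h"
  shows "has_weak_deriv \<Omega> \<alpha> (\<lambda>x. c * v x + d * w x) (\<lambda>x. c * g x + d * h x)"
proof -
  have L2: "v \<in> L2_space \<Omega>" "g \<in> L2_space \<Omega>" "w \<in> L2_space \<Omega>" "h \<in> L2_space \<Omega>"
    using assms by (auto simp: has_weak_deriv_def)
  have "L2_inner \<Omega> (\<lambda>x. c * v x + d * w x) (multi_partial \<alpha> \<phi>) = (-1) ^ size \<alpha> * L2_inner \<Omega> (\<lambda>x. c * g x + d * h x) \<phi>"
    if \<phi>: "\<phi> \<in> test_functions \<Omega>" for \<phi>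
  proof -
    have t: "\<phi> \<in> L2_space \<Omega>" "multi_partial \<alpha> \<phi> \<in> L2_space \<Omega>"
      using test_L2[OF open\<Omega> bdd] test_multi_partial \<phi> by blast+
    have e: "L2_inner \<Omega> v (multi_partial \<alpha> \<phi>) = (-1) ^ size \<alpha> * L2_inner \<Omega> g \<phi>"
      "L2_inner \<Omega> w (multi_partial \<alpha> \<phi>) = (-1) ^ size \<alpha> * L2_inner \<Omega> h \<phi>"
      using assms \<phi> by (auto simp: has_weak_deriv_def)
    show ?thesis unfolding L.bil[OF L2(1,3) t(2)] L.bil[OF L2(2,4) t(1)] e by (simp add: algebra_simps)
  qed
  then show ?thesis unfolding has_weak_deriv_def using L2 L.lin by blast
qed

lemma H_space_lin:
  assumes v: "v \<in> H_space \<Omega> m" and w: "w \<in> H_space \<Omega> m" shows "(\<lambda>x. c * v x + d * w x) \<in> H_space \<Omega> m"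
  unfolding H_space_def
  using L.lin[OF H_space_L2[OF v] H_space_L2[OF w]]
    has_weak_deriv_lin[OF has_weak_deriv_weak_deriv[OF v] has_weak_deriv_weak_deriv[OF w]] by blast

text \<open>Weak derivatives are chosen by \<open>SOME\<close>, so linearity holds only almost everywhere.\<close>
lemma weak_deriv_lin:
  assumes "v \<in> H_space \<Omega> m" "w \<in> H_space \<Omega> m" "size \<alpha> \<le> m"
  shows "AE x in lebesgue_on \<Omega>. weak_deriv \<Omega> \<alpha> (\<lambda>x. c * v x + d * w x) x = c * weak_deriv \<Omega> \<alpha> v x + d * weak_deriv \<Omega> \<alpha> w x"
  by (rule weak_deriv_eqI, rule has_weak_deriv_lin) (use assms has_weak_deriv_weak_deriv in blast)+

lemma weak_deriv_inner_lin:
  assumes "v \<in> H_space \<Omega> m" "w \<in> H_space \<Omega> m" "size \<alpha> \<le> m" "u \<in> L2_space \<Omega>"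
  shows "L2_inner \<Omega> (weak_deriv \<Omega> \<alpha> (\<lambda>x. c * v x + d * w x)) u
    = c * L2_inner \<Omega> (weak_deriv \<Omega> \<alpha> v) u + d * L2_inner \<Omega> (weak_deriv \<Omega> \<alpha> w) u"
proof -
  have "L2_inner \<Omega> (weak_deriv \<Omega> \<alpha> (\<lambda>x. c * v x + d * w x)) u
      = L2_inner \<Omega> (\<lambda>x. c * weak_deriv \<Omega> \<alpha> v x + d * weak_deriv \<Omega> \<alpha> w x) u"
    by (rule L2_inner_cong[OF open\<Omega> bdd weak_deriv_L2[OF H_space_lin[OF assms(1,2)] assms(3)] assms(4) weak_deriv_lin[OF assms(1-3)]]) simp
  also have "\<dots> = c * L2_inner \<Omega> (weak_deriv \<Omega> \<alpha> v) u + d * L2_inner \<Omega> (weak_deriv \<Omega> \<alpha> w) u"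
    by (rule L.bil[OF weak_deriv_L2[OF assms(1,3)] weak_deriv_L2[OF assms(2,3)] assms(4)])
  finally show ?thesis .
qed

lemma has_weak_deriv_empty: "v \<in> L2_space \<Omega> \<Longrightarrow> has_weak_deriv \<Omega> {#} v v"
  by (simp add: has_weak_deriv_def multi_partial_eqs)

lemma H_space_0: "H_space \<Omega> 0 = L2_space \<Omega>"
  using has_weak_deriv_empty by (auto simp: H_space_def)

lemma zero_weak_deriv: "has_weak_deriv \<Omega> \<alpha> (\<lambda>_. 0) (\<lambda>_. 0)"
  using L.zero by (simp add: has_weak_deriv_def L2_inner_def)

lemma H_semi_inner: "semi_inner (H_space \<Omega> m) (H_inner \<Omega> m)"
proof
  show "(\<lambda>_. 0) \<in> H_space \<Omega> m" unfolding H_space_def using L.zero zero_weak_deriv by blast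
  fix v w u c d assume v: "v \<in> H_space \<Omega> m" and w: "w \<in> H_space \<Omega> m"
  show "(\<lambda>x. c * v x + d * w x) \<in> H_space \<Omega> m" by (rule H_space_lin[OF v w])
  show "H_inner \<Omega> m v w = H_inner \<Omega> m w v"
    unfolding H_inner_def using weak_deriv_L2 v w by (intro sum.cong refl L.sym) auto
  show "0 \<le> H_inner \<Omega> m v v"
    unfolding H_inner_def using weak_deriv_L2 v by (intro sum_nonneg L.nonneg) auto
  assume u: "u \<in> H_space \<Omega> m"
  show "H_inner \<Omega> m (\<lambda>x. c * v x + d * w x) u = c * H_inner \<Omega> m v u + d * H_inner \<Omega> m w u"
    unfolding H_inner_def sum_distrib_left sum.distrib[symmetric]
    by (intro sum.cong refl weak_deriv_inner_lin[OF v w]) (auto intro: weak_deriv_L2[OF u])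
qed

interpretation H: semi_inner "H_space \<Omega> m" "H_inner \<Omega> m" for m by (rule H_semi_inner)

lemma H_nrm [simp]: "semi_inner.nrm (H_inner \<Omega> m) v = H_norm \<Omega> m v"
proof -
  have "L2_inner \<Omega> w w = (L2_norm \<Omega> w)\<^sup>2" for w by (simp add: L2_norm_def L2_inner_def)
  then show ?thesis unfolding H.nrm_def H_norm_def H_inner_def by simp
qed

lemma weak_deriv_norm_le:
  assumes "v \<in> H_space \<Omega> m" "size \<alpha> \<le> m" shows "L2_norm \<Omega> (weak_deriv \<Omega> \<alpha> v) \<le> H_norm \<Omega> m v"
proof -
  have "(L2_norm \<Omega> (weak_deriv \<Omega> \<alpha> v))\<^sup>2 \<le> (\<Sum>\<alpha> | size \<alpha> \<le> m. (L2_norm \<Omega> (weak_deriv \<Omega> \<alpha> v))\<^sup>2)"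
    by (rule member_le_sum) (use assms finite_multi_indices in auto)
  then show ?thesis unfolding H_norm_def
    using L.nrm_nonneg[OF weak_deriv_L2[OF assms]] by (intro real_le_rsqrt) auto
qed

lemma L2_le_H_norm:
  assumes "v \<in> H_space \<Omega> m" shows "L2_norm \<Omega> v \<le> H_norm \<Omega> m v"
proof -
  have "L2_norm \<Omega> (weak_deriv \<Omega> {#} v) = L2_norm \<Omega> v"
    by (intro L2_norm_cong[OF open\<Omega> bdd weak_deriv_L2[OF assms]] weak_deriv_eqI has_weak_deriv_empty H_space_L2[OF assms]) simp
  then show ?thesis using weak_deriv_norm_le[OF assms, of "{#}"] by simp
qed

lemma H_norm_0:
  assumes "v \<in> L2_space \<Omega>" shows "H_norm \<Omega> 0 v = L2_norm \<Omega> v"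
proof -
  have v: "v \<in> H_space \<Omega> 0" using assms by (simp add: H_space_0)
  have "L2_norm \<Omega> (weak_deriv \<Omega> {#} v) = L2_norm \<Omega> v"
    by (intro L2_norm_cong[OF open\<Omega> bdd weak_deriv_L2[OF v]] weak_deriv_eqI has_weak_deriv_empty assms) simp
  moreover have "{\<alpha> :: 'd multiset. size \<alpha> \<le> 0} = {{#}}" by auto
  ultimately show ?thesis unfolding H_norm_def using L.nrm_nonneg[OF assms] by simp
qed

lemma H_norm_mono:
  assumes "v \<in> H_space \<Omega> n" "m \<le> n" shows "H_norm \<Omega> m v \<le> H_norm \<Omega> n v"
  unfolding H_norm_def
  by (rule real_sqrt_le_mono, rule sum_mono2) (use assms(2) finite_multi_indices in auto)

lemma grad_inner_sum:
  assumes "v \<in> H_space \<Omega> 1" "w \<in> H_space \<Omega> 1"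
  shows "grad_inner \<Omega> v w = (\<Sum>i\<in>UNIV. L2_inner \<Omega> (weak_deriv \<Omega> {#i#} v) (weak_deriv \<Omega> {#i#} w))"
proof -
  have "weak_deriv \<Omega> {#i#} v \<in> L2_space \<Omega>" "weak_deriv \<Omega> {#i#} w \<in> L2_space \<Omega>" for i
    using assms by (auto intro: weak_deriv_L2)
  then show ?thesis unfolding grad_inner_def L2_inner_def weak_grad_def inner_vec_def
    using L2_prod_integrable[OF open\<Omega> bdd] by (simp add: Bochner_Integration.integral_sum)
qed

lemma grad_semi_inner: "semi_inner (H_space \<Omega> 1) (grad_inner \<Omega>)"
proof
  show "(\<lambda>_. 0) \<in> H_space \<Omega> 1" by (rule H.zero)
  fix v w u c d assume v: "v \<in> H_space \<Omega> 1" and w: "w \<in> H_space \<Omega> 1"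
  show l: "(\<lambda>x. c * v x + d * w x) \<in> H_space \<Omega> 1" by (rule H_space_lin[OF v w])
  show "grad_inner \<Omega> v w = grad_inner \<Omega> w v" by (simp add: grad_inner_def inner_commute)
  show "0 \<le> grad_inner \<Omega> v v" by (simp add: grad_inner_def)
  assume u: "u \<in> H_space \<Omega> 1"
  show "grad_inner \<Omega> (\<lambda>x. c * v x + d * w x) u = c * grad_inner \<Omega> v u + d * grad_inner \<Omega> w u"
    unfolding grad_inner_sum[OF l u] grad_inner_sum[OF v u] grad_inner_sum[OF w u] sum_distrib_left sum.distrib[symmetric]
    by (intro sum.cong refl weak_deriv_inner_lin[OF v w]) (auto intro: weak_deriv_L2[OF u])
qed

interpretation G: semi_inner "H_space \<Omega> 1" "grad_inner \<Omega>" by (rule grad_semi_inner)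

lemma G_nrm [simp]: "G.nrm = grad_norm \<Omega>" by (auto simp: G.nrm_def grad_norm_def)

lemma weak_deriv_le_grad_norm:
  assumes "v \<in> H_space \<Omega> 1" shows "L2_norm \<Omega> (weak_deriv \<Omega> {#i#} v) \<le> grad_norm \<Omega> v"
  unfolding grad_norm_def L2_norm_def grad_inner_sum[OF assms assms]
  by (rule real_sqrt_le_mono, rule member_le_sum) (auto intro!: L.nonneg weak_deriv_L2[OF assms])

lemma grad_norm_le_H_norm:
  assumes "v \<in> H_space \<Omega> m" "1 \<le> m" shows "grad_norm \<Omega> v \<le> H_norm \<Omega> m v"
proof -
  have v: "v \<in> H_space \<Omega> 1" using assms H_space_mono by blast
  have "grad_inner \<Omega> v v = (\<Sum>\<alpha>\<in>(\<lambda>i. {#i#}) ` UNIV. L2_inner \<Omega> (weak_deriv \<Omega> \<alpha> v) (weak_deriv \<Omega> \<alpha> v))"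
    unfolding grad_inner_sum[OF v v] by (subst sum.reindex) (auto intro: injI)
  also have "\<dots> \<le> H_inner \<Omega> m v v"
    unfolding H_inner_def
    by (rule sum_mono2[OF finite_multi_indices]) (use assms in \<open>auto intro!: L.nonneg weak_deriv_L2[OF assms(1)]\<close>)
  finally have "G.nrm v \<le> H.nrm m v" unfolding G.nrm_def H.nrm_def by (rule real_sqrt_le_mono)
  then show ?thesis by simp
qed

lemma weak_laplace:
  assumes "v \<in> H_space \<Omega> 2"
  shows "weak_laplace \<Omega> v \<in> L2_space \<Omega>" "L2_norm \<Omega> (weak_laplace \<Omega> v) \<le> real CARD('d) * H_norm \<Omega> 2 v"
proof -
  have e: "weak_laplace \<Omega> v = (\<lambda>x. \<Sum>i\<in>UNIV. 1 * weak_deriv \<Omega> {#i, i#} v x)" by (auto simp: weak_laplace_def)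
  have d: "weak_deriv \<Omega> {#i, i#} v \<in> L2_space \<Omega>" for i by (rule weak_deriv_L2[OF assms]) simp
  show "weak_laplace \<Omega> v \<in> L2_space \<Omega>" unfolding e by (rule L.sum_closed) (auto simp: d)
  have "L2_norm \<Omega> (weak_laplace \<Omega> v) \<le> (\<Sum>i\<in>UNIV. \<bar>1\<bar> * L2_norm \<Omega> (weak_deriv \<Omega> {#i, i#} v))"
    unfolding e using L.nrm_sum[of "UNIV :: 'd set" "\<lambda>i. weak_deriv \<Omega> {#i, i#} v" "\<lambda>_. 1"] d by simp
  also have "\<dots> \<le> (\<Sum>i\<in>(UNIV :: 'd set). H_norm \<Omega> 2 v)"
    by (rule sum_mono) (use weak_deriv_norm_le[OF assms] in simp)
  finally show "L2_norm \<Omega> (weak_laplace \<Omega> v) \<le> real CARD('d) * H_norm \<Omega> 2 v" by simp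
qed

lemma test_weak_deriv: "\<phi> \<in> test_functions \<Omega> \<Longrightarrow> has_weak_deriv \<Omega> {#i#} \<phi> (partial i \<phi>)"
  unfolding has_weak_deriv_def multi_partial_eqs
  using test_L2[OF open\<Omega> bdd] test_partial partial_by_parts[OF open\<Omega> bdd] by auto

lemma size_le_1_cases: "size (\<alpha> :: 'e multiset) \<le> 1 \<Longrightarrow> \<alpha> = {#} \<or> (\<exists>i. \<alpha> = {#i#})"
  by (cases \<alpha>) auto

lemma test_H1: "\<phi> \<in> test_functions \<Omega> \<Longrightarrow> \<phi> \<in> H_space \<Omega> 1"
  unfolding H_space_def using test_weak_deriv has_weak_deriv_empty test_L2[OF open\<Omega> bdd] size_le_1_cases by blast

lemma H10_H1: "v \<in> H10_space \<Omega> \<Longrightarrow> v \<in> H_space \<Omega> 1" by (simp add: H10_space_def)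

lemma H10_approx:
  assumes "v \<in> H10_space \<Omega>" "e > 0"
  obtains \<phi> where "\<phi> \<in> test_functions \<Omega>" "H_norm \<Omega> 1 (\<lambda>x. v x - \<phi> x) < e"
  using assms by (auto simp: H10_space_def)

lemma test_H10: "\<phi> \<in> test_functions \<Omega> \<Longrightarrow> \<phi> \<in> H10_space \<Omega>"
  unfolding H10_space_def using test_H1 H.nrm_zero[of 1] by force

lemma H10_closed:
  assumes v: "v \<in> H_space \<Omega> 1" and ap: "\<And>e. e > 0 \<Longrightarrow> \<exists>w\<in>H10_space \<Omega>. H_norm \<Omega> 1 (\<lambda>x. v x - w x) < e"
  shows "v \<in> H10_space \<Omega>"
  unfolding H10_space_def
proof (intro CollectI conjI v allI impI)
  fix e :: real assume e: "e > 0"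
  obtain w where w: "w \<in> H10_space \<Omega>" "H_norm \<Omega> 1 (\<lambda>x. v x - w x) < e / 2" using ap[of "e / 2"] e by auto
  obtain \<phi> where \<phi>: "\<phi> \<in> test_functions \<Omega>" "H_norm \<Omega> 1 (\<lambda>x. w x - \<phi> x) < e / 2" using H10_approx[OF w(1), of "e / 2"] e by auto
  have "H_norm \<Omega> 1 (\<lambda>x. (v x - w x) + (w x - \<phi> x)) \<le> H_norm \<Omega> 1 (\<lambda>x. v x - w x) + H_norm \<Omega> 1 (\<lambda>x. w x - \<phi> x)"
    using H.nrm_add[OF H.diff[OF v H10_H1[OF w(1)]] H.diff[OF H10_H1[OF w(1)] test_H1[OF \<phi>(1)]]] by simp
  then have "H_norm \<Omega> 1 (\<lambda>x. v x - \<phi> x) < e" using w(2) \<phi>(2) by simp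
  then show "\<exists>\<phi>\<in>test_functions \<Omega>. H_norm \<Omega> 1 (\<lambda>x. v x - \<phi> x) < e" using \<phi>(1) by blast
qed

lemma H10_lin:
  assumes v: "v \<in> H10_space \<Omega>" and w: "w \<in> H10_space \<Omega>"
  shows "(\<lambda>x. c * v x + d * w x) \<in> H10_space \<Omega>"
proof (rule H10_closed)
  show "(\<lambda>x. c * v x + d * w x) \<in> H_space \<Omega> 1" by (rule H_space_lin[OF H10_H1[OF v] H10_H1[OF w]])
  fix e :: real assume e: "e > 0"
  define \<delta> where "\<delta> = e / (\<bar>c\<bar> + \<bar>d\<bar> + 1)"
  have \<delta>: "\<delta> > 0" using e by (simp add: \<delta>_def)
  obtain \<phi> where \<phi>: "\<phi> \<in> test_functions \<Omega>" "H_norm \<Omega> 1 (\<lambda>x. v x - \<phi> x) < \<delta>" using H10_approx[OF v \<delta>] .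
  obtain \<psi> where \<psi>: "\<psi> \<in> test_functions \<Omega>" "H_norm \<Omega> 1 (\<lambda>x. w x - \<psi> x) < \<delta>" using H10_approx[OF w \<delta>] .
  have "H_norm \<Omega> 1 (\<lambda>x. c * (v x - \<phi> x) + d * (w x - \<psi> x)) \<le> \<bar>c\<bar> * H_norm \<Omega> 1 (\<lambda>x. v x - \<phi> x) + \<bar>d\<bar> * H_norm \<Omega> 1 (\<lambda>x. w x - \<psi> x)"
    using H.nrm_lin[OF H.diff[OF H10_H1[OF v] test_H1[OF \<phi>(1)]] H.diff[OF H10_H1[OF w] test_H1[OF \<psi>(1)]]] by simp
  also have "\<dots> \<le> \<bar>c\<bar> * \<delta> + \<bar>d\<bar> * \<delta>" using \<phi>(2) \<psi>(2) by (intro add_mono mult_left_mono) auto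
  also have "\<dots> < (\<bar>c\<bar> + \<bar>d\<bar> + 1) * \<delta>" using \<delta> by (simp add: algebra_simps)
  also have "\<dots> = e"
  proof -
    have "\<bar>c\<bar> + \<bar>d\<bar> + 1 \<noteq> 0" using abs_ge_zero[of c] abs_ge_zero[of d] by linarith
    then show ?thesis by (simp add: \<delta>_def)
  qed
  finally have "H_norm \<Omega> 1 (\<lambda>x. (c * v x + d * w x) - (c * \<phi> x + d * \<psi> x)) < e" by (simp add: algebra_simps)
  then show "\<exists>w'\<in>H10_space \<Omega>. H_norm \<Omega> 1 (\<lambda>x. (c * v x + d * w x) - w' x) < e"
    by (intro bexI[of _ "\<lambda>x. c * \<phi> x + d * \<psi> x"] test_H10 test_lin \<phi>(1) \<psi>(1))
qed

text \<open>For a test function this is the definition of the pure second weak derivatives, once \<open>partial i \<phi>\<close>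
  is recognised as a test function.\<close>
lemma green_test:
  assumes v: "v \<in> H_space \<Omega> 2" and \<phi>: "\<phi> \<in> test_functions \<Omega>"
  shows "grad_inner \<Omega> v \<phi> = - L2_inner \<Omega> (weak_laplace \<Omega> v) \<phi>"
proof -
  have v1: "v \<in> H_space \<Omega> 1" using v H_space_mono[of 1 2] by auto
  have d: "weak_deriv \<Omega> {#i, i#} v \<in> L2_space \<Omega>" "weak_deriv \<Omega> {#i#} v \<in> L2_space \<Omega>" for i
    using v by (auto intro: weak_deriv_L2)
  have "L2_inner \<Omega> (weak_deriv \<Omega> {#i#} v) (weak_deriv \<Omega> {#i#} \<phi>) = - L2_inner \<Omega> (weak_deriv \<Omega> {#i, i#} v) \<phi>" for i
  proof -
    have "L2_inner \<Omega> (weak_deriv \<Omega> {#i#} v) (weak_deriv \<Omega> {#i#} \<phi>) = L2_inner \<Omega> (weak_deriv \<Omega> {#i#} v) (partial i \<phi>)"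
      by (rule L2_inner_cong[OF open\<Omega> bdd d(2) weak_deriv_L2[OF test_H1[OF \<phi>]] _ weak_deriv_eqI[OF test_weak_deriv[OF \<phi>]]]) auto
    also have "\<dots> = - L2_inner \<Omega> v (partial i (partial i \<phi>))"
      using has_weak_deriv_weak_deriv[OF v1, of "{#i#}"] test_partial[OF \<phi>, of i]
      by (simp add: has_weak_deriv_def multi_partial_eqs)
    also have "L2_inner \<Omega> v (partial i (partial i \<phi>)) = L2_inner \<Omega> (weak_deriv \<Omega> {#i, i#} v) \<phi>"
      using has_weak_deriv_weak_deriv[OF v, of "{#i, i#}"] \<phi> by (simp add: has_weak_deriv_def multi_partial_eqs)
    finally show ?thesis .
  qed
  then have "grad_inner \<Omega> v \<phi> = - (\<Sum>i\<in>UNIV. 1 * L2_inner \<Omega> (weak_deriv \<Omega> {#i, i#} v) \<phi>)"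
    unfolding grad_inner_sum[OF v1 test_H1[OF \<phi>]] by (simp add: sum_negf)
  also have "(\<Sum>i\<in>UNIV. 1 * L2_inner \<Omega> (weak_deriv \<Omega> {#i, i#} v) \<phi>) = L2_inner \<Omega> (\<lambda>x. \<Sum>i\<in>UNIV. 1 * weak_deriv \<Omega> {#i, i#} v x) \<phi>"
    by (rule L.B_sum[symmetric]) (auto simp: d test_L2[OF open\<Omega> bdd \<phi>])
  finally show ?thesis by (simp add: weak_laplace_def[abs_def])
qed

text \<open>Both sides are continuous in \<open>w\<close> with respect to the norm of \<open>H\<^sup>1\<close>, and test functions
  are dense in \<open>H\<^sub>0\<^sup>1\<close>.\<close>
lemma green:
  assumes v: "v \<in> H_space \<Omega> 2" and w: "w \<in> H10_space \<Omega>"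
  shows "grad_inner \<Omega> v w = - L2_inner \<Omega> (weak_laplace \<Omega> v) w"
proof (rule ccontr)
  assume n: "grad_inner \<Omega> v w \<noteq> - L2_inner \<Omega> (weak_laplace \<Omega> v) w"
  have v1: "v \<in> H_space \<Omega> 1" using v H_space_mono[of 1 2] by auto
  note w1 = H10_H1[OF w]
  note l = weak_laplace(1)[OF v]
  define D where "D = \<bar>grad_inner \<Omega> v w + L2_inner \<Omega> (weak_laplace \<Omega> v) w\<bar>"
  define A where "A = grad_norm \<Omega> v + L2_norm \<Omega> (weak_laplace \<Omega> v) + 1"
  have A: "A > 0" using G.nrm_nonneg[OF v1] L.nrm_nonneg[OF l] by (simp add: A_def)
  have D: "D > 0" using n by (simp add: D_def)
  obtain \<phi> where \<phi>: "\<phi> \<in> test_functions \<Omega>" "H_norm \<Omega> 1 (\<lambda>x. w x - \<phi> x) < D / A" using H10_approx[OF w, of "D / A"] A D by auto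
  let ?z = "\<lambda>x. w x - \<phi> x"
  have z: "?z \<in> H_space \<Omega> 1" using w1 test_H1[OF \<phi>(1)] by (rule H.diff)
  have "grad_inner \<Omega> v ?z = grad_inner \<Omega> v w - grad_inner \<Omega> v \<phi>"
    using G.B_diff[OF w1 test_H1[OF \<phi>(1)] v1] G.sym[OF v1] z w1 test_H1[OF \<phi>(1)] by simp
  moreover have "L2_inner \<Omega> (weak_laplace \<Omega> v) ?z = L2_inner \<Omega> (weak_laplace \<Omega> v) w - L2_inner \<Omega> (weak_laplace \<Omega> v) \<phi>"
    using L.B_diff[OF H_space_L2[OF w1] H_space_L2[OF test_H1[OF \<phi>(1)]] l] L.sym[OF l]
      H_space_L2[OF z] H_space_L2[OF w1] H_space_L2[OF test_H1[OF \<phi>(1)]] by simp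
  ultimately have "D = \<bar>grad_inner \<Omega> v ?z + L2_inner \<Omega> (weak_laplace \<Omega> v) ?z\<bar>"
    using green_test[OF v \<phi>(1)] by (simp add: D_def)
  also have "\<dots> \<le> grad_norm \<Omega> v * grad_norm \<Omega> ?z + L2_norm \<Omega> (weak_laplace \<Omega> v) * L2_norm \<Omega> ?z"
    using G.cauchy_schwarz[OF v1 z] L.cauchy_schwarz[OF l H_space_L2[OF z]] by (simp add: abs_le_iff)
  also have "\<dots> \<le> grad_norm \<Omega> v * H_norm \<Omega> 1 ?z + L2_norm \<Omega> (weak_laplace \<Omega> v) * H_norm \<Omega> 1 ?z"
    using grad_norm_le_H_norm[OF z] L2_le_H_norm[OF z] G.nrm_nonneg[OF v1] L.nrm_nonneg[OF l]
    by (intro add_mono mult_left_mono) auto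
  also have "\<dots> \<le> A * H_norm \<Omega> 1 ?z" using H.nrm_nonneg[OF z] by (simp add: A_def algebra_simps)
  also have "\<dots> < A * (D / A)" using \<phi>(2) A by (intro mult_strict_left_mono)
  finally show False using A by simp
qed

text \<open>By density from \<open>poincare_test\<close>, in any one coordinate direction.\<close>
lemma poincare: "\<exists>C\<ge>0. \<forall>v\<in>H10_space \<Omega>. L2_norm \<Omega> v \<le> C * grad_norm \<Omega> v"
proof -
  obtain R where "\<forall>x\<in>\<Omega>. norm x \<le> R" using bdd unfolding bounded_iff by blast
  then have R: "\<And>x. x \<in> \<Omega> \<Longrightarrow> norm x \<le> \<bar>R\<bar>" by force
  let ?C = "2 * \<bar>R\<bar>"
  have t: "L2_norm \<Omega> \<phi> \<le> ?C * grad_norm \<Omega> \<phi>" if \<phi>: "\<phi> \<in> test_functions \<Omega>" for \<phi>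
  proof -
    fix i :: 'd
    have "L2_norm \<Omega> \<phi> \<le> ?C * L2_norm \<Omega> (partial i \<phi>)" by (rule poincare_test[OF open\<Omega> bdd \<phi> R]) auto
    also have "L2_norm \<Omega> (partial i \<phi>) = L2_norm \<Omega> (weak_deriv \<Omega> {#i#} \<phi>)"
      by (intro L2_norm_cong[OF open\<Omega> bdd, symmetric] weak_deriv_L2[OF test_H1[OF \<phi>]] weak_deriv_eqI test_weak_deriv \<phi>) simp
    also have "?C * \<dots> \<le> ?C * grad_norm \<Omega> \<phi>"
      by (intro mult_left_mono weak_deriv_le_grad_norm test_H1 \<phi>) auto
    finally show ?thesis .
  qed
  have "L2_norm \<Omega> v \<le> ?C * grad_norm \<Omega> v" if v: "v \<in> H10_space \<Omega>" for v
  proof (rule field_le_epsilon)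
    fix e :: real assume e: "e > 0"
    obtain \<phi> where \<phi>: "\<phi> \<in> test_functions \<Omega>" "H_norm \<Omega> 1 (\<lambda>x. v x - \<phi> x) < e / (?C + 1)"
      using H10_approx[OF v, of "e / (?C + 1)"] e by auto
    let ?z = "\<lambda>x. v x - \<phi> x"
    note v1 = H10_H1[OF v] and \<phi>1 = test_H1[OF \<phi>(1)]
    have z: "?z \<in> H_space \<Omega> 1" by (rule H.diff[OF v1 \<phi>1])
    have "L2_norm \<Omega> v \<le> L2_norm \<Omega> ?z + L2_norm \<Omega> \<phi>"
      using L.nrm_add[OF H_space_L2[OF z] H_space_L2[OF \<phi>1]] by simp
    also have "L2_norm \<Omega> \<phi> \<le> ?C * grad_norm \<Omega> \<phi>" by (rule t[OF \<phi>(1)])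
    also have "?C * grad_norm \<Omega> \<phi> \<le> ?C * (grad_norm \<Omega> v + grad_norm \<Omega> ?z)"
      using G.nrm_diff[OF v1 z] by (intro mult_left_mono) auto
    finally have "L2_norm \<Omega> v \<le> ?C * grad_norm \<Omega> v + (L2_norm \<Omega> ?z + ?C * grad_norm \<Omega> ?z)"
      by (simp add: algebra_simps)
    also have "L2_norm \<Omega> ?z + ?C * grad_norm \<Omega> ?z \<le> H_norm \<Omega> 1 ?z + ?C * H_norm \<Omega> 1 ?z"
      using L2_le_H_norm[OF z] grad_norm_le_H_norm[OF z] by (intro add_mono mult_left_mono) auto
    also have "\<dots> = (?C + 1) * H_norm \<Omega> 1 ?z" by (simp add: algebra_simps)
    also have "\<dots> \<le> (?C + 1) * (e / (?C + 1))" using \<phi>(2) by (intro mult_left_mono) auto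
    also have "\<dots> = e"
    proof -
      have "?C + 1 \<noteq> 0" using abs_ge_zero[of R] by linarith
      then show ?thesis by simp
    qed
    finally show "L2_norm \<Omega> v \<le> ?C * grad_norm \<Omega> v + e" by simp
  qed
  then show ?thesis by (intro exI[of _ ?C]) auto
qed

end

section \<open>Finite element space and projections\<close>

lemma Q_poly_lin:
  assumes "Q_poly r p" "Q_poly r q" shows "Q_poly r (\<lambda>x. c * p x + d * q x)"
proof -
  obtain a where a: "\<And>x. p x = (\<Sum>\<alpha> | \<forall>i. \<alpha> i \<le> r. a \<alpha> * (\<Prod>i\<in>UNIV. (x $ i) ^ \<alpha> i))"
    using assms(1) unfolding Q_poly_def by auto
  obtain b where b: "\<And>x. q x = (\<Sum>\<alpha> | \<forall>i. \<alpha> i \<le> r. b \<alpha> * (\<Prod>i\<in>UNIV. (x $ i) ^ \<alpha> i))"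
    using assms(2) unfolding Q_poly_def by auto
  have "c * p x + d * q x = (\<Sum>\<alpha> | \<forall>i. \<alpha> i \<le> r. (c * a \<alpha> + d * b \<alpha>) * (\<Prod>i\<in>UNIV. (x $ i) ^ \<alpha> i))" for x
    unfolding a b by (simp add: sum_distrib_left sum.distrib[symmetric] distrib_right mult.assoc)
  then show ?thesis unfolding Q_poly_def by (intro exI[of _ "\<lambda>\<alpha>. c * a \<alpha> + d * b \<alpha>"]) simp
qed

lemma Q_poly_zero: "Q_poly r (\<lambda>_. 0)"
  unfolding Q_poly_def by (intro exI[of _ "\<lambda>_. 0"]) simp

lemma span_of_indexed:
  fixes g :: "'i \<Rightarrow> 'a \<Rightarrow> real"
  assumes "finite I" "\<And>x. v x = (\<Sum>i\<in>I. c i * g i x)"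
  shows "\<exists>c. v = (\<lambda>x. \<Sum>b\<in>g ` I. c b * b x)"
proof
  show "v = (\<lambda>x. \<Sum>b\<in>g ` I. (\<Sum>i\<in>{i\<in>I. g i = b}. c i) * b x)"
  proof
    fix x
    have "v x = (\<Sum>b\<in>g ` I. \<Sum>i\<in>{i\<in>I. g i = b}. c i * g i x)"
      unfolding assms(2) by (rule sum.image_gen[OF assms(1)])
    also have "\<dots> = (\<Sum>b\<in>g ` I. (\<Sum>i\<in>{i\<in>I. g i = b}. c i) * b x)"
      unfolding sum_distrib_right by (intro sum.cong refl) auto
    finally show "v x = (\<Sum>b\<in>g ` I. (\<Sum>i\<in>{i\<in>I. g i = b}. c i) * b x)" .
  qed
qed

text \<open>A finite element function is determined by one polynomial per element, hence lies in the span of finitely many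
  functions: a monomial on one element, pulled back by a right inverse of the reference mapping, and zero elsewhere. The
  spanning functions themselves are in general not finite element functions, and overlapping elements are resolved by
  choosing one of them at each point.\<close>
lemma FE_span:
  fixes \<T> :: "'d::finite mesh"
  assumes fin: "finite \<T>" and cover: "(\<Union>F\<in>\<T>. F ` cbox 0 1) = closure \<Omega>"
  shows "\<exists>S. finite S \<and> (\<forall>v\<in>FE_space \<Omega> r \<T>. \<exists>c. v = (\<lambda>x. \<Sum>b\<in>S. c b * b x))"
proof -
  define A where "A = {\<alpha> :: 'd \<Rightarrow> nat. \<forall>i. \<alpha> i \<le> r}"
  have "A = PiE UNIV (\<lambda>_. {..r})" by (auto simp: A_def PiE_UNIV_domain)
  then have finA: "finite A" by (simp add: finite_PiE)
  define el where "el x = (SOME F. F \<in> \<T> \<and> x \<in> F ` cbox 0 1)" for x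
  define pt where "pt F x = (SOME y. y \<in> cbox 0 1 \<and> x = F y)" for F :: "real^'d \<Rightarrow> real^'d" and x
  have el: "el x \<in> \<T> \<and> x \<in> el x ` cbox 0 1" if "x \<in> closure \<Omega>" for x
  proof -
    from that have "x \<in> (\<Union>F\<in>\<T>. F ` cbox 0 1)" by (simp only: cover)
    then obtain F where "F \<in> \<T> \<and> x \<in> F ` cbox 0 1" by blast
    then show ?thesis unfolding el_def by (rule someI[of "\<lambda>F. F \<in> \<T> \<and> x \<in> F ` cbox 0 1"])
  qed
  have pt: "pt F x \<in> cbox 0 1 \<and> x = F (pt F x)" if "x \<in> F ` cbox 0 1" for F x
  proof -
    from that obtain y where "y \<in> cbox 0 1 \<and> x = F y" by blast
    then show ?thesis unfolding pt_def by (rule someI[of "\<lambda>y. y \<in> cbox 0 1 \<and> x = F y"])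
  qed
  define g where "g p x = (if x \<in> closure \<Omega> \<and> el x = fst p then \<Prod>i\<in>UNIV. (pt (fst p) x $ i) ^ (snd p i) else 0)"
    for p :: "(real^'d \<Rightarrow> real^'d) \<times> ('d \<Rightarrow> nat)" and x
  have "\<exists>c. v = (\<lambda>x. \<Sum>b\<in>g ` (\<T> \<times> A). c b * b x)" if v: "v \<in> FE_space \<Omega> r \<T>" for v
  proof -
    have "\<forall>F\<in>\<T>. \<exists>c. \<forall>x\<in>cbox 0 1. v (F x) = (\<Sum>\<alpha>\<in>A. c \<alpha> * (\<Prod>i\<in>UNIV. (x $ i) ^ \<alpha> i))"
    proof
      fix F assume "F \<in> \<T>"
      then obtain p where p: "Q_poly r p" "\<forall>x\<in>cbox 0 1. v (F x) = p x" using v unfolding FE_space_def by blast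
      obtain c where c: "\<And>x. p x = (\<Sum>\<alpha>\<in>A. c \<alpha> * (\<Prod>i\<in>UNIV. (x $ i) ^ \<alpha> i))"
        using p(1) unfolding Q_poly_def A_def by auto
      show "\<exists>c. \<forall>x\<in>cbox 0 1. v (F x) = (\<Sum>\<alpha>\<in>A. c \<alpha> * (\<Prod>i\<in>UNIV. (x $ i) ^ \<alpha> i))"
        using p(2) by (intro exI[of _ c]) (simp add: c)
    qed
    then have "\<exists>C. \<forall>F\<in>\<T>. \<forall>x\<in>cbox 0 1. v (F x) = (\<Sum>\<alpha>\<in>A. C F \<alpha> * (\<Prod>i\<in>UNIV. (x $ i) ^ \<alpha> i))"
      by (rule bchoice)
    then obtain C where C: "\<And>F x. F \<in> \<T> \<Longrightarrow> x \<in> cbox 0 1 \<Longrightarrow> v (F x) = (\<Sum>\<alpha>\<in>A. C F \<alpha> * (\<Prod>i\<in>UNIV. (x $ i) ^ \<alpha> i))"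
      by auto
    show ?thesis
    proof (rule span_of_indexed)
      show "finite (\<T> \<times> A)" using fin finA by simp
      fix x
      show "v x = (\<Sum>p\<in>\<T> \<times> A. C (fst p) (snd p) * g p x)"
      proof (cases "x \<in> closure \<Omega>")
        case True
        note e = el[OF True]
        have "(\<Sum>p\<in>\<T> \<times> A. C (fst p) (snd p) * g p x) = (\<Sum>F\<in>\<T>. \<Sum>\<alpha>\<in>A. C F \<alpha> * g (F, \<alpha>) x)"
          by (simp add: sum.cartesian_product split_def)
        also have "\<dots> = (\<Sum>F\<in>\<T>. if F = el x then \<Sum>\<alpha>\<in>A. C F \<alpha> * (\<Prod>i\<in>UNIV. (pt F x $ i) ^ \<alpha> i) else 0)"
          by (intro sum.cong refl) (auto simp: g_def True)
        also have "\<dots> = (\<Sum>\<alpha>\<in>A. C (el x) \<alpha> * (\<Prod>i\<in>UNIV. (pt (el x) x $ i) ^ \<alpha> i))"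
          using fin e by simp
        also have "\<dots> = v (el x (pt (el x) x))" using C[of "el x" "pt (el x) x"] e pt[of x "el x"] by simp
        also have "\<dots> = v x" using pt[of x "el x"] e by simp
        finally show ?thesis by simp
      next
        case False
        then show ?thesis using v by (simp add: FE_space_def g_def)
      qed
    qed
  qed
  then show ?thesis using fin finA by (intro exI[of _ "g ` (\<T> \<times> A)"]) auto
qed

context
  fixes \<Omega> :: "(real^'d::finite) set"
  assumes open\<Omega>: "open \<Omega>" and bdd: "bounded \<Omega>"
begin

interpretation L: semi_inner "L2_space \<Omega>" "L2_inner \<Omega>" by (rule L2_semi_inner[OF open\<Omega> bdd])
interpretation H: semi_inner "H_space \<Omega> m" "H_inner \<Omega> m" for m by (rule H_semi_inner[OF open\<Omega> bdd])
interpretation G: semi_inner "H_space \<Omega> 1" "grad_inner \<Omega>" by (rule grad_semi_inner[OF open\<Omega> bdd])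

lemmas nrms = L_nrm[OF open\<Omega> bdd] H_nrm[OF open\<Omega> bdd] G_nrm[OF open\<Omega> bdd]

text \<open>A nonempty open set is not negligible.\<close>
lemma AE_zero_continuous:
  assumes "continuous_on \<Omega> v" "AE x in lebesgue_on \<Omega>. v x = (0 :: real)" "x \<in> \<Omega>"
  shows "v x = 0"
proof -
  let ?S = "{x \<in> \<Omega>. v x \<noteq> 0}"
  have "open ?S"
    using continuous_open_preimage[OF assms(1) open\<Omega>, of "- {0}"] by (simp add: vimage_def Int_def open_Compl)
  moreover have "negligible ?S"
  proof -
    have "AE x in lebesgue. x \<in> \<Omega> \<longrightarrow> v x = 0" using assms(2) unfolding AE_restrict_space_iff[OF om_sets'[OF open\<Omega> bdd]] .
    moreover have "?S \<in> sets lebesgue" using \<open>open ?S\<close> by auto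
    ultimately have "?S \<in> null_sets lebesgue"
      by (subst AE_iff_null_sets) (auto elim: eventually_mono)
    then show ?thesis by (simp add: negligible_iff_null_sets)
  qed
  ultimately have "?S = {}" using open_not_negligible by blast
  then show ?thesis using assms(3) by blast
qed

context
  fixes \<T> :: "'d mesh" and r :: nat
  assumes fin: "finite \<T>" and cover: "(\<Union>F\<in>\<T>. F ` cbox 0 1) = closure \<Omega>"
begin

private abbreviation (input) "Vh \<equiv> FE_space \<Omega> r \<T>"

lemma FE_H10: "v \<in> Vh \<Longrightarrow> v \<in> H10_space \<Omega>" by (simp add: FE_space_def)
lemma FE_H1: "v \<in> Vh \<Longrightarrow> v \<in> H_space \<Omega> 1" by (rule H10_H1[OF open\<Omega> bdd FE_H10])
lemma FE_L2: "v \<in> Vh \<Longrightarrow> v \<in> L2_space \<Omega>" by (rule H_space_L2[OF FE_H1])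

lemma FE_zero: "(\<lambda>_. 0) \<in> Vh"
  unfolding FE_space_def using test_H10[OF open\<Omega> bdd test_zero] Q_poly_zero[of r]
  by (auto intro!: exI[of _ "\<lambda>_. 0"])

lemma FE_lin:
  assumes "v \<in> Vh" "w \<in> Vh" shows "(\<lambda>x. c * v x + d * w x) \<in> Vh"
proof -
  have "\<exists>p. Q_poly r p \<and> (\<forall>x\<in>cbox 0 1. c * v (F x) + d * w (F x) = p x)" if F: "F \<in> \<T>" for F
  proof -
    obtain p q where "Q_poly r p" "\<forall>x\<in>cbox 0 1. v (F x) = p x" "Q_poly r q" "\<forall>x\<in>cbox 0 1. w (F x) = q x"
      using assms F unfolding FE_space_def by blast
    then show ?thesis using Q_poly_lin[of r p q c d] by (intro exI[of _ "\<lambda>x. c * p x + d * q x"]) auto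
  qed
  moreover have "continuous_on (closure \<Omega>) (\<lambda>x. c * v x + d * w x)"
    using assms by (intro continuous_intros) (auto simp: FE_space_def)
  moreover have "\<forall>x. x \<notin> closure \<Omega> \<longrightarrow> c * v x + d * w x = 0" using assms by (simp add: FE_space_def)
  ultimately show ?thesis using H10_lin[OF open\<Omega> bdd FE_H10[OF assms(1)] FE_H10[OF assms(2)]]
    unfolding FE_space_def by blast
qed

lemma FE_L2_semi: "semi_inner Vh (L2_inner \<Omega>)"
  by (rule semi_inner_subset[OF L2_semi_inner[OF open\<Omega> bdd] _ FE_zero FE_lin]) (use FE_L2 in auto)

lemma FE_grad_semi: "semi_inner Vh (grad_inner \<Omega>)"
  by (rule semi_inner_subset[OF grad_semi_inner[OF open\<Omega> bdd] _ FE_zero FE_lin]) (use FE_H1 in auto)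

lemma FE_AE_zero:
  assumes v: "v \<in> Vh" and ae: "AE x in lebesgue_on \<Omega>. v x = 0" shows "v = (\<lambda>_. 0)"
proof -
  have c: "continuous_on (closure \<Omega>) v" using v by (simp add: FE_space_def)
  have "v x = 0" if "x \<in> \<Omega>" for x
    using AE_zero_continuous[OF continuous_on_subset[OF c closure_subset] ae that] .
  then have "v x = 0" if "x \<in> closure \<Omega>" for x
    using continuous_constant_on_closure[OF c _ that] by blast
  moreover have "v x = 0" if "x \<notin> closure \<Omega>" for x using v that by (simp add: FE_space_def)
  ultimately show ?thesis by blast
qed

lemma FE_L2_definite: "v \<in> Vh \<Longrightarrow> L2_inner \<Omega> v v = 0 \<Longrightarrow> v = (\<lambda>_. 0)"
  using FE_AE_zero L2_norm_zero_AE[OF open\<Omega> bdd FE_L2] by blast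

text \<open>A zero gradient forces a zero \<open>L\<^sup>2\<close> norm by the Poincare inequality, and continuity does the rest.\<close>
lemma FE_grad_definite: "v \<in> Vh \<Longrightarrow> grad_inner \<Omega> v v = 0 \<Longrightarrow> v = (\<lambda>_. 0)"
proof -
  assume v: "v \<in> Vh" "grad_inner \<Omega> v v = 0"
  obtain C where "L2_norm \<Omega> v \<le> C * grad_norm \<Omega> v" using poincare[OF open\<Omega> bdd] FE_H10[OF v(1)] by blast
  then have "L2_norm \<Omega> v \<le> 0" using v by (simp add: grad_norm_def)
  then have "L2_inner \<Omega> v v = 0"
    using L.nonneg[OF FE_L2[OF v(1)]] by (simp add: L2_norm_def)
  then show ?thesis using FE_L2_definite v by blast
qed

lemma FE_riesz:
  assumes B: "semi_inner Vh B" and def: "\<And>v. v \<in> Vh \<Longrightarrow> B v v = 0 \<Longrightarrow> v = (\<lambda>_. 0)"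
    and ell: "\<And>v w c d. v \<in> Vh \<Longrightarrow> w \<in> Vh \<Longrightarrow> \<l> (\<lambda>x. c * v x + d * w x) = c * \<l> v + d * \<l> w"
  shows "\<exists>!v. v \<in> Vh \<and> (\<forall>w\<in>Vh. B v w = \<l> w)"
proof -
  interpret B: semi_inner Vh B by (rule B)
  from FE_span[OF fin cover, of r] obtain S where S: "finite S" "\<forall>v\<in>Vh. \<exists>c. v = (\<lambda>x. \<Sum>b\<in>S. c b * b x)"
    by (elim exE conjE)
  have ex: "\<exists>v\<in>Vh. \<forall>w\<in>Vh. B v w = \<l> w"
    by (rule B.riesz_exists[OF S(1) subset_refl FE_zero FE_lin bspec[OF S(2)] def ell])
  show ?thesis
  proof (rule ex_ex1I)
    show "\<exists>v. v \<in> Vh \<and> (\<forall>w\<in>Vh. B v w = \<l> w)" using ex unfolding Bex_def .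
    fix v v' assume a: "v \<in> Vh \<and> (\<forall>w\<in>Vh. B v w = \<l> w)" and a': "v' \<in> Vh \<and> (\<forall>w\<in>Vh. B v' w = \<l> w)"
    let ?z = "\<lambda>x. v x - v' x"
    have z: "?z \<in> Vh" by (rule B.diff[OF conjunct1[OF a] conjunct1[OF a']])
    have "B ?z ?z = B v ?z - B v' ?z" by (rule B.B_diff[OF conjunct1[OF a] conjunct1[OF a'] z])
    then have "B ?z ?z = 0" using bspec[OF conjunct2[OF a] z] bspec[OF conjunct2[OF a'] z] by simp
    then have "?z = (\<lambda>_. 0)" by (rule def[OF z])
    then show "v = v'" by (auto simp: fun_eq_iff dest: spec)
  qed
qed

lemma elliptic_proj:
  assumes "w \<in> H_space \<Omega> 1"
  shows "elliptic_proj \<Omega> Vh w \<in> Vh" "\<phi> \<in> Vh \<Longrightarrow> grad_inner \<Omega> (elliptic_proj \<Omega> Vh w) \<phi> = grad_inner \<Omega> w \<phi>"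
    "v \<in> Vh \<Longrightarrow> (\<And>\<phi>. \<phi> \<in> Vh \<Longrightarrow> grad_inner \<Omega> v \<phi> = grad_inner \<Omega> w \<phi>) \<Longrightarrow> elliptic_proj \<Omega> Vh w = v"
proof -
  have ex: "\<exists>!v. v \<in> Vh \<and> (\<forall>\<phi>\<in>Vh. grad_inner \<Omega> v \<phi> = grad_inner \<Omega> w \<phi>)"
  proof (rule FE_riesz[OF FE_grad_semi FE_grad_definite])
    fix v z c d assume v: "v \<in> Vh" and z: "z \<in> Vh"
    note h = FE_H1[OF v] FE_H1[OF z]
    show "grad_inner \<Omega> w (\<lambda>x. c * v x + d * z x) = c * grad_inner \<Omega> w v + d * grad_inner \<Omega> w z"
      unfolding G.sym[OF assms G.lin[OF h]] G.sym[OF assms h(1)] G.sym[OF assms h(2)] by (rule G.bil[OF h assms])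
  qed
  have P: "elliptic_proj \<Omega> Vh w \<in> Vh \<and> (\<forall>\<phi>\<in>Vh. grad_inner \<Omega> (elliptic_proj \<Omega> Vh w) \<phi> = grad_inner \<Omega> w \<phi>)"
    unfolding elliptic_proj_def by (rule theI'[OF ex])
  show "elliptic_proj \<Omega> Vh w \<in> Vh" by (rule conjunct1[OF P])
  show "\<phi> \<in> Vh \<Longrightarrow> grad_inner \<Omega> (elliptic_proj \<Omega> Vh w) \<phi> = grad_inner \<Omega> w \<phi>" by (rule bspec[OF conjunct2[OF P]])
  show "v \<in> Vh \<Longrightarrow> (\<And>\<phi>. \<phi> \<in> Vh \<Longrightarrow> grad_inner \<Omega> v \<phi> = grad_inner \<Omega> w \<phi>) \<Longrightarrow> elliptic_proj \<Omega> Vh w = v"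
    unfolding elliptic_proj_def by (intro the1_equality[OF ex] conjI ballI)
qed

lemma L2_proj:
  assumes "w \<in> L2_space \<Omega>"
  shows "L2_proj \<Omega> Vh w \<in> Vh" "\<phi> \<in> Vh \<Longrightarrow> L2_inner \<Omega> (L2_proj \<Omega> Vh w) \<phi> = L2_inner \<Omega> w \<phi>"
proof -
  have ex: "\<exists>!v. v \<in> Vh \<and> (\<forall>\<phi>\<in>Vh. L2_inner \<Omega> v \<phi> = L2_inner \<Omega> w \<phi>)"
  proof (rule FE_riesz[OF FE_L2_semi FE_L2_definite])
    fix v z c d assume v: "v \<in> Vh" and z: "z \<in> Vh"
    note h = FE_L2[OF v] FE_L2[OF z]
    show "L2_inner \<Omega> w (\<lambda>x. c * v x + d * z x) = c * L2_inner \<Omega> w v + d * L2_inner \<Omega> w z"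
      unfolding L.sym[OF assms L.lin[OF h]] L.sym[OF assms h(1)] L.sym[OF assms h(2)] by (rule L.bil[OF h assms])
  qed
  have P: "L2_proj \<Omega> Vh w \<in> Vh \<and> (\<forall>\<phi>\<in>Vh. L2_inner \<Omega> (L2_proj \<Omega> Vh w) \<phi> = L2_inner \<Omega> w \<phi>)"
    unfolding L2_proj_def by (rule theI'[OF ex])
  show "L2_proj \<Omega> Vh w \<in> Vh" by (rule conjunct1[OF P])
  show "\<phi> \<in> Vh \<Longrightarrow> L2_inner \<Omega> (L2_proj \<Omega> Vh w) \<phi> = L2_inner \<Omega> w \<phi>" by (rule bspec[OF conjunct2[OF P]])
qed

lemma discrete_laplace:
  assumes "w \<in> H_space \<Omega> 1"
  shows "discrete_laplace \<Omega> Vh w \<in> Vh" "\<phi> \<in> Vh \<Longrightarrow> L2_inner \<Omega> (discrete_laplace \<Omega> Vh w) \<phi> = grad_inner \<Omega> w \<phi>"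
proof -
  have ex: "\<exists>!v. v \<in> Vh \<and> (\<forall>\<phi>\<in>Vh. L2_inner \<Omega> v \<phi> = grad_inner \<Omega> w \<phi>)"
  proof (rule FE_riesz[OF FE_L2_semi FE_L2_definite])
    fix v z c d assume v: "v \<in> Vh" and z: "z \<in> Vh"
    note h = FE_H1[OF v] FE_H1[OF z]
    show "grad_inner \<Omega> w (\<lambda>x. c * v x + d * z x) = c * grad_inner \<Omega> w v + d * grad_inner \<Omega> w z"
      unfolding G.sym[OF assms G.lin[OF h]] G.sym[OF assms h(1)] G.sym[OF assms h(2)] by (rule G.bil[OF h assms])
  qed
  have P: "discrete_laplace \<Omega> Vh w \<in> Vh \<and> (\<forall>\<phi>\<in>Vh. L2_inner \<Omega> (discrete_laplace \<Omega> Vh w) \<phi> = grad_inner \<Omega> w \<phi>)"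
    unfolding discrete_laplace_def by (rule theI'[OF ex])
  show "discrete_laplace \<Omega> Vh w \<in> Vh" by (rule conjunct1[OF P])
  show "\<phi> \<in> Vh \<Longrightarrow> L2_inner \<Omega> (discrete_laplace \<Omega> Vh w) \<phi> = grad_inner \<Omega> w \<phi>" by (rule bspec[OF conjunct2[OF P]])
qed

lemma elliptic_proj_lin:
  assumes v: "v \<in> H_space \<Omega> 1" and w: "w \<in> H_space \<Omega> 1"
  shows "elliptic_proj \<Omega> Vh (\<lambda>x. c * v x + d * w x)
    = (\<lambda>x. c * elliptic_proj \<Omega> Vh v x + d * elliptic_proj \<Omega> Vh w x)"
proof (rule elliptic_proj(3)[OF G.lin[OF v w]])
  show "(\<lambda>x. c * elliptic_proj \<Omega> Vh v x + d * elliptic_proj \<Omega> Vh w x) \<in> Vh"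
    by (intro FE_lin elliptic_proj v w)
  fix \<phi> assume \<phi>: "\<phi> \<in> Vh"
  show "grad_inner \<Omega> (\<lambda>x. c * elliptic_proj \<Omega> Vh v x + d * elliptic_proj \<Omega> Vh w x) \<phi> = grad_inner \<Omega> (\<lambda>x. c * v x + d * w x) \<phi>"
    using FE_H1[OF \<phi>] FE_H1[OF elliptic_proj(1)[OF v]] FE_H1[OF elliptic_proj(1)[OF w]] v w elliptic_proj(2)[OF v \<phi>] elliptic_proj(2)[OF w \<phi>]
    by (simp add: G.bil)
qed

text \<open>The projection sees its argument only through weak derivatives, which depend on the class almost everywhere. This is
  how the initial values \<open>u\<^sub>0\<close> and \<open>u\<^sub>1\<close>, given up to null sets, are replaced by
  values of the solution.\<close>
lemma elliptic_proj_cong: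
  assumes "AE x in lebesgue_on \<Omega>. v x = w x" shows "elliptic_proj \<Omega> Vh v = elliptic_proj \<Omega> Vh w"
proof -
  have "grad_inner \<Omega> v \<phi> = grad_inner \<Omega> w \<phi>" for \<phi> by (rule grad_cong[OF open\<Omega> bdd assms]) simp
  then show ?thesis unfolding elliptic_proj_def by simp
qed

end

text \<open>The norm of the difference is bounded by the sum of two norms that tend to zero, and the limit point is nontrivial.\<close>
lemma has_time_deriv_unique:
  assumes g: "\<And>s. s \<in> S \<Longrightarrow> g s \<in> L2_space \<Omega>" and s: "s \<in> S" "at s within S \<noteq> bot"
    and a: "a \<in> L2_space \<Omega>" "has_time_deriv \<Omega> 0 S g s a" and b: "b \<in> L2_space \<Omega>" "has_time_deriv \<Omega> 0 S g s b"
  shows "AE x in lebesgue_on \<Omega>. a x = b x"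
proof -
  define q where "q s' x = (g s' x - g s x) / (s' - s)" for s' x
  have q: "q s' \<in> L2_space \<Omega>" if "s' \<in> S" for s'
    using L.scale[OF L.diff[OF g[OF that] g[OF s(1)]], of "1 / (s' - s)"] by (simp add: q_def[abs_def])
  have lim: "((\<lambda>s'. L2_norm \<Omega> (\<lambda>x. q s' x - c x)) \<longlongrightarrow> 0) (at s within S)"
    if "c \<in> L2_space \<Omega>" "has_time_deriv \<Omega> 0 S g s c" for c
  proof (rule Lim_transform_eventually)
    show "((\<lambda>s'. H_norm \<Omega> 0 (\<lambda>x. q s' x - c x)) \<longlongrightarrow> 0) (at s within S)"
      using that(2) by (simp add: has_time_deriv_def q_def)
    show "\<forall>\<^sub>F s' in at s within S. H_norm \<Omega> 0 (\<lambda>x. q s' x - c x) = L2_norm \<Omega> (\<lambda>x. q s' x - c x)"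
      unfolding eventually_at_filter
      by (rule always_eventually) (use H_norm_0[OF open\<Omega> bdd] L.diff q that(1) in blast)
  qed
  have "((\<lambda>s'. L2_norm \<Omega> (\<lambda>x. q s' x - a x) + L2_norm \<Omega> (\<lambda>x. q s' x - b x)) \<longlongrightarrow> 0 + 0) (at s within S)"
    by (intro tendsto_add lim a b)
  moreover have "\<forall>\<^sub>F s' in at s within S. L2_norm \<Omega> (\<lambda>x. a x - b x) \<le> L2_norm \<Omega> (\<lambda>x. q s' x - a x) + L2_norm \<Omega> (\<lambda>x. q s' x - b x)"
    unfolding eventually_at_filter
  proof (rule always_eventually, intro allI impI)
    fix s' assume "s' \<in> S"
    from L.nrm_diff[OF L.diff[OF q[OF this] b(1)] L.diff[OF q[OF this] a(1)]]
    show "L2_norm \<Omega> (\<lambda>x. a x - b x) \<le> L2_norm \<Omega> (\<lambda>x. q s' x - a x) + L2_norm \<Omega> (\<lambda>x. q s' x - b x)"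
      by (simp add: nrms)
  qed
  ultimately have "L2_norm \<Omega> (\<lambda>x. a x - b x) \<le> 0 + 0"
    by (rule tendsto_lowerbound[OF _ _ s(2)])
  then have "L2_inner \<Omega> (\<lambda>x. a x - b x) (\<lambda>x. a x - b x) = 0"
    using L.nonneg[OF L.diff[OF a(1) b(1)]] by (simp add: L2_norm_def)
  from L2_norm_zero_AE[OF open\<Omega> bdd L.diff[OF a(1) b(1)] this] show ?thesis by simp
qed

lemma time_deriv_eq:
  assumes "\<And>s. s \<in> S \<Longrightarrow> g s \<in> L2_space \<Omega>" "s \<in> S" "at s within S \<noteq> bot"
    and a: "a \<in> L2_space \<Omega>" "has_time_deriv \<Omega> 0 S g s a"
  shows "AE x in lebesgue_on \<Omega>. time_deriv \<Omega> S g s x = a x" "time_deriv \<Omega> S g s \<in> L2_space \<Omega>"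
proof -
  have *: "time_deriv \<Omega> S g s \<in> L2_space \<Omega> \<and> has_time_deriv \<Omega> 0 S g s (time_deriv \<Omega> S g s)"
    unfolding time_deriv_def by (rule someI[of _ a]) (use a in simp)
  then show "time_deriv \<Omega> S g s \<in> L2_space \<Omega>" by simp
  show "AE x in lebesgue_on \<Omega>. time_deriv \<Omega> S g s x = a x"
    by (rule has_time_deriv_unique[OF assms(1-3) _ _ a]) (use * in auto)
qed

lemma has_time_deriv_sum:
  assumes J: "finite J" and a: "\<And>j. j \<in> J \<Longrightarrow> a j \<in> L2_space \<Omega>"
    and g: "\<And>s. s \<in> S \<Longrightarrow> AE x in lebesgue_on \<Omega>. g s x = (\<Sum>j\<in>J. \<theta> j s * a j x)"
    and d: "\<And>j. j \<in> J \<Longrightarrow> (\<theta> j has_real_derivative \<theta>' j) (at s within S)" and s: "s \<in> S"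
  shows "has_time_deriv \<Omega> 0 S g s (\<lambda>x. \<Sum>j\<in>J. \<theta>' j * a j x)"
proof -
  define c where "c s' j = (\<theta> j s' - \<theta> j s) / (s' - s) - \<theta>' j" for s' j
  have "((\<lambda>s'. c s' j) \<longlongrightarrow> 0) (at s within S)" if "j \<in> J" for j
    using d[OF that] unfolding c_def has_field_derivative_iff by (rule LIM_zero)
  then have "((\<lambda>s'. \<Sum>j\<in>J. \<bar>c s' j\<bar> * L2_norm \<Omega> (a j)) \<longlongrightarrow> (\<Sum>j\<in>J. \<bar>0\<bar> * L2_norm \<Omega> (a j))) (at s within S)"
    by (intro tendsto_intros) auto
  then have lim: "((\<lambda>s'. \<Sum>j\<in>J. \<bar>c s' j\<bar> * L2_norm \<Omega> (a j)) \<longlongrightarrow> 0) (at s within S)" by simp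
  have bound: "0 \<le> H_norm \<Omega> 0 (\<lambda>x. (g s' x - g s x) / (s' - s) - (\<Sum>j\<in>J. \<theta>' j * a j x)) \<and>
      H_norm \<Omega> 0 (\<lambda>x. (g s' x - g s x) / (s' - s) - (\<Sum>j\<in>J. \<theta>' j * a j x)) \<le> (\<Sum>j\<in>J. \<bar>c s' j\<bar> * L2_norm \<Omega> (a j))"
    if s': "s' \<in> S" for s'
  proof -
    have "AE x in lebesgue_on \<Omega>. (g s' x - g s x) / (s' - s) - (\<Sum>j\<in>J. \<theta>' j * a j x) = (\<Sum>j\<in>J. c s' j * a j x)"
      using g[OF s'] g[OF s]
    proof eventually_elim
      case (elim x)
      show ?case unfolding elim c_def
        by (simp add: sum_subtractf[symmetric] sum_divide_distrib diff_divide_distrib algebra_simps)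
    qed
    then have "H_norm \<Omega> 0 (\<lambda>x. (g s' x - g s x) / (s' - s) - (\<Sum>j\<in>J. \<theta>' j * a j x)) = H_norm \<Omega> 0 (\<lambda>x. \<Sum>j\<in>J. c s' j * a j x)"
      by (rule H_norm_cong[OF open\<Omega> bdd])
    also have "\<dots> = L2_norm \<Omega> (\<lambda>x. \<Sum>j\<in>J. c s' j * a j x)"
      by (rule H_norm_0[OF open\<Omega> bdd]) (rule L.sum_closed[OF J a])
    finally show ?thesis
      using L.nrm_sum[OF J a, where c = "c s'"] L.nrm_nonneg[OF L.sum_closed[OF J a, where c = "c s'"]] by (simp add: nrms)
  qed
  show ?thesis unfolding has_time_deriv_def
    by (rule tendsto_sandwich[OF _ _ tendsto_const lim])
      (unfold eventually_at_filter, (rule always_eventually, use bound in blast)+)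
qed

end

section \<open>The exact solution as a function of time\<close>

text \<open>A derivative at a mesh point is assembled from the two one-sided derivatives; closedness excludes the intervals that
  do not contain the point.\<close>
lemma has_time_deriv_Union:
  assumes "finite \<S>" "\<And>S. S \<in> \<S> \<Longrightarrow> closed S"
    and "\<And>S. S \<in> \<S> \<Longrightarrow> s \<in> S \<Longrightarrow> has_time_deriv \<Omega> l S g s a"
  shows "has_time_deriv \<Omega> l (\<Union>\<S>) g s a"
  using assms
proof (induction \<S> rule: finite_induct)
  case empty
  then show ?case by (simp add: has_time_deriv_def)
next
  case (insert S \<S>)
  have "has_time_deriv \<Omega> l S g s a"
  proof (cases "s \<in> S")
    case False
    have "closure (S - {s}) = S" using False insert.prems(1)[of S] by simp
    then have "at s within S = bot" using False by (simp add: trivial_limit_within islimpt_in_closure)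
    then show ?thesis by (simp add: has_time_deriv_def)
  qed (use insert in simp)
  moreover have "has_time_deriv \<Omega> l (\<Union>\<S>) g s a" using insert by simp
  ultimately show ?case unfolding has_time_deriv_def by (simp add: at_within_union filterlim_sup)
qed

lemma at_within_Icc_nontrivial:
  fixes a b s :: real
  assumes "a < b" "s \<in> {a..b}" shows "at s within {a..b} \<noteq> bot"
  using assms by (simp add: trivial_limit_within islimpt_Icc)

context
  fixes \<Omega> :: "(real^'d::finite) set"
  assumes open\<Omega>: "open \<Omega>" and bdd: "bounded \<Omega>"
begin

interpretation L: semi_inner "L2_space \<Omega>" "L2_inner \<Omega>" by (rule L2_semi_inner[OF open\<Omega> bdd])
interpretation H: semi_inner "H_space \<Omega> m" "H_inner \<Omega> m" for m by (rule H_semi_inner[OF open\<Omega> bdd])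
interpretation G: semi_inner "H_space \<Omega> 1" "grad_inner \<Omega>" by (rule grad_semi_inner[OF open\<Omega> bdd])

context
  fixes u :: "real \<Rightarrow> 'd field" and T :: real and M :: nat
  assumes T: "0 < T" and u: "u \<in> C_H_space \<Omega> {0..T} M M" and M1: "1 \<le> M"
    and uH10_all: "\<forall>s\<in>{0<..T}. u s \<in> H10_space \<Omega>"
begin

lemmas uH10 = bspec[OF uH10_all]

private abbreviation (input) "D j \<equiv> (time_deriv \<Omega> {0..T} ^^ j) u"

lemma D_H: "j \<le> M \<Longrightarrow> s \<in> {0..T} \<Longrightarrow> D j s \<in> H_space \<Omega> M"
  using u by (simp add: C_H_space_def)

lemma D_continuous: "j \<le> M \<Longrightarrow> s \<in> {0..T} \<Longrightarrow> ((\<lambda>s'. H_norm \<Omega> M (\<lambda>x. D j s' x - D j s x)) \<longlongrightarrow> 0) (at s within {0..T})"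
  using u by (simp add: C_H_space_def time_continuous_def)

lemma D_deriv: "j < M \<Longrightarrow> s \<in> {0..T} \<Longrightarrow> has_time_deriv \<Omega> M {0..T} (D j) s (D (Suc j) s)"
  using u by (simp add: C_H_space_def)

text \<open>Membership in the closed subspace \<open>H\<^sub>0\<^sup>1\<close> passes from \<open>u\<close> to its difference
  quotients and their limits, and to \<open>s = 0\<close> by continuity.\<close>
lemma D_H10: "j \<le> M \<Longrightarrow> s \<in> {0..T} \<Longrightarrow> D j s \<in> H10_space \<Omega>"
proof (induction j arbitrary: s)
  case 0
  have nt: "at s within {0..T} \<noteq> bot" using at_within_Icc_nontrivial T 0 by blast
  show ?case
  proof (cases "s = 0")
    case False
    then show ?thesis using uH10[of s] 0 by simp
  next
    case True
    have uH: "u s' \<in> H_space \<Omega> M" if "s' \<in> {0..T}" for s' using D_H[of 0 s'] that by simp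
    have "u s \<in> H10_space \<Omega>"
    proof (rule H10_closed[OF open\<Omega> bdd])
      show "u s \<in> H_space \<Omega> 1" using uH[OF 0(2)] H_space_mono[OF M1] by blast
      fix e :: real assume "e > 0"
      have "\<forall>\<^sub>F s' in at s within {0..T}. H_norm \<Omega> M (\<lambda>x. u s' x - u s x) < e"
        using order_tendstoD(2)[OF D_continuous[OF 0] \<open>e > 0\<close>] by simp
      moreover have "\<forall>\<^sub>F s' in at s within {0..T}. s' \<in> {0..T} \<and> s' \<noteq> s" unfolding eventually_at_filter by simp
      ultimately have "\<forall>\<^sub>F s' in at s within {0..T}. H_norm \<Omega> M (\<lambda>x. u s' x - u s x) < e \<and> s' \<in> {0..T} \<and> s' \<noteq> s"
        by (rule eventually_conj)
      then obtain s' where s': "H_norm \<Omega> M (\<lambda>x. u s' x - u s x) < e" "s' \<in> {0..T}" "s' \<noteq> s"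
        using eventually_happens'[OF nt] by blast
      have "(\<lambda>x. u s' x - u s x) \<in> H_space \<Omega> M" by (rule H.diff[OF uH[OF s'(2)] uH[OF 0(2)]])
      from H_norm_mono[OF open\<Omega> bdd this M1] s'(1) have *: "H_norm \<Omega> 1 (\<lambda>x. u s' x - u s x) < e" by simp
      have "(\<lambda>x. u s' x - u s x) \<in> H_space \<Omega> 1" using H_space_mono[OF M1] \<open>(\<lambda>x. u s' x - u s x) \<in> H_space \<Omega> M\<close> by blast
      from H.nrm_scale[OF this, of "-1"] * have "H_norm \<Omega> 1 (\<lambda>x. u s x - u s' x) < e"
        by (simp add: H_nrm[OF open\<Omega> bdd])
      moreover have "u s' \<in> H10_space \<Omega>" by (rule uH10) (use s' True in auto)
      ultimately show "\<exists>w\<in>H10_space \<Omega>. H_norm \<Omega> 1 (\<lambda>x. u s x - w x) < e" by (intro bexI[of _ "u s'"])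
    qed
    then show ?thesis by simp
  qed
next
  case (Suc j)
  have nt: "at s within {0..T} \<noteq> bot" using at_within_Icc_nontrivial T Suc.prems by blast
  have H: "D (Suc j) s \<in> H_space \<Omega> M" by (rule D_H[OF Suc.prems])
  have Hj: "D j s' \<in> H_space \<Omega> M" if "s' \<in> {0..T}" for s' by (rule D_H) (use Suc.prems that in auto)
  show ?case
  proof (rule H10_closed[OF open\<Omega> bdd])
    show "D (Suc j) s \<in> H_space \<Omega> 1" using D_H[OF Suc.prems] H_space_mono[OF M1] by blast
    fix e :: real assume "e > 0"
    define q where "q s' = (\<lambda>x. (1 / (s' - s)) * D j s' x + (- 1 / (s' - s)) * D j s x)" for s'
    have qH10: "q s' \<in> H10_space \<Omega>" if "s' \<in> {0..T}" for s'
      unfolding q_def by (rule H10_lin[OF open\<Omega> bdd]) (use Suc that in auto)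
    have q: "(\<lambda>x. (D j s' x - D j s x) / (s' - s) - D (Suc j) s x) = (\<lambda>x. q s' x - D (Suc j) s x)" for s'
      by (auto simp: q_def diff_divide_distrib)
    have "\<forall>\<^sub>F s' in at s within {0..T}. H_norm \<Omega> M (\<lambda>x. q s' x - D (Suc j) s x) < e"
      using order_tendstoD(2)[OF D_deriv[of j s, unfolded has_time_deriv_def q] \<open>e > 0\<close>] Suc.prems by simp
    moreover have "\<forall>\<^sub>F s' in at s within {0..T}. s' \<in> {0..T}" unfolding eventually_at_filter by simp
    ultimately have "\<forall>\<^sub>F s' in at s within {0..T}. H_norm \<Omega> M (\<lambda>x. q s' x - D (Suc j) s x) < e \<and> s' \<in> {0..T}"
      by (rule eventually_conj)
    then obtain s' where s': "H_norm \<Omega> M (\<lambda>x. q s' x - D (Suc j) s x) < e" "s' \<in> {0..T}"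
      using eventually_happens'[OF nt] by blast
    have "q s' \<in> H_space \<Omega> M" unfolding q_def by (rule H.lin[OF Hj[OF s'(2)] Hj[OF Suc.prems(2)]])
    then have z: "(\<lambda>x. q s' x - D (Suc j) s x) \<in> H_space \<Omega> M" using H by (rule H.diff)
    from H_norm_mono[OF open\<Omega> bdd this M1] s'(1) have *: "H_norm \<Omega> 1 (\<lambda>x. q s' x - D (Suc j) s x) < e" by simp
    have "(\<lambda>x. q s' x - D (Suc j) s x) \<in> H_space \<Omega> 1" using H_space_mono[OF M1] z by blast
    from H.nrm_scale[OF this, of "-1"] * have "H_norm \<Omega> 1 (\<lambda>x. D (Suc j) s x - q s' x) < e"
      by (simp add: H_nrm[OF open\<Omega> bdd])
    then show "\<exists>w\<in>H10_space \<Omega>. H_norm \<Omega> 1 (\<lambda>x. D (Suc j) s x - w x) < e"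
      using qH10[OF s'(2)] by (intro bexI[of _ "q s'"])
  qed
qed

text \<open>A bounded linear functional commutes with the derivative of a curve in \<open>H\<^sup>M\<close>. It is stated for
  functionals on \<open>H\<^sub>0\<^sup>1 \<inter> H\<^sup>M\<close> because the error of the elliptic projection is
  known to be bounded only there.\<close>
lemma functional_deriv:
  assumes lin: "\<And>v w c d. v \<in> H10_space \<Omega> \<inter> H_space \<Omega> M \<Longrightarrow> w \<in> H10_space \<Omega> \<inter> H_space \<Omega> M \<Longrightarrow>
      \<Lambda> (\<lambda>x. c * v x + d * w x) = c * \<Lambda> v + d * \<Lambda> w"
    and bound: "\<And>v. v \<in> H10_space \<Omega> \<inter> H_space \<Omega> M \<Longrightarrow> \<bar>\<Lambda> v\<bar> \<le> K * H_norm \<Omega> M v"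
    and j: "j < M" and s: "s \<in> {0..T}"
  shows "((\<lambda>s. \<Lambda> (D j s)) has_real_derivative \<Lambda> (D (Suc j) s)) (at s within {0..T})"
proof -
  let ?X = "H10_space \<Omega> \<inter> H_space \<Omega> M"
  have X: "D i s' \<in> ?X" if "i \<le> M" "s' \<in> {0..T}" for i s' using D_H10 D_H that by blast
  have lX: "(\<lambda>x. c * v x + d * w x) \<in> ?X" if "v \<in> ?X" "w \<in> ?X" for c d v w
    using H10_lin[OF open\<Omega> bdd] H.lin that by blast
  define q where "q s' = (\<lambda>x. (1 / (s' - s)) * D j s' x + (- 1 / (s' - s)) * D j s x)" for s'
  have q: "(\<lambda>x. (D j s' x - D j s x) / (s' - s) - D (Suc j) s x) = (\<lambda>x. 1 * q s' x + (-1) * D (Suc j) s x)" for s'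
    by (auto simp: q_def diff_divide_distrib)
  have *: "\<bar>(\<Lambda> (D j s') - \<Lambda> (D j s)) / (s' - s) - \<Lambda> (D (Suc j) s)\<bar>
      \<le> K * H_norm \<Omega> M (\<lambda>x. (D j s' x - D j s x) / (s' - s) - D (Suc j) s x)" if "s' \<in> {0..T}" for s'
  proof -
    have 1: "D j s' \<in> ?X" "D j s \<in> ?X" "D (Suc j) s \<in> ?X"
      using X[of j s'] X[of j s] X[of "Suc j" s] j s that by linarith+
    have qX: "q s' \<in> ?X" unfolding q_def by (rule lX[OF 1(1,2)])
    have "\<Lambda> (\<lambda>x. 1 * q s' x + (-1) * D (Suc j) s x) = 1 * \<Lambda> (q s') + (-1) * \<Lambda> (D (Suc j) s)" by (rule lin[OF qX 1(3)])
    also have "\<Lambda> (q s') = (1 / (s' - s)) * \<Lambda> (D j s') + (- 1 / (s' - s)) * \<Lambda> (D j s)" unfolding q_def by (rule lin[OF 1(1,2)])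
    finally have "(\<Lambda> (D j s') - \<Lambda> (D j s)) / (s' - s) - \<Lambda> (D (Suc j) s) = \<Lambda> (\<lambda>x. 1 * q s' x + (-1) * D (Suc j) s x)"
      by (simp add: diff_divide_distrib)
    then show ?thesis unfolding q using bound[OF lX[OF qX 1(3)], of 1 "-1"] by simp
  qed
  have "((\<lambda>s'. K * H_norm \<Omega> M (\<lambda>x. (D j s' x - D j s x) / (s' - s) - D (Suc j) s x)) \<longlongrightarrow> K * 0) (at s within {0..T})"
    by (intro tendsto_intros D_deriv[OF j s, unfolded has_time_deriv_def])
  then have "((\<lambda>s'. K * H_norm \<Omega> M (\<lambda>x. (D j s' x - D j s x) / (s' - s) - D (Suc j) s x)) \<longlongrightarrow> 0) (at s within {0..T})" by simp
  then have "((\<lambda>s'. (\<Lambda> (D j s') - \<Lambda> (D j s)) / (s' - s) - \<Lambda> (D (Suc j) s)) \<longlongrightarrow> 0) (at s within {0..T})"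
    by (rule Lim_null_comparison[rotated]) (unfold eventually_at_filter, rule always_eventually, use * in auto)
  then show ?thesis unfolding has_field_derivative_iff by (rule LIM_zero_cancel)
qed

text \<open>Continuity on a compact interval; without it the suprema in \<open>deriv_quantity\<close> would be meaningless values.\<close>
lemma H_norm_bdd:
  assumes j: "j \<le> M" and m: "m \<le> M"
  shows "bdd_above ((\<lambda>s. H_norm \<Omega> m (D j s)) ` {0..T})"
proof -
  have Hm: "D j s \<in> H_space \<Omega> m" if "s \<in> {0..T}" for s using D_H[OF j that] H_space_mono[OF m] by blast
  have "continuous_on {0..T} (\<lambda>s. H_norm \<Omega> m (D j s))"
    unfolding continuous_on_def
  proof
    fix s assume s: "s \<in> {0..T}"
    have "((\<lambda>s'. H_norm \<Omega> m (D j s') - H_norm \<Omega> m (D j s)) \<longlongrightarrow> 0) (at s within {0..T})"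
    proof (rule Lim_null_comparison[OF _ D_continuous[OF j s]])
      show "\<forall>\<^sub>F s' in at s within {0..T}. norm (H_norm \<Omega> m (D j s') - H_norm \<Omega> m (D j s)) \<le> H_norm \<Omega> M (\<lambda>x. D j s' x - D j s x)"
        unfolding eventually_at_filter
      proof (rule always_eventually, intro allI impI)
        fix s' assume s': "s' \<in> {0..T}"
        have d: "(\<lambda>x. D j s' x - D j s x) \<in> H_space \<Omega> m" by (rule H.diff[OF Hm[OF s'] Hm[OF s]])
        have "H_norm \<Omega> m (D j s') \<le> H_norm \<Omega> m (D j s) + H_norm \<Omega> m (\<lambda>x. D j s' x - D j s x)"
          using H.nrm_add[OF Hm[OF s] d] by (simp add: H_nrm[OF open\<Omega> bdd])
        moreover have "H_norm \<Omega> m (D j s) \<le> H_norm \<Omega> m (D j s') + H_norm \<Omega> m (\<lambda>x. D j s' x - D j s x)"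
          using H.nrm_diff[OF Hm[OF s'] d] by (simp add: H_nrm[OF open\<Omega> bdd])
        moreover have "H_norm \<Omega> m (\<lambda>x. D j s' x - D j s x) \<le> H_norm \<Omega> M (\<lambda>x. D j s' x - D j s x)"
          by (rule H_norm_mono[OF open\<Omega> bdd H.diff[OF D_H[OF j s'] D_H[OF j s]] m])
        ultimately show "norm (H_norm \<Omega> m (D j s') - H_norm \<Omega> m (D j s)) \<le> H_norm \<Omega> M (\<lambda>x. D j s' x - D j s x)"
          by simp
      qed
    qed
    then show "((\<lambda>s. H_norm \<Omega> m (D j s)) \<longlongrightarrow> H_norm \<Omega> m (D j s)) (at s within {0..T})" by (rule LIM_zero_cancel)
  qed
  then have "compact ((\<lambda>s. H_norm \<Omega> m (D j s)) ` {0..T})" by (rule compact_continuous_image) simp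
  then show ?thesis by (rule bounded_imp_bdd_above[OF compact_imp_bounded])
qed

lemma deriv_quantity_bound:
  assumes J: "finite J" "\<And>j m. (j, m) \<in> J \<Longrightarrow> j + 1 \<le> M \<and> m \<le> M"
  shows "0 \<le> deriv_quantity \<Omega> T J (time_deriv \<Omega> {0..T} u)"
    "(j, m) \<in> J \<Longrightarrow> s \<in> {0..T} \<Longrightarrow> H_norm \<Omega> m (D (Suc j) s) \<le> deriv_quantity \<Omega> T J (time_deriv \<Omega> {0..T} u)"
proof -
  have e: "(time_deriv \<Omega> {0..T} ^^ j) (time_deriv \<Omega> {0..T} u) = D (Suc j)" for j by (simp add: funpow_swap1)
  define S where "S p = (SUP s\<in>{0..T}. H_norm \<Omega> (snd p) (D (Suc (fst p)) s))" for p :: "nat \<times> nat"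
  have dq: "deriv_quantity \<Omega> T J (time_deriv \<Omega> {0..T} u) = (\<Sum>p\<in>J. S p)"
    unfolding deriv_quantity_def e S_def by (simp add: split_def)
  have le: "H_norm \<Omega> (snd p) (D (Suc (fst p)) s) \<le> S p" if "p \<in> J" "s \<in> {0..T}" for p s
    unfolding S_def by (rule cSUP_upper[OF that(2) H_norm_bdd]) (use J(2)[of "fst p" "snd p"] that(1) in auto)
  have S0: "0 \<le> S p" if "p \<in> J" for p
  proof -
    have "D (Suc (fst p)) 0 \<in> H_space \<Omega> (snd p)"
      using D_H[of "Suc (fst p)" 0] H_space_mono[of "snd p" M] J(2)[of "fst p" "snd p"] that T by auto
    then have "0 \<le> H_norm \<Omega> (snd p) (D (Suc (fst p)) 0)" using H.nrm_nonneg by (simp add: H_nrm[OF open\<Omega> bdd])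
    also have "\<dots> \<le> S p" by (rule le[OF that]) (use T in simp)
    finally show ?thesis .
  qed
  show "0 \<le> deriv_quantity \<Omega> T J (time_deriv \<Omega> {0..T} u)" unfolding dq by (rule sum_nonneg[OF S0])
  assume jm: "(j, m) \<in> J" and s: "s \<in> {0..T}"
  have "H_norm \<Omega> m (D (Suc j) s) \<le> S (j, m)" using le[OF jm s] by simp
  also have "\<dots> \<le> (\<Sum>p\<in>J. S p)" by (rule member_le_sum[OF jm _ J(1)]) (use S0 in auto)
  finally show "H_norm \<Omega> m (D (Suc j) s) \<le> deriv_quantity \<Omega> T J (time_deriv \<Omega> {0..T} u)" unfolding dq .
qed

lemma L2_functional:
  assumes \<phi>: "\<phi> \<in> L2_space \<Omega>" and "j < M" "s \<in> {0..T}"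
  shows "((\<lambda>s. L2_inner \<Omega> (D j s) \<phi>) has_real_derivative L2_inner \<Omega> (D (Suc j) s) \<phi>) (at s within {0..T})"
proof (rule functional_deriv[OF _ _ assms(2,3), where K = "L2_norm \<Omega> \<phi>"])
  fix v w c d assume "v \<in> H10_space \<Omega> \<inter> H_space \<Omega> M" "w \<in> H10_space \<Omega> \<inter> H_space \<Omega> M"
  then have "v \<in> L2_space \<Omega>" "w \<in> L2_space \<Omega>" by (auto intro: H_space_L2)
  then show "L2_inner \<Omega> (\<lambda>x. c * v x + d * w x) \<phi> = c * L2_inner \<Omega> v \<phi> + d * L2_inner \<Omega> w \<phi>"
    using \<phi> by (rule L.bil)
next
  fix v assume v: "v \<in> H10_space \<Omega> \<inter> H_space \<Omega> M"
  then have v2: "v \<in> L2_space \<Omega>" by (auto intro: H_space_L2)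
  have "\<bar>L2_inner \<Omega> v \<phi>\<bar> \<le> L2_norm \<Omega> v * L2_norm \<Omega> \<phi>"
    using L.cauchy_schwarz[OF v2 \<phi>] by (simp add: L_nrm[OF open\<Omega> bdd])
  also have "\<dots> \<le> H_norm \<Omega> M v * L2_norm \<Omega> \<phi>"
    using v L2_le_H_norm[OF open\<Omega> bdd, of v M] L.nrm_nonneg[OF \<phi>] by (intro mult_right_mono) (auto simp: L_nrm[OF open\<Omega> bdd])
  finally show "\<bar>L2_inner \<Omega> v \<phi>\<bar> \<le> L2_norm \<Omega> \<phi> * H_norm \<Omega> M v" by (simp add: mult.commute)
qed

lemma grad_functional:
  assumes \<phi>: "\<phi> \<in> H_space \<Omega> 1" and "j < M" "s \<in> {0..T}"
  shows "((\<lambda>s. grad_inner \<Omega> (D j s) \<phi>) has_real_derivative grad_inner \<Omega> (D (Suc j) s) \<phi>) (at s within {0..T})"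
proof (rule functional_deriv[OF _ _ assms(2,3), where K = "grad_norm \<Omega> \<phi>"])
  fix v w c d assume "v \<in> H10_space \<Omega> \<inter> H_space \<Omega> M" "w \<in> H10_space \<Omega> \<inter> H_space \<Omega> M"
  then have "v \<in> H_space \<Omega> 1" "w \<in> H_space \<Omega> 1" using H10_H1[OF open\<Omega> bdd] by blast+
  then show "grad_inner \<Omega> (\<lambda>x. c * v x + d * w x) \<phi> = c * grad_inner \<Omega> v \<phi> + d * grad_inner \<Omega> w \<phi>"
    using \<phi> by (rule G.bil)
next
  fix v assume v: "v \<in> H10_space \<Omega> \<inter> H_space \<Omega> M"
  then have v1: "v \<in> H_space \<Omega> 1" using H10_H1[OF open\<Omega> bdd] by blast
  have "\<bar>grad_inner \<Omega> v \<phi>\<bar> \<le> grad_norm \<Omega> v * grad_norm \<Omega> \<phi>"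
    using G.cauchy_schwarz[OF v1 \<phi>] by (simp add: G_nrm[OF open\<Omega> bdd])
  also have "\<dots> \<le> H_norm \<Omega> M v * grad_norm \<Omega> \<phi>"
    using v grad_norm_le_H_norm[OF open\<Omega> bdd, of v M] G.nrm_nonneg[OF \<phi>] M1
    by (intro mult_right_mono) (auto simp: G_nrm[OF open\<Omega> bdd])
  finally show "\<bar>grad_inner \<Omega> v \<phi>\<bar> \<le> grad_norm \<Omega> \<phi> * H_norm \<Omega> M v" by (simp add: mult.commute)
qed

text \<open>For positive times this is Green's formula. The equation is not assumed at \<open>s = 0\<close>, where both sides are
  limits of their values at positive times.\<close>
lemma wave_weak_form:
  assumes M2: "3 \<le> M" and f: "f \<in> C_H_space \<Omega> {0..T} 1 0"
    and pde_all: "\<forall>s\<in>{0<..T}. AE x in lebesgue_on \<Omega>. D 2 s x - weak_laplace \<Omega> (u s) x = f s x"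
    and s: "s \<in> {0..T}" and \<phi>: "\<phi> \<in> H10_space \<Omega>"
  shows "L2_inner \<Omega> (f s) \<phi> = L2_inner \<Omega> (D 2 s) \<phi> + grad_inner \<Omega> (u s) \<phi>" "f s \<in> L2_space \<Omega>"
proof -
  note pde = bspec[OF pde_all]
  have \<phi>1: "\<phi> \<in> H_space \<Omega> 1" by (rule H10_H1[OF open\<Omega> bdd \<phi>])
  have \<phi>2: "\<phi> \<in> L2_space \<Omega>" by (rule H_space_L2[OF \<phi>1])
  have "\<forall>j\<le>1. (\<forall>s\<in>{0..T}. (time_deriv \<Omega> {0..T} ^^ j) f s \<in> H_space \<Omega> 0) \<and>
      time_continuous \<Omega> 0 {0..T} ((time_deriv \<Omega> {0..T} ^^ j) f)"
    using f unfolding C_H_space_def by simp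
  from this[rule_format, of 0] have fC: "\<forall>s\<in>{0..T}. f s \<in> H_space \<Omega> 0" "time_continuous \<Omega> 0 {0..T} f" by simp_all
  have fL: "f s \<in> L2_space \<Omega>" if "s \<in> {0..T}" for s
    using fC that by (auto intro: H_space_L2)
  then show "f s \<in> L2_space \<Omega>" using s by blast
  have main: "L2_inner \<Omega> (f s) \<phi> = L2_inner \<Omega> (D 2 s) \<phi> + grad_inner \<Omega> (u s) \<phi>" if s: "s \<in> {0<..T}" for s
  proof -
    have s': "s \<in> {0..T}" using s by auto
    have u2: "u s \<in> H_space \<Omega> 2" using D_H[of 0 s] s' H_space_mono[of 2 M] M2 by auto
    have q: "D 2 s \<in> L2_space \<Omega>" by (rule H_space_L2[OF D_H]) (use M2 s' in auto)
    have l: "weak_laplace \<Omega> (u s) \<in> L2_space \<Omega>" by (rule weak_laplace(1)[OF open\<Omega> bdd u2])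
    have "L2_inner \<Omega> (\<lambda>x. D 2 s x - weak_laplace \<Omega> (u s) x) \<phi> = L2_inner \<Omega> (f s) \<phi>"
      by (rule L2_inner_cong[OF open\<Omega> bdd L.diff[OF q l] \<phi>2 pde[OF s]]) simp
    then show ?thesis using L.B_diff[OF q l \<phi>2] green[OF open\<Omega> bdd u2 \<phi>] by simp
  qed
  show "L2_inner \<Omega> (f s) \<phi> = L2_inner \<Omega> (D 2 s) \<phi> + grad_inner \<Omega> (u s) \<phi>"
  proof (cases "s = 0")
    case False then show ?thesis using main[of s] s by simp
  next
    case True
    have nt: "at s within {0..T} \<noteq> bot" using at_within_Icc_nontrivial T s by blast
    have lf: "((\<lambda>s'. L2_inner \<Omega> (f s') \<phi>) \<longlongrightarrow> L2_inner \<Omega> (f s) \<phi>) (at s within {0..T})"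
    proof (rule LIM_zero_cancel, rule Lim_null_comparison)
      have "((\<lambda>s'. H_norm \<Omega> 0 (\<lambda>x. f s' x - f s x)) \<longlongrightarrow> 0) (at s within {0..T})"
        using s fC(2) by (simp add: time_continuous_def)
      from tendsto_mult_right[OF this, of "L2_norm \<Omega> \<phi>"]
      show "((\<lambda>s'. H_norm \<Omega> 0 (\<lambda>x. f s' x - f s x) * L2_norm \<Omega> \<phi>) \<longlongrightarrow> 0) (at s within {0..T})" by simp
      show "\<forall>\<^sub>F s' in at s within {0..T}. norm (L2_inner \<Omega> (f s') \<phi> - L2_inner \<Omega> (f s) \<phi>) \<le> H_norm \<Omega> 0 (\<lambda>x. f s' x - f s x) * L2_norm \<Omega> \<phi>"
        unfolding eventually_at_filter
      proof (rule always_eventually, intro allI impI)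
        fix s' assume s': "s' \<in> {0..T}"
        have d: "(\<lambda>x. f s' x - f s x) \<in> L2_space \<Omega>" by (rule L.diff[OF fL[OF s'] fL[OF s]])
        have "\<bar>L2_inner \<Omega> (\<lambda>x. f s' x - f s x) \<phi>\<bar> \<le> L2_norm \<Omega> (\<lambda>x. f s' x - f s x) * L2_norm \<Omega> \<phi>"
          using L.cauchy_schwarz[OF d \<phi>2] by (simp add: L_nrm[OF open\<Omega> bdd])
        then show "norm (L2_inner \<Omega> (f s') \<phi> - L2_inner \<Omega> (f s) \<phi>) \<le> H_norm \<Omega> 0 (\<lambda>x. f s' x - f s x) * L2_norm \<Omega> \<phi>"
          using L.B_diff[OF fL[OF s'] fL[OF s] \<phi>2] H_norm_0[OF open\<Omega> bdd d] by simp
      qed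
    qed
    have "((\<lambda>s. L2_inner \<Omega> (D 2 s) \<phi>) has_real_derivative L2_inner \<Omega> (D (Suc 2) s) \<phi>) (at s within {0..T})"
      by (rule L2_functional[OF \<phi>2 _ s]) (use M2 in simp)
    then have l2: "((\<lambda>s'. L2_inner \<Omega> (D 2 s') \<phi>) \<longlongrightarrow> L2_inner \<Omega> (D 2 s) \<phi>) (at s within {0..T})"
      using DERIV_continuous continuous_within by blast
    have "((\<lambda>s. grad_inner \<Omega> (D 0 s) \<phi>) has_real_derivative grad_inner \<Omega> (D (Suc 0) s) \<phi>) (at s within {0..T})"
      by (rule grad_functional[OF \<phi>1 _ s]) (use M2 in simp)
    then have l3: "((\<lambda>s'. grad_inner \<Omega> (D 0 s') \<phi>) \<longlongrightarrow> grad_inner \<Omega> (D 0 s) \<phi>) (at s within {0..T})"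
      using DERIV_continuous continuous_within by blast
    have "((\<lambda>s'. L2_inner \<Omega> (f s') \<phi>) \<longlongrightarrow> L2_inner \<Omega> (D 2 s) \<phi> + grad_inner \<Omega> (D 0 s) \<phi>) (at s within {0..T})"
    proof (rule Lim_transform_eventually[OF tendsto_add[OF l2 l3]])
      show "\<forall>\<^sub>F s' in at s within {0..T}. L2_inner \<Omega> (D 2 s') \<phi> + grad_inner \<Omega> (D 0 s') \<phi> = L2_inner \<Omega> (f s') \<phi>"
        unfolding eventually_at_filter using main True by (intro always_eventually) auto
    qed
    from tendsto_unique[OF nt lf this] show ?thesis by simp
  qed
qed

end

end

section \<open>The lifting on one time interval\<close>

text \<open>On closed intervals, with one-sided values: by continuity the representation on \<open>{t (n - 1)<..t n}\<close>
  extends to the left end point.\<close>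
definition piecewise_poly :: "'d::finite field set \<Rightarrow> nat \<Rightarrow> nat \<Rightarrow> (nat \<Rightarrow> real) \<Rightarrow> (real \<Rightarrow> 'd field) \<Rightarrow> (nat \<Rightarrow> nat \<Rightarrow> 'd field) \<Rightarrow> bool" where
  "piecewise_poly B k N t w a \<longleftrightarrow> (\<forall>n\<in>{1..N}. (\<forall>j\<le>k. a n j \<in> B) \<and>
     (\<forall>s\<in>{t (n - 1)..t n}. w s = (\<lambda>x. \<Sum>j\<le>k. s ^ j * a n j x)))"

lemma time_mesh_less:
  assumes "time_mesh T N t" "i < j" "j \<le> N" shows "t i < t j"
  using assms(2,3)
proof (induction j)
  case (Suc j)
  have "t j < t (Suc j)" using assms(1) Suc.prems by (simp add: time_mesh_def)
  then show ?case using Suc by (cases "i = j") (auto simp: less_Suc_eq)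
qed simp

lemma time_mesh_le: "time_mesh T N t \<Longrightarrow> i \<le> j \<Longrightarrow> j \<le> N \<Longrightarrow> t i \<le> t j"
  using time_mesh_less[of T N t i j] by (cases "i = j") auto

lemma time_mesh_step: "time_mesh T N t \<Longrightarrow> n \<in> {1..N} \<Longrightarrow> t (n - 1) < t n"
  by (rule time_mesh_less) auto

lemma time_mesh_sub:
  assumes "time_mesh T N t" "n \<in> {1..N}" shows "{t (n - 1)..t n} \<subseteq> {0..T}"
  using time_mesh_le[OF assms(1), of 0 "n - 1"] time_mesh_le[OF assms(1), of n N] assms
  by (auto simp: time_mesh_def)

lemma time_mesh_cover:
  assumes mesh: "time_mesh T N t" shows "(\<Union>n\<in>{1..N}. {t (n - 1)..t n}) = {0..T}"
proof
  show "(\<Union>n\<in>{1..N}. {t (n - 1)..t n}) \<subseteq> {0..T}" using time_mesh_sub[OF mesh] by blast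
  show "{0..T} \<subseteq> (\<Union>n\<in>{1..N}. {t (n - 1)..t n})"
  proof
    fix s assume s: "s \<in> {0..T}"
    have N: "1 \<le> N" "t 0 = 0" "t N = T" using mesh by (auto simp: time_mesh_def)
    show "s \<in> (\<Union>n\<in>{1..N}. {t (n - 1)..t n})"
    proof (cases "s = 0")
      case True
      have "s \<in> {t (1 - 1)..t 1}" using True N time_mesh_step[OF mesh, of 1] by auto
      then show ?thesis using N by (intro UN_I[of 1]) auto
    next
      case False
      define n where "n = (LEAST n. s \<le> t n)"
      have ex: "s \<le> t N" using s N by simp
      have n: "s \<le> t n" "n \<le> N" unfolding n_def by (rule LeastI[of "\<lambda>n. s \<le> t n" N, OF ex]) (rule Least_le[of "\<lambda>n. s \<le> t n" N, OF ex])
      have "n \<noteq> 0" using n(1) N False s by (intro notI) auto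
      then have "\<not> s \<le> t (n - 1)" unfolding n_def by (intro not_less_Least) simp
      then show ?thesis using n \<open>n \<noteq> 0\<close> by (intro UN_I[of n]) auto
    qed
  qed
qed

lemma time_mesh_Least:
  assumes mesh: "time_mesh T N t" and n: "n \<in> {1..N}" and s: "t (n - 1) < s" "s \<le> t n"
  shows "(LEAST n. s \<le> t n) = n"
proof (rule Least_equality)
  fix m assume m: "s \<le> t m"
  show "n \<le> m"
  proof (rule ccontr)
    assume "\<not> n \<le> m"
    then have "t m \<le> t (n - 1)" using n by (intro time_mesh_le[OF mesh]) auto
    then show False using m s by simp
  qed
qed (rule s(2))

context
  fixes \<Omega> :: "(real^'d::finite) set" and \<T> :: "'d mesh" and r :: nat
  assumes open\<Omega>: "open \<Omega>" and bdd: "bounded \<Omega>"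
    and fin: "finite \<T>" and cover: "(\<Union>F\<in>\<T>. F ` cbox 0 1) = closure \<Omega>"
begin

private abbreviation (input) "\<V> \<equiv> FE_space \<Omega> r \<T>"

lemmas FE_facts = FE_L2[OF open\<Omega> bdd fin cover, of _ r] FE_H1[OF open\<Omega> bdd fin cover, of _ r]

interpretation L: semi_inner "L2_space \<Omega>" "L2_inner \<Omega>" by (rule L2_semi_inner[OF open\<Omega> bdd])
interpretation G: semi_inner "H_space \<Omega> 1" "grad_inner \<Omega>" by (rule grad_semi_inner[OF open\<Omega> bdd])
interpretation V: semi_inner \<V> "L2_inner \<Omega>" by (rule FE_L2_semi[OF open\<Omega> bdd fin cover])
interpretation VG: semi_inner \<V> "grad_inner \<Omega>" by (rule FE_grad_semi[OF open\<Omega> bdd fin cover])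

lemma FE_eqI:
  assumes v: "v \<in> \<V>" and w: "w \<in> \<V>" and eq: "\<And>\<phi>. \<phi> \<in> \<V> \<Longrightarrow> L2_inner \<Omega> v \<phi> = L2_inner \<Omega> w \<phi>"
  shows "v = w"
proof -
  have z: "(\<lambda>x. v x - w x) \<in> \<V>" by (rule V.diff[OF v w])
  have "L2_inner \<Omega> (\<lambda>x. v x - w x) (\<lambda>x. v x - w x) = 0"
    using V.B_diff[OF v w z] eq[OF z] by simp
  then have "(\<lambda>x. v x - w x) = (\<lambda>_. 0)" by (rule FE_L2_definite[OF open\<Omega> bdd fin cover z])
  then show ?thesis by (auto simp: fun_eq_iff dest: spec)
qed

text \<open>The left end point of an interval is reached by continuity in \<open>L\<^sup>2\<close>, and finite element functions
  that agree almost everywhere are equal.\<close>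
lemma cont_time_poly_pieces:
  assumes mesh: "time_mesh T N t" and w: "w \<in> cont_time_poly \<Omega> k N t \<V>"
  shows "\<exists>a. piecewise_poly \<V> k N t w a"
proof -
  have t0N: "t 0 = 0" "t N = T" using mesh by (auto simp: time_mesh_def)
  have wV: "w s \<in> \<V>" if "s \<in> {0..T}" for s using w that t0N by (simp add: cont_time_poly_def)
  have "\<exists>b. (\<forall>j\<le>k. b j \<in> \<V>) \<and> (\<forall>s\<in>{t (n - 1)..t n}. w s = (\<lambda>x. \<Sum>j\<le>k. s ^ j * b j x))" if n: "n \<in> {1..N}" for n
  proof -
    have "\<exists>p\<in>time_poly k \<V>. \<forall>s\<in>{t (n - 1)<..t n}. w s = p s"
      using w n unfolding cont_time_poly_def by (elim CollectE conjE) (rule bspec)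
    then obtain p where p: "p \<in> time_poly k \<V>" "\<And>s. s \<in> {t (n - 1)<..t n} \<Longrightarrow> w s = p s"
      by (elim bexE) metis
    obtain b where b: "\<forall>j\<le>k. b j \<in> \<V>" "\<forall>s x. p s x = (\<Sum>j\<le>k. s ^ j * b j x)"
      using p(1) unfolding time_poly_def by (elim CollectE exE conjE)
    have b: "\<And>j. j \<le> k \<Longrightarrow> b j \<in> \<V>" "\<And>s x. p s x = (\<Sum>j\<le>k. s ^ j * b j x)" using b by simp_all
    have pe: "p s = (\<lambda>x. \<Sum>j\<le>k. s ^ j * b j x)" for s using b(2) by (rule ext)
    have pV: "p s \<in> \<V>" for s unfolding pe by (rule V.sum_closed) (use b(1) in auto)
    define s0 where "s0 = t (n - 1)"
    define S where "S = {s0<..t n}"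
    have st: "s0 < t n" unfolding s0_def by (rule time_mesh_step[OF mesh n])
    have sub: "S \<subseteq> {0..T}" "s0 \<in> {0..T}" using time_mesh_sub[OF mesh n] st by (auto simp: S_def s0_def)
    have nt: "at s0 within S \<noteq> bot"
      using st by (auto simp: S_def trivial_limit_within islimpt_Ioc)
    have wL: "w s \<in> L2_space \<Omega>" if "s \<in> {0..T}" for s using FE_facts(1)[OF wV[OF that]] .
    have pL: "p s \<in> L2_space \<Omega>" for s using FE_facts(1)[OF pV] .
    have "((\<lambda>s'. H_norm \<Omega> 0 (\<lambda>x. w s' x - w s0 x)) \<longlongrightarrow> 0) (at s0 within {0..T})"
      using w sub(2) t0N by (simp add: cont_time_poly_def time_continuous_def)
    then have l1: "((\<lambda>s'. H_norm \<Omega> 0 (\<lambda>x. w s' x - w s0 x)) \<longlongrightarrow> 0) (at s0 within S)"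
      by (rule tendsto_within_subset[OF _ sub(1)])
    have l2: "((\<lambda>s'. \<Sum>j\<le>k. \<bar>s' ^ j - s0 ^ j\<bar> * L2_norm \<Omega> (b j)) \<longlongrightarrow> (\<Sum>j\<le>k. \<bar>s0 ^ j - s0 ^ j\<bar> * L2_norm \<Omega> (b j))) (at s0 within S)"
      by (intro tendsto_intros)
    have "L2_norm \<Omega> (\<lambda>x. w s0 x - p s0 x) \<le> 0 + (\<Sum>j\<le>k. \<bar>s0 ^ j - s0 ^ j\<bar> * L2_norm \<Omega> (b j))"
    proof (rule tendsto_lowerbound[OF tendsto_add[OF l1 l2] _ nt])
      show "\<forall>\<^sub>F s' in at s0 within S. L2_norm \<Omega> (\<lambda>x. w s0 x - p s0 x)
          \<le> H_norm \<Omega> 0 (\<lambda>x. w s' x - w s0 x) + (\<Sum>j\<le>k. \<bar>s' ^ j - s0 ^ j\<bar> * L2_norm \<Omega> (b j))"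
        unfolding eventually_at_filter
      proof (rule always_eventually, intro allI impI)
        fix s' assume s': "s' \<in> S"
        have d1: "(\<lambda>x. w s' x - w s0 x) \<in> L2_space \<Omega>" using wL sub s' by (intro L.diff) auto
        have d2: "(\<lambda>x. p s' x - p s0 x) \<in> L2_space \<Omega>" using pL by (intro L.diff)
        have e2: "(\<lambda>x. p s' x - p s0 x) = (\<lambda>x. \<Sum>j\<le>k. (s' ^ j - s0 ^ j) * b j x)"
          by (auto simp: pe sum_subtractf left_diff_distrib)
        have "L2_norm \<Omega> (\<lambda>x. (p s' x - p s0 x) - (w s' x - w s0 x)) \<le> L2_norm \<Omega> (\<lambda>x. p s' x - p s0 x) + L2_norm \<Omega> (\<lambda>x. w s' x - w s0 x)"
          using L.nrm_diff[OF d2 d1] by (simp add: L_nrm[OF open\<Omega> bdd])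
        also have "(\<lambda>x. (p s' x - p s0 x) - (w s' x - w s0 x)) = (\<lambda>x. w s0 x - p s0 x)"
          using p(2)[of s'] s' by (auto simp: S_def s0_def)
        also have "L2_norm \<Omega> (\<lambda>x. p s' x - p s0 x) \<le> (\<Sum>j\<le>k. \<bar>s' ^ j - s0 ^ j\<bar> * L2_norm \<Omega> (b j))"
          unfolding e2 using L.nrm_sum[of "{..k}" b "\<lambda>j. s' ^ j - s0 ^ j"] FE_facts(1)[OF b(1)]
          by (simp add: L_nrm[OF open\<Omega> bdd])
        finally show "L2_norm \<Omega> (\<lambda>x. w s0 x - p s0 x)
          \<le> H_norm \<Omega> 0 (\<lambda>x. w s' x - w s0 x) + (\<Sum>j\<le>k. \<bar>s' ^ j - s0 ^ j\<bar> * L2_norm \<Omega> (b j))"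
          unfolding H_norm_0[OF open\<Omega> bdd d1] by simp
      qed
    qed
    then have "L2_norm \<Omega> (\<lambda>x. w s0 x - p s0 x) \<le> 0" by simp
    moreover have z: "(\<lambda>x. w s0 x - p s0 x) \<in> \<V>" by (rule V.diff[OF wV[OF sub(2)] pV])
    ultimately have "L2_inner \<Omega> (\<lambda>x. w s0 x - p s0 x) (\<lambda>x. w s0 x - p s0 x) = 0"
      using V.nonneg[OF z] by (simp add: L2_norm_def)
    then have "(\<lambda>x. w s0 x - p s0 x) = (\<lambda>_. 0)" by (rule FE_L2_definite[OF open\<Omega> bdd fin cover z])
    then have ws0: "w s0 = p s0" by (auto simp: fun_eq_iff dest: spec)
    have "w s = p s" if "s \<in> {t (n - 1)..t n}" for s
      using ws0 p(2)[of s] that by (cases "s = s0") (auto simp: s0_def)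
    then show ?thesis using b(1) pe by (intro exI[of _ b]) auto
  qed
  then show ?thesis unfolding piecewise_poly_def
    using bchoice[of "{1..N}" "\<lambda>n b. (\<forall>j\<le>k. b j \<in> \<V>) \<and> (\<forall>s\<in>{t (n - 1)..t n}. w s = (\<lambda>x. \<Sum>j\<le>k. s ^ j * b j x))"] by blast
qed

context
  fixes T :: real and N k :: nat and t :: "nat \<Rightarrow> real" and w :: "real \<Rightarrow> 'd field" and a :: "nat \<Rightarrow> nat \<Rightarrow> 'd field"
  assumes mesh: "time_mesh T N t" and k1: "1 \<le> k"
    and pieces: "piecewise_poly \<V> k N t w a"
begin

lemma aV: "n \<in> {1..N} \<Longrightarrow> j \<le> k \<Longrightarrow> a n j \<in> \<V>"
  using pieces unfolding piecewise_poly_def by blast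

lemma wa: "n \<in> {1..N} \<Longrightarrow> s \<in> {t (n - 1)..t n} \<Longrightarrow> w s = (\<lambda>x. \<Sum>j\<le>k. s ^ j * a n j x)"
  by (rule bspec[OF conjunct2[OF bspec[OF pieces[unfolded piecewise_poly_def]]]])

definition piece_deriv :: "nat \<Rightarrow> real \<Rightarrow> 'd field" where
  "piece_deriv n s = (\<lambda>x. \<Sum>j\<le>k. (real j * s ^ (j - 1)) * a n j x)"

lemma piece_deriv_V: "n \<in> {1..N} \<Longrightarrow> piece_deriv n s \<in> \<V>"
  unfolding piece_deriv_def by (rule V.sum_closed) (use aV in auto)

lemma w_V: "s \<in> {0..T} \<Longrightarrow> w s \<in> \<V>"
proof -
  assume "s \<in> {0..T}"
  then obtain n where n: "n \<in> {1..N}" "s \<in> {t (n - 1)..t n}" using time_mesh_cover[OF mesh] by blast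
  show ?thesis unfolding wa[OF n] by (rule V.sum_closed) (use aV n in auto)
qed

lemma piece_time_deriv:
  assumes n: "n \<in> {1..N}" and s: "s \<in> {t (n - 1)..t n}"
  shows "AE x in lebesgue_on \<Omega>. time_deriv \<Omega> {t (n - 1)..t n} w s x = piece_deriv n s x"
    "time_deriv \<Omega> {t (n - 1)..t n} w s \<in> L2_space \<Omega>"
proof -
  have h: "has_time_deriv \<Omega> 0 {t (n - 1)..t n} w s (piece_deriv n s)"
    unfolding piece_deriv_def
  proof (rule has_time_deriv_sum[OF open\<Omega> bdd])
    show "a n j \<in> L2_space \<Omega>" if "j \<in> {..k}" for j using FE_facts(1)[OF aV[OF n]] that by auto
    show "AE x in lebesgue_on \<Omega>. w s x = (\<Sum>j\<le>k. s ^ j * a n j x)" if "s \<in> {t (n - 1)..t n}" for s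
      using wa[OF n that] by simp
    show "((\<lambda>s. s ^ j) has_real_derivative real j * s ^ (j - 1)) (at s within {t (n - 1)..t n})" for j
      by (auto intro!: derivative_eq_intros)
  qed (use s in auto)
  have wL: "w s \<in> L2_space \<Omega>" if "s \<in> {t (n - 1)..t n}" for s
    using w_V time_mesh_sub[OF mesh n] that FE_facts(1) by blast
  have nt: "at s within {t (n - 1)..t n} \<noteq> bot" by (rule at_within_Icc_nontrivial[OF time_mesh_step[OF mesh n] s])
  show "AE x in lebesgue_on \<Omega>. time_deriv \<Omega> {t (n - 1)..t n} w s x = piece_deriv n s x"
    "time_deriv \<Omega> {t (n - 1)..t n} w s \<in> L2_space \<Omega>"
    by (rule time_deriv_eq[OF open\<Omega> bdd wL s nt FE_facts(1)[OF piece_deriv_V[OF n]] h]; assumption)+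
qed

context
  fixes Z :: "real \<Rightarrow> 'd field" and d\<^sub>0 :: "'d field"
  assumes Z_all: "\<forall>s\<in>{0..T}. Z s \<in> \<V>" and d0: "d\<^sub>0 = Z 0"
    and res_all: "\<forall>n\<in>{1..N}. \<forall>\<mu>\<le>k. \<forall>x.
      piece_deriv n (lobatto_point k t n \<mu>) x - Z (lobatto_point k t n \<mu>) x
        = (piece_deriv n (t (n - 1)) x - Z (t (n - 1)) x) * poly (pderiv (lift_poly k t n)) (lobatto_point k t n \<mu>)"
begin

lemmas Z = bspec[OF Z_all]
lemmas res = bspec[OF res_all, rule_format]

definition "gam n = (\<lambda>x. piece_deriv n (t (n - 1)) x - Z (t (n - 1)) x)"

text \<open>The derivative of the lifted function on one interval. By the assumption on the residual, the coefficient \<open>gam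
  n\<close> makes it equal to \<open>Z\<close> at the left end point, and then at all nodes.\<close>
definition lift_deriv :: "nat \<Rightarrow> real \<Rightarrow> 'd field" where
  "lift_deriv n s = (\<lambda>x. piece_deriv n s x - poly (pderiv (lift_poly k t n)) s * gam n x)"

lemma gam_V: "n \<in> {1..N} \<Longrightarrow> gam n \<in> \<V>"
proof -
  assume n: "n \<in> {1..N}"
  have "t (n - 1) \<in> {0..T}" using time_mesh_sub[OF mesh n] time_mesh_step[OF mesh n] by auto
  then show ?thesis unfolding gam_def by (intro V.diff piece_deriv_V[OF n] Z)
qed

lemma lift_deriv_V: "n \<in> {1..N} \<Longrightarrow> lift_deriv n s \<in> \<V>"
  unfolding lift_deriv_def by (intro V.diff piece_deriv_V V.scale gam_V)

lemma lift_deriv_node: "n \<in> {1..N} \<Longrightarrow> \<mu> \<le> k \<Longrightarrow> lift_deriv n (lobatto_point k t n \<mu>) = Z (lobatto_point k t n \<mu>)"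
proof
  fix x assume "n \<in> {1..N}" "\<mu> \<le> k"
  from res[OF this, of x] show "lift_deriv n (lobatto_point k t n \<mu>) x = Z (lobatto_point k t n \<mu>) x"
    by (simp add: lift_deriv_def gam_def mult.commute)
qed

text \<open>A scalar polynomial that is the lifted function at a point \<open>x\<close> in space, so that the facts on the
  reference interval apply pointwise.\<close>
lemma lift_deriv_poly:
  assumes n: "n \<in> {1..N}"
  obtains Y where "degree Y \<le> Suc k" "\<And>s. poly (pderiv Y) s = lift_deriv n s x"
    "\<And>\<mu>. \<mu> \<le> k \<Longrightarrow> poly Y (lobatto_point k t n \<mu>) = w (lobatto_point k t n \<mu>) x"
proof -
  have st: "t (n - 1) < t n" by (rule time_mesh_step[OF mesh n])
  note lp = lift_poly_props[of k t n, OF k1 st]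
  define Y where "Y = (\<Sum>j\<le>k. monom (a n j x) j) - smult (gam n x) (lift_poly k t n)"
  have "degree Y \<le> Suc k"
    unfolding Y_def
  proof (rule degree_diff_le)
    show "degree (\<Sum>j\<le>k. monom (a n j x) j) \<le> Suc k"
      by (rule degree_sum_le) (auto intro: order.trans[OF degree_monom_le])
    show "degree (smult (gam n x) (lift_poly k t n)) \<le> Suc k"
      using lp(1) by (intro order.trans[OF degree_smult_le]) simp
  qed
  moreover have "poly (pderiv Y) s = lift_deriv n s x" for s
    unfolding Y_def lift_deriv_def piece_deriv_def pderiv_diff sum_pderiv pderiv_smult pderiv_monom
    by (simp add: poly_sum poly_monom mult_ac)
  moreover have "poly Y (lobatto_point k t n \<mu>) = w (lobatto_point k t n \<mu>) x" if "\<mu> \<le> k" for \<mu>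
  proof -
    have "lobatto_point k t n \<mu> \<in> {t (n - 1)..t n}"
      using ref_map(3,4)[of t n, OF st] lobatto_node_root(2)[OF k1 that] by simp
    then show ?thesis unfolding wa[OF n \<open>lobatto_point k t n \<mu> \<in> _\<close>] Y_def
      using lp(2)[OF that] by (simp add: poly_sum poly_monom mult.commute)
  qed
  ultimately show thesis by (rule that)
qed

lemma lift_deriv_increment:
  assumes n: "n \<in> {1..N}" and \<mu>: "\<mu> \<le> k"
  shows "w (lobatto_point k t n \<mu>) x - w (t (n - 1)) x
    = (t n - t (n - 1)) / 2 * (\<Sum>\<nu>\<le>k. rk k \<mu> \<nu> * Z (lobatto_point k t n \<nu>) x)"
proof -
  have st: "t (n - 1) < t n" by (rule time_mesh_step[OF mesh n])
  obtain Y where Y: "degree Y \<le> Suc k" "\<And>s. poly (pderiv Y) s = lift_deriv n s x"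
    "\<And>\<mu>. \<mu> \<le> k \<Longrightarrow> poly Y (lobatto_point k t n \<mu>) = w (lobatto_point k t n \<mu>) x"
    by (rule lift_deriv_poly[OF n, of x]) blast
  have "degree (pcompose Y (ref_map t n)) \<le> Suc k" using Y(1) degree_ref_map[of t n] st by (simp add: degree_pcompose)
  from nodal_increment[OF k1 this, of \<mu>] have "poly Y (lobatto_point k t n \<mu>) - poly Y (t (n - 1))
      = (\<Sum>\<nu>\<le>k. rk k \<mu> \<nu> * ((t n - t (n - 1)) / 2 * lift_deriv n (lobatto_point k t n \<nu>) x))"
    unfolding poly_pderiv_ref_map poly_pcompose ref_map(1)[of t n, OF st] ref_map(3)[of t n, OF st, symmetric] Y(2) .
  also have "\<dots> = (t n - t (n - 1)) / 2 * (\<Sum>\<nu>\<le>k. rk k \<mu> \<nu> * Z (lobatto_point k t n \<nu>) x)"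
    unfolding sum_distrib_left by (rule sum.cong) (auto simp: lift_deriv_node[OF n])
  finally show ?thesis using Y(3)[OF \<mu>] Y(3)[of 0] lobatto_point_ends[of k t n, OF k1 st] by simp
qed

lemma lift_deriv_interp:
  assumes n: "n \<in> {1..N}"
  shows "lift_deriv n (poly (ref_map t n) y) = (\<lambda>x. \<Sum>\<mu>\<le>k. poly (lagr k \<mu>) y * Z (lobatto_point k t n \<mu>) x)"
proof
  fix x
  have st: "t (n - 1) < t n" by (rule time_mesh_step[OF mesh n])
  obtain Y where Y: "degree Y \<le> Suc k" "\<And>s. poly (pderiv Y) s = lift_deriv n s x"
    by (rule lift_deriv_poly[OF n, of x]) blast
  have "degree (pcompose (pderiv Y) (ref_map t n)) \<le> k"
    using Y(1) degree_ref_map[of t n] st by (simp add: degree_pcompose degree_pderiv)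
  from arg_cong[OF lagr_interp[OF k1 this], of "\<lambda>p. poly p y"]
  have "poly (pderiv Y) (poly (ref_map t n) y) = (\<Sum>\<mu>\<le>k. poly (lagr k \<mu>) y * poly (pderiv Y) (lobatto_point k t n \<mu>))"
    by (simp add: poly_pcompose poly_sum mult.commute ref_map(3)[of t n, OF st])
  then show "lift_deriv n (poly (ref_map t n) y) x = (\<Sum>\<mu>\<le>k. poly (lagr k \<mu>) y * Z (lobatto_point k t n \<mu>) x)"
    by (simp add: Y(2) lift_deriv_node[OF n])
qed

lemma lifted_piece_deriv:
  assumes n: "n \<in> {1..N}" and s: "s \<in> {t (n - 1)..t n}"
    and g: "\<And>s. s \<in> {t (n - 1)..t n} \<Longrightarrow> AE x in lebesgue_on \<Omega>. g s x = w s x - gam n x * poly (lift_poly k t n) s"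
  shows "has_time_deriv \<Omega> 0 {t (n - 1)..t n} g s (lift_deriv n s)"
    "\<And>s. s \<in> {t (n - 1)..t n} \<Longrightarrow> g s \<in> L2_space \<Omega>"
proof -
  define b where "b j = (if j \<le> k then a n j else gam n)" for j
  define \<theta> where "\<theta> j s = (if j \<le> k then s ^ j else - poly (lift_poly k t n) s)" for j s
  define \<theta>' where "\<theta>' j = (if j \<le> k then real j * s ^ (j - 1) else - poly (pderiv (lift_poly k t n)) s)" for j
  have "has_time_deriv \<Omega> 0 {t (n - 1)..t n} g s (\<lambda>x. \<Sum>j\<in>{..Suc k}. \<theta>' j * b j x)"
  proof (rule has_time_deriv_sum[OF open\<Omega> bdd])
    show "b j \<in> L2_space \<Omega>" for j using FE_facts(1) aV[OF n] gam_V[OF n] by (auto simp: b_def)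
    show "AE x in lebesgue_on \<Omega>. g s' x = (\<Sum>j\<in>{..Suc k}. \<theta> j s' * b j x)" if s': "s' \<in> {t (n - 1)..t n}" for s'
      using g[OF s']
    proof eventually_elim
      case (elim x)
      then show ?case unfolding wa[OF n s'] by (simp add: \<theta>_def b_def)
    qed
    show "(\<theta> j has_real_derivative \<theta>' j) (at s within {t (n - 1)..t n})" for j
      unfolding \<theta>_def[abs_def] \<theta>'_def
      by (cases "j \<le> k") (auto intro!: derivative_eq_intros DERIV_subset[OF poly_DERIV])
  qed (use s in auto)
  also have "(\<lambda>x. \<Sum>j\<in>{..Suc k}. \<theta>' j * b j x) = lift_deriv n s"
    by (auto simp: \<theta>'_def b_def lift_deriv_def piece_deriv_def)
  finally show "has_time_deriv \<Omega> 0 {t (n - 1)..t n} g s (lift_deriv n s)" .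
  fix s assume s: "s \<in> {t (n - 1)..t n}"
  have "(\<lambda>x. w s x - poly (lift_poly k t n) s * gam n x) \<in> \<V>"
    using w_V time_mesh_sub[OF mesh n] s gam_V[OF n] by (intro V.diff V.scale) auto
  then show "g s \<in> L2_space \<Omega>"
    by (rule L2_AE[OF open\<Omega> bdd FE_facts(1)]) (use g[OF s] in \<open>auto simp: mult.commute\<close>)
qed

text \<open>Induction over the intervals: the one-sided derivative of the lifted function at the right end point of an interval is
  \<open>Z\<close> there, so the recursion for the next coefficient subtracts the same value that \<open>gam\<close>
  does.\<close>
lemma lift_coeff_AE:
  "m < N \<Longrightarrow> lift_coeff \<Omega> k t d\<^sub>0 w m \<in> L2_space \<Omega> \<and> (AE x in lebesgue_on \<Omega>. lift_coeff \<Omega> k t d\<^sub>0 w m x = gam (Suc m) x)"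
proof (induction m)
  case 0
  have n: "1 \<in> {1..N}" using 0 by simp
  have t0: "t 0 = 0" "t 0 \<in> {t (1 - 1)..t 1}" using mesh time_mesh_step[OF mesh n] by (auto simp: time_mesh_def)
  note td = piece_time_deriv[OF n t0(2)]
  have "AE x in lebesgue_on \<Omega>. lift_coeff \<Omega> k t d\<^sub>0 w 0 x = gam (Suc 0) x"
    using td(1) by eventually_elim (simp add: gam_def d0 t0)
  moreover have "lift_coeff \<Omega> k t d\<^sub>0 w 0 \<in> L2_space \<Omega>"
    by (rule L2_AE[OF open\<Omega> bdd FE_facts(1)[OF gam_V[OF n]]]) (use calculation in \<open>auto simp: eq_commute\<close>)
  ultimately show ?case by simp
next
  case (Suc m)
  have n: "Suc m \<in> {1..N}" "Suc (Suc m) \<in> {1..N}" using Suc.prems by auto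
  have s1: "t (Suc m) \<in> {t (Suc m - 1)..t (Suc m)}" "t (Suc m) \<in> {t (Suc (Suc m) - 1)..t (Suc (Suc m))}"
    using time_mesh_step[OF mesh n(1)] time_mesh_step[OF mesh n(2)] by auto
  let ?g = "\<lambda>s y. w s y - lift_coeff \<Omega> k t d\<^sub>0 w m y * poly (lift_poly k t (Suc m)) s"
  have IH: "AE x in lebesgue_on \<Omega>. lift_coeff \<Omega> k t d\<^sub>0 w m x = gam (Suc m) x" using Suc by simp
  have g: "AE x in lebesgue_on \<Omega>. ?g s x = w s x - gam (Suc m) x * poly (lift_poly k t (Suc m)) s" for s
    using IH by eventually_elim simp
  note lpd = lifted_piece_deriv[OF n(1) s1(1) g]
  have "AE x in lebesgue_on \<Omega>. time_deriv \<Omega> {t (Suc m - 1)..t (Suc m)} ?g (t (Suc m)) x = lift_deriv (Suc m) (t (Suc m)) x"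
    by (rule time_deriv_eq(1)[OF open\<Omega> bdd lpd(2) s1(1) at_within_Icc_nontrivial[OF time_mesh_step[OF mesh n(1)] s1(1)]
          FE_facts(1)[OF lift_deriv_V[OF n(1)]] lpd(1)])
  moreover have "lift_deriv (Suc m) (t (Suc m)) = Z (t (Suc m))"
    using lift_deriv_node[OF n(1), of k] lobatto_point_ends(2)[of k t "Suc m", OF k1 time_mesh_step[OF mesh n(1)]] by simp
  ultimately have 1: "AE x in lebesgue_on \<Omega>. time_deriv \<Omega> {t m..t (Suc m)} ?g (t (Suc m)) x = Z (t (Suc m)) x" by simp
  have 2: "AE x in lebesgue_on \<Omega>. time_deriv \<Omega> {t (Suc m)..t (Suc (Suc m))} w (t (Suc m)) x = piece_deriv (Suc (Suc m)) (t (Suc m)) x"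
    using piece_time_deriv(1)[OF n(2) s1(2)] by simp
  have "AE x in lebesgue_on \<Omega>. lift_coeff \<Omega> k t d\<^sub>0 w (Suc m) x = gam (Suc (Suc m)) x"
    using 1 2 by eventually_elim (simp add: gam_def)
  moreover have "lift_coeff \<Omega> k t d\<^sub>0 w (Suc m) \<in> L2_space \<Omega>"
    by (rule L2_AE[OF open\<Omega> bdd FE_facts(1)[OF gam_V[OF n(2)]]]) (use calculation in \<open>auto simp: eq_commute\<close>)
  ultimately show ?case by simp
qed

text \<open>At a mesh point both one-sided derivatives equal \<open>Z\<close>, so the lifting is differentiable there as well.\<close>
lemma lifting_time_deriv:
  assumes n: "n \<in> {1..N}" and s: "s \<in> {t (n - 1)..t n}"
  shows "AE x in lebesgue_on \<Omega>. time_deriv \<Omega> {0..T} (lifting \<Omega> k t d\<^sub>0 w) s x = lift_deriv n s x"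
    "time_deriv \<Omega> {0..T} (lifting \<Omega> k t d\<^sub>0 w) s \<in> L2_space \<Omega>"
proof -
  let ?g = "lifting \<Omega> k t d\<^sub>0 w"
  have t0: "t 0 = 0" using mesh by (simp add: time_mesh_def)
  have zero: "poly (lift_poly k t m) (t (m - 1)) = 0 \<and> poly (lift_poly k t m) (t m) = 0" if m: "m \<in> {1..N}" for m
    using lift_poly_props(2)[of k t m 0] lift_poly_props(2)[of k t m k] k1 time_mesh_step[OF mesh m]
      lobatto_point_ends[of k t m, OF k1 time_mesh_step[OF mesh m]] by simp
  have g: "AE x in lebesgue_on \<Omega>. ?g s x = w s x - gam m x * poly (lift_poly k t m) s"
    if m: "m \<in> {1..N}" and s: "s \<in> {t (m - 1)..t m}" for m s
  proof (cases "s = t (m - 1)")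
    case True
    have "?g s = w s"
    proof (cases "s \<le> t 0")
      case False
      have m1: "m - 1 \<in> {1..N}" using True False m by (cases "m = 1") auto
      have "(LEAST n. s \<le> t n) = m - 1"
        using time_mesh_Least[OF mesh m1, of s] time_mesh_step[OF mesh m1] True by simp
      then show ?thesis using False zero[OF m1] True by (simp add: lifting_def Let_def)
    qed (simp add: lifting_def)
    then show ?thesis using zero[OF m] True by simp
  next
    case False
    then have s': "t (m - 1) < s" "s \<le> t m" using s by auto
    have "m - 1 \<le> N" using m by auto
    then have "\<not> s \<le> t 0" using s'(1) time_mesh_le[OF mesh, of 0 "m - 1"] by simp
    then have e: "?g s = (\<lambda>x. w s x - lift_coeff \<Omega> k t d\<^sub>0 w (m - 1) x * poly (lift_poly k t m) s)"
      using time_mesh_Least[OF mesh m s'] by (simp add: lifting_def Let_def)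
    have "AE x in lebesgue_on \<Omega>. lift_coeff \<Omega> k t d\<^sub>0 w (m - 1) x = gam m x"
      using lift_coeff_AE[of "m - 1"] m by auto
    then show ?thesis unfolding e by eventually_elim simp
  qed
  have gL: "?g s \<in> L2_space \<Omega>" if s: "s \<in> {0..T}" for s
  proof -
    obtain m where m: "m \<in> {1..N}" "s \<in> {t (m - 1)..t m}" using time_mesh_cover[OF mesh] s by blast
    show ?thesis by (rule lifted_piece_deriv(2)[OF m g[OF m(1)] m(2)])
  qed
  have same: "lift_deriv m s = lift_deriv n s" if m: "m \<in> {1..N}" "s \<in> {t (m - 1)..t m}" for m
  proof (cases "m = n")
    case False
    have ends: "lift_deriv i (t (i - 1)) = Z (t (i - 1))" "lift_deriv i (t i) = Z (t i)" if i: "i \<in> {1..N}" for i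
      using lift_deriv_node[OF i, of 0] lift_deriv_node[OF i, of k]
        lobatto_point_ends[of k t i, OF k1 time_mesh_step[OF mesh i]] by simp_all
    have "(s = t m \<and> s = t (n - 1)) \<or> (s = t n \<and> s = t (m - 1))"
    proof (cases "m < n")
      case True
      then have "t m \<le> t (n - 1)" using n by (intro time_mesh_le[OF mesh]) auto
      then show ?thesis using s m by auto
    next
      case F: False
      then have "t n \<le> t (m - 1)" using \<open>m \<noteq> n\<close> m by (intro time_mesh_le[OF mesh]) auto
      then show ?thesis using s m by auto
    qed
    then show ?thesis using ends[OF m(1)] ends[OF n] by metis
  qed simp
  have h: "has_time_deriv \<Omega> 0 {0..T} ?g s (lift_deriv n s)"
    unfolding time_mesh_cover[OF mesh, symmetric]
  proof (rule has_time_deriv_Union)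
    fix S assume "S \<in> (\<lambda>n. {t (n - 1)..t n}) ` {1..N}" and sS: "s \<in> S"
    then obtain m where m: "m \<in> {1..N}" "S = {t (m - 1)..t m}" by blast
    have sm: "s \<in> {t (m - 1)..t m}" using sS m by simp
    show "has_time_deriv \<Omega> 0 S ?g s (lift_deriv n s)"
      unfolding m(2) same[OF m(1) sm, symmetric] by (rule lifted_piece_deriv(1)[OF m(1) sm g[OF m(1)]])
  qed auto
  have s': "s \<in> {0..T}" using time_mesh_sub[OF mesh n] s by blast
  have T: "0 < T" using time_mesh_less[OF mesh, of 0 N] mesh by (auto simp: time_mesh_def)
  note te = time_deriv_eq[OF open\<Omega> bdd gL s' at_within_Icc_nontrivial[OF T s'] FE_facts(1)[OF lift_deriv_V[OF n]] h]
  show "AE x in lebesgue_on \<Omega>. time_deriv \<Omega> {0..T} (lifting \<Omega> k t d\<^sub>0 w) s x = lift_deriv n s x" by (rule te(1))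
  show "time_deriv \<Omega> {0..T} (lifting \<Omega> k t d\<^sub>0 w) s \<in> L2_space \<Omega>" by (rule te(2))
qed

end

end

end

section \<open>The lifted solution as a collocation solution\<close>

lemma poly_time_poly_scaled:
  assumes "degree \<psi> < k" "\<phi> \<in> B" and "\<And>c. (\<lambda>x. c * \<phi> x) \<in> B"
  shows "(\<lambda>s x. poly \<psi> s * \<phi> x) \<in> time_poly (k - 1) B"
  unfolding time_poly_def
proof (intro CollectI exI[of _ "\<lambda>j x. coeff \<psi> j * \<phi> x"] conjI allI impI)
  show "(\<lambda>x. coeff \<psi> j * \<phi> x) \<in> B" for j by (rule assms(3))
  fix s x
  have "poly \<psi> s = (\<Sum>j\<le>k - 1. coeff \<psi> j * s ^ j)"
    unfolding poly_altdef by (rule sum.mono_neutral_left) (use assms(1) in \<open>auto simp: coeff_eq_0\<close>)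
  then show "poly \<psi> s * \<phi> x = (\<Sum>j\<le>k - 1. s ^ j * (coeff \<psi> j * \<phi> x))"
    by (simp only: sum_distrib_right) (simp add: mult_ac)
qed

context
  fixes \<Omega> :: "(real^'d::finite) set" and \<T> :: "'d mesh" and r :: nat
  assumes open\<Omega>: "open \<Omega>" and bdd: "bounded \<Omega>"
    and fin: "finite \<T>" and cover: "(\<Union>F\<in>\<T>. F ` cbox 0 1) = closure \<Omega>"
begin

private abbreviation (input) "\<W> \<equiv> FE_space \<Omega> r \<T>"

lemmas FE_in = FE_L2[OF open\<Omega> bdd fin cover, of _ r] FE_H1[OF open\<Omega> bdd fin cover, of _ r]

interpretation L: semi_inner "L2_space \<Omega>" "L2_inner \<Omega>" by (rule L2_semi_inner[OF open\<Omega> bdd])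
interpretation G: semi_inner "H_space \<Omega> 1" "grad_inner \<Omega>" by (rule grad_semi_inner[OF open\<Omega> bdd])
interpretation V: semi_inner \<W> "L2_inner \<Omega>" by (rule FE_L2_semi[OF open\<Omega> bdd fin cover])
interpretation VG: semi_inner \<W> "grad_inner \<Omega>" by (rule FE_grad_semi[OF open\<Omega> bdd fin cover])

context
  fixes T :: real and N k :: nat and t :: "nat \<Rightarrow> real" and w\<^sub>0 w\<^sub>1 f :: "real \<Rightarrow> 'd field"
    and a\<^sub>0 a\<^sub>1 :: "nat \<Rightarrow> nat \<Rightarrow> 'd field" and U\<^sub>0
  assumes mesh: "time_mesh T N t" and k1: "1 \<le> k"
    and pc0: "piecewise_poly \<W> k N t w\<^sub>0 a\<^sub>0" and pc1: "piecewise_poly \<W> k N t w\<^sub>1 a\<^sub>1"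
    and fL_all: "\<forall>s\<in>{0..T}. f s \<in> L2_space \<Omega>"
    and fds: "fully_discrete_solution \<Omega> \<W> k N t f U\<^sub>0 w\<^sub>0 w\<^sub>1"
begin

lemmas fL = bspec[OF fL_all]
lemmas a0 = aV[OF open\<Omega> bdd fin cover mesh k1 pc0] and w0 = wa[OF open\<Omega> bdd fin cover mesh k1 pc0]
lemmas a1 = aV[OF open\<Omega> bdd fin cover mesh k1 pc1] and w1 = wa[OF open\<Omega> bdd fin cover mesh k1 pc1]

private abbreviation (input) "pd\<^sub>0 \<equiv> piece_deriv k a\<^sub>0"
private abbreviation (input) "pd\<^sub>1 \<equiv> piece_deriv k a\<^sub>1"

lemmas w_in = w_V[OF open\<Omega> bdd fin cover mesh k1 pc0] w_V[OF open\<Omega> bdd fin cover mesh k1 pc1]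

lemma node_in: assumes "n \<in> {1..N}" "\<mu> \<le> k"
  shows "lobatto_point k t n \<mu> \<in> {t (n - 1)..t n}" "lobatto_point k t n \<mu> \<in> {0..T}"
proof -
  have st: "t (n - 1) < t n" by (rule time_mesh_step[OF mesh assms(1)])
  show 1: "lobatto_point k t n \<mu> \<in> {t (n - 1)..t n}"
    using ref_map(3,4)[of t n, OF st] lobatto_node_root(2)[OF k1 assms(2)] by simp
  show "lobatto_point k t n \<mu> \<in> {0..T}" using time_mesh_sub[OF mesh assms(1)] 1 by blast
qed

text \<open>Test functions in time of the form \<open>\<psi>(s) v(x)\<close> turn the scheme into scalar Galerkin equations.\<close>
lemma scheme_tested:
  assumes n: "n \<in> {1..N}" and v: "v\<^sub>0 \<in> \<W>" "v\<^sub>1 \<in> \<W>" and \<psi>: "degree \<psi> < k"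
  shows "integral {t (n - 1)..t n} (\<lambda>s. (L2_inner \<Omega> (pd\<^sub>0 n s) v\<^sub>0 - L2_inner \<Omega> (w\<^sub>1 s) v\<^sub>0
      + L2_inner \<Omega> (pd\<^sub>1 n s) v\<^sub>1 + grad_inner \<Omega> (w\<^sub>0 s) v\<^sub>1) * poly \<psi> s)
    = lobatto_quad k t n (\<lambda>s. L2_inner \<Omega> (f s) v\<^sub>1 * poly \<psi> s)"
proof -
  let ?I = "{t (n - 1)..t n}"
  let ?t0 = "\<lambda>s x. poly \<psi> s * v\<^sub>0 x" and ?t1 = "\<lambda>s x. poly \<psi> s * v\<^sub>1 x"
  have tp: "?t0 \<in> time_poly (k - 1) \<W>" "?t1 \<in> time_poly (k - 1) \<W>"
    by (intro poly_time_poly_scaled \<psi> v V.scale)+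
  have eq: "integral ?I (\<lambda>s.
          L2_inner_pair \<Omega> (time_deriv \<Omega> ?I w\<^sub>0 s, time_deriv \<Omega> ?I w\<^sub>1 s) (?t0 s, ?t1 s) +
          L2_inner_pair \<Omega> (discrete_wave_op \<Omega> \<W> (w\<^sub>0 s, w\<^sub>1 s)) (?t0 s, ?t1 s))
        = lobatto_quad k t n (\<lambda>s. L2_inner_pair \<Omega> (\<lambda>x. 0, f s) (?t0 s, ?t1 s))"
    by (rule bspec[OF bspec[OF bspec[OF conjunct2[OF conjunct2[OF conjunct2[OF
          fds[unfolded fully_discrete_solution_def]]]] n] tp(1)] tp(2)])
  have tV: "?t0 s \<in> \<W>" "?t1 s \<in> \<W>" for s by (intro V.scale v)+
  have scR: "L2_inner \<Omega> z (\<lambda>x. c * v x) = c * L2_inner \<Omega> z v" if "z \<in> L2_space \<Omega>" "v \<in> \<W>" for z c v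
    using L.B_scale[OF FE_in(1)[OF that(2)] that(1), of c] L.sym[OF that(1) FE_in(1)[OF that(2)]]
      L.sym[OF that(1) FE_in(1)[OF V.scale[OF that(2)]], of c] by simp
  have "L2_inner_pair \<Omega> (time_deriv \<Omega> ?I w\<^sub>0 s, time_deriv \<Omega> ?I w\<^sub>1 s) (?t0 s, ?t1 s) +
      L2_inner_pair \<Omega> (discrete_wave_op \<Omega> \<W> (w\<^sub>0 s, w\<^sub>1 s)) (?t0 s, ?t1 s)
    = (L2_inner \<Omega> (pd\<^sub>0 n s) v\<^sub>0 - L2_inner \<Omega> (w\<^sub>1 s) v\<^sub>0 + L2_inner \<Omega> (pd\<^sub>1 n s) v\<^sub>1 + grad_inner \<Omega> (w\<^sub>0 s) v\<^sub>1) * poly \<psi> s"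
    if s: "s \<in> ?I" for s
  proof -
    have s': "s \<in> {0..T}" using time_mesh_sub[OF mesh n] s by blast
    note p0 = piece_time_deriv[OF open\<Omega> bdd fin cover mesh k1 pc0 n s]
    note p1 = piece_time_deriv[OF open\<Omega> bdd fin cover mesh k1 pc1 n s]
    note pV = piece_deriv_V[OF open\<Omega> bdd fin cover mesh k1 pc0 n, of s] piece_deriv_V[OF open\<Omega> bdd fin cover mesh k1 pc1 n, of s]
    have 1: "L2_inner \<Omega> (time_deriv \<Omega> ?I w\<^sub>0 s) (?t0 s) = poly \<psi> s * L2_inner \<Omega> (pd\<^sub>0 n s) v\<^sub>0"
      unfolding scR[OF FE_in(1)[OF pV(1)] v(1), symmetric]
      by (rule L2_inner_cong[OF open\<Omega> bdd p0(2) FE_in(1)[OF tV(1)] p0(1)]) simp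
    have 2: "L2_inner \<Omega> (time_deriv \<Omega> ?I w\<^sub>1 s) (?t1 s) = poly \<psi> s * L2_inner \<Omega> (pd\<^sub>1 n s) v\<^sub>1"
      unfolding scR[OF FE_in(1)[OF pV(2)] v(2), symmetric]
      by (rule L2_inner_cong[OF open\<Omega> bdd p1(2) FE_in(1)[OF tV(2)] p1(1)]) simp
    have 3: "L2_inner \<Omega> (\<lambda>x. - w\<^sub>1 s x) (?t0 s) = - (poly \<psi> s * L2_inner \<Omega> (w\<^sub>1 s) v\<^sub>0)"
      using V.B_minus[OF w_in(2)[OF s'] tV(1), of s] scR[OF FE_in(1)[OF w_in(2)[OF s']] v(1)] by simp
    have 4: "L2_inner \<Omega> (discrete_laplace \<Omega> \<W> (w\<^sub>0 s)) (?t1 s) = poly \<psi> s * grad_inner \<Omega> (w\<^sub>0 s) v\<^sub>1"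
      using scR[OF FE_in(1)[OF discrete_laplace(1)[OF open\<Omega> bdd fin cover FE_in(2)[OF w_in(1)[OF s']]]] v(2)]
        discrete_laplace(2)[OF open\<Omega> bdd fin cover FE_in(2)[OF w_in(1)[OF s']] v(2)] by simp
    show ?thesis unfolding L2_inner_pair_def discrete_wave_op_def fst_conv snd_conv 1 2 3 4
      by (simp add: algebra_simps)
  qed
  then have "integral ?I (\<lambda>s. (L2_inner \<Omega> (pd\<^sub>0 n s) v\<^sub>0 - L2_inner \<Omega> (w\<^sub>1 s) v\<^sub>0
      + L2_inner \<Omega> (pd\<^sub>1 n s) v\<^sub>1 + grad_inner \<Omega> (w\<^sub>0 s) v\<^sub>1) * poly \<psi> s)
    = lobatto_quad k t n (\<lambda>s. L2_inner_pair \<Omega> (\<lambda>x. 0, f s) (?t0 s, ?t1 s))"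
    unfolding eq[symmetric] by (intro Henstock_Kurzweil_Integration.integral_cong) simp
  also have "\<dots> = lobatto_quad k t n (\<lambda>s. L2_inner \<Omega> (f s) v\<^sub>1 * poly \<psi> s)"
    unfolding lobatto_quad_def
  proof (intro arg_cong2[where f = "(*)"] sum.cong refl)
    fix \<mu> assume "\<mu> \<in> {..k}"
    then have p: "lobatto_point k t n \<mu> \<in> {0..T}" using node_in(2)[OF n] by simp
    show "L2_inner_pair \<Omega> (\<lambda>x. 0, f (lobatto_point k t n \<mu>)) (?t0 (lobatto_point k t n \<mu>), ?t1 (lobatto_point k t n \<mu>))
        = L2_inner \<Omega> (f (lobatto_point k t n \<mu>)) v\<^sub>1 * poly \<psi> (lobatto_point k t n \<mu>)"
      unfolding L2_inner_pair_def fst_conv snd_conv scR[OF fL[OF p] v(2)] L.B_zero[OF FE_in(1)[OF tV(1)]] by simp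
  qed
  finally show ?thesis .
qed

lemma scheme_residual:
  assumes n: "n \<in> {1..N}" and \<mu>: "\<mu> \<le> k" and v: "v\<^sub>0 \<in> \<W>" "v\<^sub>1 \<in> \<W>"
  defines "res \<equiv> \<lambda>s. L2_inner \<Omega> (pd\<^sub>0 n s) v\<^sub>0 - L2_inner \<Omega> (w\<^sub>1 s) v\<^sub>0
      + L2_inner \<Omega> (pd\<^sub>1 n s) v\<^sub>1 + grad_inner \<Omega> (w\<^sub>0 s) v\<^sub>1 - L2_inner \<Omega> (f s) v\<^sub>1"
  shows "res (lobatto_point k t n \<mu>) = res (t (n - 1)) * poly (pderiv (lift_poly k t n)) (lobatto_point k t n \<mu>)"
proof -
  let ?I = "{t (n - 1)..t n}"
  have st: "t (n - 1) < t n" by (rule time_mesh_step[OF mesh n])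
  define P0 where "P0 = (\<Sum>j\<le>k. monom (L2_inner \<Omega> (a\<^sub>0 n j) v\<^sub>0) j)"
  define P1 where "P1 = (\<Sum>j\<le>k. monom (L2_inner \<Omega> (a\<^sub>1 n j) v\<^sub>1) j)"
  define Q0 where "Q0 = (\<Sum>j\<le>k. monom (grad_inner \<Omega> (a\<^sub>0 n j) v\<^sub>1) j)"
  define Q1 where "Q1 = (\<Sum>j\<le>k. monom (L2_inner \<Omega> (a\<^sub>1 n j) v\<^sub>0) j)"
  define g where "g = pderiv P0 - Q1 + pderiv P1 + Q0"
  have deg: "degree P0 \<le> k" "degree P1 \<le> k" "degree Q0 \<le> k" "degree Q1 \<le> k"
    unfolding P0_def P1_def Q0_def Q1_def by (auto intro!: degree_sum_le order.trans[OF degree_monom_le])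
  have dg: "degree g \<le> k" unfolding g_def
    using deg by (intro degree_add_le degree_diff_le) (auto simp: degree_pderiv)
  have g: "poly g s = L2_inner \<Omega> (pd\<^sub>0 n s) v\<^sub>0 - L2_inner \<Omega> (w\<^sub>1 s) v\<^sub>0
      + L2_inner \<Omega> (pd\<^sub>1 n s) v\<^sub>1 + grad_inner \<Omega> (w\<^sub>0 s) v\<^sub>1" if s: "s \<in> ?I" for s
  proof -
    have "L2_inner \<Omega> (pd\<^sub>0 n s) v\<^sub>0 = poly (pderiv P0) s"
      unfolding piece_deriv_def[OF open\<Omega> bdd fin cover mesh k1 pc0] P0_def
      using V.B_sum[of "{..k}" "a\<^sub>0 n" v\<^sub>0 "\<lambda>j. real j * s ^ (j - 1)"] a0[OF n] v(1)
      by (simp add: sum_pderiv pderiv_monom poly_sum poly_monom mult_ac)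
    moreover have "L2_inner \<Omega> (pd\<^sub>1 n s) v\<^sub>1 = poly (pderiv P1) s"
      unfolding piece_deriv_def[OF open\<Omega> bdd fin cover mesh k1 pc1] P1_def
      using V.B_sum[of "{..k}" "a\<^sub>1 n" v\<^sub>1 "\<lambda>j. real j * s ^ (j - 1)"] a1[OF n] v(2)
      by (simp add: sum_pderiv pderiv_monom poly_sum poly_monom mult_ac)
    moreover have "L2_inner \<Omega> (w\<^sub>1 s) v\<^sub>0 = poly Q1 s"
      unfolding w1[OF n s] Q1_def using V.B_sum[of "{..k}" "a\<^sub>1 n" v\<^sub>0 "\<lambda>j. s ^ j"] a1[OF n] v(1)
      by (simp add: poly_sum poly_monom mult.commute)
    moreover have "grad_inner \<Omega> (w\<^sub>0 s) v\<^sub>1 = poly Q0 s"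
      unfolding w0[OF n s] Q0_def using VG.B_sum[of "{..k}" "a\<^sub>0 n" v\<^sub>1 "\<lambda>j. s ^ j"] a0[OF n] v(2)
      by (simp add: poly_sum poly_monom mult.commute)
    ultimately show ?thesis by (simp add: g_def)
  qed
  have "poly g (lobatto_point k t n \<mu>) - L2_inner \<Omega> (f (lobatto_point k t n \<mu>)) v\<^sub>1
      = (poly g (t (n - 1)) - L2_inner \<Omega> (f (t (n - 1))) v\<^sub>1) * poly (pderiv (lift_poly k t n)) (lobatto_point k t n \<mu>)"
  proof (rule galerkin_residual[OF k1 st dg _ \<mu>])
    fix \<psi> :: "real poly" assume \<psi>: "degree \<psi> < k"
    have "integral ?I (\<lambda>s. poly g s * poly \<psi> s) = integral ?I (\<lambda>s. (L2_inner \<Omega> (pd\<^sub>0 n s) v\<^sub>0 - L2_inner \<Omega> (w\<^sub>1 s) v\<^sub>0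
      + L2_inner \<Omega> (pd\<^sub>1 n s) v\<^sub>1 + grad_inner \<Omega> (w\<^sub>0 s) v\<^sub>1) * poly \<psi> s)"
      by (intro Henstock_Kurzweil_Integration.integral_cong) (simp add: g)
    then show "integral ?I (\<lambda>s. poly g s * poly \<psi> s) = lobatto_quad k t n (\<lambda>s. L2_inner \<Omega> (f s) v\<^sub>1 * poly \<psi> s)"
      unfolding scheme_tested[OF n v \<psi>] .
  qed
  moreover have "t (n - 1) \<in> ?I" using st by simp
  ultimately show ?thesis using g node_in(1)[OF n \<mu>] by (simp add: res_def)
qed

text \<open>The value \<open>P\<^sub>hf - A\<^sub>hw\<^sub>0\<close> that the second equation of the semidiscrete problem
  prescribes for \<open>\<partial>\<^sub>tw\<^sub>1\<close>.\<close>
definition Zv :: "real \<Rightarrow> 'd field" where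
  "Zv s = (\<lambda>x. L2_proj \<Omega> \<W> (f s) x - discrete_laplace \<Omega> \<W> (w\<^sub>0 s) x)"

lemma Zv_V: "s \<in> {0..T} \<Longrightarrow> Zv s \<in> \<W>"
  unfolding Zv_def
  by (intro V.diff L2_proj(1)[OF open\<Omega> bdd fin cover] discrete_laplace(1)[OF open\<Omega> bdd fin cover] fL FE_in(2) w_in(1))

lemma Zv_inner: "s \<in> {0..T} \<Longrightarrow> \<phi> \<in> \<W> \<Longrightarrow> L2_inner \<Omega> (Zv s) \<phi> = L2_inner \<Omega> (f s) \<phi> - grad_inner \<Omega> (w\<^sub>0 s) \<phi>"
proof -
  assume s: "s \<in> {0..T}" and \<phi>: "\<phi> \<in> \<W>"
  note h = FE_in(2)[OF w_in(1)[OF s]]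
  show ?thesis unfolding Zv_def
    using V.B_diff[OF L2_proj(1)[OF open\<Omega> bdd fin cover fL[OF s]] discrete_laplace(1)[OF open\<Omega> bdd fin cover h] \<phi>]
      L2_proj(2)[OF open\<Omega> bdd fin cover fL[OF s] \<phi>] discrete_laplace(2)[OF open\<Omega> bdd fin cover h \<phi>] by simp
qed

text \<open>The tested residuals satisfy these equations for every finite element function, and an element of the space is
  determined by its inner products.\<close>
lemma residual_functions:
  assumes n: "n \<in> {1..N}" and \<mu>: "\<mu> \<le> k"
  defines "p \<equiv> lobatto_point k t n \<mu>" and "\<theta> \<equiv> poly (pderiv (lift_poly k t n)) (lobatto_point k t n \<mu>)"
  shows "pd\<^sub>0 n p x - w\<^sub>1 p x = (pd\<^sub>0 n (t (n - 1)) x - w\<^sub>1 (t (n - 1)) x) * \<theta>"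
    and "pd\<^sub>1 n p x - Zv p x = (pd\<^sub>1 n (t (n - 1)) x - Zv (t (n - 1)) x) * \<theta>"
proof -
  have p: "p \<in> {0..T}" unfolding p_def by (rule node_in(2)[OF n \<mu>])
  have q: "t (n - 1) \<in> {0..T}" using time_mesh_sub[OF mesh n] time_mesh_step[OF mesh n] by auto
  note pV = piece_deriv_V[OF open\<Omega> bdd fin cover mesh k1 pc0 n] piece_deriv_V[OF open\<Omega> bdd fin cover mesh k1 pc1 n]
  have z: "grad_inner \<Omega> v (\<lambda>_. 0) = 0" "L2_inner \<Omega> v (\<lambda>_. 0) = 0" "L2_inner \<Omega> v' (\<lambda>_. 0) = 0" if "v \<in> \<W>" "v' \<in> L2_space \<Omega>" for v v'
    using V.sym[OF that(1) V.zero] VG.sym[OF that(1) V.zero] V.B_zero[OF that(1)] VG.B_zero[OF that(1)]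
      L.sym[OF that(2) L.zero] L.B_zero[OF that(2)] by simp_all
  have "(\<lambda>x. pd\<^sub>0 n p x - w\<^sub>1 p x) = (\<lambda>x. \<theta> * (pd\<^sub>0 n (t (n - 1)) x - w\<^sub>1 (t (n - 1)) x))"
  proof (rule FE_eqI[OF open\<Omega> bdd fin cover])
    show a: "(\<lambda>x. pd\<^sub>0 n p x - w\<^sub>1 p x) \<in> \<W>" by (intro V.diff pV w_in p)
    have b: "(\<lambda>x. pd\<^sub>0 n (t (n - 1)) x - w\<^sub>1 (t (n - 1)) x) \<in> \<W>" by (intro V.diff pV w_in q)
    then show "(\<lambda>x. \<theta> * (pd\<^sub>0 n (t (n - 1)) x - w\<^sub>1 (t (n - 1)) x)) \<in> \<W>" by (rule V.scale)
    fix \<phi> assume \<phi>: "\<phi> \<in> \<W>"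
    have "L2_inner \<Omega> (pd\<^sub>0 n p) \<phi> - L2_inner \<Omega> (w\<^sub>1 p) \<phi>
        = (L2_inner \<Omega> (pd\<^sub>0 n (t (n - 1))) \<phi> - L2_inner \<Omega> (w\<^sub>1 (t (n - 1))) \<phi>) * \<theta>"
      using scheme_residual[OF n \<mu> \<phi> V.zero] z(2)[OF pV(2) fL[OF p]] z(1)[OF w_in(1)[OF p] fL[OF p]] z(3)[OF V.zero fL[OF p]]
        z(1)[OF w_in(1)[OF q] fL[OF q]] z(3)[OF V.zero fL[OF q]] unfolding p_def \<theta>_def by simp
    then show "L2_inner \<Omega> (\<lambda>x. pd\<^sub>0 n p x - w\<^sub>1 p x) \<phi> = L2_inner \<Omega> (\<lambda>x. \<theta> * (pd\<^sub>0 n (t (n - 1)) x - w\<^sub>1 (t (n - 1)) x)) \<phi>"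
      unfolding V.B_scale[OF b \<phi>] V.B_diff[OF pV(1) w_in(2)[OF p] \<phi>] V.B_diff[OF pV(1) w_in(2)[OF q] \<phi>] by simp
  qed
  from fun_cong[OF this, of x] show "pd\<^sub>0 n p x - w\<^sub>1 p x = (pd\<^sub>0 n (t (n - 1)) x - w\<^sub>1 (t (n - 1)) x) * \<theta>" by simp
  have "(\<lambda>x. pd\<^sub>1 n p x - Zv p x) = (\<lambda>x. \<theta> * (pd\<^sub>1 n (t (n - 1)) x - Zv (t (n - 1)) x))"
  proof (rule FE_eqI[OF open\<Omega> bdd fin cover])
    show a: "(\<lambda>x. pd\<^sub>1 n p x - Zv p x) \<in> \<W>" by (intro V.diff pV Zv_V p)
    have b: "(\<lambda>x. pd\<^sub>1 n (t (n - 1)) x - Zv (t (n - 1)) x) \<in> \<W>" by (intro V.diff pV Zv_V q)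
    then show "(\<lambda>x. \<theta> * (pd\<^sub>1 n (t (n - 1)) x - Zv (t (n - 1)) x)) \<in> \<W>" by (rule V.scale)
    fix \<phi> assume \<phi>: "\<phi> \<in> \<W>"
    have "L2_inner \<Omega> (pd\<^sub>1 n p) \<phi> - L2_inner \<Omega> (Zv p) \<phi>
        = (L2_inner \<Omega> (pd\<^sub>1 n (t (n - 1))) \<phi> - L2_inner \<Omega> (Zv (t (n - 1))) \<phi>) * \<theta>"
      using scheme_residual[OF n \<mu> V.zero \<phi>] z(2)[OF pV(1) fL[OF p]] z(2)[OF w_in(2)[OF p] fL[OF p]] z(2)[OF w_in(2)[OF q] fL[OF q]]
        Zv_inner[OF p \<phi>] Zv_inner[OF q \<phi>] unfolding p_def \<theta>_def by (simp add: left_diff_distrib distrib_right)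
    then show "L2_inner \<Omega> (\<lambda>x. pd\<^sub>1 n p x - Zv p x) \<phi> = L2_inner \<Omega> (\<lambda>x. \<theta> * (pd\<^sub>1 n (t (n - 1)) x - Zv (t (n - 1)) x)) \<phi>"
      unfolding V.B_scale[OF b \<phi>] V.B_diff[OF pV(2) Zv_V[OF p] \<phi>] V.B_diff[OF pV(2) Zv_V[OF q] \<phi>] by simp
  qed
  from fun_cong[OF this, of x] show "pd\<^sub>1 n p x - Zv p x = (pd\<^sub>1 n (t (n - 1)) x - Zv (t (n - 1)) x) * \<theta>" by simp
qed

end


text \<open>Everything that the error analysis needs to know about the discrete solution. The initial value prescribed for the
  derivative of the lifting is \<open>(w\<^sub>1(0), Z(0))\<close>, which makes the first interval no exception.\<close>
lemma lifted_collocation: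
  fixes w\<^sub>0 w\<^sub>1 f :: "real \<Rightarrow> 'd field"
  assumes mesh: "time_mesh T N t" and k1: "1 \<le> k"
    and fL: "\<forall>s\<in>{0..T}. f s \<in> L2_space \<Omega>"
    and fds: "fully_discrete_solution \<Omega> \<W> k N t f U\<^sub>0 w\<^sub>0 w\<^sub>1"
  defines "D\<^sub>0 \<equiv> lift_init \<Omega> \<W> f U\<^sub>0"
  obtains Z where "\<And>s. s \<in> {0..T} \<Longrightarrow> w\<^sub>0 s \<in> \<W>" "\<And>s. s \<in> {0..T} \<Longrightarrow> w\<^sub>1 s \<in> \<W>" "\<And>s. s \<in> {0..T} \<Longrightarrow> Z s \<in> \<W>"
    "(w\<^sub>0 0, w\<^sub>1 0) = U\<^sub>0"
    "\<And>s \<phi>. s \<in> {0..T} \<Longrightarrow> \<phi> \<in> \<W> \<Longrightarrow> L2_inner \<Omega> (Z s) \<phi> = L2_inner \<Omega> (f s) \<phi> - grad_inner \<Omega> (w\<^sub>0 s) \<phi>"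
    "\<And>n \<mu> x. n \<in> {1..N} \<Longrightarrow> \<mu> \<le> k \<Longrightarrow> w\<^sub>0 (lobatto_point k t n \<mu>) x - w\<^sub>0 (t (n - 1)) x
      = (t n - t (n - 1)) / 2 * (\<Sum>\<nu>\<le>k. rk k \<mu> \<nu> * w\<^sub>1 (lobatto_point k t n \<nu>) x)"
    "\<And>n \<mu> x. n \<in> {1..N} \<Longrightarrow> \<mu> \<le> k \<Longrightarrow> w\<^sub>1 (lobatto_point k t n \<mu>) x - w\<^sub>1 (t (n - 1)) x
      = (t n - t (n - 1)) / 2 * (\<Sum>\<nu>\<le>k. rk k \<mu> \<nu> * Z (lobatto_point k t n \<nu>) x)"
    "\<And>n y. n \<in> {1..N} \<Longrightarrow> y \<in> {-1..1} \<Longrightarrow> AE x in lebesgue_on \<Omega>.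
      time_deriv \<Omega> {0..T} (lifting \<Omega> k t (fst D\<^sub>0) w\<^sub>0) (poly (ref_map t n) y) x
        = (\<Sum>\<mu>\<le>k. poly (lagr k \<mu>) y * w\<^sub>1 (lobatto_point k t n \<mu>) x)"
    "\<And>n y. n \<in> {1..N} \<Longrightarrow> y \<in> {-1..1} \<Longrightarrow> AE x in lebesgue_on \<Omega>.
      time_deriv \<Omega> {0..T} (lifting \<Omega> k t (snd D\<^sub>0) w\<^sub>1) (poly (ref_map t n) y) x
        = (\<Sum>\<mu>\<le>k. poly (lagr k \<mu>) y * Z (lobatto_point k t n \<mu>) x)"
proof -
  have ct: "w\<^sub>0 \<in> cont_time_poly \<Omega> k N t \<W>" "w\<^sub>1 \<in> cont_time_poly \<Omega> k N t \<W>" and init: "(w\<^sub>0 0, w\<^sub>1 0) = U\<^sub>0"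
    using fds by (simp_all add: fully_discrete_solution_def)
  obtain a\<^sub>0 where pc0: "piecewise_poly \<W> k N t w\<^sub>0 a\<^sub>0"
    using cont_time_poly_pieces[OF open\<Omega> bdd fin cover mesh ct(1)] by blast
  obtain a\<^sub>1 where pc1: "piecewise_poly \<W> k N t w\<^sub>1 a\<^sub>1"
    using cont_time_poly_pieces[OF open\<Omega> bdd fin cover mesh ct(2)] by blast
  note env = mesh k1 pc0 pc1 fL fds
  define Z where "Z = Zv w\<^sub>0 f"
  have ZV: "Z s \<in> \<W>" if "s \<in> {0..T}" for s unfolding Z_def by (rule Zv_V[OF env that])
  have Zi: "L2_inner \<Omega> (Z s) \<phi> = L2_inner \<Omega> (f s) \<phi> - grad_inner \<Omega> (w\<^sub>0 s) \<phi>" if "s \<in> {0..T}" "\<phi> \<in> \<W>" for s \<phi>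
    unfolding Z_def by (rule Zv_inner[OF env that])
  have wV: "w\<^sub>0 s \<in> \<W>" "w\<^sub>1 s \<in> \<W>" if "s \<in> {0..T}" for s
    by (rule w_V[OF open\<Omega> bdd fin cover mesh k1 pc0 that], rule w_V[OF open\<Omega> bdd fin cover mesh k1 pc1 that])
  have T0: "0 \<in> {0..T}" using time_mesh_less[OF mesh, of 0 N] mesh by (auto simp: time_mesh_def)
  have i0: "fst D\<^sub>0 = w\<^sub>1 0"
  proof -
    have "L2_proj \<Omega> \<W> (\<lambda>_. 0) = (\<lambda>_. 0)"
    proof (rule FE_eqI[OF open\<Omega> bdd fin cover L2_proj(1)[OF open\<Omega> bdd fin cover L.zero] V.zero])
      fix \<phi> assume "\<phi> \<in> \<W>"
      from L2_proj(2)[OF open\<Omega> bdd fin cover L.zero this]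
      show "L2_inner \<Omega> (L2_proj \<Omega> \<W> (\<lambda>_. 0)) \<phi> = L2_inner \<Omega> (\<lambda>_. 0) \<phi>" .
    qed
    then show ?thesis unfolding D\<^sub>0_def lift_init_def discrete_wave_op_def init[symmetric] by simp
  qed
  have i1: "snd D\<^sub>0 = Z 0"
    unfolding D\<^sub>0_def lift_init_def discrete_wave_op_def init[symmetric] Z_def Zv_def[OF env] by simp
  have wV': "\<forall>s\<in>{0..T}. w\<^sub>1 s \<in> \<W>" and ZV': "\<forall>s\<in>{0..T}. Z s \<in> \<W>" using wV(2) ZV by blast+
  have r0: "\<forall>n\<in>{1..N}. \<forall>\<mu>\<le>k. \<forall>x. piece_deriv k a\<^sub>0 n (lobatto_point k t n \<mu>) x - w\<^sub>1 (lobatto_point k t n \<mu>) x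
      = (piece_deriv k a\<^sub>0 n (t (n - 1)) x - w\<^sub>1 (t (n - 1)) x) * poly (pderiv (lift_poly k t n)) (lobatto_point k t n \<mu>)"
    by (intro ballI allI impI residual_functions(1)[OF env])
  have r1: "\<forall>n\<in>{1..N}. \<forall>\<mu>\<le>k. \<forall>x. piece_deriv k a\<^sub>1 n (lobatto_point k t n \<mu>) x - Z (lobatto_point k t n \<mu>) x
      = (piece_deriv k a\<^sub>1 n (t (n - 1)) x - Z (t (n - 1)) x) * poly (pderiv (lift_poly k t n)) (lobatto_point k t n \<mu>)"
    unfolding Z_def by (intro ballI allI impI residual_functions(2)[OF env])
  note c0 = open\<Omega> bdd fin cover mesh k1 pc0 wV' i0 r0
  note c1 = open\<Omega> bdd fin cover mesh k1 pc1 ZV' i1 r1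
  show thesis
  proof (rule that[OF wV(1) wV(2) ZV init Zi])
    fix n \<mu> x assume n: "n \<in> {1..N}" "\<mu> \<le> k"
    show "w\<^sub>0 (lobatto_point k t n \<mu>) x - w\<^sub>0 (t (n - 1)) x
      = (t n - t (n - 1)) / 2 * (\<Sum>\<nu>\<le>k. rk k \<mu> \<nu> * w\<^sub>1 (lobatto_point k t n \<nu>) x)"
      by (rule lift_deriv_increment[OF c0 n])
    show "w\<^sub>1 (lobatto_point k t n \<mu>) x - w\<^sub>1 (t (n - 1)) x
      = (t n - t (n - 1)) / 2 * (\<Sum>\<nu>\<le>k. rk k \<mu> \<nu> * Z (lobatto_point k t n \<nu>) x)"
      by (rule lift_deriv_increment[OF c1 n])
  next
    fix n and y :: real assume n: "n \<in> {1..N}" and y: "y \<in> {-1..1}"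
    have s: "poly (ref_map t n) y \<in> {t (n - 1)..t n}" by (rule ref_map(4)[of t n, OF time_mesh_step[OF mesh n] y])
    from lifting_time_deriv(1)[OF c0 n s] show "AE x in lebesgue_on \<Omega>.
      time_deriv \<Omega> {0..T} (lifting \<Omega> k t (fst D\<^sub>0) w\<^sub>0) (poly (ref_map t n) y) x
        = (\<Sum>\<mu>\<le>k. poly (lagr k \<mu>) y * w\<^sub>1 (lobatto_point k t n \<mu>) x)"
      unfolding lift_deriv_interp[OF c0 n] .
    from lifting_time_deriv(1)[OF c1 n s] show "AE x in lebesgue_on \<Omega>.
      time_deriv \<Omega> {0..T} (lifting \<Omega> k t (snd D\<^sub>0) w\<^sub>1) (poly (ref_map t n) y) x
        = (\<Sum>\<mu>\<le>k. poly (lagr k \<mu>) y * Z (lobatto_point k t n \<mu>) x)"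
      unfolding lift_deriv_interp[OF c1 n] .
  qed
qed

end

section \<open>The error estimate\<close>

text \<open>Duality with the error itself: the scalar estimate applies to the inner product of the curve with the fixed vector
  \<open>\<phi>\<close>, its interpolation error, and the estimate is linear in the norm of \<open>\<phi>\<close>.\<close>
lemma (in semi_inner) nrm_interp_error:
  fixes g :: "nat \<Rightarrow> real \<Rightarrow> 'a \<Rightarrow> real"
  assumes k: "k \<ge> 1" and ab: "a < b"
    and gV: "\<And>i s. i \<le> Suc k \<Longrightarrow> s \<in> {a..b} \<Longrightarrow> g i s \<in> V"
    and der: "\<And>\<phi> i s. \<phi> \<in> V \<Longrightarrow> i \<le> k \<Longrightarrow> s \<in> {a..b} \<Longrightarrow>
      ((\<lambda>s. B (g i s) \<phi>) has_real_derivative B (g (Suc i) s) \<phi>) (at s within {a..b})"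
    and M: "\<And>s. s \<in> {a..b} \<Longrightarrow> nrm (g (Suc k) s) \<le> M"
    and x: "x \<in> {-1..1}"
  defines "\<sigma> \<equiv> \<lambda>x. (a + b) / 2 + (b - a) / 2 * x"
  shows "nrm (\<lambda>z. g 0 (\<sigma> x) z - (\<Sum>\<mu>\<le>k. poly (lagr k \<mu>) x * g 0 (\<sigma> (lobatto_node k \<mu>)) z))
    \<le> (1 + (real k + 1) * lagr_bound k) * (M * (b - a) ^ (k + 1))"
proof -
  define S where "S = (\<lambda>z. \<Sum>\<mu>\<le>k. poly (lagr k \<mu>) x * g 0 (\<sigma> (lobatto_node k \<mu>)) z)"
  define \<phi> where "\<phi> = (\<lambda>z. g 0 (\<sigma> x) z - S z)"
  let ?L = "1 + (real k + 1) * lagr_bound k"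
  have \<sigma>: "\<sigma> y \<in> {a..b}" if "y \<in> {-1..1}" for y unfolding \<sigma>_def by (rule affine_ref_in[OF ab that])
  have nV: "g 0 (\<sigma> (lobatto_node k \<mu>)) \<in> V" if "\<mu> \<in> {..k}" for \<mu>
    using gV \<sigma> lobatto_node_root(2)[OF k] that by auto
  have gx: "g 0 (\<sigma> x) \<in> V" using gV \<sigma> x by auto
  have SV: "S \<in> V" unfolding S_def by (rule sum_closed[OF finite_atMost nV])
  have \<phi>V: "\<phi> \<in> V" unfolding \<phi>_def by (rule diff[OF gx SV])
  have "B \<phi> \<phi> = B (g 0 (\<sigma> x)) \<phi> - (\<Sum>\<mu>\<le>k. poly (lagr k \<mu>) x * B (g 0 (\<sigma> (lobatto_node k \<mu>))) \<phi>)"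
    using B_diff[OF gx SV \<phi>V] B_sum[OF finite_atMost nV \<phi>V] by (simp add: \<phi>_def S_def)
  also have "\<bar>\<dots>\<bar> \<le> ?L * ((M * nrm \<phi>) * (b - a) ^ (k + 1))"
    unfolding \<sigma>_def
  proof (rule interp_error[where g = "\<lambda>i s. B (g i s) \<phi>", OF k ab _ _ x])
    show "((\<lambda>s. B (g i s) \<phi>) has_real_derivative B (g (Suc i) s) \<phi>) (at s within {a..b})" if "i \<le> k" "s \<in> {a..b}" for i s
      by (rule der[OF \<phi>V that])
    fix s assume s: "s \<in> {a..b}"
    have "\<bar>B (g (Suc k) s) \<phi>\<bar> \<le> nrm (g (Suc k) s) * nrm \<phi>" by (rule cauchy_schwarz[OF gV[OF order.refl s] \<phi>V])
    also have "\<dots> \<le> M * nrm \<phi>" by (rule mult_right_mono[OF M[OF s] nrm_nonneg[OF \<phi>V]])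
    finally show "\<bar>B (g (Suc k) s) \<phi>\<bar> \<le> M * nrm \<phi>" .
  qed
  finally have "nrm \<phi> * nrm \<phi> \<le> ?L * (M * (b - a) ^ (k + 1)) * nrm \<phi>"
    using nonneg[OF \<phi>V] nrm_sq[OF \<phi>V] by (simp add: power2_eq_square mult_ac)
  moreover have "0 \<le> ?L * (M * (b - a) ^ (k + 1))"
  proof -
    have "a \<in> {a..b}" using ab by simp
    then have "0 \<le> M" using order.trans[OF nrm_nonneg M] gV[OF order.refl] by blast
    then show ?thesis using ab lagr_bound(1)[of k] by simp
  qed
  ultimately have "nrm \<phi> \<le> ?L * (M * (b - a) ^ (k + 1))"
    using nrm_nonneg[OF \<phi>V] by (cases "nrm \<phi> = 0") (auto dest: mult_right_le_imp_le)
  then show ?thesis by (simp only: \<phi>_def S_def)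
qed

lemma mesh_size_bounds:
  fixes \<T> :: "'d::finite mesh"
  assumes "finite \<T>" "\<T> \<noteq> {}" "(\<Union>F\<in>\<T>. F ` cbox 0 1) = closure \<Omega>" "bounded \<Omega>"
  shows "0 \<le> mesh_size \<T>" "mesh_size \<T> \<le> diameter (closure \<Omega>)"
proof -
  have "mesh_size \<T> \<in> (\<lambda>F. diameter (F ` cbox 0 1)) ` \<T>"
    unfolding mesh_size_def using assms(1,2) by (intro Max_in) auto
  then obtain F where F: "F \<in> \<T>" "mesh_size \<T> = diameter (F ` cbox 0 1)" by blast
  have sub: "F ` cbox 0 1 \<subseteq> closure \<Omega>" using F(1) unfolding assms(3)[symmetric] by blast
  have b: "bounded (closure \<Omega>)" using assms(4) by (rule bounded_closure)
  show "0 \<le> mesh_size \<T>" unfolding F(2) by (rule diameter_ge_0) (rule bounded_subset[OF b sub])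
  show "mesh_size \<T> \<le> diameter (closure \<Omega>)" unfolding F(2) by (rule diameter_subset[OF sub b])
qed

lemma time_mesh_size_bounds:
  assumes mesh: "time_mesh T N t"
  shows "n \<in> {1..N} \<Longrightarrow> t n - t (n - 1) \<le> time_mesh_size N t" "0 < time_mesh_size N t"
proof -
  show le: "t n - t (n - 1) \<le> time_mesh_size N t" if "n \<in> {1..N}" for n
    unfolding time_mesh_size_def by (rule Max_ge) (use that in auto)
  have "1 \<in> {1..N}" using mesh by (simp add: time_mesh_def)
  from le[OF this] time_mesh_step[OF mesh this] show "0 < time_mesh_size N t" by simp
qed

text \<open>The initial defect is propagated without growth, the defects of the steps add up to \<open>T\<close>, and one more
  factor leads from the beginning of an interval to its interior.\<close>
definition energy_const :: "real \<Rightarrow> real \<Rightarrow> real \<Rightarrow> nat \<Rightarrow> real" where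
  "energy_const d c T k = stab_const k * (1 + stab_const k * T + T) * ((1 + d) * quad_err_const k + c)"

lemma quad_err_const_nonneg: "0 \<le> quad_err_const k"
  unfolding quad_err_const_def by (intro add_nonneg_nonneg sum_nonneg) auto

text \<open>The three estimates with their constants. They involve the mesh only through \<open>\<tau>\<close> and
  \<open>h\<close>, and \<open>Ct\<close> and \<open>Cx\<close> are arbitrary bounds for derivatives of the exact
  solution.\<close>
lemma error_estimate:
  fixes \<Omega> :: "(real^'d::finite) set" and \<T> :: "'d mesh" and u f w\<^sub>0 w\<^sub>1 :: "real \<Rightarrow> 'd field"
  assumes open\<Omega>: "open \<Omega>" and bdd: "bounded \<Omega>" and fin: "finite \<T>" and ne: "\<T> \<noteq> {}"
    and cover: "(\<Union>F\<in>\<T>. F ` cbox 0 1) = closure \<Omega>"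
    and Tpos: "0 < T" and u: "u \<in> C_H_space \<Omega> {0..T} M M" and k1: "1 \<le> k" and Mk: "k + 4 \<le> M" and Mr: "r + 1 \<le> M"
    and uH10: "\<forall>s\<in>{0<..T}. u s \<in> H10_space \<Omega>" and f: "f \<in> C_H_space \<Omega> {0..T} 1 0"
    and pde: "\<forall>s\<in>{0<..T}. AE x in lebesgue_on \<Omega>. (time_deriv \<Omega> {0..T} ^^ 2) u s x - weak_laplace \<Omega> (u s) x = f s x"
    and u0: "AE x in lebesgue_on \<Omega>. u 0 x = u\<^sub>0 x"
    and u1: "AE x in lebesgue_on \<Omega>. time_deriv \<Omega> {0..T} u 0 x = u\<^sub>1 x"
    and ea: "elliptic_approx \<Omega> r C\<^sub>R \<T>" and mesh: "time_mesh T N t"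
  defines "R \<equiv> elliptic_proj \<Omega> (FE_space \<Omega> r \<T>)"
  assumes fds: "fully_discrete_solution \<Omega> (FE_space \<Omega> r \<T>) k N t f (R u\<^sub>0, R u\<^sub>1) w\<^sub>0 w\<^sub>1"
  defines "U \<equiv> \<lambda>j. (time_deriv \<Omega> {0..T} ^^ j) u"
    and "D\<^sub>0 \<equiv> lift_init \<Omega> (FE_space \<Omega> r \<T>) f (R u\<^sub>0, R u\<^sub>1)"
    and "\<tau> \<equiv> time_mesh_size N t" and "h \<equiv> mesh_size \<T>" and "d \<equiv> real CARD('d)" and "c \<equiv> \<bar>C\<^sub>R\<bar>"
    and "Lk \<equiv> (real k + 1) * lagr_bound k"
  assumes Ct: "0 \<le> Ct" "\<And>s. s \<in> {0..T} \<Longrightarrow> H_norm \<Omega> 1 (U (k + 3) s) \<le> Ct" "\<And>s. s \<in> {0..T} \<Longrightarrow> H_norm \<Omega> 2 (U (k + 2) s) \<le> Ct"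
    and Cx: "0 \<le> Cx" "\<And>j s. j \<in> {1, 2, 3} \<Longrightarrow> s \<in> {0..T} \<Longrightarrow> H_norm \<Omega> (r + 1) (U j s) \<le> Cx"
    and s: "s \<in> {0..T}"
  defines "X\<^sub>t \<equiv> \<tau> ^ (k + 1) * Ct" and "X\<^sub>x \<equiv> h ^ (r + 1) * Cx" and "X\<^sub>x' \<equiv> h ^ r * Cx"
    and "e\<^sub>0 \<equiv> \<lambda>x. U 1 s x - time_deriv \<Omega> {0..T} (lifting \<Omega> k t (fst D\<^sub>0) w\<^sub>0) s x"
    and "e\<^sub>1 \<equiv> \<lambda>x. U 2 s x - time_deriv \<Omega> {0..T} (lifting \<Omega> k t (snd D\<^sub>0) w\<^sub>1) s x"
    and "K \<equiv> energy_const d c T k"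
  assumes CP: "0 \<le> CP" "\<And>v. v \<in> H10_space \<Omega> \<Longrightarrow> L2_norm \<Omega> v \<le> CP * grad_norm \<Omega> v"
  shows "L2_norm \<Omega> e\<^sub>0 \<le> (1 + Lk) * X\<^sub>t + Lk * c * X\<^sub>x + CP * K * (X\<^sub>t + X\<^sub>x)"
    "L2_norm \<Omega> e\<^sub>1 \<le> (1 + Lk) * X\<^sub>t + Lk * c * X\<^sub>x + K * (X\<^sub>t + X\<^sub>x)"
    "grad_norm \<Omega> e\<^sub>0 \<le> (1 + Lk) * X\<^sub>t + Lk * c * X\<^sub>x' + K * (X\<^sub>t + X\<^sub>x)"
    "e\<^sub>0 \<in> L2_space \<Omega>" "e\<^sub>1 \<in> L2_space \<Omega>"
proof -
  define W where "W = FE_space \<Omega> r \<T>"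
  interpret L: semi_inner "L2_space \<Omega>" "L2_inner \<Omega>" by (rule L2_semi_inner[OF open\<Omega> bdd])
  interpret G: semi_inner "H_space \<Omega> 1" "grad_inner \<Omega>" by (rule grad_semi_inner[OF open\<Omega> bdd])
  interpret V: semi_inner W "L2_inner \<Omega>" unfolding W_def by (rule FE_L2_semi[OF open\<Omega> bdd fin cover])
  interpret VG: semi_inner W "grad_inner \<Omega>" unfolding W_def by (rule FE_grad_semi[OF open\<Omega> bdd fin cover])
  note nrmL = L_nrm[OF open\<Omega> bdd] and nrmG = G_nrm[OF open\<Omega> bdd]
  have M1: "1 \<le> M" "3 \<le> M" using Mk by auto
  note ctx = open\<Omega> bdd Tpos u M1(1) uH10
  have WL: "v \<in> W \<Longrightarrow> v \<in> L2_space \<Omega>" and WG: "v \<in> W \<Longrightarrow> v \<in> H_space \<Omega> 1" and W10: "v \<in> W \<Longrightarrow> v \<in> H10_space \<Omega>" for v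
    unfolding W_def using FE_L2[OF open\<Omega> bdd fin cover] FE_H1[OF open\<Omega> bdd fin cover] FE_H10[OF open\<Omega> bdd fin cover] by blast+
  have UX: "U j s \<in> H10_space \<Omega> \<inter> H_space \<Omega> M" if "j \<le> M" "s \<in> {0..T}" for j s
    unfolding U_def using D_H[OF ctx that] D_H10[OF ctx that] by blast
  have UH: "U j s \<in> H_space \<Omega> m" if "j \<le> M" "s \<in> {0..T}" "m \<le> M" for j s m
    using UX[OF that(1,2)] H_space_mono[OF that(3)] by blast
  have UL: "U j s \<in> L2_space \<Omega>" if "j \<le> M" "s \<in> {0..T}" for j s using H_space_L2[OF UH[OF that order.refl]] .
  have UG: "U j s \<in> H_space \<Omega> 1" if "j \<le> M" "s \<in> {0..T}" for j s using UH[OF that M1(1)] .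
  have hb: "0 \<le> h" unfolding h_def by (rule mesh_size_bounds[OF fin ne cover bdd])
  have \<tau>0: "0 < \<tau>" and \<tau>n: "\<And>n. n \<in> {1..N} \<Longrightarrow> t n - t (n - 1) \<le> \<tau>"
    unfolding \<tau>_def using time_mesh_size_bounds[OF mesh] by auto
  have c0: "0 \<le> c" and d0: "0 \<le> d" by (simp_all add: c_def d_def)
  have qc0: "0 \<le> quad_err_const k" by (rule quad_err_const_nonneg)
  have Xp: "0 \<le> X\<^sub>t" "0 \<le> X\<^sub>x" unfolding X\<^sub>t_def X\<^sub>x_def using \<tau>0 hb Ct Cx by auto
  have RW: "R v \<in> W" if "v \<in> H_space \<Omega> 1" for v unfolding R_def W_def by (rule elliptic_proj(1)[OF open\<Omega> bdd fin cover that])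
  have RG: "grad_inner \<Omega> (R v) \<phi> = grad_inner \<Omega> v \<phi>" if "v \<in> H_space \<Omega> 1" "\<phi> \<in> W" for v \<phi>
    using elliptic_proj(2)[OF open\<Omega> bdd fin cover that(1), of \<phi> r] that(2) unfolding R_def W_def .
  have Rerr: "L2_norm \<Omega> (\<lambda>x. v x - R v x) \<le> c * h ^ (r + 1) * H_norm \<Omega> (r + 1) v"
    "grad_norm \<Omega> (\<lambda>x. v x - R v x) \<le> c * h ^ r * H_norm \<Omega> (r + 1) v"
    if v: "v \<in> H10_space \<Omega> \<inter> H_space \<Omega> M" for v
  proof -
    have v1: "v \<in> H_space \<Omega> 1" using v H_space_mono[OF M1(1)] by blast
    have vr: "v \<in> H10_space \<Omega> \<inter> H_space \<Omega> (r + 1)" using v H_space_mono[OF Mr] by blast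
    have z: "(\<lambda>x. v x - R v x) \<in> H_space \<Omega> 1" by (rule G.diff[OF v1 WG[OF RW[OF v1]]])
    have H0: "0 \<le> H_norm \<Omega> (r + 1) v" unfolding H_norm_def by (simp add: sum_nonneg)
    have le: "C\<^sub>R * x * H_norm \<Omega> (r + 1) v \<le> c * x * H_norm \<Omega> (r + 1) v" if "0 \<le> x" for x
      using H0 that by (intro mult_right_mono) (auto simp: c_def)
    have a: "H_norm \<Omega> m (\<lambda>x. v x - R v x) \<le> C\<^sub>R * h ^ (r + 1 - m) * H_norm \<Omega> (r + 1) v" if "m \<in> {0, 1}" for m
      using bspec[OF bspec[OF ea[unfolded elliptic_approx_def] vr] that] unfolding R_def h_def .
    from a[of 0] le[of "h ^ (r + 1)"] hb H_norm_0[OF open\<Omega> bdd H_space_L2[OF z]]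
    show "L2_norm \<Omega> (\<lambda>x. v x - R v x) \<le> c * h ^ (r + 1) * H_norm \<Omega> (r + 1) v" by simp
    from a[of 1] le[of "h ^ r"] hb grad_norm_le_H_norm[OF open\<Omega> bdd z]
    show "grad_norm \<Omega> (\<lambda>x. v x - R v x) \<le> c * h ^ r * H_norm \<Omega> (r + 1) v" by simp
  qed
  have RerrU: "L2_norm \<Omega> (\<lambda>x. U j s x - R (U j s) x) \<le> c * X\<^sub>x" "grad_norm \<Omega> (\<lambda>x. U j s x - R (U j s) x) \<le> c * X\<^sub>x'"
    if j: "j \<in> {1, 2, 3}" and s: "s \<in> {0..T}" for j s
  proof -
    have jM: "j \<le> M" using j M1 by auto
    have "c * h ^ i * H_norm \<Omega> (r + 1) (U j s) \<le> c * h ^ i * Cx" for i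
      using Cx(2)[OF j s] c0 hb by (intro mult_left_mono) auto
    from order.trans[OF Rerr(1)[OF UX[OF jM s]] this] order.trans[OF Rerr(2)[OF UX[OF jM s]] this]
    show "L2_norm \<Omega> (\<lambda>x. U j s x - R (U j s) x) \<le> c * X\<^sub>x" "grad_norm \<Omega> (\<lambda>x. U j s x - R (U j s) x) \<le> c * X\<^sub>x'"
      by (simp_all add: X\<^sub>x_def X\<^sub>x'_def mult.assoc)
  qed
  have fL: "\<forall>s\<in>{0..T}. f s \<in> L2_space \<Omega>"
    using wave_weak_form(2)[OF ctx M1(2) f pde _ test_H10[OF open\<Omega> bdd test_zero]] by blast
  obtain Z where w0V': "\<And>s. s \<in> {0..T} \<Longrightarrow> w\<^sub>0 s \<in> FE_space \<Omega> r \<T>" and w1V': "\<And>s. s \<in> {0..T} \<Longrightarrow> w\<^sub>1 s \<in> FE_space \<Omega> r \<T>"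
    and ZV': "\<And>s. s \<in> {0..T} \<Longrightarrow> Z s \<in> FE_space \<Omega> r \<T>"
    and init: "(w\<^sub>0 0, w\<^sub>1 0) = (R u\<^sub>0, R u\<^sub>1)"
    and Zi': "\<And>s \<phi>. s \<in> {0..T} \<Longrightarrow> \<phi> \<in> FE_space \<Omega> r \<T> \<Longrightarrow> L2_inner \<Omega> (Z s) \<phi> = L2_inner \<Omega> (f s) \<phi> - grad_inner \<Omega> (w\<^sub>0 s) \<phi>"
    and inc0: "\<And>n \<mu> x. n \<in> {1..N} \<Longrightarrow> \<mu> \<le> k \<Longrightarrow> w\<^sub>0 (lobatto_point k t n \<mu>) x - w\<^sub>0 (t (n - 1)) x
      = (t n - t (n - 1)) / 2 * (\<Sum>\<nu>\<le>k. rk k \<mu> \<nu> * w\<^sub>1 (lobatto_point k t n \<nu>) x)"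
    and inc1: "\<And>n \<mu> x. n \<in> {1..N} \<Longrightarrow> \<mu> \<le> k \<Longrightarrow> w\<^sub>1 (lobatto_point k t n \<mu>) x - w\<^sub>1 (t (n - 1)) x
      = (t n - t (n - 1)) / 2 * (\<Sum>\<nu>\<le>k. rk k \<mu> \<nu> * Z (lobatto_point k t n \<nu>) x)"
    and dt0: "\<And>n y. n \<in> {1..N} \<Longrightarrow> y \<in> {-1..1} \<Longrightarrow> AE x in lebesgue_on \<Omega>.
      time_deriv \<Omega> {0..T} (lifting \<Omega> k t (fst D\<^sub>0) w\<^sub>0) (poly (ref_map t n) y) x
        = (\<Sum>\<mu>\<le>k. poly (lagr k \<mu>) y * w\<^sub>1 (lobatto_point k t n \<mu>) x)"
    and dt1: "\<And>n y. n \<in> {1..N} \<Longrightarrow> y \<in> {-1..1} \<Longrightarrow> AE x in lebesgue_on \<Omega>.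
      time_deriv \<Omega> {0..T} (lifting \<Omega> k t (snd D\<^sub>0) w\<^sub>1) (poly (ref_map t n) y) x
        = (\<Sum>\<mu>\<le>k. poly (lagr k \<mu>) y * Z (lobatto_point k t n \<mu>) x)"
    unfolding D\<^sub>0_def
  proof (rule lifted_collocation[OF open\<Omega> bdd fin cover mesh k1 fL fds], goal_cases)
    case (1 Z)
    show ?case by (rule 1(1)[of Z], (fact 1(2-))+)
  qed
  note w0V = w0V'[folded W_def] and w1V = w1V'[folded W_def] and ZV = ZV'[folded W_def] and Zi = Zi'[folded W_def]
  have Zi2: "L2_inner \<Omega> (Z s) \<phi> = L2_inner \<Omega> (U 2 s) \<phi> + grad_inner \<Omega> (U 0 s) \<phi> - grad_inner \<Omega> (w\<^sub>0 s) \<phi>"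
    if "s \<in> {0..T}" "\<phi> \<in> W" for s \<phi>
    using Zi[OF that] wave_weak_form(1)[OF ctx M1(2) f pde that(1) W10[OF that(2)]] by (simp add: U_def)
  define E0 where "E0 s = (\<lambda>x. R (U 1 s) x - w\<^sub>1 s x)" for s
  define E1 where "E1 s = (\<lambda>x. R (U 2 s) x - Z s x)" for s
  have RU: "R (U j s) \<in> W" if "j \<le> M" "s \<in> {0..T}" for j s by (rule RW[OF UG[OF that]])
  have EV: "E0 s \<in> W" "E1 s \<in> W" if "s \<in> {0..T}" for s
    unfolding E0_def E1_def using M1 by (intro V.diff RU w1V ZV that; simp)+
  have E0g: "grad_inner \<Omega> (E0 s) \<phi> = grad_inner \<Omega> (U 1 s) \<phi> - grad_inner \<Omega> (w\<^sub>1 s) \<phi>" if "s \<in> {0..T}" "\<phi> \<in> W" for s \<phi>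
    unfolding E0_def using VG.B_diff[OF RU[OF M1(1) that(1)] w1V[OF that(1)] that(2)] RG[OF UG[OF M1(1) that(1)] that(2)] by simp
  have M2: "2 \<le> M" "0 \<le> M" using M1 by auto
  have E1g: "grad_inner \<Omega> (E1 s) \<phi> = grad_inner \<Omega> (U 2 s) \<phi> - grad_inner \<Omega> (Z s) \<phi>" if "s \<in> {0..T}" "\<phi> \<in> W" for s \<phi>
    unfolding E1_def using VG.B_diff[OF RU[OF M2(1) that(1)] ZV[OF that(1)] that(2)] RG[OF UG[OF M2(1) that(1)] that(2)] by simp
  \<comment> \<open>The part of the elliptic projection error that the weak form sees. It is linear in \<open>v\<close>, so its increments in
    time are controlled by the projection error of \<open>\<partial>\<^sub>t\<^sup>3u\<close>, with a factor equal to the length of the step.\<close>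
  define \<Lambda> where "\<Lambda> \<phi> v = L2_inner \<Omega> (\<lambda>x. v x - R v x) \<phi>" for \<phi> v
  have E1L: "L2_inner \<Omega> (E1 s) \<phi> = - \<Lambda> \<phi> (U 2 s) - grad_inner \<Omega> (U 0 s) \<phi> + grad_inner \<Omega> (w\<^sub>0 s) \<phi>"
    if "s \<in> {0..T}" "\<phi> \<in> W" for s \<phi>
    unfolding E1_def \<Lambda>_def
    using V.B_diff[OF RU[OF M2(1) that(1)] ZV[OF that(1)] that(2)] Zi2[OF that]
      L.B_diff[OF UL[OF M2(1) that(1)] WL[OF RU[OF M2(1) that(1)]] WL[OF that(2)]] by simp
  define B where "B = (1 + d) * quad_err_const k * X\<^sub>t + c * X\<^sub>x"
  have B0: "0 \<le> B" unfolding B_def using Xp c0 d0 qc0 by (intro add_nonneg_nonneg mult_nonneg_nonneg) auto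
  have cB: "c * X\<^sub>x \<le> B" unfolding B_def using Xp d0 qc0 by simp
  have \<Lambda>der: "\<bar>\<Lambda> \<phi> (U 2 b) - \<Lambda> \<phi> (U 2 a)\<bar> \<le> (b - a) * (c * X\<^sub>x * L2_norm \<Omega> \<phi>)"
    if ab: "0 \<le> a" "a \<le> b" "b \<le> T" and \<phi>: "\<phi> \<in> W" for a b \<phi>
  proof -
    have N0: "0 \<le> L2_norm \<Omega> \<phi>" using V.nonneg[OF \<phi>] by (simp add: L2_norm_def)
    have X1: "v \<in> H_space \<Omega> 1" if "v \<in> H10_space \<Omega> \<inter> H_space \<Omega> M" for v using that H10_H1[OF open\<Omega> bdd] by blast
    have bnd: "\<bar>\<Lambda> \<phi> v\<bar> \<le> L2_norm \<Omega> (\<lambda>x. v x - R v x) * L2_norm \<Omega> \<phi>" if v: "v \<in> H10_space \<Omega> \<inter> H_space \<Omega> M" for v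
      unfolding \<Lambda>_def using L.cauchy_schwarz[OF L.diff[OF H_space_L2[OF X1[OF v]] WL[OF RW[OF X1[OF v]]]] WL[OF \<phi>]] by (simp add: nrmL)
    have der: "((\<lambda>s. \<Lambda> \<phi> (U 2 s)) has_real_derivative \<Lambda> \<phi> (U 3 s)) (at s within {0..T})" if s: "s \<in> {0..T}" for s
      unfolding U_def numeral_3_eq_3 numeral_2_eq_2
    proof (rule functional_deriv[OF ctx _ _ _ s, where K = "c * h ^ (r + 1) * L2_norm \<Omega> \<phi>"])
      show "Suc (Suc 0) < M" using M1 by simp
      fix v w :: "'d field" and a b :: real
      assume v: "v \<in> H10_space \<Omega> \<inter> H_space \<Omega> M"
      have "\<bar>\<Lambda> \<phi> v\<bar> \<le> L2_norm \<Omega> (\<lambda>x. v x - R v x) * L2_norm \<Omega> \<phi>" by (rule bnd[OF v])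
      also have "\<dots> \<le> (c * h ^ (r + 1) * H_norm \<Omega> M v) * L2_norm \<Omega> \<phi>"
      proof (rule mult_right_mono[OF order.trans[OF Rerr(1)[OF v]] N0])
        have "H_norm \<Omega> (r + 1) v \<le> H_norm \<Omega> M v" by (rule H_norm_mono[OF open\<Omega> bdd _ Mr]) (use v in blast)
        then show "c * h ^ (r + 1) * H_norm \<Omega> (r + 1) v \<le> c * h ^ (r + 1) * H_norm \<Omega> M v"
          using c0 hb by (intro mult_left_mono) auto
      qed
      finally show "\<bar>\<Lambda> \<phi> v\<bar> \<le> c * h ^ (r + 1) * L2_norm \<Omega> \<phi> * H_norm \<Omega> M v" by (simp add: mult_ac)
      assume w: "w \<in> H10_space \<Omega> \<inter> H_space \<Omega> M"
      have Rl: "R (\<lambda>x. a * v x + b * w x) = (\<lambda>x. a * R v x + b * R w x)"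
        unfolding R_def by (rule elliptic_proj_lin[OF open\<Omega> bdd fin cover X1[OF v] X1[OF w]])
      have e: "(\<lambda>x. (a * v x + b * w x) - R (\<lambda>x. a * v x + b * w x) x) = (\<lambda>x. a * (v x - R v x) + b * (w x - R w x))"
        unfolding Rl by (auto simp: algebra_simps)
      show "\<Lambda> \<phi> (\<lambda>x. a * v x + b * w x) = a * \<Lambda> \<phi> v + b * \<Lambda> \<phi> w"
        unfolding \<Lambda>_def e
        by (intro L.bil L.diff H_space_L2[OF X1] WL RW X1 v w \<phi>)
    qed
    have "norm (\<Lambda> \<phi> (U 2 b) - \<Lambda> \<phi> (U 2 a)) \<le> (c * X\<^sub>x * L2_norm \<Omega> \<phi>) * norm (b - a)"
    proof (rule field_differentiable_bound[of "{a..b}" _ "\<lambda>s. \<Lambda> \<phi> (U 3 s)"])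
      fix s assume "s \<in> {a..b}"
      then have s: "s \<in> {0..T}" using ab by auto
      show "((\<lambda>s. \<Lambda> \<phi> (U 2 s)) has_real_derivative \<Lambda> \<phi> (U 3 s)) (at s within {a..b})"
        by (rule DERIV_subset[OF der[OF s]]) (use ab in auto)
      show "norm (\<Lambda> \<phi> (U 3 s)) \<le> c * X\<^sub>x * L2_norm \<Omega> \<phi>"
        using order.trans[OF bnd[OF UX[OF M1(2) s]] mult_right_mono[OF RerrU(1)[of 3 s] N0]] s by simp
    qed (use ab in auto)
    then show ?thesis using ab by (simp add: mult.commute)
  qed
  have gder: "((\<lambda>s. grad_inner \<Omega> (U j s) \<phi>) has_real_derivative grad_inner \<Omega> (U (Suc j) s) \<phi>) (at s within S)"
    if "\<phi> \<in> H_space \<Omega> 1" "j < M" "s \<in> {0..T}" "S \<subseteq> {0..T}" for j s \<phi> S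
    unfolding U_def by (rule DERIV_subset[OF grad_functional[OF ctx that(1-3)] that(4)])
  have lder: "((\<lambda>s. L2_inner \<Omega> (U j s) \<phi>) has_real_derivative L2_inner \<Omega> (U (Suc j) s) \<phi>) (at s within S)"
    if "\<phi> \<in> L2_space \<Omega>" "j < M" "s \<in> {0..T}" "S \<subseteq> {0..T}" for j s \<phi> S
    unfolding U_def by (rule DERIV_subset[OF L2_functional[OF ctx that(1-3)] that(4)])
  have pt: "lobatto_point k t n \<mu> \<in> {t (n - 1)..t n}" "lobatto_point k t n \<mu> \<in> {0..T}" if "n \<in> {1..N}" "\<mu> \<le> k" for n \<mu>
  proof -
    have st: "t (n - 1) < t n" by (rule time_mesh_step[OF mesh that(1)])
    show 1: "lobatto_point k t n \<mu> \<in> {t (n - 1)..t n}"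
      using ref_map(3,4)[of t n, OF st] lobatto_node_root(2)[OF k1 that(2)] by simp
    show "lobatto_point k t n \<mu> \<in> {0..T}" using time_mesh_sub[OF mesh that(1)] 1 by blast
  qed
  have tin: "t (n - 1) \<in> {0..T}" "t n \<in> {0..T}" if "n \<in> {1..N}" for n
    using time_mesh_sub[OF mesh that] time_mesh_step[OF mesh that] by auto
  \<comment> \<open>Consistency of the exact solution with the collocation rule. In \<open>cons1\<close> the test function is measured in
    \<open>L\<^sup>2\<close>, so Green's formula moves both derivatives to the exact solution; this is where its norm in \<open>H\<^sup>2\<close> enters.\<close>
  have Ctbound: "quad_err_const k * (Ct * y * (t n - t (n - 1)) ^ (k + 2)) \<le> (t n - t (n - 1)) * (quad_err_const k * X\<^sub>t * y)"
    if n: "n \<in> {1..N}" and y: "0 \<le> y" for n y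
  proof -
    define \<delta> where "\<delta> = t n - t (n - 1)"
    have \<delta>: "0 < \<delta>" "\<delta> \<le> \<tau>" using time_mesh_step[OF mesh n] \<tau>n[OF n] by (simp_all add: \<delta>_def)
    have "\<delta> ^ (k + 2) \<le> \<delta> * \<tau> ^ (k + 1)"
      using power_mono[OF \<delta>(2), of "k + 1"] \<delta>(1) by simp
    then have "quad_err_const k * (Ct * y * \<delta> ^ (k + 2)) \<le> quad_err_const k * (Ct * y * (\<delta> * \<tau> ^ (k + 1)))"
      using qc0 Ct(1) y by (intro mult_left_mono) auto
    then show ?thesis unfolding \<delta>_def[symmetric] X\<^sub>t_def by (simp add: mult_ac)
  qed
  have cons0: "\<bar>grad_inner \<Omega> (U 1 (lobatto_point k t n \<mu>)) \<phi> - grad_inner \<Omega> (U 1 (t (n - 1))) \<phi>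
      - (t n - t (n - 1)) / 2 * (\<Sum>\<nu>\<le>k. rk k \<mu> \<nu> * grad_inner \<Omega> (U 2 (lobatto_point k t n \<nu>)) \<phi>)\<bar>
      \<le> (t n - t (n - 1)) * (quad_err_const k * X\<^sub>t * grad_norm \<Omega> \<phi>)"
    if n: "n \<in> {1..N}" and \<mu>: "\<mu> \<le> k" and \<phi>: "\<phi> \<in> W" for n \<mu> \<phi>
  proof -
    have y0: "0 \<le> grad_norm \<Omega> \<phi>" using VG.nonneg[OF \<phi>] by (simp add: grad_norm_def)
    let ?g = "\<lambda>j s. grad_inner \<Omega> (U (Suc j) s) \<phi>"
    have "\<bar>?g 0 ((t (n - 1) + t n) / 2 + (t n - t (n - 1)) / 2 * lobatto_node k \<mu>) - ?g 0 (t (n - 1))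
        - (t n - t (n - 1)) / 2 * (\<Sum>\<nu>\<le>k. rk k \<mu> \<nu> * ?g 1 ((t (n - 1) + t n) / 2 + (t n - t (n - 1)) / 2 * lobatto_node k \<nu>))\<bar>
        \<le> quad_err_const k * (Ct * grad_norm \<Omega> \<phi> * (t n - t (n - 1)) ^ (k + 2))"
    proof (rule quad_error[OF k1 time_mesh_step[OF mesh n] _ _ \<mu>])
      fix j s assume "j \<le> Suc k" "s \<in> {t (n - 1)..t n}"
      then show "(?g j has_real_derivative ?g (Suc j) s) (at s within {t (n - 1)..t n})"
        using time_mesh_sub[OF mesh n] Mk by (intro gder WG \<phi>) auto
    next
      fix s assume "s \<in> {t (n - 1)..t n}"
      then have s: "s \<in> {0..T}" using time_mesh_sub[OF mesh n] by blast
      have M3: "k + 3 \<le> M" using Mk by simp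
      have "\<bar>grad_inner \<Omega> (U (k + 3) s) \<phi>\<bar> \<le> grad_norm \<Omega> (U (k + 3) s) * grad_norm \<Omega> \<phi>"
        using G.cauchy_schwarz[OF UG[OF M3 s] WG[OF \<phi>]] by (simp add: nrmG)
      also have "\<dots> \<le> Ct * grad_norm \<Omega> \<phi>"
        using grad_norm_le_H_norm[OF open\<Omega> bdd UG[OF M3 s] order.refl] Ct(2)[OF s] y0 by (intro mult_right_mono) auto
      finally show "\<bar>?g (Suc (Suc k)) s\<bar> \<le> Ct * grad_norm \<Omega> \<phi>" by (simp add: numeral_3_eq_3)
    qed
    then have "\<bar>?g 0 (lobatto_point k t n \<mu>) - ?g 0 (t (n - 1)) - (t n - t (n - 1)) / 2 * (\<Sum>\<nu>\<le>k. rk k \<mu> \<nu> * ?g 1 (lobatto_point k t n \<nu>))\<bar>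
        \<le> quad_err_const k * (Ct * grad_norm \<Omega> \<phi> * (t n - t (n - 1)) ^ (k + 2))"
      unfolding lobatto_point_def .
    from order.trans[OF this Ctbound[OF n y0]] show ?thesis by (simp add: numeral_2_eq_2)
  qed
  have cons1: "\<bar>grad_inner \<Omega> (U 0 (lobatto_point k t n \<mu>)) \<phi> - grad_inner \<Omega> (U 0 (t (n - 1))) \<phi>
      - (t n - t (n - 1)) / 2 * (\<Sum>\<nu>\<le>k. rk k \<mu> \<nu> * grad_inner \<Omega> (U 1 (lobatto_point k t n \<nu>)) \<phi>)\<bar>
      \<le> (t n - t (n - 1)) * (quad_err_const k * X\<^sub>t * (d * L2_norm \<Omega> \<phi>))"
    if n: "n \<in> {1..N}" and \<mu>: "\<mu> \<le> k" and \<phi>: "\<phi> \<in> W" for n \<mu> \<phi>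
  proof -
    have y0: "0 \<le> L2_norm \<Omega> \<phi>" using V.nonneg[OF \<phi>] by (simp add: L2_norm_def)
    let ?g = "\<lambda>j s. grad_inner \<Omega> (U j s) \<phi>"
    have "\<bar>?g 0 ((t (n - 1) + t n) / 2 + (t n - t (n - 1)) / 2 * lobatto_node k \<mu>) - ?g 0 (t (n - 1))
        - (t n - t (n - 1)) / 2 * (\<Sum>\<nu>\<le>k. rk k \<mu> \<nu> * ?g 1 ((t (n - 1) + t n) / 2 + (t n - t (n - 1)) / 2 * lobatto_node k \<nu>))\<bar>
        \<le> quad_err_const k * (Ct * (d * L2_norm \<Omega> \<phi>) * (t n - t (n - 1)) ^ (k + 2))"
    proof (rule quad_error[OF k1 time_mesh_step[OF mesh n] _ _ \<mu>])
      fix j s assume "j \<le> Suc k" "s \<in> {t (n - 1)..t n}"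
      then show "(?g j has_real_derivative ?g (Suc j) s) (at s within {t (n - 1)..t n})"
        using time_mesh_sub[OF mesh n] Mk by (intro gder WG \<phi>) auto
    next
      fix s assume "s \<in> {t (n - 1)..t n}"
      then have s: "s \<in> {0..T}" using time_mesh_sub[OF mesh n] by blast
      have M3: "k + 2 \<le> M" using Mk by simp
      note U2 = UH[OF M3 s M2(1)]
      note wl = weak_laplace[OF open\<Omega> bdd U2]
      have "\<bar>grad_inner \<Omega> (U (k + 2) s) \<phi>\<bar> = \<bar>L2_inner \<Omega> (weak_laplace \<Omega> (U (k + 2) s)) \<phi>\<bar>"
        unfolding green[OF open\<Omega> bdd U2 W10[OF \<phi>]] by simp
      also have "\<dots> \<le> L2_norm \<Omega> (weak_laplace \<Omega> (U (k + 2) s)) * L2_norm \<Omega> \<phi>"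
        using L.cauchy_schwarz[OF wl(1) WL[OF \<phi>]] by (simp add: nrmL)
      also have "\<dots> \<le> (d * Ct) * L2_norm \<Omega> \<phi>"
        using order.trans[OF wl(2)[folded d_def] mult_left_mono[OF Ct(3)[OF s] d0]] y0 by (rule mult_right_mono)
      finally show "\<bar>?g (Suc (Suc k)) s\<bar> \<le> Ct * (d * L2_norm \<Omega> \<phi>)" by (simp add: mult_ac)
    qed
    then have "\<bar>?g 0 (lobatto_point k t n \<mu>) - ?g 0 (t (n - 1)) - (t n - t (n - 1)) / 2 * (\<Sum>\<nu>\<le>k. rk k \<mu> \<nu> * ?g 1 (lobatto_point k t n \<nu>))\<bar>
        \<le> quad_err_const k * (Ct * (d * L2_norm \<Omega> \<phi>) * (t n - t (n - 1)) ^ (k + 2))"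
      unfolding lobatto_point_def .
    moreover have "0 \<le> d * L2_norm \<Omega> \<phi>" using d0 y0 by simp
    ultimately show ?thesis using order.trans[OF _ Ctbound[OF n]] by blast
  qed
  \<comment> \<open>In one step the nodal errors solve the collocation equations up to a defect \<open>\<delta> B\<close>: the discrete terms cancel by
    \<open>inc0\<close> and \<open>inc1\<close>, and \<open>R\<close> disappears from all gradient terms by its definition.\<close>
  define En where "En v w = sqrt (grad_inner \<Omega> v v + L2_inner \<Omega> w w)" for v w
  have step: "En (E0 (t n)) (E1 (t n)) \<le> En (E0 (t (n - 1))) (E1 (t (n - 1))) + stab_const k * ((t n - t (n - 1)) * B)"
    "\<And>y. y \<in> {-1..1} \<Longrightarrow> En (\<lambda>x. \<Sum>\<mu>\<le>k. poly (lagr k \<mu>) y * E0 (lobatto_point k t n \<mu>) x)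
        (\<lambda>x. \<Sum>\<mu>\<le>k. poly (lagr k \<mu>) y * E1 (lobatto_point k t n \<mu>) x)
      \<le> stab_const k * (En (E0 (t (n - 1))) (E1 (t (n - 1))) + (t n - t (n - 1)) * B)"
    if n: "n \<in> {1..N}" for n
  proof -
    define p where "p \<mu> = lobatto_point k t n \<mu>" for \<mu>
    define \<delta> where "\<delta> = t n - t (n - 1)"
    have st: "t (n - 1) < t n" by (rule time_mesh_step[OF mesh n])
    have pe: "p 0 = t (n - 1)" "p k = t n" unfolding p_def using lobatto_point_ends[of k t n, OF k1 st] by auto
    have pT: "p \<mu> \<in> {0..T}" if "\<mu> \<le> k" for \<mu> unfolding p_def by (rule pt(2)[OF n that])
    have q0: "t (n - 1) \<in> {0..T}" by (rule tin(1)[OF n])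
    have \<delta>0: "0 \<le> \<delta>" using st by (simp add: \<delta>_def)
    define e0 where "e0 \<mu> = E0 (p \<mu>)" for \<mu>
    define e1 where "e1 \<mu> = E1 (p \<mu>)" for \<mu>
    have eV: "e0 \<mu> \<in> W" "e1 \<mu> \<in> W" if "\<mu> \<le> k" for \<mu> unfolding e0_def e1_def using EV[OF pT[OF that]] by auto
    have winc: "grad_inner \<Omega> (w\<^sub>0 (p \<mu>)) \<phi> - grad_inner \<Omega> (w\<^sub>0 (t (n - 1))) \<phi> = \<delta> / 2 * (\<Sum>\<nu>\<le>k. rk k \<mu> \<nu> * grad_inner \<Omega> (w\<^sub>1 (p \<nu>)) \<phi>)"
      "grad_inner \<Omega> (w\<^sub>1 (p \<mu>)) \<phi> - grad_inner \<Omega> (w\<^sub>1 (t (n - 1))) \<phi> = \<delta> / 2 * (\<Sum>\<nu>\<le>k. rk k \<mu> \<nu> * grad_inner \<Omega> (Z (p \<nu>)) \<phi>)"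
      if \<mu>: "\<mu> \<le> k" and \<phi>: "\<phi> \<in> W" for \<mu> \<phi>
    proof -
      have "(\<lambda>x. w\<^sub>0 (p \<mu>) x - w\<^sub>0 (t (n - 1)) x) = (\<lambda>x. \<Sum>\<nu>\<le>k. (\<delta> / 2 * rk k \<mu> \<nu>) * w\<^sub>1 (p \<nu>) x)"
        unfolding p_def inc0[OF n \<mu>] by (simp add: \<delta>_def sum_distrib_left mult.assoc)
      then show "grad_inner \<Omega> (w\<^sub>0 (p \<mu>)) \<phi> - grad_inner \<Omega> (w\<^sub>0 (t (n - 1))) \<phi> = \<delta> / 2 * (\<Sum>\<nu>\<le>k. rk k \<mu> \<nu> * grad_inner \<Omega> (w\<^sub>1 (p \<nu>)) \<phi>)"
        using VG.B_diff[OF w0V[OF pT[OF \<mu>]] w0V[OF q0] \<phi>]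
          VG.B_sum[of "{..k}" "\<lambda>\<nu>. w\<^sub>1 (p \<nu>)" \<phi> "\<lambda>\<nu>. \<delta> / 2 * rk k \<mu> \<nu>"] w1V pT \<phi>
        by (simp add: sum_distrib_left mult.assoc)
      have "(\<lambda>x. w\<^sub>1 (p \<mu>) x - w\<^sub>1 (t (n - 1)) x) = (\<lambda>x. \<Sum>\<nu>\<le>k. (\<delta> / 2 * rk k \<mu> \<nu>) * Z (p \<nu>) x)"
        unfolding p_def inc1[OF n \<mu>] by (simp add: \<delta>_def sum_distrib_left mult.assoc)
      then show "grad_inner \<Omega> (w\<^sub>1 (p \<mu>)) \<phi> - grad_inner \<Omega> (w\<^sub>1 (t (n - 1))) \<phi> = \<delta> / 2 * (\<Sum>\<nu>\<le>k. rk k \<mu> \<nu> * grad_inner \<Omega> (Z (p \<nu>)) \<phi>)"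
        using VG.B_diff[OF w1V[OF pT[OF \<mu>]] w1V[OF q0] \<phi>]
          VG.B_sum[of "{..k}" "\<lambda>\<nu>. Z (p \<nu>)" \<phi> "\<lambda>\<nu>. \<delta> / 2 * rk k \<mu> \<nu>"] ZV pT \<phi>
        by (simp add: sum_distrib_left mult.assoc)
    qed
    have eq0: "\<bar>grad_inner \<Omega> (\<lambda>x. e0 \<mu> x - e0 0 x) \<phi> - \<delta> / 2 * (\<Sum>\<nu>\<le>k. rk k \<mu> \<nu> * grad_inner \<Omega> (e1 \<nu>) \<phi>)\<bar>
        \<le> (\<delta> * B) * sqrt (grad_inner \<Omega> \<phi> \<phi>)" if \<mu>: "\<mu> \<le> k" and \<phi>: "\<phi> \<in> W" for \<mu> \<phi>
    proof -
      have y0: "0 \<le> grad_norm \<Omega> \<phi>" using VG.nonneg[OF \<phi>] by (simp add: grad_norm_def)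
      have s: "(\<Sum>\<nu>\<le>k. rk k \<mu> \<nu> * grad_inner \<Omega> (e1 \<nu>) \<phi>)
          = (\<Sum>\<nu>\<le>k. rk k \<mu> \<nu> * grad_inner \<Omega> (U 2 (p \<nu>)) \<phi>) - (\<Sum>\<nu>\<le>k. rk k \<mu> \<nu> * grad_inner \<Omega> (Z (p \<nu>)) \<phi>)"
        unfolding e1_def sum_subtractf[symmetric] right_diff_distrib[symmetric]
        by (rule sum.cong) (auto simp: E1g[OF pT \<phi>])
      have "grad_inner \<Omega> (\<lambda>x. e0 \<mu> x - e0 0 x) \<phi> = (grad_inner \<Omega> (U 1 (p \<mu>)) \<phi> - grad_inner \<Omega> (w\<^sub>1 (p \<mu>)) \<phi>)
          - (grad_inner \<Omega> (U 1 (t (n - 1))) \<phi> - grad_inner \<Omega> (w\<^sub>1 (t (n - 1))) \<phi>)"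
        using VG.B_diff[OF eV(1)[OF \<mu>] eV(1)[of 0] \<phi>] E0g[OF pT[OF \<mu>] \<phi>] E0g[OF q0 \<phi>] by (simp add: e0_def pe)
      then have "grad_inner \<Omega> (\<lambda>x. e0 \<mu> x - e0 0 x) \<phi> - \<delta> / 2 * (\<Sum>\<nu>\<le>k. rk k \<mu> \<nu> * grad_inner \<Omega> (e1 \<nu>) \<phi>)
          = grad_inner \<Omega> (U 1 (p \<mu>)) \<phi> - grad_inner \<Omega> (U 1 (t (n - 1))) \<phi> - \<delta> / 2 * (\<Sum>\<nu>\<le>k. rk k \<mu> \<nu> * grad_inner \<Omega> (U 2 (p \<nu>)) \<phi>)"
        unfolding s using winc(2)[OF \<mu> \<phi>] by (simp only: right_diff_distrib; linarith)
      then have "\<bar>grad_inner \<Omega> (\<lambda>x. e0 \<mu> x - e0 0 x) \<phi> - \<delta> / 2 * (\<Sum>\<nu>\<le>k. rk k \<mu> \<nu> * grad_inner \<Omega> (e1 \<nu>) \<phi>)\<bar>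
          \<le> \<delta> * (quad_err_const k * X\<^sub>t * grad_norm \<Omega> \<phi>)"
        using cons0[OF n \<mu> \<phi>] unfolding p_def \<delta>_def by simp
      also have "\<dots> \<le> \<delta> * (B * grad_norm \<Omega> \<phi>)"
      proof (intro mult_left_mono[OF _ \<delta>0] mult_right_mono[OF _ y0])
        have "0 \<le> d * (quad_err_const k * X\<^sub>t)" "0 \<le> c * X\<^sub>x" using d0 qc0 Xp c0 by auto
        then show "quad_err_const k * X\<^sub>t \<le> B" unfolding B_def by (simp add: distrib_right)
      qed
      finally show ?thesis by (simp add: grad_norm_def mult.assoc)
    qed
    have eq1: "\<bar>L2_inner \<Omega> (\<lambda>x. e1 \<mu> x - e1 0 x) \<phi> + \<delta> / 2 * (\<Sum>\<nu>\<le>k. rk k \<mu> \<nu> * grad_inner \<Omega> (e0 \<nu>) \<phi>)\<bar>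
        \<le> (\<delta> * B) * sqrt (L2_inner \<Omega> \<phi> \<phi>)" if \<mu>: "\<mu> \<le> k" and \<phi>: "\<phi> \<in> W" for \<mu> \<phi>
    proof -
      have y0: "0 \<le> L2_norm \<Omega> \<phi>" using V.nonneg[OF \<phi>] by (simp add: L2_norm_def)
      have s: "(\<Sum>\<nu>\<le>k. rk k \<mu> \<nu> * grad_inner \<Omega> (e0 \<nu>) \<phi>)
          = (\<Sum>\<nu>\<le>k. rk k \<mu> \<nu> * grad_inner \<Omega> (U 1 (p \<nu>)) \<phi>) - (\<Sum>\<nu>\<le>k. rk k \<mu> \<nu> * grad_inner \<Omega> (w\<^sub>1 (p \<nu>)) \<phi>)"
        unfolding e0_def sum_subtractf[symmetric] right_diff_distrib[symmetric]
        by (rule sum.cong) (auto simp: E0g[OF pT \<phi>])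
      define Q where "Q = grad_inner \<Omega> (U 0 (p \<mu>)) \<phi> - grad_inner \<Omega> (U 0 (t (n - 1))) \<phi> - \<delta> / 2 * (\<Sum>\<nu>\<le>k. rk k \<mu> \<nu> * grad_inner \<Omega> (U 1 (p \<nu>)) \<phi>)"
      have Q: "\<bar>Q\<bar> \<le> \<delta> * (quad_err_const k * X\<^sub>t * (d * L2_norm \<Omega> \<phi>))"
        using cons1[OF n \<mu> \<phi>] unfolding Q_def p_def \<delta>_def .
      have "L2_inner \<Omega> (\<lambda>x. e1 \<mu> x - e1 0 x) \<phi> = L2_inner \<Omega> (E1 (p \<mu>)) \<phi> - L2_inner \<Omega> (E1 (t (n - 1))) \<phi>"
        using V.B_diff[OF eV(2)[OF \<mu>] eV(2)[of 0] \<phi>] by (simp add: e1_def pe)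
      then have e: "L2_inner \<Omega> (\<lambda>x. e1 \<mu> x - e1 0 x) \<phi> + \<delta> / 2 * (\<Sum>\<nu>\<le>k. rk k \<mu> \<nu> * grad_inner \<Omega> (e0 \<nu>) \<phi>)
          = - (\<Lambda> \<phi> (U 2 (p \<mu>)) - \<Lambda> \<phi> (U 2 (t (n - 1)))) - Q"
        unfolding s E1L[OF pT[OF \<mu>] \<phi>] E1L[OF q0 \<phi>] Q_def using winc(1)[OF \<mu> \<phi>] by (simp only: right_diff_distrib; linarith)
      have "p \<mu> - t (n - 1) \<le> \<delta>" "t (n - 1) \<le> p \<mu>" using pt(1)[OF n \<mu>] by (auto simp: p_def \<delta>_def)
      then have "\<bar>\<Lambda> \<phi> (U 2 (p \<mu>)) - \<Lambda> \<phi> (U 2 (t (n - 1)))\<bar> \<le> \<delta> * (c * X\<^sub>x * L2_norm \<Omega> \<phi>)"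
        using \<Lambda>der[of "t (n - 1)" "p \<mu>" \<phi>] q0 pT[OF \<mu>] \<phi> mult_right_mono[of "p \<mu> - t (n - 1)" \<delta> "c * X\<^sub>x * L2_norm \<Omega> \<phi>"] c0 Xp y0
        by (auto intro: order.trans)
      then have "\<bar>- (\<Lambda> \<phi> (U 2 (p \<mu>)) - \<Lambda> \<phi> (U 2 (t (n - 1)))) - Q\<bar>
          \<le> \<delta> * (c * X\<^sub>x * L2_norm \<Omega> \<phi>) + \<delta> * (quad_err_const k * X\<^sub>t * (d * L2_norm \<Omega> \<phi>))"
        using Q by linarith
      also have "\<dots> = \<delta> * ((c * X\<^sub>x + d * (quad_err_const k * X\<^sub>t)) * L2_norm \<Omega> \<phi>)" by (simp add: algebra_simps)
      also have "\<dots> \<le> \<delta> * (B * L2_norm \<Omega> \<phi>)"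
      proof (intro mult_left_mono[OF _ \<delta>0] mult_right_mono[OF _ y0])
        have "0 \<le> quad_err_const k * X\<^sub>t" using qc0 Xp by auto
        then show "c * X\<^sub>x + d * (quad_err_const k * X\<^sub>t) \<le> B" unfolding B_def by (simp add: distrib_right)
      qed
      finally show ?thesis unfolding e by (simp add: L2_norm_def mult.assoc)
    qed
    have \<delta>B: "0 \<le> \<delta> * B" using \<delta>0 B0 by simp
    have stab: "En (e0 k) (e1 k) \<le> En (e0 0) (e1 0) + stab_const k * (\<delta> * B)"
      "\<forall>y\<in>{-1..1}. En (\<lambda>x. \<Sum>\<mu>\<le>k. poly (lagr k \<mu>) y * e0 \<mu> x) (\<lambda>x. \<Sum>\<mu>\<le>k. poly (lagr k \<mu>) y * e1 \<mu> x)
        \<le> stab_const k * (En (e0 0) (e1 0) + \<delta> * B)"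
      unfolding En_def
      by (rule lobatto_step_stability(1)[OF k1 VG.semi_inner_axioms V.semi_inner_axioms, where ?e0.0 = e0 and ?e1.0 = e1 and h = "\<delta> / 2" and \<delta> = "\<delta> * B"]; fact eV \<delta>B eq0 eq1)
        (rule ballI, rule lobatto_step_stability(2)[OF k1 VG.semi_inner_axioms V.semi_inner_axioms, where ?e0.0 = e0 and ?e1.0 = e1 and h = "\<delta> / 2" and \<delta> = "\<delta> * B"]; (rule \<delta>B | rule eV eq0 eq1; assumption)?)
    show "En (E0 (t n)) (E1 (t n)) \<le> En (E0 (t (n - 1))) (E1 (t (n - 1))) + stab_const k * ((t n - t (n - 1)) * B)"
      using stab(1) unfolding En_def e0_def e1_def pe \<delta>_def by simp
    fix y :: real assume "y \<in> {-1..1}"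
    from bspec[OF stab(2) this]
    show "En (\<lambda>x. \<Sum>\<mu>\<le>k. poly (lagr k \<mu>) y * E0 (lobatto_point k t n \<mu>) x)
        (\<lambda>x. \<Sum>\<mu>\<le>k. poly (lagr k \<mu>) y * E1 (lobatto_point k t n \<mu>) x)
      \<le> stab_const k * (En (E0 (t (n - 1))) (E1 (t (n - 1))) + (t n - t (n - 1)) * B)"
      unfolding En_def e0_def e1_def pe \<delta>_def unfolding p_def by simp
  qed
  \<comment> \<open>With the initial values \<open>R u\<^sub>0\<close> and \<open>R u\<^sub>1\<close> the first error component starts at zero. The second one is
    \<open>R \<partial>\<^sub>t\<^sup>2u - P \<partial>\<^sub>t\<^sup>2u\<close> with the \<open>L\<^sup>2\<close> projection \<open>P\<close>, because the gradients of \<open>u(0)\<close> and \<open>R u\<^sub>0\<close> agree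
    when tested with \<open>W\<close>.\<close>
  have T0: "0 \<in> {0..T}" using Tpos by simp
  have tz: "t 0 = 0" "t N = T" using mesh by (auto simp: time_mesh_def)
  have En0: "En (E0 0) (E1 0) \<le> B"
  proof -
    have "R u\<^sub>1 = R (U 1 0)" unfolding R_def
      by (rule elliptic_proj_cong[OF open\<Omega> bdd fin cover, symmetric]) (use u1 in \<open>simp add: U_def\<close>)
    then have z0: "E0 0 = (\<lambda>_. 0)" using init by (simp add: E0_def)
    have "R u\<^sub>0 = R (U 0 0)" unfolding R_def
      by (rule elliptic_proj_cong[OF open\<Omega> bdd fin cover, symmetric]) (use u0 in \<open>simp add: U_def\<close>)
    then have w00: "grad_inner \<Omega> (w\<^sub>0 0) \<phi> = grad_inner \<Omega> (U 0 0) \<phi>" if "\<phi> \<in> W" for \<phi>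
      using init RG[OF UG[OF M2(2) T0] that] by simp
    note e1V = EV(2)[OF T0]
    have y0: "0 \<le> L2_norm \<Omega> (E1 0)" using V.nonneg[OF e1V] by (simp add: L2_norm_def)
    have "L2_inner \<Omega> (E1 0) (E1 0) \<le> \<bar>\<Lambda> (E1 0) (U 2 0)\<bar>" using E1L[OF T0 e1V] w00[OF e1V] by simp
    also have "\<dots> \<le> L2_norm \<Omega> (\<lambda>x. U 2 0 x - R (U 2 0) x) * L2_norm \<Omega> (E1 0)"
      unfolding \<Lambda>_def using L.cauchy_schwarz[OF L.diff[OF UL[OF M2(1) T0] WL[OF RU[OF M2(1) T0]]] WL[OF e1V]] by (simp add: nrmL)
    also have "\<dots> \<le> B * L2_norm \<Omega> (E1 0)"
      using order.trans[OF RerrU(1)[of 2 0] cB] T0 y0 by (intro mult_right_mono) auto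
    finally have "L2_norm \<Omega> (E1 0) * L2_norm \<Omega> (E1 0) \<le> B * L2_norm \<Omega> (E1 0)"
      using V.nonneg[OF e1V] by (simp add: L2_norm_def)
    then have "L2_norm \<Omega> (E1 0) \<le> B" using y0 B0 by (cases "L2_norm \<Omega> (E1 0) = 0") (auto dest: mult_right_le_imp_le)
    then show ?thesis unfolding En_def z0 using VG.B_zero[OF V.zero] by (simp add: L2_norm_def)
  qed
  have Ks0: "0 \<le> stab_const k" by (rule stab_const_nonneg)
  have Enn: "En (E0 (t n)) (E1 (t n)) \<le> B + stab_const k * (t n * B)" if "n \<le> N" for n
    using that
  proof (induction n)
    case 0
    then show ?case using En0 tz by simp
  next
    case (Suc n)
    then have n: "Suc n \<in> {1..N}" by simp
    have "En (E0 (t (Suc n))) (E1 (t (Suc n))) \<le> En (E0 (t n)) (E1 (t n)) + stab_const k * ((t (Suc n) - t n) * B)"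
      using step(1)[OF n] by simp
    also have "En (E0 (t n)) (E1 (t n)) \<le> B + stab_const k * (t n * B)" using Suc by simp
    finally show ?case by (simp add: algebra_simps)
  qed
  obtain n where n: "n \<in> {1..N}" "s \<in> {t (n - 1)..t n}" using time_mesh_cover[OF mesh] s by blast
  have st: "t (n - 1) < t n" by (rule time_mesh_step[OF mesh n(1)])
  obtain y where y: "y \<in> {-1..1}" "poly (ref_map t n) y = s" using ref_map_surj[of t n, OF st n(2)] by blast
  define p where "p \<mu> = lobatto_point k t n \<mu>" for \<mu>
  define l where "l \<mu> = poly (lagr k \<mu>) y" for \<mu>
  have pT: "p \<mu> \<in> {0..T}" if "\<mu> \<le> k" for \<mu> unfolding p_def by (rule pt(2)[OF n(1) that])
  have lb: "\<bar>l \<mu>\<bar> \<le> lagr_bound k" if "\<mu> \<le> k" for \<mu> unfolding l_def by (rule lagr_bound(2)[OF that y(1)])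
  define F0 where "F0 = (\<lambda>x. \<Sum>\<mu>\<le>k. l \<mu> * E0 (p \<mu>) x)"
  define F1 where "F1 = (\<lambda>x. \<Sum>\<mu>\<le>k. l \<mu> * E1 (p \<mu>) x)"
  have FV: "F0 \<in> W" "F1 \<in> W" unfolding F0_def F1_def by (intro V.sum_closed; use EV pT in auto)+
  have EF: "En F0 F1 \<le> K * (X\<^sub>t + X\<^sub>x)"
  proof -
    have "En F0 F1 \<le> stab_const k * (En (E0 (t (n - 1))) (E1 (t (n - 1))) + (t n - t (n - 1)) * B)"
      unfolding F0_def F1_def l_def p_def by (rule step(2)[OF n(1) y(1)])
    also have "\<dots> \<le> stab_const k * ((1 + stab_const k * T + T) * B)"
    proof (rule mult_left_mono[OF _ Ks0])
      have "n - 1 \<le> N" using n(1) by (cases n) auto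
      from Enn[OF this] have "En (E0 (t (n - 1))) (E1 (t (n - 1))) \<le> B + stab_const k * (t (n - 1) * B)" .
      also have "stab_const k * (t (n - 1) * B) \<le> stab_const k * (T * B)"
        using tin(1)[OF n(1)] B0 Ks0 by (intro mult_left_mono mult_right_mono) auto
      finally have 1: "En (E0 (t (n - 1))) (E1 (t (n - 1))) \<le> B + stab_const k * (T * B)" by simp
      have "(t n - t (n - 1)) * B \<le> T * B" using tin[OF n(1)] B0 by (intro mult_right_mono) auto
      with 1 show "En (E0 (t (n - 1))) (E1 (t (n - 1))) + (t n - t (n - 1)) * B \<le> (1 + stab_const k * T + T) * B"
        by (simp add: algebra_simps)
    qed
    also have "\<dots> \<le> stab_const k * ((1 + stab_const k * T + T) * (((1 + d) * quad_err_const k + c) * (X\<^sub>t + X\<^sub>x)))"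
    proof (intro mult_left_mono Ks0)
      have "0 \<le> (1 + d) * quad_err_const k * X\<^sub>x" "0 \<le> c * X\<^sub>t" using d0 qc0 c0 Xp by auto
      then show "B \<le> ((1 + d) * quad_err_const k + c) * (X\<^sub>t + X\<^sub>x)" unfolding B_def by (simp add: algebra_simps)
      show "0 \<le> 1 + stab_const k * T + T" using Ks0 Tpos by simp
    qed
    also have "\<dots> = K * (X\<^sub>t + X\<^sub>x)" unfolding K_def energy_const_def by (simp only: mult.assoc)
    finally show ?thesis .
  qed
  have gF: "grad_norm \<Omega> F0 \<le> K * (X\<^sub>t + X\<^sub>x)" and lF: "L2_norm \<Omega> F1 \<le> K * (X\<^sub>t + X\<^sub>x)"
  proof -
    have "grad_norm \<Omega> F0 \<le> En F0 F1" "L2_norm \<Omega> F1 \<le> En F0 F1"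
      unfolding grad_norm_def L2_norm_def En_def using V.nonneg[OF FV(2)] VG.nonneg[OF FV(1)] by (auto intro: real_sqrt_le_mono)
    with EF show "grad_norm \<Omega> F0 \<le> K * (X\<^sub>t + X\<^sub>x)" "L2_norm \<Omega> F1 \<le> K * (X\<^sub>t + X\<^sub>x)" by simp_all
  qed
  \<comment> \<open>The error at \<open>s\<close> is \<open>I + S + F\<close>: \<open>I\<close> is the error of interpolating the exact solution in time, \<open>S\<close> interpolates
    its projection error, and \<open>F\<close> interpolates the nodal errors, to which the stability estimate applies.\<close>
  define I where "I j = (\<lambda>x. U j s x - (\<Sum>\<mu>\<le>k. l \<mu> * U j (p \<mu>) x))" for j
  have lk0: "0 \<le> Lk" unfolding Lk_def using lagr_bound(1)[of k] by simp
  have Ctb: "(1 + Lk) * (Ct * (t n - t (n - 1)) ^ (k + 1)) \<le> (1 + Lk) * X\<^sub>t"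
  proof -
    have "(t n - t (n - 1)) ^ (k + 1) \<le> \<tau> ^ (k + 1)" using \<tau>n[OF n(1)] st by (intro power_mono) auto
    then show ?thesis unfolding X\<^sub>t_def using lk0 Ct(1) by (subst mult.commute[of "\<tau> ^ (k + 1)"]) (intro mult_left_mono; simp)
  qed
  have sy: "s = (t (n - 1) + t n) / 2 + (t n - t (n - 1)) / 2 * y" using y(2) by (simp add: ref_map_def mult.commute)
  have sumL: "(\<lambda>x. \<Sum>\<mu>\<le>k. l \<mu> * U j (p \<mu>) x) \<in> L2_space \<Omega>" "(\<lambda>x. \<Sum>\<mu>\<le>k. l \<mu> * U j (p \<mu>) x) \<in> H_space \<Omega> 1" if "j \<le> M" for j
    by (rule L.sum_closed, use UL[OF that] pT in auto)[1] (rule G.sum_closed, use UG[OF that] pT in auto)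
  have IL: "I j \<in> L2_space \<Omega>" "I j \<in> H_space \<Omega> 1" if "j \<le> M" for j
    unfolding I_def using L.diff[OF UL[OF that s] sumL(1)[OF that]] G.diff[OF UG[OF that s] sumL(2)[OF that]] .
  have Ie: "I j = (\<lambda>z. U (j + 0) ((t (n - 1) + t n) / 2 + (t n - t (n - 1)) / 2 * y) z - (\<Sum>\<mu>\<le>k. poly (lagr k \<mu>) y
      * U (j + 0) ((t (n - 1) + t n) / 2 + (t n - t (n - 1)) / 2 * lobatto_node k \<mu>) z))" for j
    unfolding I_def l_def p_def lobatto_point_def sy[symmetric] add_0_right ..
  have sT: "s' \<in> {0..T}" if "s' \<in> {t (n - 1)..t n}" for s' using time_mesh_sub[OF mesh n(1)] that by blast
  have interpL: "L2_norm \<Omega> (I j) \<le> (1 + Lk) * X\<^sub>t" if j: "j \<in> {1, 2}" for j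
  proof -
    have jM: "j + i \<le> M" if "i \<le> Suc k" for i using j Mk that by auto
    have "L2_norm \<Omega> (U (j + Suc k) s') \<le> Ct" if "s' \<in> {0..T}" for s'
      using j L2_le_H_norm[OF open\<Omega> bdd UH[of "k + 3" s' 1]] L2_le_H_norm[OF open\<Omega> bdd UH[of "k + 2" s' 2]]
        Ct(2,3)[OF that] that Mk by (auto simp: numeral_3_eq_3)
    then have "L2_norm \<Omega> (I j) \<le> (1 + Lk) * (Ct * (t n - t (n - 1)) ^ (k + 1))"
      unfolding nrmL[symmetric] Lk_def Ie using j Mk
      by (intro L.nrm_interp_error[where g = "\<lambda>i. U (j + i)", OF k1 st _ _ _ y(1)])
        (auto simp only: nrmL add_Suc_right intro!: UL jM sT lder time_mesh_sub[OF mesh n(1)])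
    also note Ctb
    finally show ?thesis .
  qed
  have interpG: "grad_norm \<Omega> (I 1) \<le> (1 + Lk) * X\<^sub>t"
  proof -
    have jM: "1 + i \<le> M" if "i \<le> Suc k" for i using Mk that by auto
    have "grad_norm \<Omega> (U (1 + Suc k) s') \<le> Ct" if "s' \<in> {0..T}" for s'
      using grad_norm_le_H_norm[OF open\<Omega> bdd UH[of "k + 2" s' 2]] Ct(3)[OF that] that Mk by simp
    then have "grad_norm \<Omega> (I 1) \<le> (1 + Lk) * (Ct * (t n - t (n - 1)) ^ (k + 1))"
      unfolding nrmG[symmetric] Lk_def Ie using Mk
      by (intro G.nrm_interp_error[where g = "\<lambda>i. U (1 + i)", OF k1 st _ _ _ y(1)])
        (auto simp only: nrmG add_Suc_right intro!: UG jM sT gder time_mesh_sub[OF mesh n(1)])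
    also note Ctb
    finally show ?thesis .
  qed
  define S where "S j = (\<lambda>x. \<Sum>\<mu>\<le>k. l \<mu> * (U j (p \<mu>) x - R (U j (p \<mu>)) x))" for j
  have SL: "S j \<in> L2_space \<Omega>" "S j \<in> H_space \<Omega> 1" if "j \<le> M" for j
  proof -
    show "S j \<in> L2_space \<Omega>" unfolding S_def
      by (rule L.sum_closed[OF finite_atMost L.diff]) (use UL[OF that] WL[OF RU[OF that]] pT in auto)
    show "S j \<in> H_space \<Omega> 1" unfolding S_def
      by (rule G.sum_closed[OF finite_atMost G.diff]) (use UG[OF that] WG[OF RU[OF that]] pT in auto)
  qed
  have SX: "L2_norm \<Omega> (S j) \<le> Lk * c * X\<^sub>x" "grad_norm \<Omega> (S j) \<le> Lk * c * X\<^sub>x'" if j: "j \<in> {1, 2}" for j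
  proof -
    have jM: "j \<le> M" using j M1 by auto
    have j3: "j \<in> {1, 2, 3}" using j by auto
    have dL: "(\<lambda>x. U j (p \<mu>) x - R (U j (p \<mu>)) x) \<in> L2_space \<Omega>" "(\<lambda>x. U j (p \<mu>) x - R (U j (p \<mu>)) x) \<in> H_space \<Omega> 1"
      if "\<mu> \<in> {..k}" for \<mu>
      using L.diff[OF UL[OF jM pT] WL[OF RU[OF jM pT]]] G.diff[OF UG[OF jM pT] WG[OF RU[OF jM pT]]] that by auto
    have "L2_norm \<Omega> (S j) \<le> (\<Sum>\<mu>\<le>k. \<bar>l \<mu>\<bar> * L2_norm \<Omega> (\<lambda>x. U j (p \<mu>) x - R (U j (p \<mu>)) x))"
      unfolding S_def using L.nrm_sum[OF finite_atMost dL(1), where c = l] by (simp add: nrmL)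
    also have "\<dots> \<le> (\<Sum>\<mu>\<le>k. lagr_bound k * (c * X\<^sub>x))"
      by (rule sum_mono, rule mult_mono) (use lb RerrU(1)[OF j3 pT] lagr_bound(1) L.nonneg[OF dL(1)] in \<open>auto simp: L2_norm_def\<close>)
    finally show "L2_norm \<Omega> (S j) \<le> Lk * c * X\<^sub>x" by (simp add: Lk_def mult_ac add.commute)
    have "grad_norm \<Omega> (S j) \<le> (\<Sum>\<mu>\<le>k. \<bar>l \<mu>\<bar> * grad_norm \<Omega> (\<lambda>x. U j (p \<mu>) x - R (U j (p \<mu>)) x))"
      unfolding S_def using G.nrm_sum[OF finite_atMost dL(2), where c = l] by (simp add: nrmG)
    also have "\<dots> \<le> (\<Sum>\<mu>\<le>k. lagr_bound k * (c * X\<^sub>x'))"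
      by (rule sum_mono, rule mult_mono) (use lb RerrU(2)[OF j3 pT] lagr_bound(1) G.nonneg[OF dL(2)] in \<open>auto simp: grad_norm_def\<close>)
    finally show "grad_norm \<Omega> (S j) \<le> Lk * c * X\<^sub>x'" by (simp add: Lk_def mult_ac add.commute)
  qed
  have e0: "AE x in lebesgue_on \<Omega>. I 1 x + (S 1 x + F0 x) = e\<^sub>0 x"
    using dt0[OF n(1) y(1)]
  proof eventually_elim
    case (elim x)
    then show ?case unfolding e\<^sub>0_def y(2) I_def S_def F0_def E0_def
      by (simp add: l_def p_def right_diff_distrib sum_subtractf)
  qed
  have e1: "AE x in lebesgue_on \<Omega>. I 2 x + (S 2 x + F1 x) = e\<^sub>1 x"
    using dt1[OF n(1) y(1)]
  proof eventually_elim
    case (elim x)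
    then show ?case unfolding e\<^sub>1_def y(2) I_def S_def F1_def E1_def
      by (simp add: l_def p_def right_diff_distrib sum_subtractf)
  qed
  have SF0: "(\<lambda>x. S 1 x + F0 x) \<in> L2_space \<Omega>" "(\<lambda>x. S 1 x + F0 x) \<in> H_space \<Omega> 1"
    using L.add[OF SL(1)[OF M1(1)] WL[OF FV(1)]] G.add[OF SL(2)[OF M1(1)] WG[OF FV(1)]] .
  have SF1: "(\<lambda>x. S 2 x + F1 x) \<in> L2_space \<Omega>" by (rule L.add[OF SL(1)[OF M2(1)] WL[OF FV(2)]])
  note ISF0 = L.add[OF IL(1)[OF M1(1)] SF0(1)] and ISF1 = L.add[OF IL(1)[OF M2(1)] SF1]
  show "e\<^sub>0 \<in> L2_space \<Omega>" by (rule L2_AE[OF open\<Omega> bdd ISF0 e0])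
  show "e\<^sub>1 \<in> L2_space \<Omega>" by (rule L2_AE[OF open\<Omega> bdd ISF1 e1])
  have "L2_norm \<Omega> F0 \<le> CP * grad_norm \<Omega> F0" by (rule CP(2)[OF W10[OF FV(1)]])
  also have "\<dots> \<le> CP * (K * (X\<^sub>t + X\<^sub>x))" by (rule mult_left_mono[OF gF CP(1)])
  finally have F0L: "L2_norm \<Omega> F0 \<le> CP * K * (X\<^sub>t + X\<^sub>x)" by (simp add: mult.assoc)
  have "L2_norm \<Omega> e\<^sub>0 = L2_norm \<Omega> (\<lambda>x. I 1 x + (S 1 x + F0 x))" by (rule L2_norm_cong[OF open\<Omega> bdd ISF0 e0, symmetric])
  also have "\<dots> \<le> L2_norm \<Omega> (I 1) + (L2_norm \<Omega> (S 1) + L2_norm \<Omega> F0)"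
    using L.nrm_add[OF IL(1)[OF M1(1)] SF0(1)] L.nrm_add[OF SL(1)[OF M1(1)] WL[OF FV(1)]] by (simp add: nrmL)
  finally show "L2_norm \<Omega> e\<^sub>0 \<le> (1 + Lk) * X\<^sub>t + Lk * c * X\<^sub>x + CP * K * (X\<^sub>t + X\<^sub>x)"
    using interpL[of 1] SX(1)[of 1] F0L by simp
  have "L2_norm \<Omega> e\<^sub>1 = L2_norm \<Omega> (\<lambda>x. I 2 x + (S 2 x + F1 x))" by (rule L2_norm_cong[OF open\<Omega> bdd ISF1 e1, symmetric])
  also have "\<dots> \<le> L2_norm \<Omega> (I 2) + (L2_norm \<Omega> (S 2) + L2_norm \<Omega> F1)"
    using L.nrm_add[OF IL(1)[OF M2(1)] SF1] L.nrm_add[OF SL(1)[OF M2(1)] WL[OF FV(2)]] by (simp add: nrmL)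
  finally show "L2_norm \<Omega> e\<^sub>1 \<le> (1 + Lk) * X\<^sub>t + Lk * c * X\<^sub>x + K * (X\<^sub>t + X\<^sub>x)"
    using interpL[of 2] SX(1)[of 2] lF by simp
  have "grad_norm \<Omega> e\<^sub>0 = grad_norm \<Omega> (\<lambda>x. I 1 x + (S 1 x + F0 x))"
    unfolding grad_norm_def using grad_cong[OF open\<Omega> bdd e0 e0] by simp
  also have "\<dots> \<le> grad_norm \<Omega> (I 1) + (grad_norm \<Omega> (S 1) + grad_norm \<Omega> F0)"
    using G.nrm_add[OF IL(2)[OF M1(1)] SF0(2)] G.nrm_add[OF SL(2)[OF M1(1)] WG[OF FV(1)]] by (simp add: nrmG)
  finally show "grad_norm \<Omega> e\<^sub>0 \<le> (1 + Lk) * X\<^sub>t + Lk * c * X\<^sub>x' + K * (X\<^sub>t + X\<^sub>x)"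
    using interpG SX(2)[of 1] gF by simp
qed

section \<open>The main estimate\<close>

lemma L2_norm_pair_le:
  assumes "open \<Omega>" "bounded \<Omega>" "v \<in> L2_space \<Omega>" "w \<in> L2_space \<Omega>"
  shows "L2_norm_pair \<Omega> (v, w) \<le> L2_norm \<Omega> v + L2_norm \<Omega> w"
proof -
  interpret semi_inner "L2_space \<Omega>" "L2_inner \<Omega>" by (rule L2_semi_inner[OF assms(1,2)])
  show ?thesis unfolding L2_norm_pair_def L2_inner_pair_def L2_norm_def fst_conv snd_conv
    by (rule sqrt_add_le_add_sqrt) (intro nonneg assms)+
qed

theorem theorem5p6:
  fixes k r :: nat
  assumes dim: "CARD('d::finite) \<in> {2, 3}"
    and k: "k \<ge> 2"
    and r: "r \<ge> 1"
  shows "\<exists>M J\<^sub>t J\<^sub>x. finite J\<^sub>t \<and> finite J\<^sub>x \<and> (\<forall>(j, m)\<in>J\<^sub>t \<union> J\<^sub>x. j + 1 \<le> M \<and> m \<le> M) \<and>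
    (\<forall>(\<Omega> :: (real^'d) set) T \<sigma> C\<^sub>R. polyhedral_domain \<Omega> \<longrightarrow> 0 < T \<longrightarrow>
      (\<exists>C. \<forall>f u\<^sub>0 u\<^sub>1 u.
        f \<in> C_H_space \<Omega> {0..T} 1 0 \<longrightarrow>
        wave_solution \<Omega> T f u\<^sub>0 u\<^sub>1 u \<longrightarrow>
        u \<in> C_H_space \<Omega> {0..T} M M \<longrightarrow>
        (\<exists>C'. \<forall>\<T> N t w\<^sub>0 w\<^sub>1.
          let V\<^sub>h = FE_space \<Omega> r \<T>;
              U\<^sub>0 = (elliptic_proj \<Omega> V\<^sub>h u\<^sub>0, elliptic_proj \<Omega> V\<^sub>h u\<^sub>1);
              D = lift_init \<Omega> V\<^sub>h f U\<^sub>0;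
              Lw\<^sub>0 = lifting \<Omega> k t (fst D) w\<^sub>0;
              Lw\<^sub>1 = lifting \<Omega> k t (snd D) w\<^sub>1;
              dt = time_deriv \<Omega> {0..T};
              C\<^sub>t = deriv_quantity \<Omega> T J\<^sub>t (dt u);
              C\<^sub>x = deriv_quantity \<Omega> T J\<^sub>x (dt u);
              \<tau> = time_mesh_size N t;
              h = mesh_size \<T>
          in shape_regular_mesh \<Omega> \<sigma> \<T> \<longrightarrow>
             elliptic_approx \<Omega> r C\<^sub>R \<T> \<longrightarrow>
             time_mesh T N t \<longrightarrow>
             fully_discrete_solution \<Omega> V\<^sub>h k N t f U\<^sub>0 w\<^sub>0 w\<^sub>1 \<longrightarrow>
             (\<forall>s\<in>{0..T}.
               L2_norm_pair \<Omega> ((\<lambda>x. dt u s x - dt Lw\<^sub>0 s x), (\<lambda>x. dt (dt u) s x - dt Lw\<^sub>1 s x))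
                 \<le> C * (\<tau> ^ (k + 1) * C\<^sub>t + h ^ (r + 1) * C\<^sub>x) \<and>
               \<tau> ^ (k + 1) * C\<^sub>t + h ^ (r + 1) * C\<^sub>x \<le> C' * (\<tau> ^ (k + 1) + h ^ (r + 1)) \<and>
               grad_norm \<Omega> (\<lambda>x. dt u s x - dt Lw\<^sub>0 s x)
                 \<le> C * (\<tau> ^ (k + 1) * C\<^sub>t + h ^ r * C\<^sub>x) \<and>
               \<tau> ^ (k + 1) * C\<^sub>t + h ^ r * C\<^sub>x \<le> C' * (\<tau> ^ (k + 1) + h ^ r)))))"
proof (rule exI[of _ "k + r + 4"], rule exI[of _ "{(k + 2, 1), (k + 1, 2)}"], rule exI[of _ "{(0, r + 1), (1, r + 1), (2, r + 1)}"],
    intro conjI allI impI, goal_cases)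
  case (4 \<Omega> T \<sigma> C\<^sub>R)
  \<comment> \<open>With \<open>v = \<partial>\<^sub>tu\<close>: interpolation and quadrature in time need \<open>\<partial>\<^sub>t\<^sup>k\<^sup>+\<^sup>2 v\<close> in \<open>H\<^sup>1\<close> and
    \<open>\<partial>\<^sub>t\<^sup>k\<^sup>+\<^sup>1 v\<close> in \<open>H\<^sup>2\<close>, the latter for Green's formula; the elliptic projection is applied to \<open>v\<close>,
    \<open>\<partial>\<^sub>tv\<close> and \<open>\<partial>\<^sub>t\<^sup>2v\<close>.\<close>
  let ?M = "k + r + 4"
  let ?J\<^sub>t = "{(k + 2, 1), (k + 1, 2)} :: (nat \<times> nat) set"
  let ?J\<^sub>x = "{(0, r + 1), (1, r + 1), (2, r + 1)} :: (nat \<times> nat) set"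
  have open\<Omega>: "open \<Omega>" and bdd: "bounded \<Omega>" and T: "0 < T" using 4 by (auto simp: polyhedral_domain_def)
  obtain CP where CP: "0 \<le> CP" "\<forall>v\<in>H10_space \<Omega>. L2_norm \<Omega> v \<le> CP * grad_norm \<Omega> v"
    using poincare[OF open\<Omega> bdd] by blast
  define Lk where "Lk = (real k + 1) * lagr_bound k"
  define c where "c = \<bar>C\<^sub>R\<bar>"
  define K where "K = energy_const (real CARD('d)) c T k"
  define \<delta> where "\<delta> = diameter (closure \<Omega>)"
  \<comment> \<open>The domain has diameter \<open>\<delta>\<close>, so \<open>h \<le> \<delta>\<close>: in the gradient estimate the
    energy part of order \<open>h ^ (r + 1)\<close> is absorbed into \<open>h ^ r\<close>.\<close>
  define C where "C = 2 * (1 + Lk) + 2 * (Lk * c) + CP * K + K * (1 + \<delta>)"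
  have nn: "0 \<le> Lk" "0 \<le> c" "0 \<le> K" "0 \<le> \<delta>"
    unfolding Lk_def c_def K_def \<delta>_def energy_const_def
    using lagr_bound(1)[of k] quad_err_const_nonneg[of k] stab_const_nonneg[of k] T diameter_ge_0[OF bounded_closure[OF bdd]] by auto
  show ?case
  proof (rule exI[of _ C], intro allI impI, goal_cases)
    case (1 f u\<^sub>0 u\<^sub>1 u)
    note fCH = 1(1) and u = 1(3)
    have uH10: "\<forall>s\<in>{0<..T}. u s \<in> H10_space \<Omega>"
      and pde: "\<forall>s\<in>{0<..T}. AE x in lebesgue_on \<Omega>. (time_deriv \<Omega> {0..T} ^^ 2) u s x - weak_laplace \<Omega> (u s) x = f s x"
      and u0: "AE x in lebesgue_on \<Omega>. u 0 x = u\<^sub>0 x" and u1: "AE x in lebesgue_on \<Omega>. time_deriv \<Omega> {0..T} u 0 x = u\<^sub>1 x"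
      using 1(2) unfolding wave_solution_def by blast+
    define Ct where "Ct = deriv_quantity \<Omega> T ?J\<^sub>t (time_deriv \<Omega> {0..T} u)"
    define Cx where "Cx = deriv_quantity \<Omega> T ?J\<^sub>x (time_deriv \<Omega> {0..T} u)"
    have M1: "1 \<le> ?M" by simp
    note dq = deriv_quantity_bound[OF open\<Omega> bdd T u M1 uH10]
    have Ct: "0 \<le> Ct" "\<And>j m s. (j, m) \<in> ?J\<^sub>t \<Longrightarrow> s \<in> {0..T} \<Longrightarrow> H_norm \<Omega> m ((time_deriv \<Omega> {0..T} ^^ Suc j) u s) \<le> Ct"
      unfolding Ct_def by (rule dq(1); auto) (rule dq(2); auto)
    have Cx: "0 \<le> Cx" "\<And>j m s. (j, m) \<in> ?J\<^sub>x \<Longrightarrow> s \<in> {0..T} \<Longrightarrow> H_norm \<Omega> m ((time_deriv \<Omega> {0..T} ^^ Suc j) u s) \<le> Cx"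
      unfolding Cx_def by (rule dq(1); auto) (rule dq(2); auto)
    have Ct3: "H_norm \<Omega> 1 ((time_deriv \<Omega> {0..T} ^^ (k + 3)) u s) \<le> Ct" if "s \<in> {0..T}" for s
      using Ct(2)[of "k + 2" 1 s] that by (simp add: numeral_3_eq_3)
    have Ct2: "H_norm \<Omega> 2 ((time_deriv \<Omega> {0..T} ^^ (k + 2)) u s) \<le> Ct" if "s \<in> {0..T}" for s
      using Ct(2)[of "k + 1" 2 s] that by (simp add: numeral_2_eq_2)
    have Cx3: "H_norm \<Omega> (r + 1) ((time_deriv \<Omega> {0..T} ^^ j) u s) \<le> Cx" if "j \<in> {1, 2, 3}" "s \<in> {0..T}" for j s
      using Cx(2)[of "j - 1" "r + 1" s] that by (auto simp: numeral_2_eq_2 numeral_3_eq_3)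
    show ?case
      unfolding Let_def Ct_def[symmetric] Cx_def[symmetric]
    proof (rule exI[of _ "Ct + Cx"], intro allI impI ballI, goal_cases)
      case (1 \<T> N t w\<^sub>0 w\<^sub>1 s)
      define \<tau> where "\<tau> = time_mesh_size N t"
      define h where "h = mesh_size \<T>"
      have mesh: "finite \<T>" "\<T> \<noteq> {}" "(\<Union>F\<in>\<T>. F ` cbox 0 1) = closure \<Omega>" using 1(1) by (auto simp: shape_regular_mesh_def)
      have \<tau>0: "0 \<le> \<tau>" and h0: "0 \<le> h" and h\<delta>: "h \<le> \<delta>"
        unfolding \<tau>_def h_def \<delta>_def using time_mesh_size_bounds(2)[OF 1(3)] mesh_size_bounds[OF mesh bdd] by auto
      define Xt where "Xt = \<tau> ^ (k + 1) * Ct"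
      define Xx where "Xx = h ^ (r + 1) * Cx"
      define Xx' where "Xx' = h ^ r * Cx"
      have X0: "0 \<le> Xt" "0 \<le> Xx" "0 \<le> Xx'" unfolding Xt_def Xx_def Xx'_def using \<tau>0 h0 Ct(1) Cx(1) by auto
      have Xx\<delta>: "Xx \<le> \<delta> * Xx'"
        unfolding Xx_def Xx'_def using mult_right_mono[OF h\<delta>, of "h ^ r * Cx"] h0 Cx(1) by (simp add: mult.assoc)
      have k1: "1 \<le> k" and Mk: "k + 4 \<le> ?M" and Mr: "r + 1 \<le> ?M" using k by auto
      define D\<^sub>0 where "D\<^sub>0 = lift_init \<Omega> (FE_space \<Omega> r \<T>) f (elliptic_proj \<Omega> (FE_space \<Omega> r \<T>) u\<^sub>0, elliptic_proj \<Omega> (FE_space \<Omega> r \<T>) u\<^sub>1)"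
      define e\<^sub>0 where "e\<^sub>0 = (\<lambda>x. time_deriv \<Omega> {0..T} u s x - time_deriv \<Omega> {0..T} (lifting \<Omega> k t (fst D\<^sub>0) w\<^sub>0) s x)"
      define e\<^sub>1 where "e\<^sub>1 = (\<lambda>x. time_deriv \<Omega> {0..T} (time_deriv \<Omega> {0..T} u) s x - time_deriv \<Omega> {0..T} (lifting \<Omega> k t (snd D\<^sub>0) w\<^sub>1) s x)"
      have U12: "(time_deriv \<Omega> {0..T} ^^ 1) u = time_deriv \<Omega> {0..T} u"
        "(time_deriv \<Omega> {0..T} ^^ 2) u = time_deriv \<Omega> {0..T} (time_deriv \<Omega> {0..T} u)" by (simp_all add: numeral_2_eq_2)
      note est = error_estimate[OF open\<Omega> bdd mesh T u k1 Mk Mr uH10 fCH pde u0 u1 1(2,3,4) Ct(1) Ct3 Ct2 Cx(1) Cx3 1(5) CP(1) bspec[OF CP(2)],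
          folded D\<^sub>0_def \<tau>_def h_def c_def Lk_def, folded Xt_def Xx_def Xx'_def K_def, unfolded U12, folded e\<^sub>0_def e\<^sub>1_def]
      have KX: "0 \<le> K * Xt" "0 \<le> K * Xx" "0 \<le> K * Xx'" "0 \<le> Lk * Xt" "0 \<le> Lk * Xx" "0 \<le> Lk * Xx'" "0 \<le> Lk * c * Xt" "0 \<le> Lk * c * Xx" "0 \<le> Lk * c * Xx'"
          "0 \<le> CP * K * Xt" "0 \<le> CP * K * Xx" "0 \<le> CP * K * Xx'" "0 \<le> K * \<delta> * Xt" "0 \<le> K * \<delta> * Xx" "0 \<le> K * \<delta> * Xx'"
        using nn X0 CP(1) by auto
      have "L2_norm_pair \<Omega> (e\<^sub>0, e\<^sub>1) \<le> L2_norm \<Omega> e\<^sub>0 + L2_norm \<Omega> e\<^sub>1" by (rule L2_norm_pair_le[OF open\<Omega> bdd est(4,5)])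
      also have "\<dots> \<le> C * (Xt + Xx)" using est(1,2) KX X0 unfolding C_def by (simp add: algebra_simps)
      finally have 1: "L2_norm_pair \<Omega> (e\<^sub>0, e\<^sub>1) \<le> C * (Xt + Xx)" .
      have "K * Xx \<le> K * \<delta> * Xx'" using mult_left_mono[OF Xx\<delta> nn(3)] by (simp add: mult.assoc)
      then have 2: "grad_norm \<Omega> e\<^sub>0 \<le> C * (Xt + Xx')" using est(3) KX X0 unfolding C_def by (simp add: algebra_simps)
      have 3: "Xt + h ^ i * Cx \<le> (Ct + Cx) * (\<tau> ^ (k + 1) + h ^ i)" for i
      proof -
        have "0 \<le> Ct * h ^ i" "0 \<le> Cx * \<tau> ^ (k + 1)" using Ct(1) Cx(1) h0 \<tau>0 by auto
        then show ?thesis unfolding Xt_def by (simp add: algebra_simps)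
      qed
      show ?case
        unfolding D\<^sub>0_def[symmetric] e\<^sub>0_def[symmetric] e\<^sub>1_def[symmetric] \<tau>_def[symmetric] h_def[symmetric]
        using 1 2 3[of "r + 1"] 3[of r] unfolding Xt_def Xx_def Xx'_def by blast
    qed
  qed
qed auto

end
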